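(* Let $(M,f,c)$ and $(M',f',c')$ be two symmetric bilinear lattices equipped with characteristic forms. Then $(G_f,\phi_{f,c})\simeq(G_{f'},\phi_{f',c'})$ (i.e. there is a group isomorphism $\Psi:G_f\to G_{f'}$ with $\phi_{f',c'}\circ\Psi=\phi_{f,c}$) if and only if there exist $n,n'\in\mathbb N$ such that $(M,f,c)\oplus n(\mathbb Z,\pm1,1)\simeq(M',f',c')\oplus n'(\mathbb Z,\pm1,1)$.
   Context: A symmetric bilinear lattice $(M,f)$ is a finitely generated free abelian group $M$ with a symmetric bilinear form $f:M\times M\to\mathbb Z$ (possibly degenerate). Put $V=M\otimes\mathbb Q$, $f_{\mathbb Q}$ the extension of $f$ to $V$, $M^*=\mathrm{Hom}(M,\mathbb Z)$, $\widehat f:M\to M^*$, $\widehat f(x)=f(x,-)$. A characteristic form for $f$ is $c\in M^*$ with $f(x,x)-c(x)\in2\mathbb Z$ for all $x\in M$; $c_{\mathbb Q}:V\to\mathbb Q$ is its linear extension. Set $M^\sharp=\{x\in V:f_{\mathbb Q}(x,M)\subset\mathbb Z\}$, $G_f=M^\sharp/M$, and $\phi_{f,c}:G_f\to\mathbb Q/\mathbb Z$, $\phi_{f,c}([x])=\tfrac12(f_{\mathbb Q}(x,x)-c_{\mathbb Q}(x))\bmod\mathbb Z$. Two triples are isomorphic, $(M,f,c)\simeq(M',f',c')$, if there is a group isomorphism $\theta:M\to M'$ with $f'(\theta x,\theta y)=f(x,y)$ for all $x,y\in M$ and $c'\circ\theta\equiv c\bmod2\widehat f(M)$. Triples are added by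 orthogonal sum $\oplus$. For a sign $\varepsilon=\pm1$, $(\mathbb Z,\varepsilon,1)$ denotes $\mathbb Z$ with the bilinear form $(x,y)\mapsto\varepsilon xy$ equipped with the Wu class $1$, i.e. with the characteristic form $x\mapsto\varepsilon x$ (which agrees with $x\mapsto x$ modulo $2\widehat{\varepsilon}(\mathbb Z)=2\,\mathrm{Hom}(\mathbb Z,\mathbb Z)$). For $n\in\mathbb N$ (with $n=0$ allowed), $n(\mathbb Z,\pm1,1)$ denotes an $n$-fold orthogonal sum of some copies of $(\mathbb Z,1,1)$ and $(\mathbb Z,-1,1)$, the signs being arbitrary for each summand. *)

theory Defs
  imports "HOL-Algebra.Free_Abelian_Groups"
begin

section \<open>Symmetric bilinear lattices and characteristic forms\<close>

definition fin_gen_free_abelian :: "('a, 'm) monoid_scheme \<Rightarrow> bool"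
  where "fin_gen_free_abelian M \<longleftrightarrow>
    comm_group M \<and> (\<exists>S :: nat set. finite S \<and> M \<cong> free_Abelian_group S)"

definition symmetric_bilinear_lattice :: "('a, 'm) monoid_scheme \<Rightarrow> ('a \<Rightarrow> 'a \<Rightarrow> int) \<Rightarrow> bool"
  where "symmetric_bilinear_lattice M f \<longleftrightarrow>
    fin_gen_free_abelian M \<and>
    (\<forall>x\<in>carrier M. f x \<in> hom M integer_group) \<and>
    (\<forall>x\<in>carrier M. \<forall>y\<in>carrier M. f x y = f y x)"

definition characteristic_form :: "('a, 'm) monoid_scheme \<Rightarrow> ('a \<Rightarrow> 'a \<Rightarrow> int) \<Rightarrow> ('a \<Rightarrow> int) \<Rightarrow> bool"
  where "characteristic_form M f c \<longleftrightarrow>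
    c \<in> hom M integer_group \<and> (\<forall>x\<in>carrier M. even (f x x - c x))"


section \<open>The rational extension \<open>M \<otimes> \<rat>\<close>\<close>

text \<open>
  The tensor product over the integers is the free abelian group on pairs \<open>(x, q)\<close> modulo the
  subgroup generated by the biadditivity relations; its elements are cosets.
\<close>

definition tensor_relations :: "('a, 'm) monoid_scheme \<Rightarrow> (('a \<times> rat) \<Rightarrow>\<^sub>0 int) set"
  where "tensor_relations M =
    {frag_of (x \<otimes>\<^bsub>M\<^esub> y, q) - frag_of (x, q) - frag_of (y, q) | x y q.
        x \<in> carrier M \<and> y \<in> carrier M} \<union>
    {frag_of (x, q + r) - frag_of (x, q) - frag_of (x, r) | x q r. x \<in> carrier M}"

definition tensor_kernel :: "('a, 'm) monoid_scheme \<Rightarrow> (('a \<times> rat) \<Rightarrow>\<^sub>0 int) set"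
  where "tensor_kernel M =
    generate (free_Abelian_group (carrier M \<times> UNIV)) (tensor_relations M)"

definition rat_tensor :: "('a, 'm) monoid_scheme \<Rightarrow> (('a \<times> rat) \<Rightarrow>\<^sub>0 int) set monoid"
  where "rat_tensor M = free_Abelian_group (carrier M \<times> UNIV) Mod tensor_kernel M"

definition pure_tensor :: "('a, 'm) monoid_scheme \<Rightarrow> 'a \<Rightarrow> rat \<Rightarrow> (('a \<times> rat) \<Rightarrow>\<^sub>0 int) set"
  where "pure_tensor M x q =
    tensor_kernel M #>\<^bsub>free_Abelian_group (carrier M \<times> UNIV)\<^esub> frag_of (x, q)"

definition frag_eval :: "('p \<Rightarrow> rat) \<Rightarrow> ('p \<Rightarrow>\<^sub>0 int) \<Rightarrow> rat"
  where "frag_eval g a = (\<Sum>p\<in>Poly_Mapping.keys a. of_int (Poly_Mapping.lookup a p) * g p)"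

text \<open>
  The rational extensions of linear and bilinear forms, determined by
  \<open>x \<otimes> q \<mapsto> q c(x)\<close> and \<open>(x \<otimes> q, y \<otimes> r) \<mapsto> q r f(x, y)\<close>. The value on a coset is computed on
  a representative; it does not depend on the representative by \<open>linear_ext_coset\<close> and
  \<open>bilinear_ext_coset\<close> below.
\<close>

definition linear_ext :: "('a \<Rightarrow> int) \<Rightarrow> (('a \<times> rat) \<Rightarrow>\<^sub>0 int) set \<Rightarrow> rat"
  where "linear_ext c u = the_elem (frag_eval (\<lambda>(x, q). q * of_int (c x)) ` u)"

definition bilinear_ext ::
    "('a \<Rightarrow> 'a \<Rightarrow> int) \<Rightarrow> (('a \<times> rat) \<Rightarrow>\<^sub>0 int) set \<Rightarrow> (('a \<times> rat) \<Rightarrow>\<^sub>0 int) set \<Rightarrow> rat"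
  where "bilinear_ext f u v =
    the_elem ((\<lambda>(a, b). frag_eval (\<lambda>(x, q). frag_eval (\<lambda>(y, r). q * r * of_int (f x y)) b) a) ` (u \<times> v))"


section \<open>The discriminant group and its quadratic function\<close>

definition dual_lattice :: 
    "('a, 'm) monoid_scheme \<Rightarrow> ('a \<Rightarrow> 'a \<Rightarrow> int) \<Rightarrow> (('a \<times> rat) \<Rightarrow>\<^sub>0 int) set set"
  where "dual_lattice M f =
    {u \<in> carrier (rat_tensor M). \<forall>x\<in>carrier M. bilinear_ext f u (pure_tensor M x 1) \<in> \<int>}"

definition discriminant_group ::
    "('a, 'm) monoid_scheme \<Rightarrow> ('a \<Rightarrow> 'a \<Rightarrow> int) \<Rightarrow> (('a \<times> rat) \<Rightarrow>\<^sub>0 int) set set monoid"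
  where "discriminant_group M f =
    (rat_tensor M)\<lparr>carrier := dual_lattice M f\<rparr> Mod ((\<lambda>x. pure_tensor M x 1) ` carrier M)"

definition rat_group :: "rat monoid"
  where "rat_group = \<lparr>carrier = UNIV, monoid.mult = (+), one = 0\<rparr>"

text \<open>The class of \<open>q\<close> in \<open>\<rat>/\<int>\<close>, that is, an element of \<open>rat_group Mod \<int>\<close>.\<close>

definition mod_Ints :: "rat \<Rightarrow> rat set"
  where "mod_Ints q = \<int> #>\<^bsub>rat_group\<^esub> q"

text \<open>Evaluated on a representative; see \<open>discriminant_quadratic_coset\<close>.\<close>

definition discriminant_quadratic ::
    "('a \<Rightarrow> 'a \<Rightarrow> int) \<Rightarrow> ('a \<Rightarrow> int) \<Rightarrow> (('a \<times> rat) \<Rightarrow>\<^sub>0 int) set set \<Rightarrow> rat set"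
  where "discriminant_quadratic f c X =
    the_elem ((\<lambda>u. mod_Ints ((bilinear_ext f u u - linear_ext c u) / 2)) ` X)"


section \<open>Triples, isomorphisms and orthogonal sums\<close>

type_synonym 'a lattice_triple = "'a monoid \<times> ('a \<Rightarrow> 'a \<Rightarrow> int) \<times> ('a \<Rightarrow> int)"

fun triple_iso :: "'a lattice_triple \<Rightarrow> 'b lattice_triple \<Rightarrow> bool" (infix \<open>\<simeq>\<^sub>L\<close> 50)
  where "(M, f, c) \<simeq>\<^sub>L (M', f', c') \<longleftrightarrow>
    (\<exists>\<theta>\<in>iso M M'.
      (\<forall>x\<in>carrier M. \<forall>y\<in>carrier M. f' (\<theta> x) (\<theta> y) = f x y) \<and>
      (\<exists>z\<in>carrier M. \<forall>x\<in>carrier M. c' (\<theta> x) - c x = 2 * f z x))"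

fun orth_sum :: "'a lattice_triple \<Rightarrow> 'b lattice_triple \<Rightarrow> ('a \<times> 'b) lattice_triple" (infixr \<open>\<oplus>\<^sub>L\<close> 65)
  where "(M, f, c) \<oplus>\<^sub>L (M', f', c') =
    (M \<times>\<times> M', \<lambda>(x, x') (y, y'). f x y + f' x' y', \<lambda>(x, x'). c x + c' x')"

definition orth_sum_family :: "'i set \<Rightarrow> ('i \<Rightarrow> 'a lattice_triple) \<Rightarrow> ('i \<Rightarrow> 'a) lattice_triple"
  where "orth_sum_family I T =
    (product_group I (\<lambda>i. fst (T i)),
     \<lambda>x y. \<Sum>i\<in>I. fst (snd (T i)) (x i) (y i),
     \<lambda>x. \<Sum>i\<in>I. snd (snd (T i)) (x i))"

text \<open>\<open>(\<int>, \<epsilon>, 1)\<close>: the Wu class \<open>1\<close> corresponds to the characteristic form \<open>x \<mapsto> \<epsilon>(1, x)\<close>.\<close>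

definition unit_triple :: "int \<Rightarrow> int lattice_triple"
  where "unit_triple \<epsilon> = (integer_group, \<lambda>x y. \<epsilon> * x * y, \<lambda>x. \<epsilon> * x)"

text \<open>\<open>n(\<int>, \<plusminus>1, 1)\<close>, where \<open>\<epsilon> i\<close> is the sign of the \<open>i\<close>-th summand.\<close>

definition unit_sum :: "nat \<Rightarrow> (nat \<Rightarrow> int) \<Rightarrow> (nat \<Rightarrow> int) lattice_triple"
  where "unit_sum n \<epsilon> = orth_sum_family {..<n} (\<lambda>i. unit_triple (\<epsilon> i))"


section \<open>The definitions do not depend on representatives\<close>

lemma frag_eval_superset:
  assumes "finite S" "Poly_Mapping.keys a \<subseteq> S"
  shows "frag_eval g a = (\<Sum>p\<in>S. of_int (Poly_Mapping.lookup a p) * g p)"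
  unfolding frag_eval_def
  by (rule sum.mono_neutral_left) (use assms in \<open>auto simp: in_keys_iff\<close>)

lemma frag_eval_add: "frag_eval g (a + b) = frag_eval g a + frag_eval g b"
proof -
  let ?S = "Poly_Mapping.keys a \<union> Poly_Mapping.keys b"
  have "frag_eval g (a + b) = (\<Sum>p\<in>?S. of_int (Poly_Mapping.lookup (a + b) p) * g p)"
    by (rule frag_eval_superset) (auto dest: subsetD[OF keys_add])
  also have "\<dots> = frag_eval g a + frag_eval g b"
    by (simp add: frag_eval_superset[of ?S a] frag_eval_superset[of ?S b] lookup_add
        sum.distrib algebra_simps)
  finally show ?thesis .
qed

lemma frag_eval_zero [simp]: "frag_eval g 0 = 0"
  by (simp add: frag_eval_def)

lemma frag_eval_uminus: "frag_eval g (- a) = - frag_eval g a"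
  using frag_eval_add[of g a "- a"] by simp

lemma frag_eval_diff: "frag_eval g (a - b) = frag_eval g a - frag_eval g b"
  using frag_eval_add[of g a "- b"] by (simp add: frag_eval_uminus)

lemma frag_eval_of [simp]: "frag_eval g (frag_of p) = g p"
  by (simp add: frag_eval_def)

lemma frag_eval_add_fun: "frag_eval (\<lambda>p. g p + h p) a = frag_eval g a + frag_eval h a"
  by (simp add: frag_eval_def sum.distrib algebra_simps)

lemma frag_eval_scale_fun: "frag_eval (\<lambda>p. k * g p) a = k * frag_eval g a"
  by (simp add: frag_eval_def sum_distrib_left algebra_simps)

lemma tensor_relations_subset:
  assumes "comm_group M"
  shows "tensor_relations M \<subseteq> carrier (free_Abelian_group (carrier M \<times> UNIV))"
proof -
  interpret comm_group M by fact
  show ?thesis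
    unfolding tensor_relations_def
    by (auto dest!: subsetD[OF keys_diff] split: if_splits)
qed

lemma tensor_kernel_subgroup:
  "comm_group M \<Longrightarrow> subgroup (tensor_kernel M) (free_Abelian_group (carrier M \<times> UNIV))"
  unfolding tensor_kernel_def
  by (intro group.generate_is_subgroup tensor_relations_subset) auto

lemma tensor_kernel_eval:
  assumes "comm_group M" "a \<in> tensor_kernel M"
    and rel: "\<And>a. a \<in> tensor_relations M \<Longrightarrow> frag_eval g a = 0"
  shows "frag_eval g a = 0"
  using assms(2) unfolding tensor_kernel_def
proof (induction rule: generate.induct)
  case (inv h)
  then show ?case
    using tensor_relations_subset[OF assms(1)] rel by (auto simp: frag_eval_uminus)
qed (auto simp: rel frag_eval_add)

lemma mem_tensor_cosetE:
  assumes "b \<in> tensor_kernel M #>\<^bsub>free_Abelian_group (carrier M \<times> UNIV)\<^esub> a"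
  obtains h where "h \<in> tensor_kernel M" "b = h + a"
  using assms by (auto simp: r_coset_def)

lemma tensor_coset_nonempty:
  assumes "comm_group M"
  shows "a \<in> tensor_kernel M #>\<^bsub>free_Abelian_group (carrier M \<times> UNIV)\<^esub> a"
  using subgroup.one_closed[OF tensor_kernel_subgroup[OF assms]] by (force simp: r_coset_def)

lemma linear_ext_coset:
  assumes "comm_group M" "c \<in> hom M integer_group"
  shows "linear_ext c (tensor_kernel M #>\<^bsub>free_Abelian_group (carrier M \<times> UNIV)\<^esub> a) =
    frag_eval (\<lambda>(x, q). q * of_int (c x)) a"
proof -
  let ?g = "\<lambda>(x, q). q * rat_of_int (c x)"
  let ?U = "tensor_kernel M #>\<^bsub>free_Abelian_group (carrier M \<times> UNIV)\<^esub> a"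
  have "frag_eval ?g h = 0" if "h \<in> tensor_kernel M" for h
    using assms(1) that
    by (rule tensor_kernel_eval)
      (use assms(2) in \<open>auto simp: tensor_relations_def frag_eval_diff hom_def distrib_left distrib_right\<close>)
  hence "frag_eval ?g b = frag_eval ?g a" if "b \<in> ?U" for b
    using that by (auto elim!: mem_tensor_cosetE simp: frag_eval_add)
  hence "the_elem (frag_eval ?g ` ?U) = frag_eval ?g a"
    using tensor_coset_nonempty[OF assms(1), of a] by (intro the_elem_image_unique) blast+
  thus ?thesis by (simp add: linear_ext_def)
qed

lemma bilinear_ext_coset:
  assumes "symmetric_bilinear_lattice M f"
  assumes a: "a \<in> carrier (free_Abelian_group (carrier M \<times> UNIV))"
    and b: "b \<in> carrier (free_Abelian_group (carrier M \<times> UNIV))"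
  shows "bilinear_ext f (tensor_kernel M #>\<^bsub>free_Abelian_group (carrier M \<times> UNIV)\<^esub> a)
      (tensor_kernel M #>\<^bsub>free_Abelian_group (carrier M \<times> UNIV)\<^esub> b) =
    frag_eval (\<lambda>(x, q). frag_eval (\<lambda>(y, r). q * r * of_int (f x y)) b) a"
proof -
  have M: "comm_group M" and f: "\<And>x. x \<in> carrier M \<Longrightarrow> f x \<in> hom M integer_group"
    and sym: "\<And>x y. x \<in> carrier M \<Longrightarrow> y \<in> carrier M \<Longrightarrow> f x y = f y x"
    using assms(1) by (auto simp: symmetric_bilinear_lattice_def fin_gen_free_abelian_def)
  interpret M: comm_group M by (fact M)
  let ?F = "free_Abelian_group (carrier M \<times> (UNIV :: rat set))"
  let ?B = "\<lambda>a b. frag_eval (\<lambda>(x, q). frag_eval (\<lambda>(y, r). q * r * rat_of_int (f x y)) b) a"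
  have ker: "tensor_kernel M \<subseteq> carrier ?F"
    using subgroup.subset[OF tensor_kernel_subgroup[OF M]] .
  have add1: "f (x \<otimes>\<^bsub>M\<^esub> y) z = f x z + f y z"
    if "x \<in> carrier M" "y \<in> carrier M" "z \<in> carrier M" for x y z
    using that f[of z] sym[of "x \<otimes>\<^bsub>M\<^esub> y" z] sym[of x z] sym[of y z] by (simp add: hom_def)
  have in1: "frag_eval (\<lambda>(y, r). q * r * rat_of_int (f x y)) h = 0"
    if "h \<in> tensor_kernel M" "x \<in> carrier M" for h x q
    using M that(1)
    by (rule tensor_kernel_eval)
      (use f[OF that(2)] in \<open>auto simp: tensor_relations_def frag_eval_diff hom_def distrib_left distrib_right\<close>)
  have right: "?B a h = 0" if "a \<in> carrier ?F" "h \<in> tensor_kernel M" for a h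
    unfolding frag_eval_def[of _ a] by (rule sum.neutral) (use that in1 in auto)
  have left: "?B h b = 0" if b: "b \<in> carrier ?F" and "h \<in> tensor_kernel M" for b h
    using M \<open>h \<in> _\<close>
  proof (rule tensor_kernel_eval)
    fix t assume "t \<in> tensor_relations M"
    then consider x y q where "x \<in> carrier M" "y \<in> carrier M"
        "t = frag_of (x \<otimes>\<^bsub>M\<^esub> y, q) - frag_of (x, q) - frag_of (y, q)"
      | x q r where "x \<in> carrier M" "t = frag_of (x, q + r) - frag_of (x, q) - frag_of (x, r)"
      unfolding tensor_relations_def by blast
    then show "?B t b = 0"
    proof cases
      case 1
      have "frag_eval (\<lambda>(z, r). q * r * rat_of_int (f (x \<otimes>\<^bsub>M\<^esub> y) z)) b =
          frag_eval (\<lambda>p. (\<lambda>(z, r). q * r * rat_of_int (f x z)) p + (\<lambda>(z, r). q * r * rat_of_int (f y z)) p) b"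
        unfolding frag_eval_def
        by (rule sum.cong[OF refl]) (use b 1 in \<open>auto simp: add1 algebra_simps\<close>)
      then show ?thesis using 1 by (simp add: frag_eval_diff frag_eval_add_fun)
    next
      case 2
      have "frag_eval (\<lambda>(z, s). (q + r) * s * rat_of_int (f x z)) b =
          frag_eval (\<lambda>p. (\<lambda>(z, s). q * s * rat_of_int (f x z)) p + (\<lambda>(z, s). r * s * rat_of_int (f x z)) p) b"
        unfolding frag_eval_def
        by (rule sum.cong[OF refl]) (auto simp: algebra_simps)
      then show ?thesis using 2 by (simp add: frag_eval_diff frag_eval_add_fun)
    qed
  qed
  have addr: "?B a (b + b') = ?B a b + ?B a b'" for a b b'
    by (simp add: frag_eval_add case_prod_unfold flip: frag_eval_add_fun)
  have addl: "?B (a + a') b = ?B a b + ?B a' b" for a a' b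
    by (simp add: frag_eval_add)
  have "?B a' b' = ?B a b" if a': "a' \<in> tensor_kernel M #>\<^bsub>?F\<^esub> a"
    and b': "b' \<in> tensor_kernel M #>\<^bsub>?F\<^esub> b" for a' b'
  proof -
    obtain h k where "h \<in> tensor_kernel M" "a' = h + a" "k \<in> tensor_kernel M" "b' = k + b"
      using mem_tensor_cosetE[OF a'] mem_tensor_cosetE[OF b'] by metis
    moreover from this ker have "h \<in> carrier ?F" by blast
    ultimately show ?thesis
      using left[OF b, of h] right[OF a, of k] right[of h k] by (simp only: addl addr)
  qed
  hence "the_elem ((\<lambda>(a, b). ?B a b) ` ((tensor_kernel M #>\<^bsub>?F\<^esub> a) \<times> (tensor_kernel M #>\<^bsub>?F\<^esub> b))) =
      ?B a b"
    using tensor_coset_nonempty[OF M, of a] tensor_coset_nonempty[OF M, of b]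
    by (intro the_elem_image_unique) (blast, clarify)
  thus ?thesis by (simp add: bilinear_ext_def)
qed

lemma linear_ext_pure_tensor:
  "comm_group M \<Longrightarrow> c \<in> hom M integer_group \<Longrightarrow> linear_ext c (pure_tensor M x q) = q * of_int (c x)"
  by (simp add: pure_tensor_def linear_ext_coset)

lemma bilinear_ext_pure_tensor:
  assumes "symmetric_bilinear_lattice M f" "x \<in> carrier M" "y \<in> carrier M"
  shows "bilinear_ext f (pure_tensor M x q) (pure_tensor M y r) = q * r * of_int (f x y)"
  using assms by (simp add: pure_tensor_def bilinear_ext_coset)

lemma carrier_rat_tensorE:
  assumes "u \<in> carrier (rat_tensor M)"
  obtains a where "a \<in> carrier (free_Abelian_group (carrier M \<times> UNIV))"
    "u = tensor_kernel M #>\<^bsub>free_Abelian_group (carrier M \<times> UNIV)\<^esub> a"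
  using assms by (auto simp: rat_tensor_def FactGroup_def RCOSETS_def)

lemma mult_rat_tensor_coset:
  assumes "comm_group M"
    and "a \<in> carrier (free_Abelian_group (carrier M \<times> UNIV))"
    and "b \<in> carrier (free_Abelian_group (carrier M \<times> UNIV))"
  shows "(tensor_kernel M #>\<^bsub>free_Abelian_group (carrier M \<times> UNIV)\<^esub> a) \<otimes>\<^bsub>rat_tensor M\<^esub>
      (tensor_kernel M #>\<^bsub>free_Abelian_group (carrier M \<times> UNIV)\<^esub> b) =
    tensor_kernel M #>\<^bsub>free_Abelian_group (carrier M \<times> UNIV)\<^esub> (a + b)"
proof -
  let ?F = "free_Abelian_group (carrier M \<times> (UNIV :: rat set))"
  have "tensor_kernel M \<lhd> ?F"
    using comm_group.subgroup_imp_normal[OF abelian_free_Abelian_group tensor_kernel_subgroup[OF assms(1)]] .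
  then show ?thesis
    using normal.rcos_sum[of "tensor_kernel M" ?F a b] assms(2,3)
    by (simp add: rat_tensor_def FactGroup_def)
qed

lemma linear_ext_mult:
  assumes "comm_group M" "c \<in> hom M integer_group"
    and "u \<in> carrier (rat_tensor M)" "v \<in> carrier (rat_tensor M)"
  shows "linear_ext c (u \<otimes>\<^bsub>rat_tensor M\<^esub> v) = linear_ext c u + linear_ext c v"
  using assms(3,4)
  by (auto elim!: carrier_rat_tensorE
      simp: mult_rat_tensor_coset[OF assms(1)] linear_ext_coset[OF assms(1,2)] frag_eval_add)

lemma bilinear_ext_mult:
  assumes L: "symmetric_bilinear_lattice M f"
    and u: "u \<in> carrier (rat_tensor M)" and v: "v \<in> carrier (rat_tensor M)"
    and w: "w \<in> carrier (rat_tensor M)"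
  shows "bilinear_ext f (u \<otimes>\<^bsub>rat_tensor M\<^esub> v) w = bilinear_ext f u w + bilinear_ext f v w"
    and "bilinear_ext f w (u \<otimes>\<^bsub>rat_tensor M\<^esub> v) = bilinear_ext f w u + bilinear_ext f w v"
proof -
  let ?F = "free_Abelian_group (carrier M \<times> (UNIV :: rat set))"
  have M: "comm_group M"
    using L by (auto simp: symmetric_bilinear_lattice_def fin_gen_free_abelian_def)
  obtain a b d where a: "a \<in> carrier ?F" "u = tensor_kernel M #>\<^bsub>?F\<^esub> a"
    and b: "b \<in> carrier ?F" "v = tensor_kernel M #>\<^bsub>?F\<^esub> b"
    and d: "d \<in> carrier ?F" "w = tensor_kernel M #>\<^bsub>?F\<^esub> d"
    using carrier_rat_tensorE[OF u] carrier_rat_tensorE[OF v] carrier_rat_tensorE[OF w] by metis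
  have ab: "a + b \<in> carrier ?F"
    using a(1) b(1) by (auto dest!: subsetD[OF keys_add])
  show "bilinear_ext f (u \<otimes>\<^bsub>rat_tensor M\<^esub> v) w = bilinear_ext f u w + bilinear_ext f v w"
    unfolding a(2) b(2) d(2) mult_rat_tensor_coset[OF M a(1) b(1)]
      bilinear_ext_coset[OF L ab d(1)] bilinear_ext_coset[OF L a(1) d(1)]
      bilinear_ext_coset[OF L b(1) d(1)]
    by (rule frag_eval_add)
  show "bilinear_ext f w (u \<otimes>\<^bsub>rat_tensor M\<^esub> v) = bilinear_ext f w u + bilinear_ext f w v"
    unfolding a(2) b(2) d(2) mult_rat_tensor_coset[OF M a(1) b(1)]
      bilinear_ext_coset[OF L d(1) ab] bilinear_ext_coset[OF L d(1) a(1)]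
      bilinear_ext_coset[OF L d(1) b(1)]
    by (simp add: frag_eval_add case_prod_unfold flip: frag_eval_add_fun)
qed

lemma bilinear_ext_sym:
  assumes L: "symmetric_bilinear_lattice M f"
    and u: "u \<in> carrier (rat_tensor M)" and v: "v \<in> carrier (rat_tensor M)"
  shows "bilinear_ext f u v = bilinear_ext f v u"
proof -
  let ?F = "free_Abelian_group (carrier M \<times> (UNIV :: rat set))"
  obtain a b where a: "a \<in> carrier ?F" "u = tensor_kernel M #>\<^bsub>?F\<^esub> a"
    and b: "b \<in> carrier ?F" "v = tensor_kernel M #>\<^bsub>?F\<^esub> b"
    using carrier_rat_tensorE[OF u] carrier_rat_tensorE[OF v] by metis
  have sym: "f (fst p) (fst q) = f (fst q) (fst p)"
    if "p \<in> Poly_Mapping.keys a" "q \<in> Poly_Mapping.keys b" for p q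
    using L a(1) b(1) that by (force simp: symmetric_bilinear_lattice_def)
  show ?thesis
    unfolding a(2) b(2) bilinear_ext_coset[OF L a(1) b(1)] bilinear_ext_coset[OF L b(1) a(1)]
      frag_eval_def case_prod_unfold sum_distrib_left
    by (subst sum.swap, intro sum.cong refl, subst sym, assumption, assumption)
      (simp only: mult_ac)
qed

lemma mem_mod_Ints_iff: "t \<in> mod_Ints q \<longleftrightarrow> t - q \<in> \<int>"
proof
  assume "t \<in> mod_Ints q"
  then obtain k where "k \<in> \<int>" "t = k + q" by (auto simp: mod_Ints_def r_coset_def rat_group_def)
  then show "t - q \<in> \<int>" by simp
next
  assume "t - q \<in> \<int>"
  moreover have "t = (t - q) + q" by simp
  ultimately show "t \<in> mod_Ints q"
    unfolding mod_Ints_def r_coset_def rat_group_def by (simp only: UN_iff singleton_iff monoid.simps) blast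
qed

lemma mod_Ints_eq_iff: "mod_Ints q = mod_Ints r \<longleftrightarrow> q - r \<in> \<int>"
proof
  assume "mod_Ints q = mod_Ints r"
  moreover have "q \<in> mod_Ints q" by (simp add: mem_mod_Ints_iff)
  ultimately show "q - r \<in> \<int>" by (simp add: mem_mod_Ints_iff)
next
  assume *: "q - r \<in> \<int>"
  have "t - q \<in> \<int> \<longleftrightarrow> t - r \<in> \<int>" for t
    using Ints_add[OF _ *, of "t - q"] Ints_diff[OF _ *, of "t - r"] by auto
  then show "mod_Ints q = mod_Ints r" by (auto simp: mem_mod_Ints_iff)
qed

lemma pure_tensor_closed: "x \<in> carrier M \<Longrightarrow> pure_tensor M x q \<in> carrier (rat_tensor M)"
  by (auto simp: pure_tensor_def rat_tensor_def FactGroup_def RCOSETS_def)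

lemma discriminant_quadratic_coset:
  assumes L: "symmetric_bilinear_lattice M f" and c: "characteristic_form M f c"
    and u: "u \<in> dual_lattice M f"
  shows "discriminant_quadratic f c
      (((\<lambda>x. pure_tensor M x 1) ` carrier M) #>\<^bsub>(rat_tensor M)\<lparr>carrier := dual_lattice M f\<rparr>\<^esub> u) =
    mod_Ints ((bilinear_ext f u u - linear_ext c u) / 2)"
proof -
  let ?q = "\<lambda>u. (bilinear_ext f u u - linear_ext c u) / 2"
  let ?X = "((\<lambda>x. pure_tensor M x 1) ` carrier M) #>\<^bsub>(rat_tensor M)\<lparr>carrier := dual_lattice M f\<rparr>\<^esub> u"
  have M: "comm_group M"
    using L by (auto simp: symmetric_bilinear_lattice_def fin_gen_free_abelian_def)
  have ch: "c \<in> hom M integer_group" "\<And>x. x \<in> carrier M \<Longrightarrow> even (f x x - c x)"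
    using c by (auto simp: characteristic_form_def)
  have uV: "u \<in> carrier (rat_tensor M)"
    and ui: "\<And>x. x \<in> carrier M \<Longrightarrow> bilinear_ext f u (pure_tensor M x 1) \<in> \<int>"
    using u by (auto simp: dual_lattice_def)
  have X: "?X = (\<lambda>x. pure_tensor M x 1 \<otimes>\<^bsub>rat_tensor M\<^esub> u) ` carrier M"
    by (auto simp: r_coset_def)
  have "mod_Ints (?q (pure_tensor M x 1 \<otimes>\<^bsub>rat_tensor M\<^esub> u)) = mod_Ints (?q u)"
    if x: "x \<in> carrier M" for x
  proof -
    let ?x = "pure_tensor M x 1"
    have xV: "?x \<in> carrier (rat_tensor M)" using x by (rule pure_tensor_closed)
    have prod: "?x \<otimes>\<^bsub>rat_tensor M\<^esub> u \<in> carrier (rat_tensor M)"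
    proof -
      have "tensor_kernel M \<lhd> free_Abelian_group (carrier M \<times> (UNIV :: rat set))"
        using comm_group.subgroup_imp_normal[OF abelian_free_Abelian_group tensor_kernel_subgroup[OF M]] .
      then have "group (rat_tensor M)"
        unfolding rat_tensor_def by (rule normal.factorgroup_is_group)
      then interpret V: group "rat_tensor M" .
      show ?thesis using xV uV by simp
    qed
    obtain k where k: "f x x - c x = 2 * k" using ch(2)[OF x] by (rule evenE)
    hence k': "rat_of_int (f x x) - of_int (c x) = 2 * of_int k"
      by (metis of_int_diff of_int_mult of_int_numeral)
    have "?q (?x \<otimes>\<^bsub>rat_tensor M\<^esub> u) - ?q u =
        bilinear_ext f u ?x + (bilinear_ext f ?x ?x - linear_ext c ?x) / 2"
      by (simp add: bilinear_ext_mult(1)[OF L xV uV prod] bilinear_ext_mult(2)[OF L xV uV xV]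
          bilinear_ext_mult(2)[OF L xV uV uV] linear_ext_mult[OF M ch(1) xV uV]
          bilinear_ext_sym[OF L xV uV] field_simps)
    also have "\<dots> = bilinear_ext f u ?x + of_int k"
      using k' by (simp add: bilinear_ext_pure_tensor[OF L x x] linear_ext_pure_tensor[OF M ch(1)])
    also have "\<dots> \<in> \<int>" using ui[OF x] by simp
    finally show ?thesis by (simp add: mod_Ints_eq_iff)
  qed
  moreover have "carrier M \<noteq> {}"
    using monoid.one_closed[of M] M by (auto simp: comm_group_def group_def)
  ultimately have "(\<lambda>u. mod_Ints (?q u)) ` ?X = {mod_Ints (?q u)}"
    unfolding X image_image by (auto simp: image_iff)
  thus ?thesis by (simp add: discriminant_quadratic_def)
qed

end

theory Submission
  imports Defs "Jordan_Normal_Form.Determinant" "HOL-Computational_Algebra.Primes" "HOL-Combinatorics.Permutations"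
begin

text \<open>
  Adding a copy of \<open>(\<int>, \<plusminus>1, 1)\<close> does not change the discriminant quadratic function: the summand is
  unimodular, and \<open>(\<epsilon> x\<^sup>2 - \<epsilon> x) / 2\<close> is an integer for every integer \<open>x\<close>. The other direction has an
  elementary core, the lemma \<open>stably_iso_glue\<close>, and two reductions that lead to it.

  Let \<open>A\<close> and \<open>B\<close> be the Gram matrices of two nondegenerate lattices. An isomorphism of discriminant
  groups sends the \<open>j\<close>-th column of \<open>A\<inverse>\<close> to \<open>B\<inverse> p\<close> for an integral vector \<open>p\<close>, and these vectors are
  the columns of an integral matrix \<open>P\<close>. That it respects the linking pairing means that
  \<open>S = A\<inverse> - P\<^sup>T B\<inverse> P\<close> is integral, and then the symmetric matrix \<open>U\<close> with blocks \<open>S, - P\<^sup>T, - P, - B\<close> is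
  unimodular. The lattice \<open>B \<oplus> U\<close> contains an isometric copy of \<open>A\<close> on which the orthogonal projection
  is integral, hence \<open>B \<oplus> U \<cong> A \<oplus> W\<close> with \<open>W\<close> unimodular. That the isomorphism respects the quadratic
  functions makes the characteristic forms fit together.

  A unimodular form becomes diagonal after adding enough signs (\<open>unimodular_stably_diag\<close>), and its
  characteristic forms are all congruent modulo twice the adjoint, so both \<open>U\<close> and \<open>W\<close> may be absorbed.
  For the diagonalisation an isotropic vector splits off a unimodular plane, which an induction
  removes. An anisotropic form is brought to tridiagonal shape, where its leading minors \<open>t\<^sub>i\<close> give the
  rational diagonal entries \<open>t\<^sub>i t\<^sub>i\<^sub>+\<^sub>1\<close>. Since the determinant is \<open>\<plusminus>1\<close>, the residues of these entries
  cancel at every prime, so that the form is a sum of signs in the Witt group of \<open>\<rat>\<close>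
  (\<open>witt_rel_continuant\<close>, by the descent over the primes of Milnor). Realising the Witt relations by
  changes of orthogonal bases gives a rational Lagrangian, after signs are added, and a unimodular form
  with a rational Lagrangian is an iterated sum of unimodular planes up to signs.

  In general the radical splits off: the lattice is \<open>0\<^sub>r \<oplus> N\<close> with \<open>det N \<noteq> 0\<close>, and the characteristic
  form on the radical is \<open>2 d\<close> times the first coordinate. The divisible part of the discriminant group
  is \<open>(\<rat> / \<int>)\<^sup>r\<close>, whose elements of order two determine \<open>r\<close>; on it the quadratic function is
  \<open>x \<mapsto> - d x\<^sub>1\<close>, which determines \<open>d\<close>. An isomorphism preserves the divisible part and induces an isomorphism
  of the quotients, but it need not respect the complements \<open>N\<close>. The defect changes the
  characteristic form of \<open>N\<close> by a multiple of \<open>2 d\<close>, which a shear along the radical compensates.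

  All of this takes place in coordinates: \<open>duals A\<close> is the dual lattice of \<open>\<int>\<^sup>n\<close> with Gram matrix \<open>A\<close>,
  and \<open>disc_equiv\<close> expresses an isomorphism of discriminants by maps of rational vectors that are
  additive modulo integral vectors.
\<close>

abbreviation Mat :: "nat \<Rightarrow> nat \<Rightarrow> 'a mat set" where "Mat \<equiv> carrier_mat"
abbreviation Vec :: "nat \<Rightarrow> 'a vec set" where "Vec \<equiv> carrier_vec"
abbreviation Zvec :: "nat \<Rightarrow> int vec monoid" where "Zvec n \<equiv> monoid_vec TYPE(int) n"
abbreviation scale_vec (infixl \<open>\<cdot>v\<close> 70) where "k \<cdot>v x \<equiv> smult_vec k x"
abbreviation app_vec (infixr \<open>@v\<close> 65) where "x @v y \<equiv> append_vec x y"
abbreviation mat_vec :: "'a :: semiring_0 mat \<Rightarrow> 'a vec \<Rightarrow> 'a vec" (infixl \<open>*v\<close> 70)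
  where "A *v x \<equiv> mult_mat_vec A x"

section \<open>Integral row and column reduction\<close>

definition unim :: "nat \<Rightarrow> int mat \<Rightarrow> bool"
  where "unim n E \<longleftrightarrow> E \<in> Mat n n \<and> \<bar>det E\<bar> = 1"

lemma unim_carrier [simp]: "unim n E \<Longrightarrow> E \<in> Mat n n"
  by (simp add: unim_def)

lemma unim_one [simp]: "unim n (1\<^sub>m n)"
  unfolding unim_def by simp

lemma unim_mult: "unim n E \<Longrightarrow> unim n F \<Longrightarrow> unim n (E * F)"
  unfolding unim_def by (simp add: det_mult[of E n F] abs_mult mult_carrier_mat[of E n n F n])

lemma unim_transpose [simp]: "unim n E \<Longrightarrow> unim n (E\<^sup>T)"
  unfolding unim_def by (simp add: det_transpose[of E n])

lemma unim_inverse: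
  assumes "unim n E"
  obtains F where "unim n F" "E * F = 1\<^sub>m n" "F * E = 1\<^sub>m n"
proof -
  have E: "E \<in> Mat n n" and d: "\<bar>det E\<bar> = 1" using assms by (simp_all only: unim_def)
  let ?F = "det E \<cdot>\<^sub>m adj_mat E"
  have dE: "det E = 1 \<or> det E = - 1" using d by linarith
  note adj = adj_mat[OF E]
  have F: "?F \<in> Mat n n" using adj by simp
  have sm: "det E \<cdot>\<^sub>m (det E \<cdot>\<^sub>m 1\<^sub>m n) = 1\<^sub>m n"
    using dE by (intro eq_matI) auto
  have 1: "E * ?F = 1\<^sub>m n"
    using mult_smult_distrib[OF E adj(1), of "det E"] adj(2) sm by simp
  have 2: "?F * E = 1\<^sub>m n"
    using mult_smult_assoc_mat[OF adj(1) E, of "det E"] adj(3) sm by simp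
  have "det E * det ?F = 1" using det_mult[OF E F] unfolding 1 by simp
  hence "\<bar>det E\<bar> * \<bar>det ?F\<bar> = 1" by (simp only: abs_mult[symmetric] abs_one)
  hence "unim n ?F" using F d unfolding unim_def by simp
  from this 1 2 show thesis by (rule that)
qed

lemma addrow_mat_mult_vec:
  assumes "v \<in> Vec n" "k < n" "l < n" "k \<noteq> l"
  shows "addrow_mat n a k l *v v = vec n (\<lambda>i. if i = k then v $ k + a * v $ l else v $ i)"
proof (rule eq_vecI)
  fix i assume i: "i < dim_vec (vec n (\<lambda>i. if i = k then v $ k + a * v $ l else v $ i))"
  have "(addrow_mat n a k l *v v) $ i = (\<Sum>j<n. addrow_mat n a k l $$ (i, j) * v $ j)"
    using i assms(1) by (simp add: scalar_prod_def lessThan_atLeast0)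
  also have "\<dots> = (\<Sum>j<n. (if j = i then v $ j else 0) + (if j = l then (if i = k then a * v $ j else 0) else 0))"
    using i assms by (intro sum.cong) auto
  also have "\<dots> = (if i = k then v $ k + a * v $ l else v $ i)"
    using i assms by (simp add: sum.distrib)
  finally show "(addrow_mat n a k l *v v) $ i = vec n (\<lambda>i. if i = k then v $ k + a * v $ l else v $ i) $ i"
    using i by simp
qed (use assms in auto)

lemma unim_addrow: "k < n \<Longrightarrow> l < n \<Longrightarrow> k \<noteq> l \<Longrightarrow> unim n (addrow_mat n a k l)"
  unfolding unim_def by (simp add: det_addrow_mat)

text \<open>
  The shape of a reduction that acts on the coordinates from \<open>r\<close> on only. It allows a matrix to be
  reduced column by column without destroying the columns that are already in shape.
\<close>

definition keeps :: "nat \<Rightarrow> nat \<Rightarrow> int mat \<Rightarrow> bool"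
  where "keeps n r F \<longleftrightarrow> F \<in> Mat n n \<and>
    (\<forall>v \<in> Vec n. (\<forall>i<n. r \<le> i \<longrightarrow> v $ i = 0) \<longrightarrow> F *v v = v) \<and>
    (\<forall>v \<in> Vec n. \<forall>i<n. i < r \<longrightarrow> (F *v v) $ i = v $ i)"

lemma keepsD:
  assumes "keeps n r F" "v \<in> Vec n"
  shows "\<forall>i<n. r \<le> i \<longrightarrow> v $ i = 0 \<Longrightarrow> F *v v = v" "i < n \<Longrightarrow> i < r \<Longrightarrow> (F *v v) $ i = v $ i"
  using assms unfolding keeps_def by blast+

lemma keeps_one: "keeps n r (1\<^sub>m n)" by (auto simp: keeps_def)

lemma keeps_mult: 
  assumes "keeps n r F" "keeps n r G" shows "keeps n r (F * G)"
proof -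
  have F: "F \<in> Mat n n" and G: "G \<in> Mat n n" using assms by (auto simp: keeps_def)
  have "(F * G) *v v = F *v (G *v v)" if "v \<in> Vec n" for v
    using F G that by simp
  moreover have "G *v v \<in> Vec n" if "v \<in> Vec n" for v using G that by simp
  ultimately show ?thesis using assms F G unfolding keeps_def by auto
qed

lemma keeps_addrow:
  assumes "k < n" "l < n" "k \<noteq> l" "r \<le> k" "r \<le> l"
  shows "keeps n r (addrow_mat n a k l)"
  using assms by (auto simp: keeps_def addrow_mat_mult_vec intro!: eq_vecI)

text \<open>
  The Euclidean algorithm on the entries from position \<open>r\<close> on, organised as a minimisation of the sum of
  their absolute values over all admissible matrices.
\<close>

lemma reduce_vec:
  assumes v: "v \<in> Vec n" and r: "r < n"
  shows "\<exists>F. unim n F \<and> keeps n r F \<and> (\<forall>i<n. r < i \<longrightarrow> (F *v v) $ i = 0)"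
proof -
  let ?m = "\<lambda>F. \<Sum>i\<in>{r..<n}. nat \<bar>(F *v v) $ i\<bar>"
  let ?P = "\<lambda>F. unim n F \<and> keeps n r F"
  have ex: "?P (1\<^sub>m n)" by (simp add: keeps_one)
  obtain F where F: "?P F" and min: "\<And>G. ?P G \<Longrightarrow> ?m F \<le> ?m G"
    using ex_has_least_nat[of ?P "1\<^sub>m n" ?m] ex by blast
  have Fc: "F \<in> Mat n n" using F by simp
  define w where "w = F *v v"
  have w: "w \<in> Vec n" using Fc v by (simp add: w_def)
  have step: "\<bar>w $ k\<bar> \<le> \<bar>w $ k + a * w $ l\<bar>" if kl: "k < n" "l < n" "k \<noteq> l" "r \<le> k" "r \<le> l" for k l a
  proof -
    let ?A = "addrow_mat n a k l"
    have P: "?P (?A * F)"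
      using F kl by (auto intro: unim_mult unim_addrow keeps_mult keeps_addrow)
    have AF: "(?A * F) *v v = vec n (\<lambda>i. if i = k then w $ k + a * w $ l else w $ i)"
      using Fc v kl w by (simp add: assoc_mult_mat_vec[of _ n n _ n] w_def[symmetric] addrow_mat_mult_vec)
    have kin: "k \<in> {r..<n}" using kl by auto
    have "?m F = nat \<bar>w $ k\<bar> + (\<Sum>i\<in>{r..<n}-{k}. nat \<bar>w $ i\<bar>)"
      using kin by (simp add: w_def sum.remove)
    moreover have "?m (?A * F) = nat \<bar>w $ k + a * w $ l\<bar> + (\<Sum>i\<in>{r..<n}-{k}. nat \<bar>w $ i\<bar>)"
      unfolding AF using kin by (subst sum.remove[of _ k]) (auto intro!: sum.cong)
    ultimately show ?thesis using min[OF P] by linarith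
  qed
  have le1: "w $ k = 0 \<or> w $ l = 0" if kl: "k < n" "l < n" "k \<noteq> l" "r \<le> k" "r \<le> l" for k l
  proof (rule ccontr)
    assume "\<not> ?thesis"
    thus False
      using step[OF kl, of 1] step[OF kl, of "-1"] step[of l k 1] step[of l k "-1"] kl by fastforce
  qed
  show ?thesis
  proof (cases "\<exists>k<n. r < k \<and> w $ k \<noteq> 0")
    case False
    thus ?thesis using F w_def by blast
  next
    case True
    then obtain k where k: "k < n" "r < k" "w $ k \<noteq> 0" by blast
    have z: "w $ i = 0" if "i < n" "r \<le> i" "i \<noteq> k" for i using le1[of i k] that k by auto
    let ?A = "addrow_mat n (-1) k r" and ?B = "addrow_mat n 1 r k"
    have P: "?P (?A * (?B * F))"
      using F k r by (auto intro!: unim_mult unim_addrow keeps_mult keeps_addrow)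
    have BF: "?B * F \<in> Mat n n" using Fc by (intro mult_carrier_mat[of _ n n]) auto
    have "?A * (?B * F) *v v = ?A *v (?B *v w)"
      unfolding w_def using assoc_mult_mat_vec[OF addrow_mat_carrier BF v, of "-1" k r]
        assoc_mult_mat_vec[OF addrow_mat_carrier Fc v, of 1 r k] by simp
    also have "\<dots> = vec n (\<lambda>i. if i = k then 0 else if i = r then w $ k else w $ i)"
      using k r w z by (auto simp: addrow_mat_mult_vec intro!: eq_vecI)
    finally show ?thesis using P z by (intro exI[of _ "?A * (?B * F)"]) auto
  qed
qed

lemma mult_unit_vec_col:
  "A \<in> Mat n m \<Longrightarrow> j < m \<Longrightarrow> A *v unit_vec m j = (col A j :: int vec)"
  by (intro eq_vecI) auto

lemma keeps_row:
  assumes "keeps n r F" "i < r" "i < n"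
  shows "row F i = unit_vec n i"
proof (rule eq_vecI)
  have F: "F \<in> Mat n n" using assms by (simp add: keeps_def)
  fix j assume j: "j < dim_vec (unit_vec n i :: int vec)"
  have "(F *v unit_vec n j) $ i = (unit_vec n j :: int vec) $ i"
    using assms j by (simp add: keeps_def)
  moreover have "(F *v unit_vec n j) $ i = row F i \<bullet> unit_vec n j"
    using F assms by simp
  moreover have "\<dots> = row F i $ j" using F j assms(3) by (intro scalar_prod_right_unit) auto
  ultimately show "row F i $ j = unit_vec n i $ j"
    using j assms by (auto simp: unit_vec_def)
qed (use assms in \<open>auto simp: keeps_def\<close>)

lemma mult_transpose_entry:
  assumes A: "A \<in> Mat m n" and F: "(F :: int mat) \<in> Mat k n" and "i < m" "j < k"
  shows "(A * F\<^sup>T) $$ (i, j) = (F *v row A i) $ j"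
  using assms comm_scalar_prod[of "row A i" n "row F j"] by auto

text \<open>
  The rows are treated one after the other by \<open>reduce_vec\<close>, applied to the part to the right of the diagonal.
\<close>

lemma lower_triangular_form:
  assumes Y: "Y \<in> Mat m n" and m: "m \<le> n"
  shows "\<exists>E. unim n E \<and> (\<forall>i<m. \<forall>j<n. i < j \<longrightarrow> (Y * E) $$ (i, j) = 0)"
proof -
  have "\<exists>E. unim n E \<and> (\<forall>i<r. \<forall>j<n. i < j \<longrightarrow> (Y * E) $$ (i, j) = 0)" if "r \<le> m" for r
    using that
  proof (induction r)
    case 0
    show ?case by (intro exI[of _ "1\<^sub>m n"]) simp
  next
    case (Suc r)
    then obtain E where E: "unim n E" "\<And>i j. i < r \<Longrightarrow> j < n \<Longrightarrow> i < j \<Longrightarrow> (Y * E) $$ (i, j) = 0"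
      by auto
    have Ec: "E \<in> Mat n n" using E by simp
    have YE: "Y * E \<in> Mat m n" using Y Ec by simp
    let ?v = "row (Y * E) r"
    obtain F where F: "unim n F" "keeps n r F" "\<And>i. i < n \<Longrightarrow> r < i \<Longrightarrow> (F *v ?v) $ i = 0"
      using reduce_vec[OF row_carrier_vec[OF _ YE, of r], of r] Suc.prems m by auto
    have Fc: "F \<in> Mat n n" using F by simp
    have e: "(Y * (E * F\<^sup>T)) $$ (i, j) = (F *v row (Y * E) i) $ j" if "i < m" "j < n" for i j
    proof -
      have "Y * (E * F\<^sup>T) = (Y * E) * F\<^sup>T" using Y Ec Fc by simp
      thus ?thesis using mult_transpose_entry[OF YE Fc that] by simp
    qed
    have "(Y * (E * F\<^sup>T)) $$ (i, j) = 0" if ij: "i < Suc r" "j < n" "i < j" for i j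
    proof -
      have im: "i < m" using ij Suc.prems by simp
      have "(F *v row (Y * E) i) $ j = 0"
      proof (cases "i = r")
        case True thus ?thesis using F(3)[of j] ij by simp
      next
        case False
        hence i: "i < r" using ij by simp
        have r0: "row (Y * E) i $ l = (Y * E) $$ (i, l)" if "l < n" for l
          using YE im that by (intro index_row) auto
        have z: "\<forall>l<n. r \<le> l \<longrightarrow> row (Y * E) i $ l = 0"
          using r0 E(2)[OF i] i by (metis less_le_trans)
        show ?thesis
          unfolding keepsD(1)[OF F(2) row_carrier_vec[OF im YE] z] using r0 E(2)[OF i] ij by metis
      qed
      thus ?thesis unfolding e[OF im ij(2)] .
    qed
    moreover have "unim n (E * F\<^sup>T)" using E F by (simp add: unim_mult)
    ultimately show ?case by blast
  qed
  thus ?thesis by blast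
qed

lemma congruence_entry:
  assumes F: "F \<in> Mat n n" and H: "(H :: int mat) \<in> Mat n n" and "i < n" "j < n"
    and u: "row F i = unit_vec n i"
  shows "(F * H * F\<^sup>T) $$ (j, i) = (F *v col H i) $ j"
proof -
  have FH: "F * H \<in> Mat n n" using F H by simp
  have "(F * H * F\<^sup>T) $$ (j, i) = row (F * H) j \<bullet> row F i"
    using FH F assms(3,4) by (auto simp del: index_mult_mat(3))
  also have "\<dots> = (F * H) $$ (j, i)"
    unfolding u using FH assms(3,4) by (subst scalar_prod_right_unit) (auto simp del: index_mult_mat)
  also have "\<dots> = row F j \<bullet> col H i"
    using F H assms(3,4) by auto
  also have "\<dots> = (F *v col H i) $ j"
    using F assms(4) by auto
  finally show ?thesis .
qed

text \<open>
  The \<open>i\<close>-th column is reduced below the subdiagonal. The transformation fixes the first \<open>i + 1\<close>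
  coordinates, so that the columns treated before and the symmetric rows stay as they are.
\<close>

lemma tridiagonal_form:
  assumes G: "G \<in> Mat n n" and sym: "G\<^sup>T = G"
  shows "\<exists>F. unim n F \<and> (\<forall>i<n. \<forall>j<n. Suc i < j \<longrightarrow> (F * G * F\<^sup>T) $$ (j, i) = 0)"
proof -
  have "\<exists>F. unim n F \<and> (\<forall>i<r. \<forall>j<n. Suc i < j \<longrightarrow> (F * G * F\<^sup>T) $$ (j, i) = 0)" if "r \<le> n" for r
    using that
  proof (induction r)
    case 0
    show ?case by (intro exI[of _ "1\<^sub>m n"]) simp
  next
    case (Suc r)
    then obtain E where E: "unim n E"
      "\<And>i j. i < r \<Longrightarrow> j < n \<Longrightarrow> Suc i < j \<Longrightarrow> (E * G * E\<^sup>T) $$ (j, i) = 0"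
      by auto
    have Ec: "E \<in> Mat n n" using E by simp
    define H where "H = E * G * E\<^sup>T"
    have H: "H \<in> Mat n n" using G Ec by (simp add: H_def)
    show ?case
    proof (cases "Suc r < n")
      case False
      thus ?thesis using E Suc.prems by (intro exI[of _ E]) (auto simp: less_Suc_eq)
    next
      case True
      let ?v = "col H r"
      obtain F where F: "unim n F" "keeps n (Suc r) F" "\<And>i. i < n \<Longrightarrow> Suc r < i \<Longrightarrow> (F *v ?v) $ i = 0"
        using reduce_vec[OF col_carrier_vec[OF _ H, of r], of "Suc r"] True by auto
      have Fc: "F \<in> Mat n n" using F by simp
      have eq: "F * E * G * (F * E)\<^sup>T = F * H * F\<^sup>T"
      proof -
        have "F * E * G * (F * E)\<^sup>T = F * E * G * (E\<^sup>T * F\<^sup>T)"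
          using transpose_mult[OF Fc Ec] by simp
        also have "\<dots> = F * E * G * E\<^sup>T * F\<^sup>T"
          using Ec Fc G by (intro assoc_mult_mat[symmetric, of _ n n _ n _ n]) auto
        also have "F * E * G * E\<^sup>T = F * H"
          unfolding H_def using Ec Fc G by (simp add: assoc_mult_mat[of _ n n _ n _ n])
        finally show ?thesis .
      qed
      have e: "(F * H * F\<^sup>T) $$ (j, i) = (F *v col H i) $ j" if "i \<le> r" "j < n" for i j
        using that True by (intro congruence_entry[OF Fc H] keeps_row[OF F(2)]) auto
      have "(F * H * F\<^sup>T) $$ (j, i) = 0" if ij: "i < Suc r" "j < n" "Suc i < j" for i j
      proof (cases "i = r")
        case True
        have "(F * H * F\<^sup>T) $$ (j, i) = (F *v col H i) $ j" using ij by (intro e) auto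
        also have "\<dots> = 0" using F(3)[of j] ij True by simp
        finally show ?thesis .
      next
        case False
        have z: "\<forall>l<n. Suc r \<le> l \<longrightarrow> col H i $ l = 0"
          using E(2)[of i] False ij H unfolding H_def[symmetric] by simp
        have "F *v col H i = col H i"
          using keepsD(1)[OF F(2) _ z] H ij by (simp add: carrier_vecI)
        moreover have "(F * H * F\<^sup>T) $$ (j, i) = (F *v col H i) $ j" using ij by (intro e) auto
        moreover have "col H i $ j = H $$ (j, i)" using H ij by simp
        ultimately show ?thesis using E(2)[of i j] ij False unfolding H_def[symmetric] by simp
      qed
      moreover have "unim n (F * E)" using E F by (simp add: unim_mult)
      ultimately show ?thesis using eq by metis
    qed
  qed
  thus ?thesis by blast
qed

section \<open>The Witt group of the rationals: residues\<close>

text \<open>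
  The generator \<open>frag_of a\<close> stands for the rational form \<open>\<langle>a\<rangle>\<close>. Modulo these relations the free abelian
  group becomes the Witt group of \<open>\<rat>\<close> divided by the classes of the elements of \<open>S\<close>. For \<open>S\<close> the
  nonzero integers with prime factors below \<open>n\<close> this is a step of the filtration by primes.
\<close>

inductive_set witt_rel :: "int set \<Rightarrow> (int \<Rightarrow>\<^sub>0 int) set" for S where
  zero: "0 \<in> witt_rel S"
| add: "x \<in> witt_rel S \<Longrightarrow> y \<in> witt_rel S \<Longrightarrow> x + y \<in> witt_rel S"
| minus: "x \<in> witt_rel S \<Longrightarrow> - x \<in> witt_rel S"
| square: "a \<noteq> 0 \<Longrightarrow> b \<noteq> 0 \<Longrightarrow> frag_of (a * b\<^sup>2) - frag_of a \<in> witt_rel S"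
| neg: "a \<noteq> 0 \<Longrightarrow> frag_of a + frag_of (- a) \<in> witt_rel S"
| sum: "a \<noteq> 0 \<Longrightarrow> b \<noteq> 0 \<Longrightarrow> a + b \<noteq> 0 \<Longrightarrow>
    frag_of a + frag_of b - frag_of (a + b) - frag_of (a * b * (a + b)) \<in> witt_rel S"
| unit: "s \<in> S \<Longrightarrow> s \<noteq> 0 \<Longrightarrow> frag_of s \<in> witt_rel S"

definition weq :: "int set \<Rightarrow> (int \<Rightarrow>\<^sub>0 int) \<Rightarrow> (int \<Rightarrow>\<^sub>0 int) \<Rightarrow> bool"
  where "weq S x y \<longleftrightarrow> x - y \<in> witt_rel S"

lemma witt_rel_diff: "x \<in> witt_rel S \<Longrightarrow> y \<in> witt_rel S \<Longrightarrow> x - y \<in> witt_rel S"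
  using witt_rel.add[OF _ witt_rel.minus, of x S y] by simp

lemma weq_refl [simp]: "weq S x x" by (simp add: weq_def witt_rel.zero)
lemma weq_sym: "weq S x y \<Longrightarrow> weq S y x" unfolding weq_def using witt_rel.minus by fastforce
lemma weq_trans [trans]: "weq S x y \<Longrightarrow> weq S y z \<Longrightarrow> weq S x z"
  unfolding weq_def using witt_rel.add[of "x - y" S "y - z"] by simp
lemma weq_add: "weq S x y \<Longrightarrow> weq S x' y' \<Longrightarrow> weq S (x + x') (y + y')"
  unfolding weq_def using witt_rel.add[of "x - y" S "x' - y'"] by (simp add: algebra_simps)
lemma weq_minus: "weq S x y \<Longrightarrow> weq S (- x) (- y)"
  unfolding weq_def using witt_rel.minus[of "x - y" S] by (simp add: algebra_simps)
lemma weq_add_neg: "weq S x (- y) \<Longrightarrow> weq S (y + x) 0"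
  by (simp add: weq_def add.commute)
lemma weq_0_iff: "weq S x 0 \<longleftrightarrow> x \<in> witt_rel S" by (simp add: weq_def)

lemma weq_square: "a \<noteq> 0 \<Longrightarrow> b \<noteq> 0 \<Longrightarrow> weq S (frag_of (a * b\<^sup>2)) (frag_of a)"
  unfolding weq_def by (rule witt_rel.square)
lemma weq_neg: "a \<noteq> 0 \<Longrightarrow> weq S (frag_of (- a)) (- frag_of a)"
  unfolding weq_def using witt_rel.neg[of a S] by (simp add: algebra_simps)
lemma weq_unit: "s \<in> S \<Longrightarrow> s \<noteq> 0 \<Longrightarrow> weq S (frag_of s) 0"
  unfolding weq_def using witt_rel.unit[of s S] by simp
lemma weq_sum: "a \<noteq> 0 \<Longrightarrow> b \<noteq> 0 \<Longrightarrow> a + b \<noteq> 0 \<Longrightarrow>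
    weq S (frag_of a + frag_of b) (frag_of (a + b) + frag_of (a * b * (a + b)))"
  unfolding weq_def using witt_rel.sum[of a b S] by (simp add: algebra_simps)

definition smooth :: "int \<Rightarrow> int set"
  where "smooth n = {a. a \<noteq> 0 \<and> (\<forall>q. prime q \<longrightarrow> q dvd a \<longrightarrow> q < n)}"

lemma smooth_mult: "a \<in> smooth n \<Longrightarrow> b \<in> smooth n \<Longrightarrow> a * b \<in> smooth n"
  by (auto simp: smooth_def prime_dvd_mult_iff)

lemma smooth_minus: "a \<in> smooth n \<Longrightarrow> - a \<in> smooth n"
  by (auto simp: smooth_def)

lemma smooth_small: "a \<noteq> 0 \<Longrightarrow> \<bar>a\<bar> < n \<Longrightarrow> a \<in> smooth n"
proof -
  assume a: "a \<noteq> 0" "\<bar>a\<bar> < n"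
  have "q < n" if "q dvd a" for q
    using a that zdvd_imp_le[of q "\<bar>a\<bar>"] by simp
  thus ?thesis using a(1) by (simp add: smooth_def)
qed

lemma smooth_not_dvd: "prime p \<Longrightarrow> a \<in> smooth p \<Longrightarrow> \<not> p dvd a"
  by (auto simp: smooth_def)

lemma smooth_dvd: "a \<in> smooth n \<Longrightarrow> b dvd a \<Longrightarrow> b \<in> smooth n"
  by (simp add: smooth_def) (metis dvd_0_left dvd_trans)

lemma smooth_nonzero: "a \<in> smooth n \<Longrightarrow> a \<noteq> 0"
  by (simp add: smooth_def)

lemma smooth_2: "smooth 2 = {1, -1}"
proof -
  have "a = 1 \<or> a = - 1" if a: "a \<in> smooth 2" for a
  proof (rule ccontr)
    assume "\<not> ?thesis"
    hence "\<not> is_unit a" by (simp add: zdvd1_eq abs_if split: if_splits)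
    then obtain q where "prime q" "q dvd a" using a prime_divisor_exists[of a] by (auto simp: smooth_def)
    thus False using a prime_ge_2_int[of q] by (auto simp: smooth_def)
  qed
  moreover have "1 \<in> smooth 2" "-1 \<in> smooth 2" by (auto intro: smooth_small)
  ultimately show ?thesis by blast
qed

lemma smooth_mod: "prime p \<Longrightarrow> \<not> p dvd (m::int) \<Longrightarrow> m mod p \<in> smooth p"
  using prime_gt_0_int[of p] by (intro smooth_small) (auto simp: dvd_eq_mod_eq_0)

text \<open>
  Scaling a form by a fixed integer respects all relations; it sends the generators in \<open>S\<close> to \<open>S\<close>
  because \<open>smooth n\<close> is closed under products.
\<close>

lemma witt_rel_scale:
  assumes "x \<in> witt_rel (smooth n)" "s \<in> smooth n"
  shows "frag_extend (\<lambda>a. frag_of (s * a)) x \<in> witt_rel (smooth n)"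
  using assms(1)
proof induction
  case (square a b)
  thus ?case using witt_rel.square[of "s * a" b] assms(2)
    by (simp add: frag_extend_diff smooth_def mult.assoc)
next
  case (neg a)
  thus ?case using witt_rel.neg[of "s * a"] assms(2) by (simp add: frag_extend_add smooth_def)
next
  case (sum a b)
  have s: "s \<noteq> 0" using assms(2) by (simp add: smooth_def)
  have eq: "s * a * (s * b) * (s * (a + b)) = s * (a * b * (a + b)) * s\<^sup>2"
    by (simp add: algebra_simps power2_eq_square)
  have "weq (smooth n) (frag_of (s * a) + frag_of (s * b))
      (frag_of (s * a + s * b) + frag_of (s * a * (s * b) * (s * a + s * b)))"
    using sum s by (intro weq_sum) (auto simp: distrib_left[symmetric])
  also have "weq (smooth n) \<dots> (frag_of (s * (a + b)) + frag_of (s * (a * b * (a + b))))"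
    unfolding distrib_left[symmetric] eq using sum s by (intro weq_add weq_refl weq_square) auto
  finally show ?case unfolding weq_def by (simp add: frag_extend_add frag_extend_diff algebra_simps)
next
  case (unit t)
  thus ?case using assms(2) smooth_mult[of s n t] by (auto intro!: witt_rel.unit simp: smooth_def)
qed (auto simp: frag_extend_add frag_extend_minus intro: witt_rel.intros)

text \<open>
  Write \<open>n = p l + m\<close> with \<open>m = n mod p\<close>. The sum relation for \<open>p m\<close> and \<open>p\<^sup>2 l\<close> relates \<open>\<langle>p m\<rangle>\<close> and \<open>\<langle>p n\<rangle>\<close>; up to
  squares the other two terms are \<open>\<langle>l\<rangle>\<close> and \<open>\<langle>l m n\<rangle>\<close>, which are smooth and therefore vanish.
\<close>

lemma milnor_basic:
  assumes p: "prime (p::int)" and n: "n \<in> smooth p" and l: "n div p = 0 \<or> n div p \<in> smooth p"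
  shows "weq (smooth p) (frag_of (p * n)) (frag_of (p * (n mod p)))"
proof (cases "n div p = 0")
  case True
  hence "n mod p = n" by (metis add_0 mod_mult_div_eq mult_zero_right add.right_neutral)
  thus ?thesis by simp
next
  case False
  define l where "l = n div p"
  define r where "r = n mod p"
  have p0: "p \<noteq> 0" using p by auto
  have ls: "l \<in> smooth p" using l False by (simp add: l_def)
  have rs: "r \<in> smooth p" unfolding r_def using p smooth_not_dvd[OF p n] by (rule smooth_mod)
  have nlr: "n = p * l + r" by (simp add: l_def r_def)
  have nz: "n \<noteq> 0" "l \<noteq> 0" "r \<noteq> 0" using n ls rs by (auto simp: smooth_def)
  have e1: "p * n + - (p * r) = l * p\<^sup>2" by (simp add: nlr algebra_simps power2_eq_square)
  have e2: "p * n * - (p * r) * (l * p\<^sup>2) = - (n * r * l) * (p\<^sup>2)\<^sup>2"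
    by (simp add: algebra_simps power2_eq_square)
  let ?W = "weq (smooth p)"
  have "?W (frag_of (p * n) + frag_of (- (p * r))) (frag_of (l * p\<^sup>2) + frag_of (- (n * r * l) * (p\<^sup>2)\<^sup>2))"
    using weq_sum[of "p * n" "- (p * r)" "smooth p"] unfolding e1 e2 using nz p0 by simp
  also have "?W \<dots> (frag_of l + frag_of (- (n * r * l)))"
    using nz p0 by (intro weq_add weq_square) auto
  also have "?W \<dots> (0 + 0)"
    using nz ls rs n by (intro weq_add weq_unit smooth_mult smooth_minus) auto
  finally have "?W (frag_of (p * n) + frag_of (- (p * r)) + frag_of (p * r)) (0 + 0 + frag_of (p * r))"
    by (rule weq_add) simp
  moreover have "?W (frag_of (- (p * r)) + frag_of (p * r)) 0"
    using weq_add[OF weq_neg[of "p * r" "smooth p"] weq_refl[of _ "frag_of (p * r)"]] nz p0 by simp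
  ultimately show ?thesis unfolding weq_def r_def[symmetric]
    using witt_rel_diff[of "frag_of (p * n) + frag_of (- (p * r)) + frag_of (p * r) - frag_of (p * r)" "smooth p"]
    by (auto simp: algebra_simps dest: witt_rel_diff)
qed

lemma abs_div_less:
  fixes p :: int assumes p: "0 < p" and ab: "\<bar>a\<bar> < p" "\<bar>b\<bar> < p"
  shows "\<bar>(a * b) div p\<bar> < p"
proof -
  have "\<bar>a * b\<bar> \<le> (p - 1) * (p - 1)"
    unfolding abs_mult using assms by (intro mult_mono) auto
  moreover have "(p - 1) * (p - 1) = p * (p - 1) - (p - 1)" by (simp add: algebra_simps)
  ultimately have u: "\<bar>a * b\<bar> \<le> p * (p - 1) - (p - 1)" by simp
  define m where "m = (a * b) mod p"
  have m: "0 \<le> m" "m \<le> p - 1" using p pos_mod_bound[OF p, of "a * b"] by (auto simp: m_def)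
  have d: "a * b = p * ((a * b) div p) + m" by (simp add: m_def)
  have "\<bar>p * ((a * b) div p) + m\<bar> \<le> p * (p - 1) - (p - 1)" using u d by simp
  hence "p * ((a * b) div p) \<le> p * (p - 1)" "p * (- (p - 1)) \<le> p * ((a * b) div p)"
    using m by (simp_all add: abs_le_iff right_diff_distrib)
  hence "(a * b) div p \<le> p - 1" "- (p - 1) \<le> (a * b) div p"
    using p by (simp_all only: mult_le_cancel_left_pos)
  thus ?thesis by auto
qed

text \<open>
  A smooth integer is a product of integers of absolute value below \<open>p\<close>. When two such factors are
  multiplied, the quotient of their product by \<open>p\<close> is again small, so that \<open>milnor_basic\<close> applies to one
  factor after the other.
\<close>

lemma milnor_reduction:
  assumes p: "prime (p::int)" and n: "n \<in> smooth p"
  shows "weq (smooth p) (frag_of (p * n)) (frag_of (p * (n mod p)))"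
  using n
proof (induction "nat \<bar>n\<bar>" arbitrary: n rule: less_induct)
  case less
  have p0: "p > 0" "p > 1" using p prime_gt_0_int prime_gt_1_int by auto
  have small: "weq (smooth p) (frag_of (p * (a * b))) (frag_of (p * (a * b mod p)))"
    if "a \<in> smooth p" "b \<in> smooth p" "\<bar>a\<bar> < p" "\<bar>b\<bar> < p" for a b
    using abs_div_less[OF p0(1) that(3,4)] smooth_small[of "a * b div p" p]
    by (intro milnor_basic[OF p smooth_mult] that) blast
  show ?case
  proof (cases "is_unit n")
    case True
    have "1 \<in> smooth p" using p0 by (intro smooth_small) auto
    thus ?thesis using small[of n 1] less.prems True p0 by simp
  next
    case False
    have n0: "n \<noteq> 0" using less.prems by (simp add: smooth_def)
    obtain q m where q: "prime q" and nqm: "n = q * m"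
      using False n0 prime_divisor_exists[of n] by (auto elim: dvdE)
    have sm: "q \<in> smooth p" "m \<in> smooth p"
      using less.prems nqm smooth_dvd[of n p] by auto
    have q2: "q \<ge> 2" using q by (rule prime_ge_2_int)
    have qp: "q < p" using sm(1) q by (auto simp: smooth_def)
    have m0: "m \<noteq> 0" using sm by (simp add: smooth_def)
    have "\<bar>m\<bar> < \<bar>n\<bar>" unfolding nqm abs_mult using q2 m0 by simp
    hence "weq (smooth p) (frag_of (p * m)) (frag_of (p * (m mod p)))"
      using sm by (intro less.hyps) auto
    hence "weq (smooth p) (frag_of (q * (p * m))) (frag_of (q * (p * (m mod p))))"
      unfolding weq_def using witt_rel_scale[OF _ sm(1)] by (fastforce simp: frag_extend_diff)
    hence "weq (smooth p) (frag_of (p * n)) (frag_of (p * (q * (m mod p))))"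
      by (simp add: nqm mult_ac)
    also have "weq (smooth p) \<dots> (frag_of (p * ((q * (m mod p)) mod p)))"
      using sm(1) smooth_mod[OF p smooth_not_dvd[OF p sm(2)]] q2 qp p0 by (intro small) auto
    also have "(q * (m mod p)) mod p = n mod p" by (simp add: nqm mod_mult_right_eq)
    finally show ?thesis .
  qed
qed

text \<open>
  The second residue at \<open>p\<close> of a unit \<open>m\<close>, lifted back to the group of forms: a representative of \<open>\<langle>p m\<rangle>\<close>
  that depends on \<open>m\<close> modulo \<open>p\<close> only.
\<close>

definition residue_class :: "int \<Rightarrow> int \<Rightarrow> int \<Rightarrow>\<^sub>0 int"
  where "residue_class p m = frag_of (p * (m mod p))"

lemma residue_class_cong: "m mod p = n mod p \<Longrightarrow> residue_class p m = residue_class p n"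
  by (simp add: residue_class_def)

lemma residue_class_smooth:
  "prime p \<Longrightarrow> n \<in> smooth p \<Longrightarrow> n mod p = m mod p \<Longrightarrow> weq (smooth p) (residue_class p m) (frag_of (p * n))"
  using milnor_reduction[of p n, THEN weq_sym] by (simp add: residue_class_def)

lemma residue_class_square:
  assumes p: "prime p" and "\<not> p dvd m" "\<not> p dvd s"
  shows "weq (smooth p) (residue_class p (m * s\<^sup>2)) (residue_class p m)"
proof -
  let ?r = "m mod p" and ?t = "s mod p"
  have rt: "?r \<in> smooth p" "?t \<in> smooth p" using assms by (auto intro: smooth_mod)
  have p0: "p \<noteq> 0" using p by auto
  have "weq (smooth p) (residue_class p (m * s\<^sup>2)) (frag_of (p * (?r * ?t\<^sup>2)))"
  proof (rule residue_class_smooth[OF p])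
    show "?r * ?t\<^sup>2 \<in> smooth p" using rt by (simp add: power2_eq_square smooth_mult)
    show "?r * ?t\<^sup>2 mod p = m * s\<^sup>2 mod p" by (intro mod_mult_cong) (simp_all add: power_mod)
  qed
  also have "weq (smooth p) \<dots> (frag_of (p * ?r))"
    using weq_square[of "p * ?r" ?t "smooth p"] smooth_nonzero[OF rt(1)] smooth_nonzero[OF rt(2)] p0
    by (simp add: mult.assoc)
  finally show ?thesis by (simp add: residue_class_def)
qed

lemma residue_class_minus:
  assumes p: "prime p" and "\<not> p dvd m"
  shows "weq (smooth p) (residue_class p (- m)) (- residue_class p m)"
proof -
  let ?r = "m mod p"
  have rt: "?r \<in> smooth p" using assms by (auto intro: smooth_mod)
  have p0: "p \<noteq> 0" using p by auto
  have "weq (smooth p) (residue_class p (- m)) (frag_of (p * (- ?r)))"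
    using rt by (intro residue_class_smooth p smooth_minus) (auto simp: mod_simps)
  also have "weq (smooth p) \<dots> (- frag_of (p * ?r))"
    using weq_neg[of "p * ?r" "smooth p"] smooth_nonzero[OF rt] p0 by simp
  finally show ?thesis by (simp add: residue_class_def)
qed

lemma residue_class_sum:
  assumes p: "prime p" and mn: "\<not> p dvd m" "\<not> p dvd n" "\<not> p dvd m + n"
  shows "weq (smooth p) (residue_class p m + residue_class p n)
    (residue_class p (m + n) + residue_class p (m * n * (m + n)))"
proof -
  have p0: "p > 0" "p \<noteq> 0" using p prime_gt_0_int by auto
  define r where "r = m mod p"
  define x where "x = n mod p"
  define s where "s = (if r + x < p then x else x - p)"
  have "m mod p \<noteq> 0" "n mod p \<noteq> 0" using mn by (simp_all add: dvd_eq_mod_eq_0)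
  hence r: "0 < r" "r < p" and n': "0 < x" "x < p"
    unfolding r_def x_def using pos_mod_sign[OF p0(1), of m] pos_mod_bound[OF p0(1), of m]
      pos_mod_sign[OF p0(1), of n] pos_mod_bound[OF p0(1), of n] by linarith+
  have s: "s \<noteq> 0" "\<bar>s\<bar> < p" "\<bar>r + s\<bar> < p" using r n' unfolding s_def by auto
  have ms: "r mod p = m mod p" "s mod p = n mod p" by (auto simp: r_def s_def x_def)
  hence mrs: "(r + s) mod p = (m + n) mod p" by (metis mod_add_eq)
  have "(m + n) mod p \<noteq> 0" using mn(3) by (simp add: dvd_eq_mod_eq_0)
  hence rs0: "r + s \<noteq> 0" using mrs by (metis mod_0)
  have sm: "r \<in> smooth p" "s \<in> smooth p" "r + s \<in> smooth p"
    using smooth_small[of r p] smooth_small[of s p] smooth_small[of "r + s" p] r s rs0 by simp_all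
  let ?W = "weq (smooth p)"
  have e: "p * r * (p * s) * (p * (r + s)) = p * (r * s * (r + s)) * p\<^sup>2"
    by (simp add: algebra_simps power2_eq_square)
  have "?W (residue_class p m + residue_class p n) (frag_of (p * r) + frag_of (p * s))"
    using sm ms by (intro weq_add residue_class_smooth p) auto
  also have "?W \<dots> (frag_of (p * r + p * s) + frag_of (p * r * (p * s) * (p * r + p * s)))"
    using r s rs0 p0 by (intro weq_sum) (auto simp: distrib_left[symmetric])
  also have "?W \<dots> (frag_of (p * (r + s)) + frag_of (p * (r * s * (r + s))))"
    unfolding distrib_left[symmetric] e using r s rs0 p0 by (intro weq_add weq_refl weq_square) auto
  also have "?W \<dots> (residue_class p (m + n) + residue_class p (m * n * (m + n)))"
    using sm mrs ms
    by (intro weq_add residue_class_smooth[THEN weq_sym] p smooth_mult) (auto intro: mod_mult_cong)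
  finally show ?thesis .
qed

definition residue :: "int \<Rightarrow> int \<Rightarrow> int \<Rightarrow>\<^sub>0 int"
  where "residue p a = (if odd (multiplicity p a) then residue_class p (a div p ^ multiplicity p a) else 0)"

lemma residue_eq:
  assumes p: "prime p" and m: "\<not> p dvd m"
  shows "residue p (p ^ v * m) = (if odd v then residue_class p m else 0)"
proof -
  have "m \<noteq> 0" "p \<noteq> 0" using m p by auto
  hence "multiplicity p (p ^ v * m) = v"
    using p m not_prime_unit[of p] by (subst prime_elem_multiplicity_mult_distrib)
      (auto simp: not_dvd_imp_multiplicity_0 multiplicity_same_power)
  thus ?thesis using \<open>p \<noteq> 0\<close> by (simp add: residue_def)
qed

lemma prime_power_split:
  assumes "prime (p::int)" "a \<noteq> 0"
  obtains v m where "a = p ^ v * m" "\<not> p dvd m"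
  using multiplicity_decompose'[of a p] assms by (metis not_prime_unit)

lemma prime_dvd_square_iff: "prime (p::int) \<Longrightarrow> p dvd a\<^sup>2 \<longleftrightarrow> p dvd a"
  using prime_dvd_power_iff[of p 2 a] by simp

lemma residue_square:
  assumes p: "prime p" and "a \<noteq> 0" "b \<noteq> 0"
  shows "weq (smooth p) (residue p (a * b\<^sup>2)) (residue p a)"
proof -
  obtain v m where a: "a = p ^ v * m" "\<not> p dvd m" using prime_power_split assms by blast
  obtain w k where b: "b = p ^ w * k" "\<not> p dvd k" using prime_power_split assms by blast
  have e: "a * b\<^sup>2 = p ^ (v + 2 * w) * (m * k\<^sup>2)"
    by (simp add: a b power_mult_distrib power_add power_mult algebra_simps power2_eq_square power_even_eq)
  have "\<not> p dvd m * k\<^sup>2" using p a b by (simp add: prime_dvd_mult_iff prime_dvd_square_iff)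
  hence "residue p (a * b\<^sup>2) = (if odd v then residue_class p (m * k\<^sup>2) else 0)"
    unfolding e by (subst residue_eq[OF p]) auto
  moreover have "residue p a = (if odd v then residue_class p m else 0)"
    unfolding a(1) by (rule residue_eq[OF p a(2)])
  ultimately show ?thesis using residue_class_square[OF p a(2) b(2)] by simp
qed

lemma residue_neg:
  assumes p: "prime p" and "a \<noteq> 0"
  shows "weq (smooth p) (residue p (- a)) (- residue p a)"
proof -
  obtain v m where a: "a = p ^ v * m" "\<not> p dvd m" using prime_power_split assms by blast
  have e: "- a = p ^ v * (- m)" by (simp add: a)
  show ?thesis unfolding e using residue_eq[OF p, of "- m" v] residue_eq[OF p a(2), of v] a
    residue_class_minus[OF p a(2)] by simp
qed

section \<open>Descent over the primes\<close>

lemma weq_move: "weq S (x + y) (z + w) \<Longrightarrow> weq S (x + y - z - w) 0"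
  by (simp add: weq_def diff_diff_add)

lemma residue_sum_aux:
  assumes p: "prime p" and m: "\<not> p dvd m" and n: "\<not> p dvd n" and ij: "i \<le> j"
    and nz: "p ^ i * m + p ^ j * n \<noteq> 0"
  shows "weq (smooth p) (residue p (p ^ i * m) + residue p (p ^ j * n))
    (residue p (p ^ i * m + p ^ j * n) + residue p (p ^ i * m * (p ^ j * n) * (p ^ i * m + p ^ j * n)))"
    (is "?W ?l ?r")
proof -
  have dvd_mult: "\<not> p dvd x * y" if "\<not> p dvd x" "\<not> p dvd y" for x y
    using that p by (simp add: prime_dvd_mult_iff)
  show ?thesis
  proof (cases "i = j")
    case False
    define m' where "m' = m + p ^ (j - i) * n"
    have "p dvd p ^ (j - i) * n" using False ij by (simp add: dvd_power)
    hence mod: "m' mod p = m mod p" and m': "\<not> p dvd m'"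
      using m by (auto simp: m'_def dvd_add_left_iff mod_add_eq dvd_eq_mod_eq_0)
    have s: "p ^ i * m + p ^ j * n = p ^ i * m'"
      using ij by (simp add: m'_def algebra_simps flip: power_add)
    have e: "p ^ i * m * (p ^ j * n) * (p ^ i * m') = p ^ (2 * i + j) * (m * n * m')"
      by (simp add: power_add power_mult power2_eq_square power_even_eq algebra_simps)
    have "weq (smooth p) (residue_class p n) (residue_class p (m * n * m'))"
    proof -
      have "m * n * m' mod p = n * m\<^sup>2 mod p"
        using mod_mult_cong[OF refl mod, of "m * n"] by (simp add: power2_eq_square mult_ac)
      thus ?thesis
        using residue_class_square[OF p n m, THEN weq_sym] residue_class_cong by metis
    qed
    thus ?thesis unfolding s e residue_eq[OF p m] residue_eq[OF p n] residue_eq[OF p m']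
        residue_eq[OF p dvd_mult[OF dvd_mult[OF m n] m']]
      using residue_class_cong[OF mod] by (auto intro!: weq_add)
  next
    case True
    hence ji: "j = i" by simp
    have s: "p ^ i * m + p ^ i * n = p ^ i * (m + n)" by (simp add: algebra_simps)
    have mn0: "m + n \<noteq> 0" using nz unfolding ji s by auto
    obtain k c where c: "m + n = p ^ k * c" "\<not> p dvd c" using prime_power_split[OF p mn0] .
    have s': "p ^ i * m + p ^ i * n = p ^ (i + k) * c" unfolding s c(1) by (simp add: power_add)
    have "3 * i + k = i + i + (i + k)" by simp
    hence "p ^ (3 * i + k) = p ^ i * p ^ i * p ^ (i + k)" by (simp only: power_add)
    hence e: "p ^ i * m * (p ^ i * n) * (p ^ (i + k) * c) = p ^ (3 * i + k) * (m * n * c)"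
      by (simp only: mult_ac)
    have par: "odd (3 * i + k) = odd (i + k)" by presburger
    note eqs = ji s' e residue_eq[OF p m] residue_eq[OF p n] residue_eq[OF p c(2)]
        residue_eq[OF p dvd_mult[OF dvd_mult[OF m n] c(2)]] par
    show ?thesis
    proof (cases "k = 0")
      case True
      have c': "c = m + n" using c True by simp
      have "weq (smooth p) (residue_class p m + residue_class p n)
          (residue_class p c + residue_class p (m * n * c))"
        unfolding c' using m n c by (intro residue_class_sum p) (auto simp: True)
      thus ?thesis unfolding eqs using True by (cases "odd i") auto
    next
      case False
      have "p dvd m + n" using False c by (simp add: dvd_power)
      hence nm: "n mod p = (- m) mod p"
        using mod_eq_dvd_iff[of n p "- m"] by (simp add: add.commute)
      have 1: "weq (smooth p) (residue_class p m + residue_class p n) 0"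
        unfolding residue_class_cong[OF nm] by (rule weq_add_neg[OF residue_class_minus[OF p m]])
      have "m * n * c mod p = m * (- m) * c mod p"
        using mod_mult_cong[OF mod_mult_cong[OF refl nm] refl] .
      also have "m * (- m) * c = - (c * m\<^sup>2)" by (simp add: power2_eq_square)
      finally have "residue_class p (m * n * c) = residue_class p (- (c * m\<^sup>2))"
        by (rule residue_class_cong)
      also have "weq (smooth p) \<dots> (- residue_class p (c * m\<^sup>2))"
        using m p by (intro residue_class_minus dvd_mult c) (simp_all add: prime_dvd_square_iff)
      also have "weq (smooth p) \<dots> (- residue_class p c)"
        by (intro weq_minus residue_class_square p c m)
      finally have 2: "weq (smooth p) (residue_class p c + residue_class p (m * n * c)) 0"
        by (rule weq_add_neg)
      have 3: "weq (smooth p) (residue_class p m + residue_class p n)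
          (residue_class p c + residue_class p (m * n * c))"
        by (rule weq_trans[OF 1 weq_sym[OF 2]])
      show ?thesis unfolding eqs
        using 1 3 weq_sym[OF 2] by (cases "odd i"; cases "odd (i + k)") (simp_all only: if_True if_False add_0_right weq_refl simp_thms)
    qed
  qed
qed

text \<open>
  The only relation that needs an argument: the valuations of the three numbers are compared, and after
  a common power of \<open>p\<close> is removed either all are units or one summand dominates.
\<close>

lemma residue_sum:
  assumes p: "prime p" and ab: "a \<noteq> 0" "b \<noteq> 0" "a + b \<noteq> 0"
  shows "weq (smooth p) (residue p a + residue p b) (residue p (a + b) + residue p (a * b * (a + b)))"
proof -
  obtain i m where a: "a = p ^ i * m" "\<not> p dvd m" using prime_power_split[OF p ab(1)] .
  obtain j n where b: "b = p ^ j * n" "\<not> p dvd n" using prime_power_split[OF p ab(2)] .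
  show ?thesis
  proof (cases "i \<le> j")
    case True thus ?thesis using residue_sum_aux[OF p a(2) b(2) True] ab by (simp add: a b)
  next
    case False
    hence ji: "j \<le> i" by simp
    have "weq (smooth p) (residue p b + residue p a) (residue p (b + a) + residue p (b * a * (b + a)))"
      using residue_sum_aux[OF p b(2) a(2) ji] ab unfolding a(1)[symmetric] b(1)[symmetric]
      by (simp only: add.commute[of b a] simp_thms)
    thus ?thesis by (simp only: add.commute mult.commute[of b a])
  qed
qed

lemma residue_of_smooth:
  assumes p: "prime p" and s: "s \<in> smooth (p + 1)"
  shows "weq (smooth p) (residue p s) (frag_of s)"
proof -
  have s0: "s \<noteq> 0" using s by (simp add: smooth_def)
  obtain v m where m: "s = p ^ v * m" "\<not> p dvd m" using prime_power_split[OF p s0] .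
  have ms: "m \<in> smooth p"
    unfolding smooth_def
  proof (intro CollectI conjI allI impI)
    show "m \<noteq> 0" using m by auto
    fix q assume q: "prime q" "q dvd m"
    hence "q \<noteq> p" "q < p + 1" using m s by (auto simp: smooth_def)
    thus "q < p" by simp
  qed
  have p0: "p \<noteq> 0" "m \<noteq> 0" using p m by auto
  show ?thesis
  proof (cases "odd v")
    case True
    then obtain w where v: "v = 2 * w + 1" by (elim oddE)
    have "weq (smooth p) (frag_of (p * m * (p ^ w)\<^sup>2)) (frag_of (p * m))"
      using p0 by (intro weq_square) auto
    also have "weq (smooth p) \<dots> (residue_class p m)"
      unfolding residue_class_def by (rule milnor_reduction[OF p ms])
    also have "p * m * (p ^ w)\<^sup>2 = s" by (simp add: m v power_add power_mult power2_eq_square power_mult_distrib)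
    finally show ?thesis unfolding m(1) residue_eq[OF p m(2)] using True by (simp add: weq_sym)
  next
    case False
    then obtain w where v: "v = 2 * w" by auto
    have "weq (smooth p) (frag_of (m * (p ^ w)\<^sup>2)) (frag_of m)"
      using p0 by (intro weq_square) auto
    also have "weq (smooth p) \<dots> 0" using ms p0 by (intro weq_unit)
    also have "m * (p ^ w)\<^sup>2 = s" by (simp add: m v power_mult power2_eq_square power_mult_distrib)
    finally show ?thesis unfolding m(1) residue_eq[OF p m(2)] using False by (simp add: weq_sym)
  qed
qed

text \<open>
  The residue is a splitting of the filtration: it reproduces a combination of integers with prime factors
  up to \<open>p\<close> modulo those with prime factors below \<open>p\<close>.
\<close>

lemma residue_extend_id:
  assumes p: "prime p" and x: "x \<in> witt_rel (smooth (p + 1))"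
  shows "weq (smooth p) (frag_extend (residue p) x) x"
  using x
proof induction
  case (add x y)
  thus ?case by (simp add: frag_extend_add weq_add)
next
  case (minus x)
  thus ?case by (simp add: frag_extend_minus weq_minus)
next
  case (square a b)
  have "weq (smooth p) (residue p (a * b\<^sup>2) - residue p a) 0"
    using residue_square[OF p square] by (simp add: weq_def)
  moreover have "weq (smooth p) 0 (frag_of (a * b\<^sup>2) - frag_of a)"
    using weq_sym[OF weq_square[OF square]] by (simp add: weq_def)
  ultimately show ?case unfolding frag_extend_diff frag_extend_of by (rule weq_trans)
next
  case (neg a)
  have "weq (smooth p) (residue p a + residue p (- a)) 0"
    by (rule weq_add_neg[OF residue_neg[OF p neg]])
  moreover have "weq (smooth p) 0 (frag_of a + frag_of (- a))"
    using witt_rel.neg[OF neg, of "smooth p"] by (simp add: weq_0_iff[THEN iffD2, THEN weq_sym])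
  ultimately show ?case unfolding frag_extend_add frag_extend_of by (rule weq_trans)
next
  case (sum a b)
  have "weq (smooth p) (residue p a + residue p b - residue p (a + b) - residue p (a * b * (a + b))) 0"
    using residue_sum[OF p sum] by (rule weq_move)
  moreover have "weq (smooth p) 0 (frag_of a + frag_of b - frag_of (a + b) - frag_of (a * b * (a + b)))"
    using witt_rel.sum[OF sum, of "smooth p"] by (simp add: weq_0_iff[THEN iffD2, THEN weq_sym])
  ultimately show ?case unfolding frag_extend_add frag_extend_diff frag_extend_of by (rule weq_trans)
next
  case (unit s)
  thus ?case using residue_of_smooth[OF p] by simp
qed simp

text \<open>
  A form with vanishing residues moves down the filtration one prime at a time, by
  \<open>residue_extend_id\<close>, until only the units \<open>\<plusminus>1\<close> remain.
\<close>

lemma witt_rel_descend: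
  assumes "\<And>p. prime p \<Longrightarrow> weq (smooth p) (frag_extend (residue p) x) 0"
    and "x \<in> witt_rel (smooth (int n + 2))"
  shows "x \<in> witt_rel {1, -1}"
  using assms(2)
proof (induction n)
  case 0
  thus ?case by (simp add: smooth_2)
next
  case (Suc n)
  have "x \<in> witt_rel (smooth (int n + 2))"
  proof (cases "prime (int n + 2)")
    case True
    have "weq (smooth (int n + 2)) (frag_extend (residue (int n + 2)) x) x"
      using Suc.prems True by (intro residue_extend_id) (auto simp: algebra_simps)
    from weq_trans[OF weq_sym[OF this] assms(1)[OF True]] show ?thesis by (simp add: weq_0_iff)
  next
    case False
    have "q < int n + 2" if "prime q" "q < int (Suc n) + 2" for q
      using that False by (cases "q = int n + 2") auto
    moreover have "q < int (Suc n) + 2" if "q < int n + 2" for q using that by simp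
    ultimately have "smooth (int (Suc n) + 2) = smooth (int n + 2)"
      unfolding smooth_def by blast
    thus ?thesis using Suc.prems by metis
  qed
  thus ?case by (rule Suc.IH)
qed

lemma frag_extend_sum: "frag_extend f (\<Sum>i\<in>I. g i) = (\<Sum>i\<in>I. frag_extend f (g i))"
  by (induction I rule: infinite_finite_induct) (auto simp: frag_extend_add)

lemma witt_rel_sum: "(\<And>i. i \<in> I \<Longrightarrow> x i \<in> witt_rel S) \<Longrightarrow> (\<Sum>i\<in>I. x i) \<in> witt_rel S"
  by (induction I rule: infinite_finite_induct) (auto intro: witt_rel.intros)

lemma smooth_exists:
  assumes "finite I" "\<And>i. i \<in> I \<Longrightarrow> a i \<noteq> (0::int)"
  obtains n where "\<And>i. i \<in> I \<Longrightarrow> a i \<in> smooth (int n + 2)"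
proof
  fix i assume i: "i \<in> I"
  have "\<bar>a i\<bar> \<le> (\<Sum>i\<in>I. \<bar>a i\<bar>)" using assms(1) i by (intro member_le_sum) auto
  moreover have "0 \<le> (\<Sum>i\<in>I. \<bar>a i\<bar>)" by (intro sum_nonneg) auto
  ultimately show "a i \<in> smooth (int (nat (\<Sum>i\<in>I. \<bar>a i\<bar>)) + 2)"
    using assms(2)[OF i] by (intro smooth_small) auto
qed

text \<open>
  Consecutive terms are coprime, so a prime \<open>p\<close> divides at most one of \<open>t\<^sub>i\<close> and \<open>t\<^sub>i\<^sub>+\<^sub>1\<close>. If \<open>p\<close> divides \<open>t\<^sub>i\<close>,
  then \<open>t\<^sub>i\<^sub>+\<^sub>1 \<equiv> - b\<^sup>2 t\<^sub>i\<^sub>-\<^sub>1\<close> modulo \<open>p\<close>, and the residues of the two terms that contain \<open>t\<^sub>i\<close> cancel. There is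
  no boundary contribution because the first and the last value are units.
\<close>

theorem witt_rel_continuant:
  fixes t a b :: "nat \<Rightarrow> int"
  assumes t0: "t 0 = 1" and tn: "\<bar>t n\<bar> = 1" and nz: "\<And>i. i \<le> n \<Longrightarrow> t i \<noteq> 0"
    and rec: "\<And>i. 0 < i \<Longrightarrow> i < n \<Longrightarrow> t (Suc i) = a i * t i - (b i)\<^sup>2 * t (i - 1)"
    and cop: "\<And>i. i < n \<Longrightarrow> coprime (t i) (t (Suc i))"
  shows "(\<Sum>i<n. frag_of (t i * t (Suc i))) \<in> witt_rel {1, -1}" (is "?X \<in> _")
proof -
  obtain N where N: "\<And>i. i \<in> {..<n} \<Longrightarrow> t i * t (Suc i) \<in> smooth (int N + 2)"
    using smooth_exists[of "{..<n}" "\<lambda>i. t i * t (Suc i)"] nz by auto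
  show ?thesis
  proof (rule witt_rel_descend)
    show "?X \<in> witt_rel (smooth (int N + 2))"
      using N nz by (intro witt_rel_sum witt_rel.unit) auto
  next
    fix p :: int assume p: "prime p"
    have pnu: "\<not> p dvd 1" "\<not> p dvd t 0" "\<not> p dvd t n"
      using p tn t0 not_prime_unit[of p] by (auto simp: abs_if zdvd1_eq split: if_splits)
    define L where "L i = (if p dvd t i then residue p (t i * t (Suc i)) else 0)" for i
    define R where "R i = (if p dvd t (Suc i) then residue p (t i * t (Suc i)) else 0)" for i
    have LR: "residue p (t i * t (Suc i)) = L i + R i" if "i < n" for i
    proof -
      have nb: "\<not> (p dvd t i \<and> p dvd t (Suc i))"
        using coprime_common_divisor[OF cop[OF that], of p] p not_prime_unit[of p] by blast
      have "residue p (t i * t (Suc i)) = 0" if "\<not> p dvd t i" "\<not> p dvd t (Suc i)"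
        using residue_eq[OF p, of "t i * t (Suc i)" 0] that p by (simp add: prime_dvd_mult_iff)
      thus ?thesis using nb by (auto simp: L_def R_def)
    qed
    have main: "L (Suc i) + R i \<in> witt_rel (smooth p)" if i: "Suc i < n" for i
    proof (cases "p dvd t (Suc i)")
      case False thus ?thesis by (simp add: L_def R_def witt_rel.zero)
    next
      case True
      obtain v m where m: "t (Suc i) = p ^ v * m" "\<not> p dvd m"
        using prime_power_split[OF p nz[of "Suc i"]] i by auto
      have np: "\<not> p dvd t i" "\<not> p dvd t (Suc (Suc i))"
        using True coprime_common_divisor[OF cop[of i], of p] coprime_common_divisor[OF cop[of "Suc i"], of p]
          i p not_prime_unit[of p] by auto
      have r: "t (Suc (Suc i)) = a (Suc i) * t (Suc i) - (b (Suc i))\<^sup>2 * t i" using rec[of "Suc i"] i by simp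
      have nb: "\<not> p dvd b (Suc i)" using np(2) True unfolding r by (auto simp: power2_eq_square)
      have nd: "\<not> p dvd m * t (Suc (Suc i))" "\<not> p dvd t i * m" "\<not> p dvd t i * m * (b (Suc i))\<^sup>2"
        using np m nb p by (simp_all add: prime_dvd_mult_iff prime_dvd_square_iff)
      have "p dvd a (Suc i) * t (Suc i)" using True by simp
      hence "t (Suc (Suc i)) mod p = - ((b (Suc i))\<^sup>2 * t i) mod p" unfolding r
        by (simp add: mod_eq_dvd_iff)
      hence "m * t (Suc (Suc i)) mod p = m * - ((b (Suc i))\<^sup>2 * t i) mod p" by (rule mod_mult_cong[OF refl])
      hence "residue_class p (m * t (Suc (Suc i))) = residue_class p (- (t i * m * (b (Suc i))\<^sup>2))"
        by (intro residue_class_cong) (simp add: mult_ac)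
      also have "weq (smooth p) \<dots> (- residue_class p (t i * m * (b (Suc i))\<^sup>2))"
        by (rule residue_class_minus[OF p nd(3)])
      also have "weq (smooth p) \<dots> (- residue_class p (t i * m))"
        by (intro weq_minus residue_class_square p nd nb)
      finally have W: "residue_class p (m * t (Suc (Suc i))) + residue_class p (t i * m) \<in> witt_rel (smooth p)"
        by (simp add: weq_def)
      have e: "t (Suc i) * t (Suc (Suc i)) = p ^ v * (m * t (Suc (Suc i)))" "t i * t (Suc i) = p ^ v * (t i * m)"
        by (simp_all add: m)
      show ?thesis unfolding L_def R_def e residue_eq[OF p nd(1)] residue_eq[OF p nd(2)]
        using True W by (auto intro: witt_rel.zero)
    qed
    have "(\<Sum>i<k. L i + R i) - R (k - 1) \<in> witt_rel (smooth p)" if "0 < k" "k \<le> n" for k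
      using that
    proof (induction k)
      case (Suc k)
      show ?case
      proof (cases "k = 0")
        case True thus ?thesis using pnu by (simp add: L_def witt_rel.zero)
      next
        case False
        then obtain i where i: "k = Suc i" by (cases k) auto
        have "(\<Sum>i<k. L i + R i) - R (k - 1) \<in> witt_rel (smooth p)" using Suc False by simp
        from witt_rel.add[OF this main[of i]] show ?thesis using Suc.prems i by (simp add: algebra_simps)
      qed
    qed simp
    from this[of n] have "(\<Sum>i<n. L i + R i) \<in> witt_rel (smooth p)"
      using pnu by (cases n) (auto simp: R_def witt_rel.zero)
    thus "weq (smooth p) (frag_extend (residue p) ?X) 0"
      by (simp add: weq_0_iff frag_extend_sum LR)
  qed
qed

section \<open>Integral congruence and stable diagonalisation\<close>

definition block_sum :: "'a :: zero mat \<Rightarrow> 'a mat \<Rightarrow> 'a mat"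
  where "block_sum A B = four_block_mat A (0\<^sub>m (dim_row A) (dim_col B)) (0\<^sub>m (dim_row B) (dim_col A)) B"

lemma block_sum_carrier [simp]:
  "A \<in> Mat n m \<Longrightarrow> B \<in> Mat k l \<Longrightarrow> block_sum A B \<in> Mat (n + k) (m + l)"
  by (auto simp: block_sum_def)

lemma block_sum_mult:
  assumes "A \<in> Mat n m" "B \<in> Mat k l" "(C :: 'a :: comm_ring_1 mat) \<in> Mat m r" "D \<in> Mat l s"
  shows "block_sum A B * block_sum C D = block_sum (A * C) (B * D)"
proof -
  have z: "0\<^sub>m n l \<in> Mat n l" "0\<^sub>m k m \<in> Mat k m"
    "0\<^sub>m m s \<in> Mat m s" "0\<^sub>m l r \<in> Mat l r" by auto
  have e1: "block_sum A B = four_block_mat A (0\<^sub>m n l) (0\<^sub>m k m) B" "block_sum C D = four_block_mat C (0\<^sub>m m s) (0\<^sub>m l r) D"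
    using assms by (auto simp: block_sum_def)
  have e2: "block_sum (A * C) (B * D) = four_block_mat (A * C) (0\<^sub>m n s) (0\<^sub>m k r) (B * D)"
    using assms by (auto simp: block_sum_def)
  have c: "A * C \<in> Mat n r" "B * D \<in> Mat k s" using assms by (auto intro: mult_carrier_mat)
  show ?thesis
    unfolding e1 e2 mult_four_block_mat[OF assms(1) z(1,2) assms(2) assms(3) z(3,4) assms(4)]
      left_mult_zero_mat[OF assms(4)] left_mult_zero_mat[OF assms(3)] left_mult_zero_mat[OF z(3)] left_mult_zero_mat[OF z(4)]
      right_mult_zero_mat[OF assms(1)] right_mult_zero_mat[OF assms(2)]
    using c by simp
qed

lemma block_sum_transpose:
  "A \<in> Mat n m \<Longrightarrow> B \<in> Mat k l \<Longrightarrow> (block_sum A B)\<^sup>T = block_sum (A\<^sup>T) (B\<^sup>T)"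
  unfolding block_sum_def using transpose_four_block_mat[of A n m "0\<^sub>m n l" l "0\<^sub>m k m" k B]
  by (auto simp: zero_transpose_mat)

lemma block_sum_det:
  "(A :: int mat) \<in> Mat n n \<Longrightarrow> B \<in> Mat k k \<Longrightarrow> det (block_sum A B) = det A * det B"
  unfolding block_sum_def using det_four_block_mat_upper_right_zero[of A n "0\<^sub>m n k" k "0\<^sub>m k n" B] by auto

lemma block_sum_dim [simp]:
  "dim_row (block_sum A B) = dim_row A + dim_row B" "dim_col (block_sum A B) = dim_col A + dim_col B"
  by (simp_all add: block_sum_def)

lemma block_sum_index:
  assumes "i < dim_row A + dim_row B" "j < dim_col A + dim_col B"
  shows "block_sum A B $$ (i, j) = (if i < dim_row A then if j < dim_col A then A $$ (i, j) else 0
     else if j < dim_col A then 0 else B $$ (i - dim_row A, j - dim_col A))"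
proof -
  have "i < dim_row A + dim_row B" "j < dim_col A + dim_col B" using assms by auto
  thus ?thesis unfolding block_sum_def by (subst index_mat_four_block(1)) (use assms in \<open>simp_all\<close>)
qed

lemma block_sum_assoc: "block_sum (block_sum A B) C = block_sum A (block_sum B C)"
  using assoc_four_block_mat[of A B C] unfolding block_sum_def by simp

lemma block_sum_mat_diag:
  "block_sum (mat_diag n f) (mat_diag m g) = mat_diag (n + m) (\<lambda>i. if i < n then f i else g (i - n))"
proof (rule eq_matI)
  fix i j assume "i < dim_row (mat_diag (n + m) (\<lambda>i. if i < n then f i else g (i - n)))"
    "j < dim_col (mat_diag (n + m) (\<lambda>i. if i < n then f i else g (i - n)))"
  hence ij: "i < n + m" "j < n + m" by (simp_all add: mat_diag_def)
  show "block_sum (mat_diag n f) (mat_diag m g) $$ (i, j) = mat_diag (n + m) (\<lambda>i. if i < n then f i else g (i - n)) $$ (i, j)"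
    using ij by (cases "i < n"; cases "j < n") (auto simp: block_sum_index mat_diag_def)
qed (simp_all add: mat_diag_def)

lemma unim_block_sum: "unim n E \<Longrightarrow> unim m F \<Longrightarrow> unim (n + m) (block_sum E F)"
  unfolding unim_def using block_sum_det[of E n F m] by (auto simp: abs_mult)

definition mcong :: "int mat \<Rightarrow> int mat \<Rightarrow> bool"
  where "mcong A B \<longleftrightarrow> (\<exists>n E. A \<in> Mat n n \<and> unim n E \<and> B = E * A * E\<^sup>T)"

lemma mcongI: "A \<in> Mat n n \<Longrightarrow> unim n E \<Longrightarrow> B = E * A * E\<^sup>T \<Longrightarrow> mcong A B"
  unfolding mcong_def by blast

lemma congruence_carrier:
  "A \<in> Mat n n \<Longrightarrow> E \<in> Mat m n \<Longrightarrow> E * A * E\<^sup>T \<in> Mat m m"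
  by (intro mult_carrier_mat[of _ m n]) auto

lemma mcong_refl: "A \<in> Mat n n \<Longrightarrow> mcong A A"
  by (rule mcongI[of A n "1\<^sub>m n"]) auto

lemma congruence_mult:
  assumes "A \<in> Mat n n" "E \<in> Mat n n" "(F :: int mat) \<in> Mat n n"
  shows "F * (E * A * E\<^sup>T) * F\<^sup>T = F * E * A * (F * E)\<^sup>T"
proof -
  have "F * (E * A * E\<^sup>T) = F * E * A * E\<^sup>T"
    using assms by (simp add: assoc_mult_mat[of _ n n _ n _ n])
  moreover have "F * E * A * E\<^sup>T * F\<^sup>T = F * E * A * (E\<^sup>T * F\<^sup>T)"
    using assms by (intro assoc_mult_mat[of _ n n _ n _ n]) auto
  ultimately show ?thesis using assms by (simp add: transpose_mult[of _ n n])
qed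

lemma mcong_trans: 
  assumes "mcong A B" "mcong B C" shows "mcong A C"
proof -
  obtain n E where E: "A \<in> Mat n n" "unim n E" "B = E * A * E\<^sup>T"
    using assms(1) unfolding mcong_def by blast
  obtain m F where F: "B \<in> Mat m m" "unim m F" "C = F * B * F\<^sup>T"
    using assms(2) unfolding mcong_def by blast
  have "B \<in> Mat n n" unfolding E(3) by (rule congruence_carrier[OF E(1) unim_carrier[OF E(2)]])
  hence m: "m = n" using F(1) by auto
  show ?thesis
    using congruence_mult[OF E(1) unim_carrier[OF E(2)] unim_carrier[OF F(2)[unfolded m]]] E F m
    by (intro mcongI[of A n "F * E"] unim_mult) auto
qed

lemma mcong_carrier: "mcong A B \<Longrightarrow> A \<in> Mat n n \<Longrightarrow> B \<in> Mat n n"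
  unfolding mcong_def using unim_carrier by fastforce

lemma mcong_block_sum:
  assumes "mcong A B" "mcong C D" shows "mcong (block_sum A C) (block_sum B D)"
proof -
  obtain n E where E: "A \<in> Mat n n" "unim n E" "B = E * A * E\<^sup>T"
    using assms(1) unfolding mcong_def by blast
  obtain m F where F: "C \<in> Mat m m" "unim m F" "D = F * C * F\<^sup>T"
    using assms(2) unfolding mcong_def by blast
  note c = unim_carrier[OF E(2)] unim_carrier[OF F(2)]
  have "block_sum B D = block_sum E F * block_sum A C * (block_sum E F)\<^sup>T"
    unfolding E(3) F(3) block_sum_transpose[OF c] block_sum_mult[OF c E(1) F(1)]
    using c E(1) F(1) by (intro block_sum_mult[symmetric, of _ n n _ m m _ n _ m]) auto
  thus ?thesis using E F by (intro mcongI[of _ "n + m" "block_sum E F"] unim_block_sum) auto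
qed

text \<open>
  The basis vectors of the two summands are exchanged.
\<close>

lemma mcong_comm:
  assumes A: "A \<in> Mat n n" and B: "B \<in> Mat m m"
  shows "mcong (block_sum A B) (block_sum B A)"
proof -
  define E :: "int mat" where "E = four_block_mat (0\<^sub>m m n) (1\<^sub>m m) (1\<^sub>m n) (0\<^sub>m n m)"
  have "E \<in> Mat (m + n) (n + m)"
    unfolding E_def by (rule four_block_carrier_mat) simp_all
  hence Ec: "E \<in> Mat (n + m) (n + m)" by (simp add: add.commute)
  have Et: "E\<^sup>T = four_block_mat (0\<^sub>m n m) (1\<^sub>m n) (1\<^sub>m m) (0\<^sub>m m n)"
    unfolding E_def
      transpose_four_block_mat[OF zero_carrier_mat[of m n] one_carrier_mat[of m] one_carrier_mat[of n] zero_carrier_mat[of n m]]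
    by simp
  have d: "block_sum A B = four_block_mat A (0\<^sub>m n m) (0\<^sub>m m n) B" "block_sum B A = four_block_mat B (0\<^sub>m m n) (0\<^sub>m n m) A"
    using A B by (simp_all add: block_sum_def)
  have "E * block_sum A B = four_block_mat (0\<^sub>m m n) B A (0\<^sub>m n m)"
    unfolding E_def d mult_four_block_mat[OF zero_carrier_mat[of m n] one_carrier_mat[of m] one_carrier_mat[of n]
      zero_carrier_mat[of n m] A zero_carrier_mat[of n m] zero_carrier_mat[of m n] B]
    using A B by simp
  hence 1: "E * block_sum A B * E\<^sup>T = block_sum B A"
    unfolding Et d using A B
    by (simp add: mult_four_block_mat[OF zero_carrier_mat[of m n] B A zero_carrier_mat[of n m]
      zero_carrier_mat[of n m] one_carrier_mat[of n] one_carrier_mat[of m] zero_carrier_mat[of m n]])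
  have "E * E\<^sup>T = 1\<^sub>m (m + n)"
    unfolding Et unfolding E_def mult_four_block_mat[OF zero_carrier_mat[of m n] one_carrier_mat[of m] one_carrier_mat[of n]
      zero_carrier_mat[of n m] zero_carrier_mat[of n m] one_carrier_mat[of n] one_carrier_mat[of m] zero_carrier_mat[of m n]]
    by simp
  hence 2: "E * E\<^sup>T = 1\<^sub>m (n + m)" by (simp add: add.commute)
  have "det E * det E = 1"
    using det_mult[OF Ec, of "E\<^sup>T"] Ec 2 by (simp add: det_transpose[of E "n + m"])
  hence "\<bar>det E\<bar> = 1" by (metis abs_1 abs_square_eq_1 power2_eq_square abs_minus_cancel zmult_eq_1_iff)
  hence "unim (n + m) E" using Ec unfolding unim_def by blast
  thus ?thesis using 1 A B Ec by (intro mcongI[of _ "n + m" E]) auto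
qed

definition signs :: "nat \<Rightarrow> (nat \<Rightarrow> int) \<Rightarrow> bool"
  where "signs k \<epsilon> \<longleftrightarrow> (\<forall>i<k. \<epsilon> i \<in> {1, -1})"

definition stably_diag :: "int mat \<Rightarrow> bool"
  where "stably_diag U \<longleftrightarrow> (\<exists>k \<epsilon> k' \<epsilon>'. signs k \<epsilon> \<and> signs k' \<epsilon>' \<and>
    mcong (block_sum U (mat_diag k \<epsilon>)) (mat_diag k' \<epsilon>'))"

lemma stably_diagI:
  "signs k \<epsilon> \<Longrightarrow> signs k' \<epsilon>' \<Longrightarrow> mcong (block_sum U (mat_diag k \<epsilon>)) (mat_diag k' \<epsilon>') \<Longrightarrow> stably_diag U"
  unfolding stably_diag_def by blast

lemma signs_append: "signs k \<epsilon> \<Longrightarrow> signs k' \<epsilon>' \<Longrightarrow> signs (k + k') (\<lambda>i. if i < k then \<epsilon> i else \<epsilon>' (i - k))"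
  by (auto simp: signs_def)

lemma mcong_block_sum_swap:
  assumes "A \<in> Mat n n" "B \<in> Mat m m" "C \<in> Mat k k"
  shows "mcong (block_sum (block_sum A B) C) (block_sum (block_sum A C) B)"
  unfolding block_sum_assoc using assms by (intro mcong_block_sum mcong_refl mcong_comm) auto

text \<open>
  The signs that diagonalise one summand commute past the other one.
\<close>

lemma stably_diag_block_sum:
  assumes U: "mcong U (block_sum A B)" and A: "A \<in> Mat n n" "stably_diag A" and B: "B \<in> Mat m m" "stably_diag B"
  shows "stably_diag U"
proof -
  obtain k \<epsilon> k' \<epsilon>' where a: "signs k \<epsilon>" "signs k' \<epsilon>'" "mcong (block_sum A (mat_diag k \<epsilon>)) (mat_diag k' \<epsilon>')"
    using A(2) unfolding stably_diag_def by blast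
  obtain l \<delta> l' \<delta>' where b: "signs l \<delta>" "signs l' \<delta>'" "mcong (block_sum B (mat_diag l \<delta>)) (mat_diag l' \<delta>')"
    using B(2) unfolding stably_diag_def by blast
  let ?D = "mat_diag k \<epsilon>" and ?D' = "mat_diag l \<delta>"
  have DD: "block_sum ?D ?D' \<in> Mat (k + l) (k + l)" by simp
  have AD: "block_sum (block_sum (block_sum A B) ?D) ?D' = block_sum (block_sum A B) (block_sum ?D ?D')"
    "block_sum (block_sum (block_sum A ?D) B) ?D' = block_sum (block_sum A ?D) (block_sum B ?D')" by (rule block_sum_assoc)+
  have 1: "mcong (block_sum U (block_sum ?D ?D')) (block_sum (block_sum A B) (block_sum ?D ?D'))"
    by (rule mcong_block_sum[OF U mcong_refl[OF DD]])
  have 2: "mcong (block_sum (block_sum (block_sum A B) ?D) ?D') (block_sum (block_sum (block_sum A ?D) B) ?D')"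
    by (rule mcong_block_sum[OF mcong_block_sum_swap[OF A(1) B(1) mat_diag_dim] mcong_refl[OF mat_diag_dim]])
  have 3: "mcong (block_sum (block_sum A ?D) (block_sum B ?D')) (block_sum (mat_diag k' \<epsilon>') (mat_diag l' \<delta>'))"
    by (rule mcong_block_sum[OF a(3) b(3)])
  have "mcong (block_sum U (block_sum ?D ?D')) (block_sum (mat_diag k' \<epsilon>') (mat_diag l' \<delta>'))"
    using mcong_trans[OF mcong_trans[OF 1 2[unfolded AD]] 3] .
  thus ?thesis unfolding block_sum_mat_diag by (rule stably_diagI[OF signs_append[OF a(1) b(1)] signs_append[OF a(2) b(2)]])
qed

lemma stably_diagI_stab:
  assumes "signs k \<epsilon>" "stably_diag (block_sum U (mat_diag k \<epsilon>))"
  shows "stably_diag U"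
proof -
  obtain l \<delta> l' \<delta>' where b: "signs l \<delta>" "signs l' \<delta>'"
    "mcong (block_sum (block_sum U (mat_diag k \<epsilon>)) (mat_diag l \<delta>)) (mat_diag l' \<delta>')"
    using assms(2) unfolding stably_diag_def by blast
  show ?thesis using b(3) unfolding block_sum_assoc block_sum_mat_diag
    by (rule stably_diagI[OF signs_append[OF assms(1) b(1)] b(2)])
qed

lemma stably_diag_mcong:
  assumes "mcong U V" "stably_diag V" shows "stably_diag U"
proof -
  obtain l \<delta> l' \<delta>' where b: "signs l \<delta>" "signs l' \<delta>'" "mcong (block_sum V (mat_diag l \<delta>)) (mat_diag l' \<delta>')"
    using assms(2) unfolding stably_diag_def by blast
  have "mcong (block_sum U (mat_diag l \<delta>)) (block_sum V (mat_diag l \<delta>))"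
    by (intro mcong_block_sum assms(1) mcong_refl[of _ l]) auto
  from stably_diagI[OF b(1,2) mcong_trans[OF this b(3)]] show ?thesis .
qed

section \<open>Unimodular forms with a Lagrangian\<close>

lemma unim_from_congruence:
  assumes "G \<in> Mat n n" "R \<in> Mat n n" "\<bar>det (R * G * R\<^sup>T)\<bar> = 1"
  shows "unim n R" "\<bar>det G\<bar> = 1"
proof -
  have RG: "R * G \<in> Mat n n" using assms by (intro mult_carrier_mat[of _ n n]) auto
  have "det (R * G * R\<^sup>T) = det R * det G * det R"
    using det_mult[OF RG, of "R\<^sup>T"] det_mult[OF assms(2,1)] det_transpose[OF assms(2)] assms(2) by simp
  hence "\<bar>det R\<bar> * (\<bar>det G\<bar> * \<bar>det R\<bar>) = 1" using assms(3) by (simp add: abs_mult mult.assoc)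
  hence "\<bar>det R\<bar> = 1" "\<bar>det G\<bar> * \<bar>det R\<bar> = 1" using zmult_eq_1_iff[of "\<bar>det R\<bar>"] abs_ge_zero[of "det R"] by auto
  thus "unim n R" "\<bar>det G\<bar> = 1" using assms(2) unfolding unim_def by auto
qed

lemma mcong_det:
  assumes "mcong A B" "A \<in> Mat n n" shows "det B = det A"
proof -
  obtain m E where E: "A \<in> Mat m m" "unim m E" "B = E * A * E\<^sup>T"
    using assms(1) unfolding mcong_def by blast
  have Ec: "E \<in> Mat m m" by (rule unim_carrier[OF E(2)])
  have EA: "E * A \<in> Mat m m" using Ec E(1) by (rule mult_carrier_mat)
  have "det B = det E * det A * det E"
    unfolding E(3) using det_mult[OF EA, of "E\<^sup>T"] det_mult[OF Ec E(1)] det_transpose[OF Ec] Ec by simp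
  moreover have "det E * det E = 1" using E(2) unfolding unim_def by (metis abs_mult_self_eq mult_1)
  ultimately show ?thesis by (simp add: mult_ac)
qed

lemma mcong_symmetric:
  assumes "mcong A B" "A\<^sup>T = A" shows "B\<^sup>T = B"
proof -
  obtain m E where E: "A \<in> Mat m m" "unim m E" "B = E * A * E\<^sup>T"
    using assms(1) unfolding mcong_def by blast
  have Ec: "E \<in> Mat m m" by (rule unim_carrier[OF E(2)])
  have EA: "E * A \<in> Mat m m" using Ec E(1) by (rule mult_carrier_mat)
  have "B\<^sup>T = E * (A\<^sup>T * E\<^sup>T)"
    unfolding E(3) using transpose_mult[OF EA, of "E\<^sup>T" m] transpose_mult[OF Ec E(1)] Ec by simp
  thus ?thesis unfolding E(3) assms(2) using assoc_mult_mat[OF Ec E(1), of "E\<^sup>T" m] Ec by simp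
qed

lemma mcong_perm:
  assumes A: "A \<in> Mat n n" and s: "\<And>i. i < n \<Longrightarrow> \<sigma> i < n" and inj: "inj_on \<sigma> {..<n}"
  shows "mcong A (mat n n (\<lambda>(i, j). A $$ (\<sigma> i, \<sigma> j)))"
proof -
  define E :: "int mat" where "E = mat n n (\<lambda>(i, j). if j = \<sigma> i then 1 else 0)"
  have Ec: "E \<in> Mat n n" by (simp add: E_def)
  have r: "row E i = unit_vec n (\<sigma> i)" if "i < n" for i
    using that s[OF that] by (auto simp: E_def unit_vec_def)
  have e: "(E * B * E\<^sup>T) $$ (i, j) = B $$ (\<sigma> i, \<sigma> j)"
    if B: "B \<in> Mat n n" and ij: "i < n" "j < n" for i j B
  proof -
    have EB: "E * B \<in> Mat n n" using Ec B by (rule mult_carrier_mat)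
    have "(E * B * E\<^sup>T) $$ (i, j) = row (E * B) i \<bullet> row E j"
      using EB Ec ij by (auto simp del: index_mult_mat(3))
    also have "\<dots> = row (E * B) i $ \<sigma> j"
      unfolding r[OF ij(2)] using EB s[OF ij(2)] ij by (intro scalar_prod_right_unit) auto
    also have "\<dots> = row E i \<bullet> col B (\<sigma> j)"
      using Ec B ij s[OF ij(2)] by auto
    also have "\<dots> = B $$ (\<sigma> i, \<sigma> j)"
      unfolding r[OF ij(1)] using B s[OF ij(1)] s[OF ij(2)] by (subst scalar_prod_left_unit[of _ n]) auto
    finally show ?thesis .
  qed
  have "E * 1\<^sub>m n * E\<^sup>T = 1\<^sub>m n"
  proof (rule eq_matI)
    fix i j assume "i < dim_row (1\<^sub>m n :: int mat)" "j < dim_col (1\<^sub>m n :: int mat)"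
    hence ij: "i < n" "j < n" by auto
    have "\<sigma> i = \<sigma> j \<longleftrightarrow> i = j" using inj ij by (auto simp: inj_on_def)
    thus "(E * 1\<^sub>m n * E\<^sup>T) $$ (i, j) = 1\<^sub>m n $$ (i, j)"
      using e[OF one_carrier_mat ij] s ij by simp
  qed (use Ec in auto)
  hence "unim n E" by (intro unim_from_congruence(1)[OF one_carrier_mat Ec]) simp
  moreover have "mat n n (\<lambda>(i, j). A $$ (\<sigma> i, \<sigma> j)) = E * A * E\<^sup>T"
    using e[OF A] Ec A by (intro eq_matI) auto
  ultimately show ?thesis using A by (intro mcongI)
qed

lemma block_decomp:
  assumes A: "A \<in> Mat (k + l) (k + l)"
  shows "A = four_block_mat (mat k k (\<lambda>(i, j). A $$ (i, j))) (mat k l (\<lambda>(i, j). A $$ (i, j + k)))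
    (mat l k (\<lambda>(i, j). A $$ (i + k, j))) (mat l l (\<lambda>(i, j). A $$ (i + k, j + k)))" (is "_ = ?B")
proof (rule eq_matI)
  fix i j assume "i < dim_row ?B" "j < dim_col ?B"
  hence "i < k + l" "j < k + l" by simp_all
  thus "A $$ (i, j) = ?B $$ (i, j)"
    by (cases "i < k"; cases "j < k") (simp_all add: four_block_mat_def Let_def)
qed (use A in simp_all)

text \<open>
  A unimodular block on the diagonal splits off: its rows are subtracted from the others so as to clear
  the off-diagonal block.
\<close>

lemma block_split:
  fixes P :: "int mat"
  assumes P: "P \<in> Mat k k" and J: "J \<in> Mat k k" and inv: "P * J = 1\<^sub>m k" "J * P = 1\<^sub>m k"
    and sym: "J\<^sup>T = J" and Q: "Q \<in> Mat k l" and H: "H \<in> Mat l l"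
  shows "mcong (four_block_mat P Q (Q\<^sup>T) H) (block_sum P (H - Q\<^sup>T * J * Q))"
proof -
  let ?Qt = "Q\<^sup>T" and ?one = "1\<^sub>m l :: int mat"
  have Qt: "?Qt \<in> Mat l k" using Q by simp
  define X where "X = - (?Qt * J)"
  have QtJ: "?Qt * J \<in> Mat l k" using Qt J by (rule mult_carrier_mat)
  have X: "X \<in> Mat l k" using QtJ by (simp add: X_def)
  have JQ: "J * Q \<in> Mat k l" using J Q by (rule mult_carrier_mat)
  have XQ: "X * Q \<in> Mat l l" using X Q by (rule mult_carrier_mat)
  define E where "E = four_block_mat (1\<^sub>m k) (0\<^sub>m k l) X (1\<^sub>m l)"
  have Ec: "E \<in> Mat (k + l) (k + l)" by (simp add: E_def)
  have det: "det E = 1"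
    unfolding E_def using det_four_block_mat_upper_right_zero[OF one_carrier_mat[of k] refl X one_carrier_mat[of l]] by simp
  have XP: "X * P + ?Qt = 0\<^sub>m l k"
  proof -
    have "X * P = - (?Qt * J * P)" unfolding X_def using QtJ P by (intro uminus_mult_left_mat) auto
    also have "?Qt * J * P = ?Qt" using assoc_mult_mat[OF Qt J P] inv(2) Qt by simp
    finally have "X * P = - ?Qt" .
    thus ?thesis using uminus_l_inv_mat[OF Qt] by simp
  qed
  have "X\<^sup>T = - ((?Qt * J)\<^sup>T)" unfolding X_def by (rule transpose_uminus)
  also have "(?Qt * J)\<^sup>T = J * Q" using transpose_mult[OF Qt J] sym by simp
  finally have Xt: "X\<^sup>T = - (J * Q)" .
  have PX: "P * X\<^sup>T + Q = 0\<^sub>m k l"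
  proof -
    have "P * X\<^sup>T = - (P * (J * Q))" unfolding Xt using P JQ by (intro uminus_mult_right_mat) auto
    also have "P * (J * Q) = Q" using assoc_mult_mat[OF P J Q] inv(1) Q by simp
    finally have "P * X\<^sup>T = - Q" .
    thus ?thesis using uminus_l_inv_mat[OF Q] by simp
  qed
  have "E * four_block_mat P Q ?Qt H = four_block_mat P Q (0\<^sub>m l k) (X * Q + H)"
    unfolding E_def mult_four_block_mat[OF one_carrier_mat[of k] zero_carrier_mat[of k l] X one_carrier_mat[of l] P Q Qt H]
    using P Q Qt H XQ XP by simp
  moreover have "E\<^sup>T = four_block_mat (1\<^sub>m k) (X\<^sup>T) (0\<^sub>m l k) (1\<^sub>m l)"
    unfolding E_def transpose_four_block_mat[OF one_carrier_mat[of k] zero_carrier_mat[of k l] X one_carrier_mat[of l]] by simp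
  moreover have XQH: "X * Q + H \<in> Mat l l" using XQ H by simp
  moreover have Xt': "X\<^sup>T \<in> Mat k l" using X by simp
  ultimately have "E * four_block_mat P Q ?Qt H * E\<^sup>T
      = four_block_mat P (P * X\<^sup>T + Q) (0\<^sub>m l k) (0\<^sub>m l k * X\<^sup>T + (X * Q + H))"
    using mult_four_block_mat[OF P Q zero_carrier_mat[of l k] XQH one_carrier_mat[of k] Xt' zero_carrier_mat[of l k] one_carrier_mat[of l]]
      P Q XQ H by simp
  also have "\<dots> = block_sum P (H - ?Qt * J * Q)"
  proof -
    have "0\<^sub>m l k * X\<^sup>T + (X * Q + H) = H - ?Qt * J * Q"
      using X_def QtJ Q H XQ Xt' mult_carrier_mat[OF QtJ Q] by (intro eq_matI) auto
    thus ?thesis unfolding PX using P H QtJ Q by (simp add: block_sum_def)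
  qed
  finally show ?thesis using P Q H Ec det
    by (intro mcongI[of _ "k + l" E]) (auto simp only: unim_def four_block_carrier_mat abs_one)
qed

text \<open>
  The plane has determinant \<open>-1\<close> and an isotropic vector. It need not represent odd numbers, so that signs have to
  be added before a change of basis diagonalises it.
\<close>

lemma hyperbolic_stably_diag:
  assumes P: "P \<in> Mat 2 2" and p: "P $$ (0, 0) = 0" "P $$ (0, 1) = s" "P $$ (1, 0) = s" "P $$ (1, 1) = d" and s: "s * s = (1::int)"
  shows "stably_diag P"
proof -
  obtain t u where tu: "u * u = u" "d = 2 * t + 1 - u"
    by (cases "even d") (auto elim!: evenE oddE intro: that[of 1] that[of 0])
  define G where "G = block_sum P (mat_diag 1 (\<lambda>_. 1))"
  have Gc: "G \<in> Mat 3 3" using block_sum_carrier[OF P mat_diag_dim[of 1 "\<lambda>_. 1"]] by (simp add: G_def numeral_3_eq_3)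
  have G: "G = mat 3 3 (\<lambda>(i, j). [[0, s, 0], [s, d, 0], [0, 0, 1]] ! i ! j)"
    unfolding G_def using P p
    by (intro eq_matI) (auto simp: block_sum_index mat_diag_def numeral_3_eq_3 numeral_2_eq_2 less_Suc_eq)
  define R where "R = mat 3 3 (\<lambda>(i, j). [[- t * s, 1, u], [s + t * s, - 1, - u], [- u * s, 0, 1]] ! i ! j)"
  have Rc: "R \<in> Mat 3 3" by (simp add: R_def)
  define \<delta> :: "nat \<Rightarrow> int" where "\<delta> i = (if i = 1 then - 1 else 1)" for i
  have ss: "s * (s * x) = x" for x using s by (simp flip: mult.assoc)
  have uu: "u * (u * x) = u * x" for x using tu by (simp flip: mult.assoc)
  have RG: "R * G = mat 3 3 (\<lambda>(i, j). [[s, d - t, u], [- s, 1 + t - d, - u], [0, - u, 1]] ! i ! j)"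
    unfolding G R_def using s ss
    by (intro eq_matI) (auto simp: scalar_prod_def numeral_3_eq_3 less_Suc_eq algebra_simps)
  have e: "R * G * R\<^sup>T = mat_diag 3 \<delta>"
    unfolding RG unfolding R_def using s ss tu uu
    by (intro eq_matI) (auto simp: scalar_prod_def numeral_3_eq_3 less_Suc_eq algebra_simps mat_diag_def \<delta>_def)
  have "unim 3 R"
  proof (rule unim_from_congruence[OF Gc Rc])
    have "upper_triangular (mat_diag 3 \<delta>)" by (auto simp: mat_diag_def)
    hence "det (mat_diag 3 \<delta>) = -1"
      using det_upper_triangular[OF _ mat_diag_dim[of 3 \<delta>]]
      by (simp add: diag_mat_def mat_diag_def \<delta>_def numeral_3_eq_3)
    thus "\<bar>det (R * G * R\<^sup>T)\<bar> = 1" unfolding e by simp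
  qed
  hence "mcong G (mat_diag 3 \<delta>)" using mcongI[OF Gc _ e[symmetric]] by simp
  thus ?thesis unfolding G_def by (intro stably_diagI[of 1 "\<lambda>_. 1" 3 \<delta>]) (auto simp: signs_def \<delta>_def)
qed

text \<open>
  The first basis vector is isotropic and, by unimodularity, pairs to \<open>\<plusminus>1\<close> with some vector. The two span a
  unimodular plane, which splits off; the remaining isotropic basis vectors are orthogonal to the first
  one and survive in the complement.
\<close>

lemma isotropic_split:
  assumes G: "G \<in> Mat (l + 2) (l + 2)" and sym: "G\<^sup>T = G" and det: "\<bar>det G\<bar> = 1"
    and m: "0 < m" "m < l + 2" and iso: "\<And>i j. i < m \<Longrightarrow> j < m \<Longrightarrow> G $$ (i, j) = 0"
  obtains P H where "P \<in> Mat 2 2" "stably_diag P" "H \<in> Mat l l" "H\<^sup>T = H"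
    "\<bar>det H\<bar> = 1" "\<And>i j. i < m - 1 \<Longrightarrow> j < m - 1 \<Longrightarrow> H $$ (i, j) = 0" "mcong G (block_sum P H)"
proof -
  let ?n = "l + 2"
  have c0: "col G 0 \<in> Vec ?n" using G m by (intro col_carrier_vec) auto
  obtain F where F: "unim ?n F" "keeps ?n m F" "\<And>i. i < ?n \<Longrightarrow> m < i \<Longrightarrow> (F *v col G 0) $ i = 0"
    using reduce_vec[OF c0 m(2)] by blast
  define A where "A = F * G * F\<^sup>T"
  have Fc: "F \<in> Mat ?n ?n" by (rule unim_carrier[OF F(1)])
  have A: "A \<in> Mat ?n ?n" unfolding A_def by (rule congruence_carrier[OF G Fc])
  have GA: "mcong G A" by (rule mcongI[OF G F(1) A_def])
  have symA: "A\<^sup>T = A" by (rule mcong_symmetric[OF GA sym])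
  have As: "A $$ (i, j) = A $$ (j, i)" if "i < ?n" "j < ?n" for i j
    using arg_cong[OF symA, of "\<lambda>B. B $$ (j, i)"] A that by simp
  have A0: "A $$ (j, i) = (F *v col G i) $ j" if "i < m" "j < ?n" for i j
    unfolding A_def using that m by (intro congruence_entry[OF Fc G] keeps_row[OF F(2)]) auto
  have Am: "A $$ (j, i) = 0" if "i < m" "j < m" for i j
  proof -
    have "col G i \<in> Vec ?n" using G m that by (intro col_carrier_vec) auto
    from keepsD(2)[OF F(2) this, of j] show ?thesis using A0[of i j] that m iso[of j i] G by simp
  qed
  define s where "s = A $$ (m, 0)"
  have A0j: "A $$ (j, 0) = (if j = m then s else 0)" if "j < ?n" for j
    using Am[of 0 j] A0[of 0 j] F(3)[of j] that m by (cases j m rule: linorder_cases) (auto simp: s_def)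
  have "unim ?n A" using mcong_det[OF GA G] det A unfolding unim_def by simp
  then obtain X where X: "unim ?n X" "A * X = 1\<^sub>m ?n" "X * A = 1\<^sub>m ?n" by (rule unim_inverse)
  have Xc: "X \<in> Mat ?n ?n" by (rule unim_carrier[OF X(1)])
  have "1 = (X * A) $$ (0, 0)" unfolding X(3) by simp
  also have "\<dots> = (\<Sum>j<?n. X $$ (0, j) * A $$ (j, 0))"
    using Xc A by (simp add: scalar_prod_def lessThan_atLeast0)
  also have "\<dots> = (\<Sum>j<?n. if j = m then X $$ (0, m) * s else 0)"
    by (intro sum.cong) (auto simp: A0j)
  also have "\<dots> = X $$ (0, m) * s" using m by simp
  finally have "s = 1 \<or> s = -1" using zmult_eq_1_iff[of "X $$ (0, m)" s] by auto
  hence s: "s * s = 1" by auto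
  define \<sigma> where "\<sigma> i = (if i = 1 then m else if i = m then 1 else i)" for i
  have \<sigma>: "\<sigma> i < ?n" if "i < ?n" for i using that m by (auto simp: \<sigma>_def)
  have \<sigma>0: "\<sigma> 0 = 0" "\<sigma> 1 = m" using m by (auto simp: \<sigma>_def)
  have \<sigma>m: "\<sigma> i = m \<longleftrightarrow> i = 1" for i by (auto simp: \<sigma>_def)
  have inj: "inj_on \<sigma> {..<?n}" by (auto simp: inj_on_def \<sigma>_def split: if_splits)
  define B where "B = mat ?n ?n (\<lambda>(i, j). A $$ (\<sigma> i, \<sigma> j))"
  have AB: "mcong A B" unfolding B_def by (rule mcong_perm[OF A \<sigma> inj])
  have B: "B \<in> Mat (2 + l) (2 + l)" by (simp add: B_def add.commute)
  have Bij: "B $$ (i, j) = A $$ (\<sigma> i, \<sigma> j)" if "i < ?n" "j < ?n" for i j using that by (simp add: B_def)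
  have Bs: "B $$ (i, j) = B $$ (j, i)" if "i < ?n" "j < ?n" for i j using that Bij As \<sigma> by metis
  have B0: "B $$ (j, 0) = (if j = 1 then s else 0)" if "j < ?n" for j
    using that Bij[of j 0] A0j[OF \<sigma>[OF that]] \<sigma>0 \<sigma>m by simp
  define P where "P = mat 2 2 (\<lambda>(i, j). B $$ (i, j))"
  define Q where "Q = mat 2 l (\<lambda>(i, j). B $$ (i, j + 2))"
  define H where "H = mat l l (\<lambda>(i, j). B $$ (i + 2, j + 2))"
  have Pc: "P \<in> Mat 2 2" and Qc: "Q \<in> Mat 2 l" and Hc: "H \<in> Mat l l"
    by (auto simp: P_def Q_def H_def)
  have "mat l 2 (\<lambda>(i, j). B $$ (i + 2, j)) = Q\<^sup>T"
    unfolding Q_def by (intro eq_matI) (use Bs in auto)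
  hence BPQ: "B = four_block_mat P Q (Q\<^sup>T) H"
    using block_decomp[OF B] unfolding P_def Q_def H_def by simp
  define d where "d = B $$ (1, 1)"
  have p: "P $$ (0, 0) = 0" "P $$ (0, 1) = s" "P $$ (1, 0) = s" "P $$ (1, 1) = d"
    using B0[of 0] B0[of 1] Bs[of 0 1] by (simp_all add: P_def d_def)
  define J where "J = mat 2 2 (\<lambda>(i, j). if i = 0 then (if j = 0 then - d else s) else (if j = 0 then s else 0))"
  have Jc: "J \<in> Mat 2 2" by (simp add: J_def)
  have PJ: "P * J = 1\<^sub>m 2" "J * P = 1\<^sub>m 2"
    using p s Pc by (auto intro!: eq_matI simp: J_def scalar_prod_def numeral_2_eq_2 less_Suc_eq)
  have Jt: "J\<^sup>T = J" by (intro eq_matI) (auto simp: J_def)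
  have Q0: "Q $$ (0, j) = 0" if "j < l" for j
    using that B0[of "j + 2"] Bs[of 0 "j + 2"] by (simp add: Q_def)
  have QJ0: "Q\<^sup>T * J * Q = 0\<^sub>m l l"
  proof (rule eq_matI)
    fix i j assume "i < dim_row (0\<^sub>m l l :: int mat)" "j < dim_col (0\<^sub>m l l :: int mat)"
    hence ij: "i < l" "j < l" by auto
    have "(J * Q) $$ (1, j) = 0"
      using ij Q0 Jc Qc by (simp add: scalar_prod_def numeral_2_eq_2) (simp add: J_def)
    moreover have "Q\<^sup>T * J * Q = Q\<^sup>T * (J * Q)"
      using assoc_mult_mat[of "Q\<^sup>T" l 2 J 2 Q l] Qc Jc by simp
    moreover have "(Q\<^sup>T * (J * Q)) $$ (i, j) = (\<Sum>a<2. Q $$ (a, i) * (J * Q) $$ (a, j))"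
      using ij Qc Jc by (simp add: scalar_prod_def lessThan_atLeast0)
    ultimately show "(Q\<^sup>T * J * Q) $$ (i, j) = 0\<^sub>m l l $$ (i, j)"
      using ij Q0 by (simp add: numeral_2_eq_2)
  qed (use Qc in auto)
  have "mcong B (block_sum P (H - Q\<^sup>T * J * Q))"
    unfolding BPQ by (rule block_split[OF Pc Jc PJ Jt Qc Hc])
  moreover have "H - Q\<^sup>T * J * Q = H" unfolding QJ0 using Hc by (intro eq_matI) auto
  ultimately have GPH: "mcong G (block_sum P H)" using mcong_trans[OF mcong_trans[OF GA AB]] by simp
  show thesis
  proof (rule that[OF Pc _ Hc _ _ _ GPH])
    show "stably_diag P" by (rule hyperbolic_stably_diag[OF Pc p s])
    show "H\<^sup>T = H" unfolding H_def by (intro eq_matI) (use Bs in auto)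
    have "det P * det H = det G"
      using mcong_det[OF GPH G] block_sum_det[OF Pc Hc] by simp
    hence "\<bar>det P\<bar> * \<bar>det H\<bar> = 1" using det by (simp only: abs_mult[symmetric])
    thus "\<bar>det H\<bar> = 1" using zmult_eq_1_iff[of "\<bar>det P\<bar>" "\<bar>det H\<bar>"] by auto
    fix i j assume ij: "i < m - 1" "j < m - 1"
    have "\<sigma> (i + 2) < m" "\<sigma> (j + 2) < m" using ij by (auto simp: \<sigma>_def)
    thus "H $$ (i, j) = 0" using ij m Am Bij[of "i + 2" "j + 2"] by (simp add: H_def)
  qed
qed

lemma lagrangian_block_stably_diag:
  assumes "G \<in> Mat (2 * m) (2 * m)" "G\<^sup>T = G" "\<bar>det G\<bar> = 1"
    "\<And>i j. i < m \<Longrightarrow> j < m \<Longrightarrow> G $$ (i, j) = 0"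
  shows "stably_diag G"
  using assms
proof (induction m arbitrary: G)
  case 0
  have "block_sum G (mat_diag 0 (\<lambda>_. 1)) = mat_diag 0 (\<lambda>_. 1)"
    using 0 by (intro eq_matI) (auto simp: mat_diag_def)
  thus ?case using mcong_refl[OF mat_diag_dim[of 0 "\<lambda>_. 1"]]
    by (intro stably_diagI[of 0 "\<lambda>_. 1" 0 "\<lambda>_. 1"]) (simp_all add: signs_def)
next
  case (Suc m)
  have G: "G \<in> Mat (2 * m + 2) (2 * m + 2)" using Suc.prems by simp
  obtain P H where PH: "P \<in> Mat 2 2" "stably_diag P" "H \<in> Mat (2 * m) (2 * m)" "H\<^sup>T = H"
    "\<bar>det H\<bar> = 1" "\<And>i j. i < m \<Longrightarrow> j < m \<Longrightarrow> H $$ (i, j) = 0" "mcong G (block_sum P H)"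
    using isotropic_split[OF G Suc.prems(2,3), of "Suc m"] Suc.prems(4) by auto
  show ?case by (rule stably_diag_block_sum[OF PH(7,1,2,3) Suc.IH[OF PH(3,4,5,6)]])
qed

lemma mat_eq_zeroD: "mat m k f = 0\<^sub>m m k \<Longrightarrow> i < m \<Longrightarrow> j < k \<Longrightarrow> f (i, j) = 0"
  by (metis index_mat(1) index_zero_mat(1))

lemma mult_left_cancel_zero:
  assumes T: "(T :: int mat) \<in> Mat m m" "det T \<noteq> 0" and M: "M \<in> Mat m k" "T * M = 0\<^sub>m m k"
  shows "M = 0\<^sub>m m k"
proof -
  note adj = adj_mat[OF T(1)]
  have "det T \<cdot>\<^sub>m M = adj_mat T * T * M" unfolding adj(3)
    using mult_smult_assoc_mat[OF one_carrier_mat M(1), of "det T"] M(1) by simp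
  also have "\<dots> = 0\<^sub>m m k" using assoc_mult_mat[OF adj(1) T(1) M(1)] M(2) adj(1) by simp
  finally have e: "det T \<cdot>\<^sub>m M = 0\<^sub>m m k" .
  show ?thesis
  proof (rule eq_matI)
    fix i j assume "i < dim_row (0\<^sub>m m k :: int mat)" "j < dim_col (0\<^sub>m m k :: int mat)"
    thus "M $$ (i, j) = 0\<^sub>m m k $$ (i, j)"
      using arg_cong[OF e, of "\<lambda>B. B $$ (i, j)"] M(1) T(2) by simp
  qed (use M in auto)
qed

lemma mult_truncate:
  assumes T: "(T :: int mat) \<in> Mat m (m + k)" and z: "\<And>i j. i < m \<Longrightarrow> m \<le> j \<Longrightarrow> j < m + k \<Longrightarrow> T $$ (i, j) = 0"
    and Z: "Z \<in> Mat (m + k) r"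
  shows "T * Z = mat m m (\<lambda>(i, j). T $$ (i, j)) * mat m r (\<lambda>(i, j). Z $$ (i, j))"
proof (rule eq_matI)
  fix i j assume "i < dim_row (mat m m (\<lambda>(i, j). T $$ (i, j)) * mat m r (\<lambda>(i, j). Z $$ (i, j)))"
    "j < dim_col (mat m m (\<lambda>(i, j). T $$ (i, j)) * mat m r (\<lambda>(i, j). Z $$ (i, j)))"
  hence ij: "i < m" "j < r" by simp_all
  have "(T * Z) $$ (i, j) = (\<Sum>a<m + k. T $$ (i, a) * Z $$ (a, j))"
    using ij T Z by (simp add: scalar_prod_def lessThan_atLeast0)
  also have "\<dots> = (\<Sum>a<m. T $$ (i, a) * Z $$ (a, j))"
    by (rule sum.mono_neutral_right) (use z ij in auto)
  finally show "(T * Z) $$ (i, j) = (mat m m (\<lambda>(i, j). T $$ (i, j)) * mat m r (\<lambda>(i, j). Z $$ (i, j))) $$ (i, j)"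
    using ij by (simp add: scalar_prod_def lessThan_atLeast0)
qed (use T Z in auto)

text \<open>
  The rows of \<open>X\<close> span a rational Lagrangian. Column reduction replaces it by the span of the first \<open>m\<close>
  vectors of an integral basis, so that \<open>lagrangian_block_stably_diag\<close> applies.
\<close>

lemma lagrangian_stably_diag:
  assumes G: "G \<in> Mat (2 * m) (2 * m)" "G\<^sup>T = G" "\<bar>det G\<bar> = 1"
    and X: "X \<in> Mat m (2 * m)" and Y: "Y \<in> Mat (2 * m) m"
    and iso: "X * G * X\<^sup>T = 0\<^sub>m m m" and nondeg: "det (X * G * Y) \<noteq> 0"
  shows "stably_diag G"
proof -
  let ?n = "m + m"
  have n: "2 * m = ?n" by simp
  note G = G[unfolded n] and X = X[unfolded n] and Y = Y[unfolded n]
  obtain E where E: "unim ?n E" "\<And>i j. i < m \<Longrightarrow> j < ?n \<Longrightarrow> i < j \<Longrightarrow> (X * E) $$ (i, j) = 0"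
    using lower_triangular_form[OF X] by auto
  obtain F where F: "unim ?n F" "E * F = 1\<^sub>m ?n" "F * E = 1\<^sub>m ?n" using unim_inverse[OF E(1)] .
  have Ec: "E \<in> Mat ?n ?n" and Fc: "F \<in> Mat ?n ?n"
    by (rule unim_carrier[OF E(1)], rule unim_carrier[OF F(1)])
  define T where "T = X * E"
  define T1 where "T1 = mat m m (\<lambda>(i, j). T $$ (i, j))"
  have T: "T \<in> Mat m ?n" unfolding T_def using X Ec by (rule mult_carrier_mat)
  have T1: "T1 \<in> Mat m m" by (simp add: T1_def)
  have Tz: "T $$ (i, j) = 0" if "i < m" "m \<le> j" "j < ?n" for i j using E(2)[of i j] that by (simp add: T_def)
  have trunc: "T * Z = T1 * mat m r (\<lambda>(i, j). Z $$ (i, j))" if "Z \<in> Mat ?n r" for Z r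
    unfolding T1_def by (rule mult_truncate[OF T Tz that])
  have XTF: "X = T * F" unfolding T_def using assoc_mult_mat[OF X Ec Fc] F(2) X by simp
  define A where "A = F * G * F\<^sup>T"
  have A: "A \<in> Mat ?n ?n" unfolding A_def by (rule congruence_carrier[OF G(1) Fc])
  have GA: "mcong G A" by (rule mcongI[OF G(1) F(1) A_def])
  have symA: "A\<^sup>T = A" by (rule mcong_symmetric[OF GA G(2)])
  have FG: "F * G \<in> Mat ?n ?n" using Fc G(1) by (rule mult_carrier_mat)
  have XG: "X * G = T * (F * G)" unfolding XTF by (rule assoc_mult_mat[OF T Fc G(1)])
  have "X * G * Y = T * (F * G * Y)" unfolding XG by (rule assoc_mult_mat[OF T FG Y])
  also have "\<dots> = T1 * mat m m (\<lambda>(i, j). (F * G * Y) $$ (i, j))"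
    by (rule trunc[OF mult_carrier_mat[OF FG Y]])
  finally have "det T1 * det (mat m m (\<lambda>(i, j). (F * G * Y) $$ (i, j))) \<noteq> 0"
    using nondeg det_mult[OF T1] by simp
  hence d: "det T1 \<noteq> 0" by auto
  have Ft: "F\<^sup>T \<in> Mat ?n ?n" and Tt: "T\<^sup>T \<in> Mat ?n m" using Fc T by auto
  have "X * G * X\<^sup>T = T * (F * G) * (F\<^sup>T * T\<^sup>T)"
    unfolding XG by (subst XTF) (simp add: transpose_mult[OF T Fc])
  also have "\<dots> = T * (F * G) * F\<^sup>T * T\<^sup>T"
    by (rule assoc_mult_mat[OF mult_carrier_mat[OF T FG] Ft Tt, symmetric])
  also have "T * (F * G) * F\<^sup>T = T * A" unfolding A_def by (rule assoc_mult_mat[OF T FG Ft])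
  also have "T * A * T\<^sup>T = T * (A * T\<^sup>T)" by (rule assoc_mult_mat[OF T A Tt])
  also have "\<dots> = T1 * mat m m (\<lambda>(i, j). (A * T\<^sup>T) $$ (i, j))"
    by (rule trunc[OF mult_carrier_mat[OF A Tt]])
  finally have "T1 * mat m m (\<lambda>(i, j). (A * T\<^sup>T) $$ (i, j)) = 0\<^sub>m m m" unfolding iso by (rule sym)
  from mult_left_cancel_zero[OF T1 d mat_carrier this]
  have z': "(A * T\<^sup>T) $$ (i, j) = 0" if "i < m" "j < m" for i j
    using mat_eq_zeroD[OF _ that] by fastforce
  have TA: "T * A \<in> Mat m ?n" using T A by (rule mult_carrier_mat)
  have TAt: "(T * A)\<^sup>T = A * T\<^sup>T" using transpose_mult[OF T A] symA by simp
  have z'': "(T * A) $$ (j, i) = 0" if "i < m" "j < m" for i j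
  proof -
    have "(T * A)\<^sup>T $$ (i, j) = (T * A) $$ (j, i)"
      using TA that by (intro index_transpose_mat(1)) auto
    thus ?thesis using z'[OF that] unfolding TAt by simp
  qed
  have "T1 * mat m m (\<lambda>(i, j). A $$ (i, j)) = 0\<^sub>m m m"
  proof (rule eq_matI)
    fix i j assume "i < dim_row (0\<^sub>m m m :: int mat)" "j < dim_col (0\<^sub>m m m :: int mat)"
    hence ij: "i < m" "j < m" by auto
    have "(T1 * mat m m (\<lambda>(i, j). A $$ (i, j))) $$ (i, j) = (T1 * mat m ?n (\<lambda>(i, j). A $$ (i, j))) $$ (i, j)"
      using ij T1 by (simp add: scalar_prod_def)
    thus "(T1 * mat m m (\<lambda>(i, j). A $$ (i, j))) $$ (i, j) = 0\<^sub>m m m $$ (i, j)"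
      using z''[OF ij(2,1)] ij unfolding trunc[OF A] by simp
  qed (use T1 in auto)
  from mult_left_cancel_zero[OF T1 d mat_carrier this]
  have "A $$ (i, j) = 0" if "i < m" "j < m" for i j
    using mat_eq_zeroD[OF _ that] by fastforce
  hence "stably_diag A"
    using A symA mcong_det[OF GA G(1)] G(3) by (intro lagrangian_block_stably_diag[of A m]) auto
  thus ?thesis by (rule stably_diag_mcong[OF GA])
qed

section \<open>Rational orthogonal bases\<close>

definition bil :: "'a :: comm_ring_1 mat \<Rightarrow> 'a vec \<Rightarrow> 'a vec \<Rightarrow> 'a"
  where "bil A x y = x \<bullet> (A *v y)"

lemma mult_mat_vec_smult:
  "(A :: 'a :: comm_ring_1 mat) \<in> Mat m n \<Longrightarrow> v \<in> Vec n \<Longrightarrow> A *v (k \<cdot>v v) = k \<cdot>v (A *v v)"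
  by (intro eq_vecI) auto

lemma bil_add_left: "A \<in> Mat m n \<Longrightarrow> x \<in> Vec m \<Longrightarrow> x' \<in> Vec m \<Longrightarrow> y \<in> Vec n \<Longrightarrow>
  bil A (x + x') y = bil A x y + bil A x' y"
  unfolding bil_def by (intro add_scalar_prod_distrib[of _ m]) auto

lemma bil_add_right: "A \<in> Mat m n \<Longrightarrow> x \<in> Vec m \<Longrightarrow> y \<in> Vec n \<Longrightarrow> y' \<in> Vec n \<Longrightarrow>
  bil A x (y + y') = bil A x y + bil A x y'"
  unfolding bil_def by (subst mult_add_distrib_mat_vec[of _ m n], auto, intro scalar_prod_add_distrib[of _ m], auto)

lemma bil_smult_left: "A \<in> Mat m n \<Longrightarrow> x \<in> Vec m \<Longrightarrow> y \<in> Vec n \<Longrightarrow>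
  bil A (k \<cdot>v x) y = k * bil A x y"
  unfolding bil_def by (intro smult_scalar_prod_distrib[of _ m]) auto

lemma bil_smult_right: "A \<in> Mat m n \<Longrightarrow> x \<in> Vec m \<Longrightarrow> y \<in> Vec n \<Longrightarrow>
  bil A x (k \<cdot>v y) = k * bil A x y"
  using mult_mat_vec_smult[of A m n y k] scalar_prod_smult_distrib[of x m "A *v y" k] by (simp add: bil_def)

lemma bil_sym:
  assumes "A \<in> Mat n n" "A\<^sup>T = A" "x \<in> Vec n" "y \<in> Vec n"
  shows "bil A x y = bil A y x"
  using transpose_vec_mult_scalar[OF assms(1) assms(4,3)] assms comm_scalar_prod[of "A *v x" n y]
  by (simp add: bil_def)

lemma bil_block_sum:
  assumes "A \<in> Mat n n" "B \<in> Mat k k" "x \<in> Vec n" "x' \<in> Vec n"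
    "y \<in> Vec k" "y' \<in> Vec k"
  shows "bil (block_sum A B) (x @v y) (x' @v y') = bil A x x' + bil B y y'"
proof -
  have "block_sum A B = four_block_mat A (0\<^sub>m n k) (0\<^sub>m k n) B" using assms by (simp add: block_sum_def)
  hence "block_sum A B *v (x' @v y') = A *v x' @v B *v y'"
    using mult_mat_vec_split[OF assms(1,2,4,6)] by simp
  moreover have "A *v x' \<in> Vec n" "B *v y' \<in> Vec k" using assms by auto
  ultimately show ?thesis unfolding bil_def using scalar_prod_append[OF assms(3,5)] by metis
qed

text \<open>
  Equality of square classes in \<open>\<rat>\<close>, without denominators.
\<close>

definition sqc :: "int \<Rightarrow> int \<Rightarrow> bool"
  where "sqc a b \<longleftrightarrow> (\<exists>j k. j \<noteq> 0 \<and> k \<noteq> 0 \<and> j\<^sup>2 * a = k\<^sup>2 * b)"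

lemma sqc_refl [simp]: "sqc a a" unfolding sqc_def by (intro exI[of _ 1]) simp

lemma sqc_mult_square: "s \<noteq> 0 \<Longrightarrow> sqc (a * s\<^sup>2) a" "s \<noteq> 0 \<Longrightarrow> sqc a (a * s\<^sup>2)"
  unfolding sqc_def by (rule exI[of _ 1], rule exI[of _ s], simp, rule exI[of _ s], rule exI[of _ 1], simp)

lemma sqc_trans: assumes "sqc a b" "sqc b c" shows "sqc a c"
proof -
  obtain j k where jk: "j \<noteq> 0" "k \<noteq> 0" "j\<^sup>2 * a = k\<^sup>2 * b" using assms(1) by (auto simp: sqc_def)
  obtain j' k' where jk': "j' \<noteq> 0" "k' \<noteq> 0" "j'\<^sup>2 * b = k'\<^sup>2 * c" using assms(2) by (auto simp: sqc_def)
  have "(j' * j)\<^sup>2 * a = j'\<^sup>2 * (j\<^sup>2 * a)" by (simp add: power_mult_distrib)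
  also have "\<dots> = k\<^sup>2 * (j'\<^sup>2 * b)" unfolding jk(3) by simp
  also have "\<dots> = (k * k')\<^sup>2 * c" unfolding jk'(3) by (simp add: power_mult_distrib)
  finally show ?thesis unfolding sqc_def using jk jk' by (intro exI[of _ "j' * j"] exI[of _ "k * k'"]) simp
qed

text \<open>
  Over \<open>\<rat>\<close> the form \<open>G\<close> is isometric to the diagonal form with entries \<open>l\<close>. The orthogonal basis may be
  chosen integral, and its entries matter up to squares only.
\<close>

definition realizes :: "nat \<Rightarrow> int mat \<Rightarrow> int list \<Rightarrow> bool"
  where "realizes n G l \<longleftrightarrow> length l = n \<and> (\<exists>v. (\<forall>i<n. v i \<in> Vec n \<and> l ! i \<noteq> 0 \<and> sqc (bil G (v i) (v i)) (l ! i)) \<and>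
    (\<forall>i<n. \<forall>j<n. i \<noteq> j \<longrightarrow> bil G (v i) (v j) = 0))"

lemma realizes_perm:
  assumes "realizes n G l" "mset l' = mset l" shows "realizes n G l'"
proof -
  obtain v where l: "length l = n" and v: "\<And>i. i < n \<Longrightarrow> v i \<in> Vec n \<and> l ! i \<noteq> 0 \<and> sqc (bil G (v i) (v i)) (l ! i)"
    "\<And>i j. i < n \<Longrightarrow> j < n \<Longrightarrow> i \<noteq> j \<Longrightarrow> bil G (v i) (v j) = 0"
    using assms(1) unfolding realizes_def by blast
  obtain p where p: "p permutes {..<length l}" "permute_list p l = l'"
    using mset_eq_permutation[OF assms(2)] by blast
  have pl: "p i < n" if "i < n" for i using permutes_in_image[OF p(1), of i] that l by simp
  have l': "length l' = n" "\<And>i. i < n \<Longrightarrow> l' ! i = l ! p i" using p l by (auto simp: permute_list_nth)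
  have pinj: "p i = p j \<longleftrightarrow> i = j" for i j using permutes_inj[OF p(1)] by (auto simp: inj_def)
  show ?thesis unfolding realizes_def
    using l' v pl pinj by (intro conjI exI[of _ "\<lambda>i. v (p i)"]) auto
qed

text \<open>
  A change of the orthogonal basis within the plane of the first two vectors.
\<close>

lemma realizes_binary:
  assumes G: "G \<in> Mat n n" "G\<^sup>T = G"
    and r: "realizes n G (a # b # l)" and nz: "a' \<noteq> 0" "b' \<noteq> 0"
    and orth: "x * z * a + y * u * b = 0"
    and sq: "sqc (x\<^sup>2 * a + y\<^sup>2 * b) a'" "sqc (z\<^sup>2 * a + u\<^sup>2 * b) b'"
  shows "realizes n G (a' # b' # l)"
proof -
  obtain v where len: "length (a # b # l) = n" and v0: "\<forall>i<n. v i \<in> Vec n \<and> (a # b # l) ! i \<noteq> 0 \<and> sqc (bil G (v i) (v i)) ((a # b # l) ! i)"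
    "\<forall>i<n. \<forall>j<n. i \<noteq> j \<longrightarrow> bil G (v i) (v j) = 0"
    using r unfolding realizes_def by blast
  have n: "0 < n" "1 < n" using len by auto
  have vc: "\<And>i. i < n \<Longrightarrow> v i \<in> Vec n" and vo: "\<And>i j. i < n \<Longrightarrow> j < n \<Longrightarrow> i \<noteq> j \<Longrightarrow> bil G (v i) (v j) = 0"
    and vs: "\<And>i. i < n \<Longrightarrow> (a # b # l) ! i \<noteq> 0 \<and> sqc (bil G (v i) (v i)) ((a # b # l) ! i)"
    using v0 by auto
  note c0 = vc[OF n(1)] and c1 = vc[OF n(2)]
  obtain j k where jk: "j \<noteq> 0" "k \<noteq> 0" "j\<^sup>2 * bil G (v 0) (v 0) = k\<^sup>2 * a"
    using vs[OF n(1)] by (auto simp: sqc_def)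
  obtain j' k' where jk': "j' \<noteq> 0" "k' \<noteq> 0" "j'\<^sup>2 * bil G (v 1) (v 1) = k'\<^sup>2 * b"
    using vs[OF n(2)] by (auto simp: sqc_def)
  define w where "w p q = (p * (k' * j)) \<cdot>v v 0 + (q * (k * j')) \<cdot>v v 1" for p q
  have wc: "w p q \<in> Vec n" for p q unfolding w_def using c0 c1 by simp
  have bl: "bil G (w p q) t = p * (k' * j) * bil G (v 0) t + q * (k * j') * bil G (v 1) t"
    if "t \<in> Vec n" for p q t
    unfolding w_def using that c0 c1
    by (simp add: bil_add_left[OF G(1)] bil_smult_left[OF G(1)])
  have br: "bil G t (w p q) = bil G (w p q) t" if "t \<in> Vec n" for p q t
    by (rule bil_sym[OF G that wc])
  have bw: "bil G (w p q) (w p' q') = (k * k')\<^sup>2 * (p * p' * a + q * q' * b)" for p q p' q'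
  proof -
    have "bil G (w p q) (w p' q') = p * (k' * j) * bil G (v 0) (w p' q') + q * (k * j') * bil G (v 1) (w p' q')"
      by (rule bl[OF wc])
    also have "bil G (v 0) (w p' q') = p' * (k' * j) * bil G (v 0) (v 0)"
      unfolding br[OF c0] bl[OF c0] using vo[OF n(2) n(1)] by simp
    also have "bil G (v 1) (w p' q') = q' * (k * j') * bil G (v 1) (v 1)"
      unfolding br[OF c1] bl[OF c1] using vo[OF n] by simp
    also have "p * (k' * j) * (p' * (k' * j) * bil G (v 0) (v 0)) = p * p' * k'\<^sup>2 * (j\<^sup>2 * bil G (v 0) (v 0))"
      by (simp add: power2_eq_square)
    also have "q * (k * j') * (q' * (k * j') * bil G (v 1) (v 1)) = q * q' * k\<^sup>2 * (j'\<^sup>2 * bil G (v 1) (v 1))"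
      by (simp add: power2_eq_square)
    finally show ?thesis unfolding jk(3) jk'(3) by (simp add: algebra_simps power_mult_distrib)
  qed
  define v' where "v' i = (if i = 0 then w x y else if i = 1 then w z u else v i)" for i
  have kk: "k * k' \<noteq> 0" using jk jk' by simp
  have s0: "sqc (bil G (w x y) (w x y)) a'" 
    unfolding bw using sqc_trans[OF sqc_mult_square(1)[OF kk] sq(1)] by (simp add: power2_eq_square mult_ac)
  have s1: "sqc (bil G (w z u) (w z u)) b'"
    unfolding bw using sqc_trans[OF sqc_mult_square(1)[OF kk] sq(2)] by (simp add: power2_eq_square mult_ac)
  have o01: "bil G (w x y) (w z u) = 0" unfolding bw orth by simp
  have ov: "bil G (w p q) (v i) = 0" if "i < n" "i \<noteq> 0" "i \<noteq> 1" for p q i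
    unfolding bl[OF vc[OF that(1)]] using vo[OF n(1) that(1)] vo[OF n(2) that(1)] that by simp
  have nth: "(a' # b' # l) ! i = (a # b # l) ! i" if "i \<noteq> 0" "i \<noteq> 1" for i
    using that by (cases i; cases "i - 1") auto
  show ?thesis unfolding realizes_def
  proof (intro conjI exI[of _ v'] allI impI)
    show "length (a' # b' # l) = n" using len by simp
    fix i assume i: "i < n"
    show "v' i \<in> Vec n" using wc vc[OF i] by (simp add: v'_def)
    show "(a' # b' # l) ! i \<noteq> 0" using nz vs[OF i] nth[of i] by (cases "i = 0"; cases "i = 1") auto
    show "sqc (bil G (v' i) (v' i)) ((a' # b' # l) ! i)"
      using s0 s1 vs[OF i] nth[of i] by (cases "i = 0"; cases "i = 1") (auto simp: v'_def)
    fix h assume h: "h < n" "i \<noteq> h"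
    show "bil G (v' i) (v' h) = 0"
      using o01 ov[OF i] ov[OF h(1)] vo[OF i h(1) h(2)] br[OF vc[OF i]] br[OF wc] h(2)
      unfolding v'_def by auto
  qed
qed

lemma realizes_unary:
  assumes "realizes n G (a # l)" "sqc a a'" "a' \<noteq> 0" shows "realizes n G (a' # l)"
proof -
  obtain v where v: "length (a # l) = n" "\<forall>i<n. v i \<in> Vec n \<and> (a # l) ! i \<noteq> 0 \<and> sqc (bil G (v i) (v i)) ((a # l) ! i)"
    "\<forall>i<n. \<forall>j<n. i \<noteq> j \<longrightarrow> bil G (v i) (v j) = 0"
    using assms(1) unfolding realizes_def by blast
  have "v i \<in> Vec n \<and> (a' # l) ! i \<noteq> 0 \<and> sqc (bil G (v i) (v i)) ((a' # l) ! i)" if "i < n" for i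
    using v(2) that assms(2,3) sqc_trans by (cases i) auto
  thus ?thesis unfolding realizes_def using v by (intro conjI exI[of _ v]) auto
qed

lemma realizes_append:
  assumes G: "G \<in> Mat n n" and r: "realizes n G l" and d: "d \<noteq> 0"
  shows "realizes (n + 1) (block_sum G (mat_diag 1 (\<lambda>_. d))) (l @ [d])"
proof -
  obtain v where len: "length l = n" and v: "\<forall>i<n. v i \<in> Vec n \<and> l ! i \<noteq> 0 \<and> sqc (bil G (v i) (v i)) (l ! i)"
    "\<forall>i<n. \<forall>j<n. i \<noteq> j \<longrightarrow> bil G (v i) (v j) = 0"
    using r unfolding realizes_def by blast
  let ?D = "mat_diag 1 (\<lambda>_. d) :: int mat" and ?e = "vec 1 (\<lambda>_. 1) :: int vec"
  define v' where "v' i = (if i < n then v i @v 0\<^sub>v 1 else 0\<^sub>v n @v ?e)" for i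
  have D: "?D \<in> Mat 1 1" by simp
  have z: "bil ?D (0\<^sub>v 1) y = 0" "bil ?D y (0\<^sub>v 1) = 0" if "y \<in> Vec 1" for y
    using that by (auto simp: bil_def scalar_prod_def mat_diag_def)
  have z': "bil G (0\<^sub>v n) x = 0" "bil G x (0\<^sub>v n) = 0" if "x \<in> Vec n" for x
    using that G by (auto simp: bil_def scalar_prod_def)
  have e: "bil ?D ?e ?e = d" by (simp add: bil_def scalar_prod_def mat_diag_def)
  have b: "bil (block_sum G ?D) (v' i) (v' j) = (if i < n \<and> j < n then bil G (v i) (v j) else if i < n \<or> j < n then 0 else d)" for i j
    using v(1) z[OF zero_carrier_vec] z[OF vec_carrier] z'[OF zero_carrier_vec] z'(1)[of "v j"] z'(2)[of "v i"] e
      bil_block_sum[OF G D] unfolding v'_def by auto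
  show ?thesis unfolding realizes_def b
  proof (intro conjI exI[of _ v'] allI impI)
    show "length (l @ [d]) = n + 1" using len by simp
    fix i assume i: "i < n + 1"
    show "v' i \<in> Vec (n + 1)" using v(1) append_carrier_vec[OF _ zero_carrier_vec[of 1], of "v i" n]
        append_carrier_vec[OF zero_carrier_vec[of n] vec_carrier[of 1 "\<lambda>_. 1 :: int"]] by (simp add: v'_def)
    show "(l @ [d]) ! i \<noteq> 0" using v(1) d i len by (cases "i < n") (auto simp: nth_append)
    show "sqc (bil (block_sum G ?D) (v' i) (v' i)) ((l @ [d]) ! i)"
      unfolding b using v(1) i len by (cases "i < n") (auto simp: nth_append)
    fix j assume "j < n + 1" "i \<noteq> j"
    thus "bil (block_sum G ?D) (v' i) (v' j) = 0"
      unfolding b using i v(2) by auto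
  qed
qed

text \<open>
  Suitable multiples of the vectors of square classes \<open>a\<close> and \<open>- a\<close> have opposite norms, so that their sum is
  isotropic. The sums span a rational Lagrangian.
\<close>

lemma lagrangian_from_realizes:
  assumes G: "G \<in> Mat n n" "G\<^sup>T = G" "\<bar>det G\<bar> = 1"
    and r: "realizes n G (l @ map uminus l)"
  shows "stably_diag G"
proof -
  define m where "m = length l"
  obtain v where n: "n = m + m" and v0: "\<forall>i<n. v i \<in> Vec n \<and> (l @ map uminus l) ! i \<noteq> 0 \<and>
      sqc (bil G (v i) (v i)) ((l @ map uminus l) ! i)" and vo: "\<forall>i<n. \<forall>j<n. i \<noteq> j \<longrightarrow> bil G (v i) (v j) = 0"
    using r unfolding realizes_def m_def by auto
  have vc: "v i \<in> Vec n" if "i < n" for i using v0 that by blast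
  have ln: "(l @ map uminus l) ! i = l ! i" "(l @ map uminus l) ! (m + i) = - (l ! i)" if "i < m" for i
    using that by (simp_all add: nth_append m_def)
  have lnz: "l ! i \<noteq> 0" if "i < m" for i
    using spec[OF v0, of i] that n ln(1)[OF that] by simp
  have ex: "\<exists>p q c. c \<noteq> 0 \<and> p\<^sup>2 * bil G (v i) (v i) = c \<and> q\<^sup>2 * bil G (v (m + i)) (v (m + i)) = - c" if i: "i < m" for i
  proof -
    have "sqc (bil G (v i) (v i)) (l ! i)" "sqc (bil G (v (m + i)) (v (m + i))) (- (l ! i))"
      using spec[OF v0, of i] spec[OF v0, of "m + i"] i n ln[OF i] by simp_all
    then obtain j k j' k' where jk: "j \<noteq> 0" "k \<noteq> 0" "j\<^sup>2 * bil G (v i) (v i) = k\<^sup>2 * l ! i" 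
      "j' \<noteq> 0" "k' \<noteq> 0" "j'\<^sup>2 * bil G (v (m + i)) (v (m + i)) = k'\<^sup>2 * - (l ! i)"
      unfolding sqc_def by (elim exE conjE) (rule that)
    have "(k' * j)\<^sup>2 * bil G (v i) (v i) = k'\<^sup>2 * (j\<^sup>2 * bil G (v i) (v i))" by (simp add: power_mult_distrib)
    moreover have "(k * j')\<^sup>2 * bil G (v (m + i)) (v (m + i)) = k\<^sup>2 * (j'\<^sup>2 * bil G (v (m + i)) (v (m + i)))"
      by (simp add: power_mult_distrib)
    ultimately show ?thesis unfolding jk(3) jk(6)
      using jk lnz[OF i] by (intro exI[of _ "k' * j"] exI[of _ "k * j'"] exI[of _ "k'\<^sup>2 * (k\<^sup>2 * l ! i)"]) simp
  qed
  have "\<forall>i. \<exists>t. i < m \<longrightarrow> snd (snd t) \<noteq> 0 \<and> (fst t)\<^sup>2 * bil G (v i) (v i) = snd (snd t) \<and>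
      (fst (snd t))\<^sup>2 * bil G (v (m + i)) (v (m + i)) = - snd (snd t)"
  proof
    fix i
    show "\<exists>t. i < m \<longrightarrow> snd (snd t) \<noteq> 0 \<and> (fst t)\<^sup>2 * bil G (v i) (v i) = snd (snd t) \<and>
      (fst (snd t))\<^sup>2 * bil G (v (m + i)) (v (m + i)) = - snd (snd t)"
    proof (cases "i < m")
      case True
      then obtain p q c where "c \<noteq> 0" "p\<^sup>2 * bil G (v i) (v i) = c" "q\<^sup>2 * bil G (v (m + i)) (v (m + i)) = - c"
        using ex by blast
      thus ?thesis by (intro exI[of _ "(p, q, c)"]) simp
    qed simp
  qed
  then obtain t where t: "\<forall>i. i < m \<longrightarrow> snd (snd (t i)) \<noteq> 0 \<and> (fst (t i))\<^sup>2 * bil G (v i) (v i) = snd (snd (t i)) \<and>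
      (fst (snd (t i)))\<^sup>2 * bil G (v (m + i)) (v (m + i)) = - snd (snd (t i))"
    by (rule choice[THEN exE])
  define p q c where "p i = fst (t i)" and "q i = fst (snd (t i))" and "c i = snd (snd (t i))" for i
  have pqc: "\<And>i. i < m \<Longrightarrow> c i \<noteq> 0" "\<And>i. i < m \<Longrightarrow> (p i)\<^sup>2 * bil G (v i) (v i) = c i"
    "\<And>i. i < m \<Longrightarrow> (q i)\<^sup>2 * bil G (v (m + i)) (v (m + i)) = - c i"
    using t unfolding p_def q_def c_def by blast+
  define x where "x i = p i \<cdot>v v i + q i \<cdot>v v (m + i)" for i
  define y where "y i = p i \<cdot>v v i + (- q i) \<cdot>v v (m + i)" for i
  have vcm: "v i \<in> Vec n" "v (m + i) \<in> Vec n" if "i < m" for i using vc that n by auto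
  have xc: "x i \<in> Vec n" "y i \<in> Vec n" if "i < m" for i
    unfolding x_def y_def using vcm[OF that] by auto
  have ort: "bil G (v i) (v (m + j)) = 0" "bil G (v (m + i)) (v j) = 0"
    "i \<noteq> j \<Longrightarrow> bil G (v i) (v j) = 0" "i \<noteq> j \<Longrightarrow> bil G (v (m + i)) (v (m + j)) = 0" if "i < m" "j < m" for i j
    using vo that n by auto
  have expand: "bil G (p i \<cdot>v v i + r i \<cdot>v v (m + i)) (p j \<cdot>v v j + s j \<cdot>v v (m + j)) =
      p i * p j * bil G (v i) (v j) + r i * s j * bil G (v (m + i)) (v (m + j))" if "i < m" "j < m" for i j r s
    using vcm[OF that(1)] vcm[OF that(2)] ort(1,2)[OF that]
    by (simp add: bil_add_left[OF G(1)] bil_smult_left[OF G(1)] bil_add_right[OF G(1)] bil_smult_right[OF G(1)])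
  have xx: "bil G (x i) (x j) = 0" if "i < m" "j < m" for i j
  proof (cases "i = j")
    case True
    thus ?thesis using pqc(2,3)[OF that(1)] unfolding x_def expand[OF that] by (simp add: power2_eq_square)
  next
    case False
    thus ?thesis using ort(3,4)[OF that] unfolding x_def expand[OF that] by simp
  qed
  have xy: "bil G (x i) (y j) = (if i = j then 2 * c i else 0)" if "i < m" "j < m" for i j
  proof (cases "i = j")
    case True
    have "bil G (x i) (y i) = p i * p i * bil G (v i) (v i) + q i * - q i * bil G (v (m + i)) (v (m + i))"
      unfolding x_def y_def by (rule expand[OF that(1,1), of q "\<lambda>j. - q j"])
    also have "\<dots> = 2 * c i" using pqc(2,3)[OF that(1)] by (simp add: power2_eq_square)
    finally show ?thesis using True by simp
  next
    case False
    have "bil G (x i) (y j) = p i * p j * bil G (v i) (v j) + q i * - q j * bil G (v (m + i)) (v (m + j))"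
      unfolding x_def y_def by (rule expand[OF that, of q "\<lambda>j. - q j"])
    thus ?thesis using ort(3,4)[OF that] False by simp
  qed
  define X where "X = mat m n (\<lambda>(i, j). x i $ j)"
  define Y where "Y = mat n m (\<lambda>(i, j). y j $ i)"
  have X: "X \<in> Mat m n" and Y: "Y \<in> Mat n m" by (auto simp: X_def Y_def)
  have rX: "row X i = x i" if "i < m" for i using that xc(1)[OF that] by (intro eq_vecI) (auto simp: X_def)
  have cY: "col Y i = y i" if "i < m" for i using that xc(2)[OF that] by (intro eq_vecI) (auto simp: Y_def)
  have entry: "(X * G * Z) $$ (i, j) = bil G (x i) (col Z j)" if "i < m" "j < m" "Z \<in> Mat n m" for i j Z
  proof -
    have "X * G * Z = X * (G * Z)" by (rule assoc_mult_mat[OF X G(1) that(3)])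
    moreover have "col (G * Z) j = G *v col Z j" using that G(1) by (intro col_mult2[of _ n n _ m]) auto
    ultimately show ?thesis using that X G(1) rX by (simp add: bil_def)
  qed
  have XGc: "X * G \<in> Mat m n" using X G(1) by (rule mult_carrier_mat)
  have "X * G * X\<^sup>T = 0\<^sub>m m m"
    using XGc X entry[of _ _ "X\<^sup>T"] xx rX by (intro eq_matI) auto
  moreover have "det (X * G * Y) \<noteq> 0"
  proof -
    have e: "X * G * Y = mat_diag m (\<lambda>i. 2 * c i)"
      using XGc Y entry[OF _ _ Y] xy cY by (intro eq_matI) (auto simp: mat_diag_def)
    show ?thesis unfolding e using pqc(1)
      by (subst upper_triangular_imp_det_eq_0_iff[OF mat_diag_dim]) (auto simp: mat_diag_def diag_mat_def)
  qed
  ultimately show ?thesis using lagrangian_stably_diag[of G m X Y] G X Y n by (simp add: mult_2)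
qed

section \<open>Unimodular forms are stably diagonal\<close>

text \<open>
  After adding signs the form \<open>U\<close> has a rational diagonalisation with entries \<open>L\<close> and some pairs \<open>\<langle>a\<rangle> \<oplus> \<langle>- a\<rangle>\<close>.
  Such pairs and signs can be cancelled in \<open>L\<close>, which makes this a condition on the Witt class of \<open>L\<close>.
\<close>

definition witt_real :: "nat \<Rightarrow> int mat \<Rightarrow> int multiset \<Rightarrow> bool"
  where "witt_real n U L \<longleftrightarrow> (\<exists>k \<epsilon> M l. signs k \<epsilon> \<and> (\<forall>a\<in>#M. a \<noteq> 0) \<and>
    mset l = L + M + image_mset uminus M \<and> realizes (n + k) (block_sum U (mat_diag k \<epsilon>)) l)"

lemma transpose_block_sum_diag:
  assumes "U \<in> Mat n n" "U\<^sup>T = U"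
  shows "transpose_mat (block_sum U (mat_diag k \<epsilon>)) = block_sum U (mat_diag k \<epsilon>)"
proof -
  have "(mat_diag k \<epsilon>)\<^sup>T = mat_diag k \<epsilon>" by (intro eq_matI) (auto simp: mat_diag_def)
  thus ?thesis using block_sum_transpose[OF assms(1) mat_diag_dim] assms(2) by simp
qed

lemma witt_real_binary:
  assumes U: "U \<in> Mat n n" "U\<^sup>T = U"
    and r: "witt_real n U (add_mset a (add_mset b L))" and nz: "a' \<noteq> 0" "b' \<noteq> 0"
    and orth: "x * z * a + y * u * b = 0"
    and sq: "sqc (x\<^sup>2 * a + y\<^sup>2 * b) a'" "sqc (z\<^sup>2 * a + u\<^sup>2 * b) b'"
  shows "witt_real n U (add_mset a' (add_mset b' L))"
proof -
  obtain k \<epsilon> M l where k: "signs k \<epsilon>" "\<forall>a\<in>#M. a \<noteq> 0" "mset l = add_mset a (add_mset b L) + M + image_mset uminus M"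
    "realizes (n + k) (block_sum U (mat_diag k \<epsilon>)) l" using r unfolding witt_real_def by blast
  obtain l' where l': "mset l' = L + M + image_mset uminus M" using ex_mset by blast
  have "realizes (n + k) (block_sum U (mat_diag k \<epsilon>)) (a # b # l')"
    by (rule realizes_perm[OF k(4)]) (simp add: k(3) l')
  from realizes_binary[OF block_sum_carrier[OF U(1) mat_diag_dim] transpose_block_sum_diag[OF U] this nz orth sq]
  have "realizes (n + k) (block_sum U (mat_diag k \<epsilon>)) (a' # b' # l')" .
  thus ?thesis unfolding witt_real_def using k(1,2) l'
    by (intro exI[of _ k] exI[of _ \<epsilon>] exI[of _ M] exI[of _ "a' # b' # l'"]) simp
qed

lemma witt_real_unary:
  assumes r: "witt_real n U (add_mset a L)" and sq: "sqc a a'" "a' \<noteq> 0"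
  shows "witt_real n U (add_mset a' L)"
proof -
  obtain k \<epsilon> M l where k: "signs k \<epsilon>" "\<forall>a\<in>#M. a \<noteq> 0" "mset l = add_mset a L + M + image_mset uminus M"
    "realizes (n + k) (block_sum U (mat_diag k \<epsilon>)) l" using r unfolding witt_real_def by blast
  obtain l' where l': "mset l' = L + M + image_mset uminus M" using ex_mset by blast
  have "realizes (n + k) (block_sum U (mat_diag k \<epsilon>)) (a # l')"
    by (rule realizes_perm[OF k(4)]) (simp add: k(3) l')
  from realizes_unary[OF this sq] have "realizes (n + k) (block_sum U (mat_diag k \<epsilon>)) (a' # l')" .
  thus ?thesis unfolding witt_real_def using k(1,2) l'
    by (intro exI[of _ k] exI[of _ \<epsilon>] exI[of _ M] exI[of _ "a' # l'"]) simp
qed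

lemma witt_real_absorb:
  assumes r: "witt_real n U (add_mset a (add_mset (- a) L))" and a: "a \<noteq> 0"
  shows "witt_real n U L"
proof -
  obtain k \<epsilon> M l where k: "signs k \<epsilon>" "\<forall>a\<in>#M. a \<noteq> 0" "mset l = add_mset a (add_mset (- a) L) + M + image_mset uminus M"
    "realizes (n + k) (block_sum U (mat_diag k \<epsilon>)) l" using r unfolding witt_real_def by blast
  have "mset l = L + add_mset a M + image_mset uminus (add_mset a M)" using k(3) by simp
  thus ?thesis unfolding witt_real_def using k(1,2,4) a
    by (intro exI[of _ k] exI[of _ \<epsilon>] exI[of _ "add_mset a M"] exI[of _ l]) simp
qed

lemma witt_real_append:
  assumes U: "U \<in> Mat n n" and r: "witt_real n U L" and d: "d = 1 \<or> d = -1"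
  shows "witt_real n U (add_mset d L)"
proof -
  obtain k \<epsilon> M l where k: "signs k \<epsilon>" "\<forall>a\<in>#M. a \<noteq> 0" "mset l = L + M + image_mset uminus M"
    "realizes (n + k) (block_sum U (mat_diag k \<epsilon>)) l" using r unfolding witt_real_def by blast
  have d0: "d \<noteq> 0" using d by auto
  define \<epsilon>' where "\<epsilon>' i = (if i < k then \<epsilon> i else (\<lambda>_. d) (i - k))" for i
  have s: "signs (k + 1) \<epsilon>'" unfolding \<epsilon>'_def using d by (intro signs_append k(1)) (auto simp: signs_def)
  have "realizes (n + k + 1) (block_sum (block_sum U (mat_diag k \<epsilon>)) (mat_diag 1 (\<lambda>_. d))) (l @ [d])"
    by (rule realizes_append[OF block_sum_carrier[OF U mat_diag_dim] k(4) d0])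
  hence "realizes (n + (k + 1)) (block_sum U (mat_diag (k + 1) \<epsilon>')) (l @ [d])"
    unfolding block_sum_assoc block_sum_mat_diag \<epsilon>'_def by (simp only: add.assoc)
  thus ?thesis unfolding witt_real_def using s k(2,3)
    by (intro exI[of _ "k + 1"] exI[of _ \<epsilon>'] exI[of _ M] exI[of _ "l @ [d]"]) simp
qed

text \<open>
  In one direction the pair \<open>\<langle>a\<rangle> \<oplus> \<langle>- a\<rangle>\<close> is absorbed into the hyperbolic part. Conversely the signs \<open>1\<close> and
  \<open>-1\<close> may be added, and \<open>\<langle>1\<rangle> \<oplus> \<langle>-1\<rangle>\<close> is isometric to \<open>\<langle>a\<rangle> \<oplus> \<langle>- a\<rangle>\<close> over \<open>\<rat>\<close>.
\<close>

lemma witt_real_hyp: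
  assumes U: "U \<in> Mat n n" "U\<^sup>T = U" and a: "a \<noteq> 0"
  shows "witt_real n U (add_mset a (add_mset (- a) L)) \<longleftrightarrow> witt_real n U L"
proof
  assume "witt_real n U L"
  hence 1: "witt_real n U (add_mset 1 (add_mset (-1) L))" by (intro witt_real_append[OF U(1)]) auto
  show "witt_real n U (add_mset a (add_mset (- a) L))"
  proof (rule witt_real_binary[OF U 1, of a "- a" "a + 1" "a - 1" "a - 1" "a + 1"])
    have e: "(a + 1)\<^sup>2 * 1 + (a - 1)\<^sup>2 * - 1 = a * 2\<^sup>2" "(a - 1)\<^sup>2 * 1 + (a + 1)\<^sup>2 * - 1 = (- a) * 2\<^sup>2"
      by (simp_all add: power2_eq_square algebra_simps)
    show "sqc ((a + 1)\<^sup>2 * 1 + (a - 1)\<^sup>2 * - 1) a" unfolding e by (rule sqc_mult_square(1)) simp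
    show "sqc ((a - 1)\<^sup>2 * 1 + (a + 1)\<^sup>2 * - 1) (- a)" unfolding e by (rule sqc_mult_square(1)) simp
  qed (use a in auto)
qed (rule witt_real_absorb[OF _ a])

lemma witt_real_hyps:
  assumes U: "U \<in> Mat n n" "U\<^sup>T = U"
  shows "(\<forall>a\<in>#B. a \<noteq> 0) \<Longrightarrow> witt_real n U (L + B + image_mset uminus B) \<longleftrightarrow> witt_real n U L"
proof (induction B arbitrary: L)
  case (add b B)
  have "L + add_mset b B + image_mset uminus (add_mset b B) = add_mset b (add_mset (- b) (L + B + image_mset uminus B))"
    by simp
  thus ?case using witt_real_hyp[OF U, of b "L + B + image_mset uminus B"] add by (simp add: add_mset_commute)
qed simp

definition fsum :: "int multiset \<Rightarrow> (int \<Rightarrow>\<^sub>0 int)"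
  where "fsum L = (\<Sum>a\<in>#L. frag_of a)"

lemma fsum_simps [simp]: "fsum {#} = 0" "fsum (add_mset a L) = frag_of a + fsum L" "fsum (K + L) = fsum K + fsum L"
  by (simp_all add: fsum_def)

lemma lookup_fsum: "Poly_Mapping.lookup (fsum L) a = int (count L a)"
  by (induction L) (auto simp: lookup_add lookup_frag_of)

lemma fsum_eq_iff: "fsum K = fsum L \<longleftrightarrow> K = L"
  by (metis lookup_fsum multiset_eqI of_nat_eq_iff)

text \<open>
  Each defining relation of the Witt group is an equality \<open>[A] = [B]\<close> in which \<open>A\<close> can be exchanged for \<open>B\<close> in an
  orthogonal basis. The formal differences are compared through multisets of entries.
\<close>

lemma witt_rel_real:
  assumes U: "U \<in> Mat n n" "U\<^sup>T = U" and x: "x \<in> witt_rel {1, -1}"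
  shows "\<exists>A B. (\<forall>a\<in>#B. a \<noteq> 0) \<and> (\<forall>a\<in>#A. a \<noteq> 0) \<and> x = fsum A - fsum B \<and>
    (\<forall>R. witt_real n U (A + R) \<longleftrightarrow> witt_real n U (B + R))"
  using x
proof induction
  case zero
  show ?case by (intro exI[of _ "{#}"]) simp
next
  case (add x y)
  then obtain A B C D where x: "\<forall>a\<in>#B. a \<noteq> 0" "\<forall>a\<in>#A. a \<noteq> 0" "x = fsum A - fsum B"
      "\<And>R. witt_real n U (A + R) \<longleftrightarrow> witt_real n U (B + R)"
    and y: "\<forall>a\<in>#D. a \<noteq> 0" "\<forall>a\<in>#C. a \<noteq> 0" "y = fsum C - fsum D"
      "\<And>R. witt_real n U (C + R) \<longleftrightarrow> witt_real n U (D + R)" by blast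
  have "witt_real n U (A + C + R) \<longleftrightarrow> witt_real n U (B + D + R)" for R
    using x(4)[of "C + R"] y(4)[of "B + R"] by (simp add: ac_simps)
  thus ?case using x y by (intro exI[of _ "A + C"] exI[of _ "B + D"]) auto
next
  case (minus x)
  then obtain A B where x: "\<forall>a\<in>#B. a \<noteq> 0" "\<forall>a\<in>#A. a \<noteq> 0" "x = fsum A - fsum B"
      "\<And>R. witt_real n U (A + R) \<longleftrightarrow> witt_real n U (B + R)" by blast
  thus ?case by (intro exI[of _ B] exI[of _ A]) auto
next
  case (square a b)
  have "witt_real n U ({#a * b\<^sup>2#} + R) \<longleftrightarrow> witt_real n U ({#a#} + R)" for R
    using witt_real_unary[of n U "a * b\<^sup>2" R a] witt_real_unary[of n U a R "a * b\<^sup>2"] square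
      sqc_mult_square[of b a] by auto
  thus ?case using square by (intro exI[of _ "{#a * b\<^sup>2#}"] exI[of _ "{#a#}"]) auto
next
  case (neg a)
  have "witt_real n U ({#a, - a#} + R) \<longleftrightarrow> witt_real n U ({#} + R)" for R
    using witt_real_hyp[OF U neg, of R] by simp
  thus ?case using neg by (intro exI[of _ "{#a, - a#}"] exI[of _ "{#}"]) auto
next
  case (sum a b)
  have "witt_real n U (add_mset a (add_mset b R)) \<longleftrightarrow> witt_real n U (add_mset (a + b) (add_mset (a * b * (a + b)) R))" for R
  proof
    assume w: "witt_real n U (add_mset a (add_mset b R))"
    show "witt_real n U (add_mset (a + b) (add_mset (a * b * (a + b)) R))"
    proof (rule witt_real_binary[OF U w, of _ _ 1 b 1 "- a"])
      have "b\<^sup>2 * a + (- a)\<^sup>2 * b = a * b * (a + b)" by (simp add: power2_eq_square algebra_simps)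
      thus "sqc (b\<^sup>2 * a + (- a)\<^sup>2 * b) (a * b * (a + b))" by simp
    qed (use sum in auto)
  next
    assume w: "witt_real n U (add_mset (a + b) (add_mset (a * b * (a + b)) R))"
    show "witt_real n U (add_mset a (add_mset b R))"
    proof (rule witt_real_binary[OF U w, of _ _ a b 1 "- 1"])
      have e: "a\<^sup>2 * (a + b) + 1\<^sup>2 * (a * b * (a + b)) = a * (a + b)\<^sup>2"
        "b\<^sup>2 * (a + b) + (- 1)\<^sup>2 * (a * b * (a + b)) = b * (a + b)\<^sup>2"
        by (simp_all add: power2_eq_square algebra_simps)
      show "sqc (a\<^sup>2 * (a + b) + 1\<^sup>2 * (a * b * (a + b))) a" "sqc (b\<^sup>2 * (a + b) + (- 1)\<^sup>2 * (a * b * (a + b))) b"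
        unfolding e using sqc_mult_square(1)[OF sum(3)] by simp_all
      show "a * b * (a + b) + 1 * - 1 * (a * b * (a + b)) = 0" by simp
    qed (use sum in auto)
  qed
  thus ?case using sum by (intro exI[of _ "{#a, b#}"] exI[of _ "{#a + b, a * b * (a + b)#}"]) auto
next
  case (unit s)
  have s: "s = 1 \<or> s = -1" "- s = 1 \<or> - s = -1" "s \<noteq> 0" using unit by auto
  have "witt_real n U ({#s#} + R) \<longleftrightarrow> witt_real n U ({#} + R)" for R
  proof
    assume "witt_real n U ({#s#} + R)"
    from witt_real_append[OF U(1) this s(2)] have "witt_real n U (add_mset s (add_mset (- s) R))"
      by (simp add: add_mset_commute)
    thus "witt_real n U ({#} + R)" using witt_real_absorb[OF _ s(3)] by simp
  next
    assume "witt_real n U ({#} + R)"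
    thus "witt_real n U ({#s#} + R)" using witt_real_append[OF U(1) _ s(1), of R] by simp
  qed
  thus ?case using s by (intro exI[of _ "{#s#}"] exI[of _ "{#}"]) auto
qed

lemma det_mat_diag: "det (mat_diag k f) = (\<Prod>i<k. f i :: int)"
proof -
  have "det (mat_diag k f) = prod_list (diag_mat (mat_diag k f))"
    by (rule det_upper_triangular[of _ k]) (auto simp: mat_diag_def)
  also have "diag_mat (mat_diag k f) = map f [0..<k]"
    unfolding diag_mat_def by (intro map_cong) (auto simp: mat_diag_def)
  also have "prod_list \<dots> = (\<Prod>i<k. f i)"
    by (induction k) (simp_all add: mult.commute)
  finally show ?thesis .
qed

lemma det_signs: "signs k \<epsilon> \<Longrightarrow> \<bar>det (mat_diag k \<epsilon>)\<bar> = 1"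
  unfolding det_mat_diag abs_prod by (rule prod.neutral) (auto simp: signs_def)

text \<open>
  By \<open>witt_rel_real\<close> the form, with signs added, is a sum of pairs \<open>\<langle>a\<rangle> \<oplus> \<langle>- a\<rangle>\<close> over \<open>\<rat>\<close>; these give a
  rational Lagrangian.
\<close>

lemma witt_trivial_stably_diag:
  assumes U: "U \<in> Mat n n" "U\<^sup>T = U" "\<bar>det U\<bar> = 1"
    and l: "realizes n U l" and x: "fsum (mset l) \<in> witt_rel {1, -1}"
  shows "stably_diag U"
proof -
  have "block_sum U (mat_diag 0 (\<lambda>_. 1)) = U" using U(1) by (intro eq_matI) (auto simp: block_sum_index mat_diag_def)
  hence L: "witt_real n U (mset l)" unfolding witt_real_def using l
    by (intro exI[of _ 0] exI[of _ "\<lambda>_. 1"] exI[of _ "{#}"] exI[of _ l]) (simp add: signs_def)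
  obtain A B where AB: "\<forall>a\<in>#B. a \<noteq> 0" "fsum (mset l) = fsum A - fsum B"
    "\<And>R. witt_real n U (A + R) \<longleftrightarrow> witt_real n U (B + R)"
    using witt_rel_real[OF U(1,2) x] by blast
  have "fsum (mset l + B) = fsum A" using AB(2) by simp
  hence A: "mset l + B = A" by (simp only: fsum_eq_iff)
  have "witt_real n U (mset l + B + image_mset uminus B)" using L witt_real_hyps[OF U(1,2) AB(1)] by blast
  hence "witt_real n U ({#} + B + image_mset uminus B)" using AB(3)[of "image_mset uminus B"] A by simp
  hence "witt_real n U {#}" using witt_real_hyps[OF U(1,2) AB(1)] by blast
  then obtain k \<epsilon> M l' where k: "signs k \<epsilon>" "mset l' = {#} + M + image_mset uminus M"
    "realizes (n + k) (block_sum U (mat_diag k \<epsilon>)) l'" unfolding witt_real_def by blast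
  obtain ms where "mset ms = M" using ex_mset by blast
  hence r: "realizes (n + k) (block_sum U (mat_diag k \<epsilon>)) (ms @ map uminus ms)"
    using k(2) by (intro realizes_perm[OF k(3)]) simp
  have "\<bar>det (mat_diag k \<epsilon>)\<bar> = 1" by (rule det_signs[OF k(1)])
  hence "\<bar>det (block_sum U (mat_diag k \<epsilon>))\<bar> = 1" using block_sum_det[OF U(1) mat_diag_dim] U(3) by (simp add: abs_mult)
  from lagrangian_from_realizes[OF block_sum_carrier[OF U(1) mat_diag_dim] transpose_block_sum_diag[OF U(1,2)] this r]
  show ?thesis by (rule stably_diagI_stab[OF k(1)])
qed

text \<open>
  The leading principal minors of a symmetric tridiagonal matrix with diagonal \<open>a\<close> and off-diagonal \<open>b\<close>.
\<close>

fun continuant :: "(nat \<Rightarrow> int) \<Rightarrow> (nat \<Rightarrow> int) \<Rightarrow> nat \<Rightarrow> int" where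
  "continuant a b 0 = 1"
| "continuant a b (Suc 0) = a 0"
| "continuant a b (Suc (Suc i)) = a (Suc i) * continuant a b (Suc i) - (b i)\<^sup>2 * continuant a b i"

text \<open>
  The vectors \<open>w\<^sub>i\<close> given by the minors of the first \<open>i\<close> basis vectors are orthogonal and have norm \<open>t\<^sub>i t\<^sub>i\<^sub>+\<^sub>1\<close>.
  The minors do not vanish because the form is anisotropic, consecutive ones are coprime because the
  determinant is \<open>\<plusminus>1\<close>, and the Witt class is trivial by \<open>witt_rel_continuant\<close>.
\<close>

lemma tridiagonal_stably_diag:
  assumes G: "G \<in> Mat n n" "G\<^sup>T = G" "\<bar>det G\<bar> = 1"
    and tri: "\<And>i j. i < n \<Longrightarrow> j < n \<Longrightarrow> Suc i < j \<Longrightarrow> G $$ (j, i) = 0"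
    and aniso: "\<And>v. v \<in> Vec n \<Longrightarrow> v \<noteq> 0\<^sub>v n \<Longrightarrow> bil G v v \<noteq> 0"
  shows "stably_diag G"
proof -
  define a where "a i = G $$ (i, i)" for i
  define b where "b i = G $$ (i, Suc i)" for i
  define t where "t = continuant a b"
  have t_simps: "t 0 = 1" "t (Suc 0) = a 0" "t (Suc (Suc i)) = a (Suc i) * t (Suc i) - (b i)\<^sup>2 * t i" for i
    by (simp_all add: t_def)
  have Gs: "G $$ (i, j) = G $$ (j, i)" if "i < n" "j < n" for i j
    using arg_cong[OF G(2), of "\<lambda>B. B $$ (j, i)"] G(1) that by simp
  define w where "w = rec_nat (unit_vec n 0) (\<lambda>i w. t (Suc i) \<cdot>v unit_vec n (Suc i) - b i \<cdot>v w)"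
  have w0: "w 0 = unit_vec n 0" and wS: "w (Suc i) = t (Suc i) \<cdot>v unit_vec n (Suc i) - b i \<cdot>v w i" for i
    by (simp_all add: w_def)
  have wc: "w i \<in> Vec n" for i by (induction i) (auto simp: w0 wS)
  have wd: "dim_vec (w i) = n" for i using wc[of i] by simp
  have wsupp: "w i $ j = (if j = i then t i else 0)" if "i \<le> j" "j < n" for i j
    using that by (induction i arbitrary: j) (auto simp: w0 wS t_simps wd)
  have Gw: "(G *v w i) $ j = (if j = i then t (Suc i) else if j = Suc i then b i * t i else 0)"
    if "i < n" "j < n" for i j
    using that
  proof (induction i arbitrary: j)
    case 0
    have "(G *v w 0) $ j = G $$ (j, 0)" unfolding w0 using 0 G(1) by (simp add: mult_unit_vec_col[OF G(1)])
    thus ?case using 0 tri[of 0 j] Gs[of j 0] by (auto simp: t_simps a_def b_def)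
  next
    case (Suc i)
    have "G *v w (Suc i) = t (Suc i) \<cdot>v col G (Suc i) - b i \<cdot>v (G *v w i)"
      unfolding wS using Suc.prems G(1) wc[of i]
      by (simp add: mult_minus_distrib_mat_vec[of _ n n] mult_mat_vec_smult[of _ n n] mult_unit_vec_col[OF G(1)])
    hence e: "(G *v w (Suc i)) $ j = t (Suc i) * G $$ (j, Suc i) - b i * (G *v w i) $ j"
      using Suc.prems G(1) wc[of i] by simp
    have IH: "(G *v w i) $ j = (if j = i then t (Suc i) else if j = Suc i then b i * t i else 0)"
      using Suc.IH[of j] Suc.prems by simp
    consider "j < i" | "j = i" | "j = Suc i" | "j = Suc (Suc i)" | "Suc (Suc i) < j" by linarith
    thus ?case
    proof cases
      case 1 thus ?thesis using e IH tri[of j "Suc i"] Gs[of j "Suc i"] Suc.prems by simp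
    next
      case 2 thus ?thesis using e IH by (simp add: b_def)
    next
      case 3 thus ?thesis using e IH by (simp add: a_def t_simps power2_eq_square)
    next
      case 4 thus ?thesis using e IH Gs[of j "Suc i"] Suc.prems by (simp add: b_def)
    next
      case 5 thus ?thesis using e IH tri[of "Suc i" j] Suc.prems by simp
    qed
  qed
  have Gwc: "G *v w i \<in> Vec n" for i using G(1) wc by simp
  have bsum: "bil G (w i) (w j) = (\<Sum>k<n. w i $ k * (G *v w j) $ k)" for i j
    using Gwc[of j] G(1) unfolding bil_def scalar_prod_def by (simp add: lessThan_atLeast0)
  have bw: "bil G (w i) (w j) = (if i = j then t i * t (Suc i) else 0)" if "i \<le> j" "j < n" for i j
  proof -
    have "bil G (w i) (w j) = (\<Sum>k<n. if k = i then if i = j then t i * t (Suc i) else 0 else 0)"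
      unfolding bsum
    proof (rule sum.cong)
      fix k assume k: "k \<in> {..<n}"
      show "w i $ k * (G *v w j) $ k = (if k = i then if i = j then t i * t (Suc i) else 0 else 0)"
        using wsupp[of i k] Gw[of j k] that k by (cases k i rule: linorder_cases) auto
    qed simp
    thus ?thesis using that by simp
  qed
  have bw': "bil G (w i) (w j) = 0" if "i < n" "j < n" "i \<noteq> j" for i j
    using bw[of i j] bw[of j i] bil_sym[OF G(1,2) wc wc, of i j] that by (cases "i < j") auto
  have tnz: "t i \<noteq> 0" if "i \<le> n" for i
    using that
  proof (induction i)
    case (Suc i)
    have "w i $ i \<noteq> 0" using Suc wsupp[of i i] by simp
    hence "w i \<noteq> 0\<^sub>v n" using Suc.prems by auto
    thus ?case using aniso[OF wc, of i] bw[of i i] Suc.prems by auto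
  qed (simp add: t_simps)
  obtain X where X: "unim n X" "G * X = 1\<^sub>m n" "X * G = 1\<^sub>m n"
    using unim_inverse[of n G] G unfolding unim_def by blast
  have Xc: "X \<in> Mat n n" by (rule unim_carrier[OF X(1)])
  have dvdG: "p dvd v $ k" if "\<And>j. j < n \<Longrightarrow> p dvd (G *v v) $ j" "v \<in> Vec n" "k < n" for p v k
  proof -
    have "v = X *v (G *v v)" using assoc_mult_mat_vec[OF Xc G(1) that(2)] X(3) that(2) by simp
    moreover have "(X *v (G *v v)) $ k = (\<Sum>j<n. X $$ (k, j) * (G *v v) $ j)"
      using Xc G(1) that(3) by (simp add: scalar_prod_def lessThan_atLeast0 del: index_mult_mat_vec)
        (simp add: scalar_prod_def lessThan_atLeast0)
    ultimately have "v $ k = (\<Sum>j<n. X $$ (k, j) * (G *v v) $ j)" by simp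
    moreover have "p dvd (\<Sum>j<n. X $$ (k, j) * (G *v v) $ j)"
      by (rule dvd_sum) (use that(1) in simp)
    ultimately show ?thesis by simp
  qed
  have prim: "\<exists>k<n. \<not> p dvd w i $ k" if p: "prime p" and "i < n" for p i
    using \<open>i < n\<close>
  proof (induction i)
    case 0
    thus ?case using p not_prime_unit[of p] by (intro exI[of _ 0]) (auto simp: w0)
  next
    case (Suc i)
    then obtain k where k: "k < n" "\<not> p dvd w i $ k" by auto
    show ?case
    proof (rule ccontr)
      assume "\<not> ?case"
      hence all: "\<And>j. j < n \<Longrightarrow> p dvd w (Suc i) $ j" by auto
      have pt: "p dvd t (Suc i)" using all[of "Suc i"] wsupp[of "Suc i" "Suc i"] Suc.prems by simp
      have "w (Suc i) $ k = t (Suc i) * unit_vec n (Suc i) $ k - b i * w i $ k" using k wd by (simp add: wS)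
      hence "b i * w i $ k = t (Suc i) * unit_vec n (Suc i) $ k - w (Suc i) $ k" by simp
      hence "p dvd b i * w i $ k" using all[OF k(1)] pt by (simp add: dvd_diff)
      hence pb: "p dvd b i" using p k(2) by (simp add: prime_dvd_mult_iff)
      have "p dvd (G *v w i) $ j" if "j < n" for j
        using Gw[of i j] Suc.prems that pt pb by simp
      from dvdG[OF this wc k(1)] k(2) show False by simp
    qed
  qed
  have cop: "coprime (t i) (t (Suc i))" if i: "i < n" for i
  proof (rule ccontr)
    assume nc: "\<not> coprime (t i) (t (Suc i))"
    hence "\<not> is_unit (gcd (t i) (t (Suc i)))" by (simp add: is_unit_gcd coprime_iff_gcd_eq_1)
    moreover have "gcd (t i) (t (Suc i)) \<noteq> 0" using tnz[of i] i by simp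
    ultimately obtain p where p: "prime p" "p dvd gcd (t i) (t (Suc i))"
      using prime_divisor_exists[of "gcd (t i) (t (Suc i))"] by blast
    hence "p dvd (G *v w i) $ j" if "j < n" for j using Gw[OF i that] by simp
    from dvdG[OF this wc] prim[OF p(1) i] show False by blast
  qed
  define M where "M = mat n n (\<lambda>(i, j). w i $ j)"
  have M: "M \<in> Mat n n" by (simp add: M_def)
  have rM: "row M i = w i" if "i < n" for i using that by (intro eq_vecI) (simp_all add: M_def wd)
  have MGM: "M * G * M\<^sup>T = mat_diag n (\<lambda>i. t i * t (Suc i))"
  proof (rule eq_matI)
    fix i j assume "i < dim_row (mat_diag n (\<lambda>i. t i * t (Suc i)))" "j < dim_col (mat_diag n (\<lambda>i. t i * t (Suc i)))"
    hence ij: "i < n" "j < n" by (simp_all add: mat_diag_def)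
    have "M * G * M\<^sup>T = M * (G * M\<^sup>T)" using M G(1) by (intro assoc_mult_mat[of _ n n _ n _ n]) auto
    moreover have "col (G * M\<^sup>T) j = G *v w j"
      using M G(1) ij rM[OF ij(2)] col_mult2[OF G(1), of "M\<^sup>T" n j] by simp
    ultimately have "(M * G * M\<^sup>T) $$ (i, j) = bil G (w i) (w j)"
      using M G(1) ij rM by (simp add: bil_def)
    thus "(M * G * M\<^sup>T) $$ (i, j) = mat_diag n (\<lambda>i. t i * t (Suc i)) $$ (i, j)"
      using bw[of i i] bw'[of i j] ij by (auto simp: mat_diag_def)
  qed (use M in \<open>auto simp: mat_diag_def\<close>)
  have detM: "det M = (\<Prod>i<n. t i)"
  proof -
    have "det M = prod_list (diag_mat M)"
      by (rule det_lower_triangular[OF _ M]) (auto simp: M_def wsupp)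
    also have "diag_mat M = map t [0..<n]"
      unfolding diag_mat_def using wsupp by (intro map_cong) (auto simp: M_def)
    also have "prod_list \<dots> = (\<Prod>i<n. t i)"
      by (induction n) (simp_all add: mult.commute)
    finally show ?thesis .
  qed
  have "det (mat_diag n (\<lambda>i. t i * t (Suc i))) = (\<Prod>i<n. t i) * (\<Prod>i<n. t (Suc i))"
    by (simp add: det_mat_diag prod.distrib)
  also have "(\<Prod>i<n. t (Suc i)) = t n * (\<Prod>i<n. t i)"
    by (induction n) (auto simp: t_simps)
  finally have "(\<Prod>i<n. t i) * det G * (\<Prod>i<n. t i) = (\<Prod>i<n. t i) * (t n * (\<Prod>i<n. t i))"
    using det_mult[OF mult_carrier_mat[OF M G(1)], of "M\<^sup>T"] det_mult[OF M G(1)] det_transpose[OF M] M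
    unfolding MGM detM by simp
  moreover have "(\<Prod>i<n. t i) \<noteq> 0" using tnz by simp
  ultimately have "det G = t n" by simp
  hence tn: "\<bar>t n\<bar> = 1" using G(3) by simp
  have rel: "(\<Sum>i<n. frag_of (t i * t (Suc i))) \<in> witt_rel {1, -1}"
  proof (rule witt_rel_continuant[where a = a and b = "\<lambda>i. b (i - 1)", OF t_simps(1) tn tnz])
    fix i assume "0 < i" "i < n"
    then obtain j where "i = Suc j" by (cases i) auto
    thus "t (Suc i) = a i * t i - (b (i - 1))\<^sup>2 * t (i - 1)" by (simp add: t_simps)
  qed (use cop in auto)
  define l where "l = map (\<lambda>i. t i * t (Suc i)) [0..<n]"
  have "fsum (mset l) = (\<Sum>i<n. frag_of (t i * t (Suc i)))"
    unfolding l_def by (induction n) (auto simp: add.commute)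
  moreover have "realizes n G l"
    unfolding realizes_def l_def using wc bw bw' tnz by (intro conjI exI[of _ w]) auto
  ultimately show ?thesis using witt_trivial_stably_diag[OF G] rel by simp
qed

text \<open>
  Induction on the rank: an isotropic vector splits off a plane, and an anisotropic form is brought to
  tridiagonal shape.
\<close>

theorem unimodular_stably_diag:
  assumes "U \<in> Mat n n" "U\<^sup>T = U" "\<bar>det U\<bar> = 1"
  shows "stably_diag U"
  using assms
proof (induction n arbitrary: U rule: less_induct)
  case (less n)
  note U = less.prems
  show ?case
  proof (cases "\<exists>v\<in>Vec n. v \<noteq> 0\<^sub>v n \<and> bil U v v = 0")
    case False
    obtain F where F: "unim n F" "\<And>i j. i < n \<Longrightarrow> j < n \<Longrightarrow> Suc i < j \<Longrightarrow> (F * U * F\<^sup>T) $$ (j, i) = 0"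
      using tridiagonal_form[OF U(1,2)] by blast
    define G where "G = F * U * F\<^sup>T"
    have Fc: "F \<in> Mat n n" by (rule unim_carrier[OF F(1)])
    have UG: "mcong U G" by (rule mcongI[OF U(1) F(1) G_def])
    have G: "G \<in> Mat n n" by (rule mcong_carrier[OF UG U(1)])
    have "bil G v v \<noteq> 0" if v: "v \<in> Vec n" "v \<noteq> 0\<^sub>v n" for v
    proof -
      have Ft: "F\<^sup>T \<in> Mat n n" using Fc by simp
      define x where "x = F\<^sup>T *v v"
      have x: "x \<in> Vec n" unfolding x_def using Ft v by simp
      have FU: "F * U \<in> Mat n n" using Fc U(1) by (rule mult_carrier_mat)
      have "G *v v = F *v (U *v x)"
        unfolding G_def x_def using assoc_mult_mat_vec[OF FU Ft v(1)] assoc_mult_mat_vec[OF Fc U(1) x[unfolded x_def]] by simp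
      hence "bil G v v = bil U x x"
        using transpose_vec_mult_scalar[OF Fc, of "U *v x" v] U(1) x v(1)
        by (simp add: bil_def x_def[symmetric])
      moreover have "x \<noteq> 0\<^sub>v n"
      proof
        assume "x = 0\<^sub>v n"
        obtain E where E: "unim n E" "F\<^sup>T * E = 1\<^sub>m n" "E * F\<^sup>T = 1\<^sub>m n"
          using unim_inverse[OF unim_transpose[OF F(1)]] .
        have "v = E *v x" unfolding x_def
          using assoc_mult_mat_vec[OF unim_carrier[OF E(1)] Ft v(1)] E(3) v(1) by simp
        also have "\<dots> = 0\<^sub>v n" unfolding \<open>x = 0\<^sub>v n\<close> using unim_carrier[OF E(1)] by (intro eq_vecI) auto
        finally show False using v(2) by simp
      qed
      ultimately show ?thesis using False x by metis
    qed
    note aniso = this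
    have detG: "\<bar>det G\<bar> = 1" using U(3) mcong_det[OF UG U(1)] by simp
    have "stably_diag G"
      by (rule tridiagonal_stably_diag[OF G mcong_symmetric[OF UG U(2)] detG F(2)[folded G_def] aniso])
    thus ?thesis by (rule stably_diag_mcong[OF UG])
  next
    case True
    then obtain v where v: "v \<in> Vec n" "v \<noteq> 0\<^sub>v n" "bil U v v = 0" by blast
    have n0: "0 < n" using v(1,2) by (cases n) auto
    obtain F where F: "unim n F" "\<And>i. i < n \<Longrightarrow> 0 < i \<Longrightarrow> (F *v v) $ i = 0"
      using reduce_vec[OF v(1) n0] by blast
    obtain E where E: "unim n E" "F * E = 1\<^sub>m n" "E * F = 1\<^sub>m n" using unim_inverse[OF F(1)] .
    have Fc: "F \<in> Mat n n" and Ec: "E \<in> Mat n n"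
      by (rule unim_carrier[OF F(1)], rule unim_carrier[OF E(1)])
    define g where "g = (F *v v) $ 0"
    define w where "w = col E 0"
    have w: "w \<in> Vec n" unfolding w_def using Ec n0 by auto
    have "F *v v = g \<cdot>v unit_vec n 0" using F(2) Fc by (intro eq_vecI) (auto simp: g_def)
    hence "E *v (F *v v) = g \<cdot>v w"
      unfolding w_def using Ec n0 by (simp add: mult_mat_vec_smult[OF Ec] mult_unit_vec_col[OF Ec])
    hence vw: "v = g \<cdot>v w" using assoc_mult_mat_vec[OF Ec Fc v(1)] E(3) v(1) by simp
    hence "g \<noteq> 0" using v(2) w by auto
    hence ww: "bil U w w = 0"
      using v(3) w unfolding vw by (simp add: bil_smult_left[OF U(1)] bil_smult_right[OF U(1)])
    define G where "G = E\<^sup>T * U * (E\<^sup>T)\<^sup>T"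
    have UG: "mcong U G" by (rule mcongI[OF U(1) unim_transpose[OF E(1)] G_def])
    have G: "G \<in> Mat n n" by (rule mcong_carrier[OF UG U(1)])
    have G00: "G $$ (0, 0) = 0"
    proof -
      have "G = E\<^sup>T * (U * E)"
        unfolding G_def using Ec U(1) by (simp add: assoc_mult_mat[of _ n n _ n _ n])
      moreover have "col (U * E) 0 = U *v w" unfolding w_def using col_mult2[OF U(1) Ec n0] .
      ultimately have "G $$ (0, 0) = w \<bullet> (U *v w)" using Ec U(1) n0 by (simp add: w_def)
      thus ?thesis using ww by (simp add: bil_def)
    qed
    have detG: "\<bar>det G\<bar> = 1" using U(3) mcong_det[OF UG U(1)] by simp
    have "n \<noteq> 1" using detG det_single[of G] G G00 by auto
    then obtain l where n: "n = l + 2" using n0 by (metis add_2_eq_Suc' less_imp_Suc_add One_nat_def not0_implies_Suc gr_implies_not0)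
    obtain P H where PH: "P \<in> Mat 2 2" "stably_diag P" "H \<in> Mat l l" "H\<^sup>T = H"
      "\<bar>det H\<bar> = 1" "mcong G (block_sum P H)"
      using isotropic_split[OF G[unfolded n] mcong_symmetric[OF UG U(2)] detG, of 1] G00 by auto
    have "stably_diag H" using n by (intro less.IH[OF _ PH(3,4,5)]) simp
    from stably_diag_block_sum[OF PH(6,1,2,3) this] have "stably_diag G" .
    thus ?thesis by (rule stably_diag_mcong[OF UG])
  qed
qed

section \<open>Isomorphisms of triples and coordinates\<close>

text \<open>
  The part of the lattice axioms that the calculus of \<open>\<simeq>\<^sub>L\<close> requires. Sums with \<open>unit_sum\<close> satisfy it without
  any choice of a basis.
\<close>

fun bilinear :: "'a lattice_triple \<Rightarrow> bool" where
  "bilinear (M, f, c) \<longleftrightarrow> comm_group M \<and> (\<forall>x\<in>carrier M. f x \<in> hom M integer_group) \<and>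
    (\<forall>x\<in>carrier M. \<forall>y\<in>carrier M. f x y = f y x)"

lemma hom_integer_inv:
  assumes "group M" "h \<in> hom M integer_group" "x \<in> carrier M"
  shows "h (inv\<^bsub>M\<^esub> x) = - h x"
proof -
  interpret group_hom M integer_group h
    by (rule group_hom.intro) (use assms in \<open>auto simp: group_hom_axioms_def\<close>)
  show ?thesis using hom_inv[OF assms(3)] by simp
qed

lemma triple_iso_refl:
  assumes "bilinear T" shows "T \<simeq>\<^sub>L T"
proof -
  obtain M f c where T: "T = (M, f, c)" by (cases T)
  interpret M: comm_group M using assms by (simp add: T)
  let ?one = "\<one>\<^bsub>M\<^esub>"
  have "f ?one x = 0" if "x \<in> carrier M" for x
  proof -
    have "f x \<in> hom M integer_group" using assms that by (simp add: T)
    from hom_mult[OF this M.one_closed M.one_closed] have "f x ?one = f x ?one + f x ?one" by simp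
    moreover have "f ?one x = f x ?one" using assms that by (simp add: T)
    ultimately show ?thesis by simp
  qed
  thus ?thesis unfolding T triple_iso.simps
    by (intro bexI[of _ id] conjI bexI[of _ ?one]) (auto simp: iso_def hom_def bij_betw_def)
qed

text \<open>
  The correction \<open>z\<close> of the characteristic form is replaced by the image of its inverse.
\<close>

lemma triple_iso_sym:
  assumes "bilinear T" "bilinear T'" "T \<simeq>\<^sub>L T'" shows "T' \<simeq>\<^sub>L T"
proof -
  obtain M f c where T: "T = (M, f, c)" by (cases T)
  obtain M' f' c' where T': "T' = (M', f', c')" by (cases T')
  interpret M: comm_group M using assms(1) by (simp add: T)
  interpret M': comm_group M' using assms(2) by (simp add: T')
  obtain \<theta> z where th: "\<theta> \<in> iso M M'" and ff: "\<And>x y. x \<in> carrier M \<Longrightarrow> y \<in> carrier M \<Longrightarrow> f' (\<theta> x) (\<theta> y) = f x y"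
    and z: "z \<in> carrier M" "\<And>x. x \<in> carrier M \<Longrightarrow> c' (\<theta> x) - c x = 2 * f z x"
    using assms(3) unfolding T T' triple_iso.simps by blast
  define \<eta> where "\<eta> = inv_into (carrier M) \<theta>"
  have \<eta>: "\<eta> \<in> iso M' M" unfolding \<eta>_def by (rule M.iso_set_sym[OF th])
  have b: "bij_betw \<theta> (carrier M) (carrier M')" using th by (simp add: iso_def)
  have \<eta>c: "\<eta> y \<in> carrier M" "\<theta> (\<eta> y) = y" if "y \<in> carrier M'" for y
    unfolding \<eta>_def using b that by (auto simp: bij_betw_def inv_into_into f_inv_into_f)
  have \<theta>c: "\<theta> x \<in> carrier M'" if "x \<in> carrier M" for x using b that by (rule bij_betwE[THEN bspec])
  show ?thesis unfolding T T' triple_iso.simps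
  proof (intro bexI[of _ \<eta>] conjI ballI bexI[of _ "\<theta> (inv\<^bsub>M\<^esub> z)"])
    show "\<eta> \<in> iso M' M" by (rule \<eta>)
    show "\<theta> (inv\<^bsub>M\<^esub> z) \<in> carrier M'" using \<theta>c z by simp
  next
    fix x y assume xy: "x \<in> carrier M'" "y \<in> carrier M'"
    show "f (\<eta> x) (\<eta> y) = f' x y" using ff[OF \<eta>c(1)[OF xy(1)] \<eta>c(1)[OF xy(2)]] \<eta>c(2) xy by simp
  next
    fix x assume x: "x \<in> carrier M'"
    have "f' (\<theta> (inv\<^bsub>M\<^esub> z)) x = f (inv\<^bsub>M\<^esub> z) (\<eta> x)" using ff[of "inv\<^bsub>M\<^esub> z" "\<eta> x"] \<eta>c[OF x] z by simp
    also have "\<dots> = f (\<eta> x) (inv\<^bsub>M\<^esub> z)" using assms(1) \<eta>c[OF x] z by (simp add: T)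
    also have "\<dots> = - f (\<eta> x) z" using assms(1) \<eta>c[OF x] z M.is_group by (intro hom_integer_inv) (auto simp: T)
    also have "f (\<eta> x) z = f z (\<eta> x)" using assms(1) \<eta>c[OF x] z by (simp add: T)
    finally show "c (\<eta> x) - c' x = 2 * f' (\<theta> (inv\<^bsub>M\<^esub> z)) x"
      using z(2)[OF \<eta>c(1)[OF x]] \<eta>c(2)[OF x] by simp
  qed
qed

lemma triple_iso_trans:
  assumes "bilinear T" "bilinear T'" "T \<simeq>\<^sub>L T'" "T' \<simeq>\<^sub>L T''" shows "T \<simeq>\<^sub>L T''"
proof -
  obtain M f c where T: "T = (M, f, c)" by (cases T)
  obtain M' f' c' where T': "T' = (M', f', c')" by (cases T')
  obtain M'' f'' c'' where T'': "T'' = (M'', f'', c'')" by (cases T'')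
  interpret M: comm_group M using assms(1) by (simp add: T)
  obtain \<theta> z where th: "\<theta> \<in> iso M M'" and ff: "\<And>x y. x \<in> carrier M \<Longrightarrow> y \<in> carrier M \<Longrightarrow> f' (\<theta> x) (\<theta> y) = f x y"
    and z: "z \<in> carrier M" "\<And>x. x \<in> carrier M \<Longrightarrow> c' (\<theta> x) - c x = 2 * f z x"
    using assms(3) unfolding T T' triple_iso.simps by blast
  obtain \<eta> z' where et: "\<eta> \<in> iso M' M''" and ff': "\<And>x y. x \<in> carrier M' \<Longrightarrow> y \<in> carrier M' \<Longrightarrow> f'' (\<eta> x) (\<eta> y) = f' x y"
    and z': "z' \<in> carrier M'" "\<And>x. x \<in> carrier M' \<Longrightarrow> c'' (\<eta> x) - c' x = 2 * f' z' x"
    using assms(4)[unfolded T'' T' triple_iso.simps] by (elim bexE conjE) (rule that, auto)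
  have b: "bij_betw \<theta> (carrier M) (carrier M')" using th by (simp add: iso_def)
  have "z' \<in> \<theta> ` carrier M" unfolding bij_betw_imp_surj_on[OF b] by (rule z'(1))
  then obtain u where u0: "z' = \<theta> u" and u1: "u \<in> carrier M" by (rule imageE)
  note u = u1 u0[symmetric]
  have \<theta>c: "\<theta> x \<in> carrier M'" if "x \<in> carrier M" for x using b that by (rule bij_betwE[THEN bspec])
  show ?thesis unfolding T T'' triple_iso.simps
  proof (intro bexI[of _ "\<eta> \<circ> \<theta>"] conjI ballI bexI[of _ "z \<otimes>\<^bsub>M\<^esub> u"])
    show "\<eta> \<circ> \<theta> \<in> iso M M''" by (rule iso_set_trans[OF th et])
    show "z \<otimes>\<^bsub>M\<^esub> u \<in> carrier M" using z(1) u(1) by simp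
  next
    fix x y assume "x \<in> carrier M" "y \<in> carrier M"
    thus "f'' ((\<eta> \<circ> \<theta>) x) ((\<eta> \<circ> \<theta>) y) = f x y" unfolding o_def by (simp only: ff ff' \<theta>c)
  next
    fix x assume x: "x \<in> carrier M"
    have fx: "f x \<in> hom M integer_group" using assms(1) x by (simp add: T)
    have fs: "f v x = f x v" if "v \<in> carrier M" for v using assms(1) x that by (simp add: T)
    have "f (z \<otimes>\<^bsub>M\<^esub> u) x = f x (z \<otimes>\<^bsub>M\<^esub> u)" by (rule fs) (simp add: z(1) u(1))
    also have "\<dots> = f x z + f x u" using hom_mult[OF fx z(1) u(1)] by simp
    also have "\<dots> = f z x + f u x" unfolding fs[OF z(1)] fs[OF u(1)] ..
    also have "f u x = f' z' (\<theta> x)" using ff[OF u(1) x] u(2) by simp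
    finally have "f (z \<otimes>\<^bsub>M\<^esub> u) x = f z x + f' z' (\<theta> x)" .
    moreover have "c' (\<theta> x) - c x = 2 * f z x" by (rule z(2)[OF x])
    moreover have "c'' (\<eta> (\<theta> x)) - c' (\<theta> x) = 2 * f' z' (\<theta> x)" by (rule z'(2)[OF \<theta>c[OF x]])
    ultimately show "c'' ((\<eta> \<circ> \<theta>) x) - c x = 2 * f (z \<otimes>\<^bsub>M\<^esub> u) x" unfolding o_def by linarith
  qed
qed

lemma triple_iso_orth_sum:
  assumes "T1 \<simeq>\<^sub>L T1'" "T2 \<simeq>\<^sub>L T2'" shows "T1 \<oplus>\<^sub>L T2 \<simeq>\<^sub>L T1' \<oplus>\<^sub>L T2'"
proof -
  obtain M f c where T: "T1 = (M, f, c)" by (cases T1)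
  obtain M' f' c' where T': "T1' = (M', f', c')" by (cases T1')
  obtain N g d where S: "T2 = (N, g, d)" by (cases T2)
  obtain N' g' d' where S': "T2' = (N', g', d')" by (cases T2')
  obtain \<theta> z where th: "\<theta> \<in> iso M M'" and ff: "\<And>x y. x \<in> carrier M \<Longrightarrow> y \<in> carrier M \<Longrightarrow> f' (\<theta> x) (\<theta> y) = f x y"
    and z: "z \<in> carrier M" "\<And>x. x \<in> carrier M \<Longrightarrow> c' (\<theta> x) - c x = 2 * f z x"
    using assms(1) unfolding T T' triple_iso.simps by blast
  obtain \<eta> z' where et: "\<eta> \<in> iso N N'" and gg: "\<And>x y. x \<in> carrier N \<Longrightarrow> y \<in> carrier N \<Longrightarrow> g' (\<eta> x) (\<eta> y) = g x y"
    and z': "z' \<in> carrier N" "\<And>x. x \<in> carrier N \<Longrightarrow> d' (\<eta> x) - d x = 2 * g z' x"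
    using assms(2) unfolding S S' triple_iso.simps by blast
  have "bij_betw (\<lambda>(x, y). (\<theta> x, \<eta> y)) (carrier M \<times> carrier N) (carrier M' \<times> carrier N')"
  proof -
    have b: "inj_on \<theta> (carrier M)" "\<theta> ` carrier M = carrier M'" "inj_on \<eta> (carrier N)" "\<eta> ` carrier N = carrier N'"
      using th et by (simp_all add: iso_def bij_betw_def)
    have "inj_on (\<lambda>(x, y). (\<theta> x, \<eta> y)) (carrier M \<times> carrier N)"
      by (rule inj_onI) (auto dest: inj_onD[OF b(1)] inj_onD[OF b(3)])
    thus ?thesis unfolding bij_betw_def image_paired_Times b(2,4) by simp
  qed
  moreover have "(\<lambda>(x, y). (\<theta> x, \<eta> y)) \<in> hom (M \<times>\<times> N) (M' \<times>\<times> N')"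
  proof (rule homI)
    fix p q assume "p \<in> carrier (M \<times>\<times> N)" "q \<in> carrier (M \<times>\<times> N)"
    then obtain x y x' y' where p: "p = (x, y)" "x \<in> carrier M" "y \<in> carrier N"
      and q: "q = (x', y')" "x' \<in> carrier M" "y' \<in> carrier N" by (auto simp: DirProd_def)
    have h: "\<theta> \<in> hom M M'" "\<eta> \<in> hom N N'" using th et by (simp_all add: iso_def)
    show "(case p of (x, y) \<Rightarrow> (\<theta> x, \<eta> y)) \<in> carrier (M' \<times>\<times> N')"
      using hom_in_carrier[OF h(1) p(2)] hom_in_carrier[OF h(2) p(3)] by (simp add: p DirProd_def)
    show "(case p \<otimes>\<^bsub>M \<times>\<times> N\<^esub> q of (x, y) \<Rightarrow> (\<theta> x, \<eta> y)) =
        (case p of (x, y) \<Rightarrow> (\<theta> x, \<eta> y)) \<otimes>\<^bsub>M' \<times>\<times> N'\<^esub> (case q of (x, y) \<Rightarrow> (\<theta> x, \<eta> y))"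
      using hom_mult[OF h(1) p(2) q(2)] hom_mult[OF h(2) p(3) q(3)] by (simp add: p q DirProd_def)
  qed
  ultimately have "(\<lambda>(x, y). (\<theta> x, \<eta> y)) \<in> iso (M \<times>\<times> N) (M' \<times>\<times> N')"
    by (simp add: iso_def DirProd_def)
  thus ?thesis unfolding T T' S S' orth_sum.simps triple_iso.simps
  proof (intro bexI[of _ "\<lambda>(x, y). (\<theta> x, \<eta> y)"] conjI bexI[of _ "(z, z')"] ballI)
    fix p assume "p \<in> carrier (M \<times>\<times> N)"
    then obtain x y where p: "p = (x, y)" "x \<in> carrier M" "y \<in> carrier N" by (auto simp: DirProd_def)
    show "(case case p of (x, y) \<Rightarrow> (\<theta> x, \<eta> y) of (x, x') \<Rightarrow> c' x + d' x') - (case p of (x, x') \<Rightarrow> c x + d x') =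
        2 * (case (z, z') of (x, x') \<Rightarrow> \<lambda>(y, y'). f x y + g x' y') p"
      using z(2)[OF p(2)] z'(2)[OF p(3)] by (simp add: p)
  next
    fix p q assume "p \<in> carrier (M \<times>\<times> N)" "q \<in> carrier (M \<times>\<times> N)"
    then obtain x y x' y' where p: "p = (x, y)" "x \<in> carrier M" "y \<in> carrier N"
      and q: "q = (x', y')" "x' \<in> carrier M" "y' \<in> carrier N" by (auto simp: DirProd_def)
    show "(case case p of (x, y) \<Rightarrow> (\<theta> x, \<eta> y) of (x, x') \<Rightarrow> \<lambda>(y, y'). f' x y + g' x' y')
        (case q of (x, y) \<Rightarrow> (\<theta> x, \<eta> y)) = (case p of (x, x') \<Rightarrow> \<lambda>(y, y'). f x y + g x' y') q"
      using ff[OF p(2) q(2)] gg[OF p(3) q(3)] by (simp add: p q)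
  qed (use z z' in \<open>simp_all add: DirProd_def\<close>)
qed

definition coord_triple :: "int mat \<Rightarrow> int vec \<Rightarrow> int vec lattice_triple"
  where "coord_triple A c = (Zvec (dim_row A), bil A, \<lambda>x. c \<bullet> x)"

lemma monoid_vec_group: "comm_group (monoid_vec TYPE('a :: ab_group_add) n)"
proof (rule comm_groupI)
  fix x :: "'a vec" assume "x \<in> carrier (monoid_vec TYPE('a) n)"
  thus "\<exists>y\<in>carrier (monoid_vec TYPE('a) n). y \<otimes>\<^bsub>monoid_vec TYPE('a) n\<^esub> x = \<one>\<^bsub>monoid_vec TYPE('a) n\<^esub>"
    by (intro bexI[of _ "- x"]) (auto simp: monoid_vec_def)
qed (auto simp: monoid_vec_def intro: assoc_add_vec comm_add_vec)

lemma monoid_vec_simps: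
  "carrier (monoid_vec TYPE('a :: monoid_add) n) = carrier_vec n"
  "x \<otimes>\<^bsub>monoid_vec TYPE('a) n\<^esub> y = x + y" "\<one>\<^bsub>monoid_vec TYPE('a) n\<^esub> = 0\<^sub>v n"
  by (simp_all add: monoid_vec_def)

lemma bilinear_coord_triple:
  assumes "A \<in> Mat n n" "A\<^sup>T = A" shows "bilinear (coord_triple A c)"
  unfolding coord_triple_def bilinear.simps
  using assms monoid_vec_group[where 'a = int]
  by (auto simp: monoid_vec_simps hom_def bil_add_right intro: bil_sym)

text \<open>
  A change of basis by \<open>E\<close> multiplies Gram matrices by \<open>E\<close> and its transpose and characteristic vectors by \<open>E\<close>;
  adding \<open>2 B z\<close> to the characteristic vector is invisible to \<open>\<simeq>\<^sub>L\<close>.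
\<close>

lemma coord_triple_congruence:
  assumes A: "A \<in> Mat n n" "A\<^sup>T = A" and E: "unim n E" and B: "B = E * A * E\<^sup>T"
    and c: "c \<in> Vec n" and z: "z \<in> Vec n" and d: "d = E *v c + 2 \<cdot>v (B *v z)"
  shows "coord_triple B d \<simeq>\<^sub>L coord_triple A c"
proof -
  have Ec: "E \<in> Mat n n" by (rule unim_carrier[OF E])
  have Bc: "B \<in> Mat n n" unfolding B by (rule congruence_carrier[OF A(1) Ec])
  have Bs: "B\<^sup>T = B" by (rule mcong_symmetric[OF mcongI[OF A(1) E B] A(2)])
  let ?t = "\<lambda>x. E\<^sup>T *v x"
  have Et: "E\<^sup>T \<in> Mat n n" using Ec by simp
  have tc: "?t x \<in> Vec n" if "x \<in> Vec n" for x using Et that by simp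
  obtain F where F: "unim n F" "E\<^sup>T * F = 1\<^sub>m n" "F * E\<^sup>T = 1\<^sub>m n"
    using unim_inverse[OF unim_transpose[OF E]] .
  have Fc: "F \<in> Mat n n" by (rule unim_carrier[OF F(1)])
  have EA: "E * A \<in> Mat n n" using Ec A(1) by (rule mult_carrier_mat)
  have bB: "bil B x y = bil A (?t x) (?t y)" if "x \<in> Vec n" "y \<in> Vec n" for x y
  proof -
    have "B *v y = E *v (A *v ?t y)"
      unfolding B using assoc_mult_mat_vec[OF EA Et that(2)] assoc_mult_mat_vec[OF Ec A(1) tc[OF that(2)]] by simp
    thus ?thesis unfolding bil_def using transpose_vec_mult_scalar[OF Ec, of "A *v ?t y" x] A(1) tc[OF that(2)] that(1) by simp
  qed
  have "?t \<in> iso (Zvec n) (Zvec n)"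
    unfolding iso_def hom_def
  proof (intro CollectI conjI, goal_cases)
    case 1 show ?case using tc by (auto simp: monoid_vec_simps)
    case 2 show ?case using Et by (auto simp: monoid_vec_simps intro: mult_add_distrib_mat_vec)
    case 3 show ?case unfolding monoid_vec_simps
    proof (rule bij_betw_byWitness[where f' = "\<lambda>x. F *v x"])
      show "\<forall>a\<in>Vec n. F *v (E\<^sup>T *v a) = a"
        using assoc_mult_mat_vec[OF Fc Et] F(3) by simp
      show "\<forall>a\<in>Vec n. E\<^sup>T *v (F *v a) = a"
        using assoc_mult_mat_vec[OF Et Fc] F(2) by simp
    qed (use tc Fc in auto)
  qed
  moreover have "c \<bullet> ?t x - d \<bullet> x = 2 * bil B (- z) x" if x: "x \<in> Vec n" for x
  proof -
    have Bz: "B *v z \<in> Vec n" "E *v c \<in> Vec n" using Bc z Ec c by auto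
    have "d \<bullet> x = (E *v c) \<bullet> x + 2 * ((B *v z) \<bullet> x)"
      unfolding d using Bz x by (simp add: add_scalar_prod_distrib[of _ n])
    also have "(E *v c) \<bullet> x = c \<bullet> ?t x"
      using transpose_vec_mult_scalar[OF Ec c x] comm_scalar_prod[OF Bz(2) x] comm_scalar_prod[OF tc[OF x] c] by simp
    also have "(B *v z) \<bullet> x = bil B z x"
      using bil_sym[OF Bc Bs z x] comm_scalar_prod[OF Bz(1) x] by (simp add: bil_def)
    finally have "c \<bullet> ?t x - d \<bullet> x = - (2 * bil B z x)" by simp
    moreover have "bil B (- z) x = - bil B z x" using z x Bc by (simp add: bil_def)
    ultimately show ?thesis by simp
  qed
  ultimately show ?thesis
    unfolding coord_triple_def triple_iso.simps using A(1) Bc bB z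
    by (intro bexI[of _ ?t] conjI bexI[of _ "- z"]) (auto simp: monoid_vec_simps)
qed

lemma coord_triple_block_sum:
  assumes A: "A \<in> Mat n n" and B: "B \<in> Mat m m" and c: "c \<in> Vec n" and d: "d \<in> Vec m"
  shows "coord_triple A c \<oplus>\<^sub>L coord_triple B d \<simeq>\<^sub>L coord_triple (block_sum A B) (c @v d)"
proof -
  let ?t = "\<lambda>(x, y). x @v y"
  have "?t \<in> iso (Zvec n \<times>\<times> Zvec m) (Zvec (n + m))"
    unfolding iso_def hom_def
  proof (intro CollectI conjI, goal_cases)
    case 1 show ?case by (auto simp: monoid_vec_simps)
    case 2 show ?case by (auto simp: monoid_vec_simps DirProd_def append_vec_add)
    case 3 show ?case unfolding bij_betw_def
    proof
      show "inj_on ?t (carrier (Zvec n \<times>\<times> Zvec m))"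
        by (auto simp: inj_on_def monoid_vec_simps append_vec_eq)
      show "?t ` carrier (Zvec n \<times>\<times> Zvec m) = carrier (Zvec (n + m))"
      proof (intro equalityI subsetI)
        fix v assume v: "v \<in> carrier (Zvec (n + m))"
        hence "v = ?t (vec_first v n, vec_last v m)" by (simp add: monoid_vec_simps)
        thus "v \<in> ?t ` carrier (Zvec n \<times>\<times> Zvec m)"
          by (rule image_eqI) (simp add: monoid_vec_simps)
      qed (auto simp: monoid_vec_simps)
    qed
  qed
  moreover have "bil (block_sum A B) (x @v y) (x' @v y') = bil A x x' + bil B y y'"
    if "x \<in> Vec n" "x' \<in> Vec n" "y \<in> Vec m" "y' \<in> Vec m" for x x' y y'
    by (rule bil_block_sum[OF A B that])
  moreover have "(c @v d) \<bullet> (x @v y) = c \<bullet> x + d \<bullet> y" if "x \<in> Vec n" "y \<in> Vec m" for x y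
    by (rule scalar_prod_append[OF c d that])
  moreover have "bil A (0\<^sub>v n) x + bil B (0\<^sub>v m) y = 0" if "x \<in> Vec n" "y \<in> Vec m" for x y
    using A B that by (simp add: bil_def)
  ultimately show ?thesis
    unfolding coord_triple_def orth_sum.simps triple_iso.simps using A B
    by (intro bexI[of _ ?t] conjI bexI[of _ "(0\<^sub>v n, 0\<^sub>v m)"]) (auto simp: monoid_vec_simps)
qed

lemma unit_sum_coord: "unit_sum n \<epsilon> \<simeq>\<^sub>L coord_triple (mat_diag n \<epsilon>) (vec n \<epsilon>)"
proof -
  let ?M = "product_group {..<n} (\<lambda>i. integer_group)"
  have us: "unit_sum n \<epsilon> = (?M, \<lambda>x y. \<Sum>i<n. \<epsilon> i * x i * y i, \<lambda>x. \<Sum>i<n. \<epsilon> i * x i)"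
    by (simp add: unit_sum_def orth_sum_family_def unit_triple_def)
  have carr: "carrier ?M = (\<Pi>\<^sub>E i\<in>{..<n}. UNIV)" by simp
  have "vec n \<in> iso ?M (Zvec n)"
    unfolding iso_def hom_def
  proof (intro CollectI conjI, goal_cases)
    case 1 show ?case by (auto simp: monoid_vec_simps)
    case 2 show ?case by (intro ballI eq_vecI) (simp_all add: monoid_vec_simps)
    case 3 show ?case unfolding monoid_vec_simps carr
    proof (rule bij_betw_byWitness[where f' = "\<lambda>v. \<lambda>i\<in>{..<n}. v $ i"])
      show "\<forall>a\<in>{..<n} \<rightarrow>\<^sub>E (UNIV :: int set). (\<lambda>i\<in>{..<n}. vec n a $ i) = a"
      proof (intro ballI ext)
        fix a :: "nat \<Rightarrow> int" and i assume a: "a \<in> {..<n} \<rightarrow>\<^sub>E UNIV"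
        show "(\<lambda>i\<in>{..<n}. vec n a $ i) i = a i" using PiE_arb[OF a, of i] by (cases "i < n") simp_all
      qed
      show "\<forall>a\<in>Vec n. vec n (\<lambda>i\<in>{..<n}. a $ i) = (a :: int vec)"
        by (intro ballI eq_vecI) simp_all
    qed (rule image_subsetI, simp)+
  qed
  moreover have "bil (mat_diag n \<epsilon>) (vec n x) (vec n y) = (\<Sum>i<n. \<epsilon> i * x i * y i)" for x y
  proof -
    have "(mat_diag n \<epsilon> *v vec n y) $ i = \<epsilon> i * y i" if "i < n" for i
    proof -
      have "(mat_diag n \<epsilon> *v vec n y) $ i = (\<Sum>j<n. (if i = j then \<epsilon> j else 0) * y j)"
        using that by (simp add: mat_diag_def scalar_prod_def lessThan_atLeast0)
      also have "\<dots> = (\<Sum>j<n. if i = j then \<epsilon> i * y i else 0)" by (intro sum.cong) auto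
      finally show ?thesis using that by simp
    qed
    thus ?thesis unfolding bil_def scalar_prod_def by (simp add: mat_diag_def lessThan_atLeast0 mult_ac)
  qed
  moreover have "vec n \<epsilon> \<bullet> vec n x = (\<Sum>i<n. \<epsilon> i * x i)" for x
    by (simp add: scalar_prod_def lessThan_atLeast0)
  moreover have "dim_row (mat_diag n \<epsilon>) = n" by (simp add: mat_diag_def)
  ultimately show ?thesis
    unfolding us coord_triple_def triple_iso.simps
    by (intro bexI[of _ "vec n"] conjI bexI[of _ "\<lambda>i\<in>{..<n}. 0"]) (auto simp: monoid_vec_simps)
qed

lemma transpose_mat_diag: "(mat_diag k \<epsilon>)\<^sup>T = mat_diag k \<epsilon>"
  by (intro eq_matI) (auto simp: mat_diag_def)

lemma bilinear_orth_sum: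
  assumes "bilinear T" "bilinear S" shows "bilinear (T \<oplus>\<^sub>L S)"
proof -
  obtain M f c where T: "T = (M, f, c)" by (cases T)
  obtain N g d where S: "S = (N, g, d)" by (cases S)
  have M: "comm_group M" and N: "comm_group N" using assms by (simp_all add: T S)
  have "group (M \<times>\<times> N)" by (rule DirProd_group[OF comm_group.axioms(2)[OF M] comm_group.axioms(2)[OF N]])
  moreover have "x \<otimes>\<^bsub>M \<times>\<times> N\<^esub> y = y \<otimes>\<^bsub>M \<times>\<times> N\<^esub> x" if "x \<in> carrier (M \<times>\<times> N)" "y \<in> carrier (M \<times>\<times> N)" for x y
    using that comm_groupE(4)[OF M] comm_groupE(4)[OF N] by (cases x; cases y) (simp add: DirProd_def)
  ultimately have "comm_group (M \<times>\<times> N)" by (intro group.group_comm_groupI) auto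
  moreover have "(case p of (x, x') \<Rightarrow> \<lambda>(y, y'). f x y + g x' y') \<in> hom (M \<times>\<times> N) integer_group"
    if p: "p \<in> carrier (M \<times>\<times> N)" for p
  proof (rule homI)
    fix a b assume a: "a \<in> carrier (M \<times>\<times> N)" and b: "b \<in> carrier (M \<times>\<times> N)"
    obtain x y where xy: "p = (x, y)" "x \<in> carrier M" "y \<in> carrier N" using p by (auto simp: DirProd_def)
    obtain a1 a2 where a': "a = (a1, a2)" "a1 \<in> carrier M" "a2 \<in> carrier N" using a by (auto simp: DirProd_def)
    obtain b1 b2 where b': "b = (b1, b2)" "b1 \<in> carrier M" "b2 \<in> carrier N" using b by (auto simp: DirProd_def)
    have h: "f x \<in> hom M integer_group" "g y \<in> hom N integer_group" using assms xy by (simp_all add: T S)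
    show "(case p of (x, x') \<Rightarrow> \<lambda>(y, y'). f x y + g x' y') (a \<otimes>\<^bsub>M \<times>\<times> N\<^esub> b) =
        (case p of (x, x') \<Rightarrow> \<lambda>(y, y'). f x y + g x' y') a \<otimes>\<^bsub>integer_group\<^esub> (case p of (x, x') \<Rightarrow> \<lambda>(y, y'). f x y + g x' y') b"
      using hom_mult[OF h(1) a'(2) b'(2)] hom_mult[OF h(2) a'(3) b'(3)] by (simp add: xy a' b' DirProd_def)
  qed simp
  moreover have "(case p of (x, x') \<Rightarrow> \<lambda>(y, y'). f x y + g x' y') q = (case q of (x, x') \<Rightarrow> \<lambda>(y, y'). f x y + g x' y') p"
    if "p \<in> carrier (M \<times>\<times> N)" "q \<in> carrier (M \<times>\<times> N)" for p q
    using that assms by (cases p; cases q) (simp add: T S DirProd_def)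
  ultimately show ?thesis unfolding T S orth_sum.simps bilinear.simps by blast
qed

lemma bilinear_unit_sum: "bilinear (unit_sum n \<epsilon>)"
proof -
  let ?M = "product_group {..<n} (\<lambda>i. integer_group)"
  have us: "unit_sum n \<epsilon> = (?M, \<lambda>x y. \<Sum>i<n. \<epsilon> i * x i * y i, \<lambda>x. \<Sum>i<n. \<epsilon> i * x i)"
    by (simp add: unit_sum_def orth_sum_family_def unit_triple_def)
  have "comm_group ?M"
  proof (rule group.group_comm_groupI)
    show "group ?M" by simp
  qed (simp add: add.commute cong: restrict_cong)
  moreover have "(\<lambda>y. \<Sum>i<n. \<epsilon> i * x i * y i) \<in> hom ?M integer_group" for x
    by (rule homI) (simp_all add: distrib_left sum.distrib)
  moreover have "(\<Sum>i<n. \<epsilon> i * x i * y i) = (\<Sum>i<n. \<epsilon> i * y i * x i)" for x y by (simp add: mult_ac)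
  ultimately show ?thesis unfolding us bilinear.simps by blast
qed

lemma triple_iso_assoc:
  assumes "bilinear T" "bilinear S" "bilinear R"
  shows "(T \<oplus>\<^sub>L S) \<oplus>\<^sub>L R \<simeq>\<^sub>L T \<oplus>\<^sub>L (S \<oplus>\<^sub>L R)"
proof -
  obtain M f c where T: "T = (M, f, c)" by (cases T)
  obtain N g d where S: "S = (N, g, d)" by (cases S)
  obtain L h e where R: "R = (L, h, e)" by (cases R)
  let ?t = "\<lambda>p. (fst (fst p), (snd (fst p), snd p))"
  have bij: "bij_betw ?t ((carrier M \<times> carrier N) \<times> carrier L) (carrier M \<times> (carrier N \<times> carrier L))"
    by (rule bij_betw_byWitness[where f' = "\<lambda>p. ((fst p, fst (snd p)), snd (snd p))"]) auto
  have iso: "?t \<in> iso ((M \<times>\<times> N) \<times>\<times> L) (M \<times>\<times> (N \<times>\<times> L))"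
    using bij by (auto simp: iso_def hom_def DirProd_def)
  have z: "f \<one>\<^bsub>M\<^esub> x = 0" if bl: "bilinear (M, f, c)" and x: "x \<in> carrier M" for M :: "'x monoid" and f c x
  proof -
    interpret M: comm_group M using bl by simp
    have "f x \<in> hom M integer_group" using bl x by simp
    from hom_mult[OF this M.one_closed M.one_closed] have "f x \<one>\<^bsub>M\<^esub> = 0" by simp
    moreover have "f \<one>\<^bsub>M\<^esub> x = f x \<one>\<^bsub>M\<^esub>" using bl x by simp
    ultimately show ?thesis by simp
  qed
  have z': "g \<one>\<^bsub>N\<^esub> x = 0" if "x \<in> carrier N" for x
  proof -
    interpret N: comm_group N using assms(2) by (simp add: S)
    have "g x \<in> hom N integer_group" using assms(2) that by (simp add: S)
    from hom_mult[OF this N.one_closed N.one_closed] have "g x \<one>\<^bsub>N\<^esub> = 0" by simp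
    moreover have "g \<one>\<^bsub>N\<^esub> x = g x \<one>\<^bsub>N\<^esub>" using assms(2) that by (simp add: S)
    ultimately show ?thesis by simp
  qed
  have z'': "h \<one>\<^bsub>L\<^esub> x = 0" if "x \<in> carrier L" for x
  proof -
    interpret L: comm_group L using assms(3) by (simp add: R)
    have "h x \<in> hom L integer_group" using assms(3) that by (simp add: R)
    from hom_mult[OF this L.one_closed L.one_closed] have "h x \<one>\<^bsub>L\<^esub> = 0" by simp
    moreover have "h \<one>\<^bsub>L\<^esub> x = h x \<one>\<^bsub>L\<^esub>" using assms(3) that by (simp add: R)
    ultimately show ?thesis by simp
  qed
  have one: "\<one>\<^bsub>M\<^esub> \<in> carrier M" "\<one>\<^bsub>N\<^esub> \<in> carrier N" "\<one>\<^bsub>L\<^esub> \<in> carrier L"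
    using assms by (simp_all add: T S R comm_group_def comm_monoid.axioms(1) monoid.one_closed)
  show ?thesis unfolding T S R orth_sum.simps triple_iso.simps
    using iso z[OF assms(1)[unfolded T]] z' z'' one
    by (intro bexI[of _ ?t] conjI bexI[of _ "((\<one>\<^bsub>M\<^esub>, \<one>\<^bsub>N\<^esub>), \<one>\<^bsub>L\<^esub>)"]) (auto simp: DirProd_def)
qed

section \<open>Integral orthogonal splittings and characteristic vectors\<close>

text \<open>
  The rows of \<open>V\<close> span a sublattice with Gram matrix \<open>V G V\<^sup>T = A Y V\<^sup>T = A\<close>. The matrix \<open>Y\<close> is the integral
  orthogonal projection to it, hence the sublattice is an orthogonal summand.
\<close>

lemma split_off_sublattice:
  assumes G: "G \<in> Mat (n + k) (n + k)" "G\<^sup>T = G" and A: "A \<in> Mat n n"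
    and V: "V \<in> Mat n (n + k)" and Y: "Y \<in> Mat n (n + k)"
    and VG: "V * G = A * Y" and YV: "Y * V\<^sup>T = 1\<^sub>m n"
  obtains E W where "unim (n + k) E" "\<And>i. i < n \<Longrightarrow> row E i = row V i" "W \<in> Mat k k"
    "E * G * E\<^sup>T = block_sum A W"
proof -
  let ?N = "n + k"
  obtain E0 where E0: "unim ?N E0" "\<And>i j. i < n \<Longrightarrow> j < ?N \<Longrightarrow> i < j \<Longrightarrow> (Y * E0) $$ (i, j) = 0"
    using lower_triangular_form[OF Y] by auto
  obtain F where F: "unim ?N F" "E0 * F = 1\<^sub>m ?N" "F * E0 = 1\<^sub>m ?N" using unim_inverse[OF E0(1)] .
  have E0c: "E0 \<in> Mat ?N ?N" and Fc: "F \<in> Mat ?N ?N"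
    by (rule unim_carrier[OF E0(1)], rule unim_carrier[OF F(1)])
  define E where "E = mat ?N ?N (\<lambda>(i, j). if i < n then V $$ (i, j) else E0 $$ (j, i))"
  have Ec: "E \<in> Mat ?N ?N" by (simp add: E_def)
  have rV: "row E i = row V i" if "i < n" for i
    using that V by (intro eq_vecI) (auto simp: E_def)
  have rE: "row E i = col E0 i" if "n \<le> i" "i < ?N" for i
    using that E0c by (intro eq_vecI) (auto simp: E_def)
  have rEc: "row E i \<in> Vec ?N" if "i < ?N" for i using Ec that by simp
  have YE0: "Y * E0 \<in> Mat n ?N" using Y E0c by (rule mult_carrier_mat)
  have FV: "F * V\<^sup>T \<in> Mat ?N n" using Fc V by (intro mult_carrier_mat[of _ _ ?N]) auto
  have "Y * E0 * (F * V\<^sup>T) = Y * (E0 * (F * V\<^sup>T))" by (rule assoc_mult_mat[OF Y E0c FV])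
  also have "E0 * (F * V\<^sup>T) = E0 * F * V\<^sup>T"
    by (rule assoc_mult_mat[OF E0c Fc, symmetric, of _ n]) (use V in simp)
  also have "\<dots> = V\<^sup>T" unfolding F(2) using V by (intro left_mult_one_mat) auto
  finally have "Y * E0 * (F * V\<^sup>T) = 1\<^sub>m n" unfolding YV .
  moreover have "Y * E0 * (F * V\<^sup>T) = mat n n (\<lambda>(i, j). (Y * E0) $$ (i, j)) * mat n n (\<lambda>(i, j). (F * V\<^sup>T) $$ (i, j))"
    by (rule mult_truncate[OF YE0 _ FV]) (use E0(2) in auto)
  ultimately have T: "mat n n (\<lambda>(i, j). (Y * E0) $$ (i, j)) * mat n n (\<lambda>(i, j). (F * V\<^sup>T) $$ (i, j)) = 1\<^sub>m n" (is "?T * ?V1 = _")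
    by simp
  have "det ?T * det ?V1 = 1" using det_mult[of ?T n ?V1] T by simp
  hence dV1: "\<bar>det ?V1\<bar> = 1" using zmult_eq_1_iff[of "det ?T" "det ?V1"] by auto
  have Ft: "F\<^sup>T \<in> Mat ?N ?N" using Fc by simp
  define X where "X = E * F\<^sup>T"
  have X: "X \<in> Mat (n + k) (n + k)" unfolding X_def using Ec Ft by (rule mult_carrier_mat)
  have Xe: "X $$ (i, j) = row F j \<bullet> row E i" if "i < ?N" "j < ?N" for i j
    using mult_transpose_entry[OF Ec Fc that] Fc that by (simp add: X_def)
  have X1: "X $$ (i, j) = (F * V\<^sup>T) $$ (j, i)" if "i < n" "j < ?N" for i j
    using Xe[of i j] rV[OF that(1)] that Fc V by simp
  have X2: "X $$ (i, j) = (if i = j then 1 else 0)" if "n \<le> i" "i < ?N" "j < ?N" for i j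
  proof -
    have "X $$ (i, j) = (F * E0) $$ (j, i)" using Xe[of i j] rE[OF that(1,2)] that Fc E0c by simp
    thus ?thesis unfolding F(3) using that by auto
  qed
  have "X = four_block_mat (?V1\<^sup>T) (mat n k (\<lambda>(i, j). X $$ (i, j + n))) (0\<^sub>m k n) (1\<^sub>m k)"
  proof -
    have "mat n n (\<lambda>(i, j). X $$ (i, j)) = ?V1\<^sup>T" using X1 by (intro eq_matI) auto
    moreover have "mat k n (\<lambda>(i, j). X $$ (i + n, j)) = 0\<^sub>m k n" using X2 by (intro eq_matI) auto
    moreover have "mat k k (\<lambda>(i, j). X $$ (i + n, j + n)) = 1\<^sub>m k" using X2 by (intro eq_matI) auto
    ultimately show ?thesis using block_decomp[OF X] by simp
  qed
  hence "det X = det (four_block_mat (?V1\<^sup>T) (mat n k (\<lambda>(i, j). X $$ (i, j + n))) (0\<^sub>m k n) (1\<^sub>m k))"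
    by (rule arg_cong)
  also have "\<dots> = det (?V1\<^sup>T) * det (1\<^sub>m k)"
    by (rule det_four_block_mat_lower_left_zero[OF _ mat_carrier refl one_carrier_mat]) simp
  also have "\<dots> = det ?V1" using det_transpose[OF mat_carrier] by simp
  finally have "\<bar>det X\<bar> = 1" using dV1 by simp
  moreover have "det X = det E * det F" unfolding X_def using det_mult[OF Ec Ft] det_transpose[OF Fc] by simp
  ultimately have "\<bar>det E\<bar> = 1" using F(1) unfolding unim_def by (simp add: abs_mult)
  hence E: "unim ?N E" using Ec unfolding unim_def by blast
  define H where "H = E * G * E\<^sup>T"
  have H: "H \<in> Mat (n + k) (n + k)" unfolding H_def by (rule congruence_carrier[OF G(1) Ec])
  have Hs: "H\<^sup>T = H" by (rule mcong_symmetric[OF mcongI[OF G(1) E H_def] G(2)])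
  have Hsij: "H $$ (i, j) = H $$ (j, i)" if "i < ?N" "j < ?N" for i j
    using arg_cong[OF Hs, of "\<lambda>B. B $$ (j, i)"] H that by simp
  have EG: "E * G \<in> Mat ?N ?N" using Ec G(1) by (rule mult_carrier_mat)
  have VGc: "V * G \<in> Mat n ?N" using V G(1) by (rule mult_carrier_mat)
  have He: "H $$ (i, j) = row A i \<bullet> (Y *v row E j)" if "i < n" "j < ?N" for i j
  proof -
    have "H $$ (i, j) = row E j \<bullet> row (E * G) i"
      unfolding H_def using mult_transpose_entry[OF EG Ec, of i j] Ec that by simp
    also have "row (E * G) i = row (V * G) i"
      using rV[OF that(1)] that(1) Ec V G(1) by (intro eq_vecI) auto
    also have "row E j \<bullet> row (V * G) i = row (V * G) i \<bullet> row E j"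
      by (rule comm_scalar_prod[OF rEc[OF that(2)] row_carrier_vec[OF that(1) VGc]])
    also have "\<dots> = ((V * G) *v row E j) $ i"
      using VGc that(1) by (intro index_mult_mat_vec[symmetric]) auto
    also have "(V * G) *v row E j = A *v (Y *v row E j)"
      unfolding VG by (rule assoc_mult_mat_vec[OF A Y rEc[OF that(2)]])
    finally show ?thesis using A that(1) by simp
  qed
  have H1: "H $$ (i, j) = A $$ (i, j)" if "i < n" "j < n" for i j
  proof -
    have "Y *v row E j = col (Y * V\<^sup>T) j"
      using rV[OF that(2)] that(2) Y V by (subst col_mult2[OF Y, of _ n]) auto
    also have "\<dots> = unit_vec n j" unfolding YV using that by simp
    finally have "Y *v row E j = unit_vec n j" .
    thus ?thesis using He[of i j] that A scalar_prod_right_unit[of j n "row A i"] by simp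
  qed
  have H2: "H $$ (i, j) = 0" if "i < n" "n \<le> j" "j < ?N" for i j
  proof -
    have "Y *v row E j = col (Y * E0) j" using rE[OF that(2,3)] col_mult2[OF Y E0c that(3)] by simp
    also have "\<dots> = 0\<^sub>v n"
    proof (rule eq_vecI)
      fix i assume "i < dim_vec (0\<^sub>v n :: int vec)"
      hence i: "i < n" by simp
      have "col (Y * E0) j $ i = (Y * E0) $$ (i, j)" using YE0 i that by (intro index_col) auto
      thus "col (Y * E0) j $ i = 0\<^sub>v n $ i" using E0(2)[of i j] i that by simp
    qed (use YE0 Y in auto)
    finally have "Y *v row E j = 0\<^sub>v n" .
    thus ?thesis using He[of i j] that A by (simp add: scalar_prod_right_zero[of "row A i" n])
  qed
  define W where "W = mat k k (\<lambda>(i, j). H $$ (i + n, j + n))"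
  have "H = block_sum A W"
  proof -
    have "mat n n (\<lambda>(i, j). H $$ (i, j)) = A" using H1 A by (intro eq_matI) auto
    moreover have "mat n k (\<lambda>(i, j). H $$ (i, j + n)) = 0\<^sub>m n k" using H2 by (intro eq_matI) auto
    moreover have "mat k n (\<lambda>(i, j). H $$ (i + n, j)) = 0\<^sub>m k n" using H2 Hsij by (intro eq_matI) auto
    ultimately have "H = four_block_mat A (0\<^sub>m n k) (0\<^sub>m k n) W" using block_decomp[OF H] by (simp add: W_def)
    thus ?thesis using A by (simp add: block_sum_def W_def)
  qed
  thus ?thesis using that[OF E rV, of W] unfolding H_def by (simp add: W_def)
qed

definition char_vec :: "nat \<Rightarrow> int mat \<Rightarrow> int vec \<Rightarrow> bool"
  where "char_vec n A c \<longleftrightarrow> c \<in> Vec n \<and> (\<forall>x\<in>Vec n. even (bil A x x - c \<bullet> x))"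

lemma char_vec_congruence:
  assumes A: "A \<in> Mat n n" and E: "E \<in> Mat n n" and c: "char_vec n A c"
  shows "char_vec n (E * A * E\<^sup>T) (E *v c)"
  unfolding char_vec_def
proof (intro conjI ballI)
  have cc: "c \<in> Vec n" using c by (simp add: char_vec_def)
  show Ecc: "E *v c \<in> Vec n" using E cc by simp
  fix x :: "int vec" assume x: "x \<in> Vec n"
  have Et: "E\<^sup>T \<in> Mat n n" using E by simp
  let ?y = "E\<^sup>T *v x"
  have y: "?y \<in> Vec n" using Et x by simp
  have "(E * A * E\<^sup>T) *v x = E *v (A *v ?y)"
    using assoc_mult_mat_vec[OF mult_carrier_mat[OF E A] Et x] assoc_mult_mat_vec[OF E A y] by simp
  hence "bil (E * A * E\<^sup>T) x x = bil A ?y ?y"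
    using transpose_vec_mult_scalar[OF E, of "A *v ?y" x] A y x by (simp add: bil_def)
  moreover have "(E *v c) \<bullet> x = c \<bullet> ?y"
    using transpose_vec_mult_scalar[OF E cc x] comm_scalar_prod[OF Ecc x] comm_scalar_prod[OF y cc] by simp
  ultimately show "even (bil (E * A * E\<^sup>T) x x - (E *v c) \<bullet> x)"
    using c y by (simp add: char_vec_def)
qed

lemma char_vec_block_sum:
  assumes A: "A \<in> Mat n n" and B: "B \<in> Mat m m" and c: "c \<in> Vec n" and d: "d \<in> Vec m"
  shows "char_vec (n + m) (block_sum A B) (c @v d) \<longleftrightarrow> char_vec n A c \<and> char_vec m B d"
proof -
  have e: "bil (block_sum A B) (x @v y) (x @v y) - (c @v d) \<bullet> (x @v y) = (bil A x x - c \<bullet> x) + (bil B y y - d \<bullet> y)"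
    if "x \<in> Vec n" "y \<in> Vec m" for x y
    using bil_block_sum[OF A B that(1,1) that(2,2)] scalar_prod_append[OF c d that] by simp
  have z: "bil A (0\<^sub>v n) (0\<^sub>v n) - c \<bullet> 0\<^sub>v n = 0" "bil B (0\<^sub>v m) (0\<^sub>v m) - d \<bullet> 0\<^sub>v m = 0"
    using A B c d by (simp_all add: bil_def)
  show ?thesis
  proof
    assume L: "char_vec (n + m) (block_sum A B) (c @v d)"
    have ev: "even ((bil A x x - c \<bullet> x) + (bil B y y - d \<bullet> y))" if "x \<in> Vec n" "y \<in> Vec m" for x y
      using L append_carrier_vec[OF that] e[OF that] unfolding char_vec_def by metis
    have "even (bil A x x - c \<bullet> x)" if "x \<in> Vec n" for x using ev[OF that zero_carrier_vec] z(2) by simp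
    moreover have "even (bil B y y - d \<bullet> y)" if "y \<in> Vec m" for y using ev[OF zero_carrier_vec that] z(1) by simp
    ultimately show "char_vec n A c \<and> char_vec m B d" using c d by (simp add: char_vec_def)
  next
    assume R: "char_vec n A c \<and> char_vec m B d"
    have "even (bil (block_sum A B) v v - (c @v d) \<bullet> v)" if v: "v \<in> Vec (n + m)" for v
    proof -
      have "v = vec_first v n @v vec_last v m" using v by simp
      moreover have "even ((bil A (vec_first v n) (vec_first v n) - c \<bullet> vec_first v n) + (bil B (vec_last v m) (vec_last v m) - d \<bullet> vec_last v m))"
        using R by (simp add: char_vec_def)
      ultimately show ?thesis using e[of "vec_first v n" "vec_last v m"] by simp
    qed
    thus "char_vec (n + m) (block_sum A B) (c @v d)" using c d by (simp add: char_vec_def)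
  qed
qed

lemma char_vec_diag: "signs k \<epsilon> \<Longrightarrow> char_vec k (mat_diag k \<epsilon>) (vec k \<epsilon>)"
  unfolding char_vec_def
proof (intro conjI ballI)
  fix x :: "int vec" assume s: "signs k \<epsilon>" and x: "x \<in> Vec k"
  have "(mat_diag k \<epsilon> *v x) $ i = \<epsilon> i * x $ i" if "i < k" for i
  proof -
    have "(mat_diag k \<epsilon> *v x) $ i = (\<Sum>j<k. (if i = j then \<epsilon> j else 0) * x $ j)"
      using that x by (simp add: mat_diag_def scalar_prod_def lessThan_atLeast0)
    also have "\<dots> = (\<Sum>j<k. if i = j then \<epsilon> i * x $ i else 0)" by (intro sum.cong) auto
    finally show ?thesis using that by simp
  qed
  hence "bil (mat_diag k \<epsilon>) x x - vec k \<epsilon> \<bullet> x = (\<Sum>i<k. x $ i * (\<epsilon> i * x $ i)) - (\<Sum>i<k. \<epsilon> i * x $ i)"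
    using x by (simp add: bil_def scalar_prod_def mat_diag_def lessThan_atLeast0)
  also have "\<dots> = (\<Sum>i<k. \<epsilon> i * (x $ i * (x $ i - 1)))"
    by (simp add: sum_subtractf[symmetric] algebra_simps)
  finally show "even (bil (mat_diag k \<epsilon>) x x - vec k \<epsilon> \<bullet> x)" by (simp add: dvd_sum)
qed simp

text \<open>
  Two characteristic vectors differ by \<open>2 h\<close>, and \<open>h\<close> lies in the image of the unimodular matrix.
\<close>

lemma unimodular_char_iso:
  assumes A: "A \<in> Mat n n" "A\<^sup>T = A" "\<bar>det A\<bar> = 1" and AB: "mcong A B"
    and c: "char_vec n A c" and d: "char_vec n B d"
  shows "coord_triple B d \<simeq>\<^sub>L coord_triple A c"
proof -
  obtain m E where E: "A \<in> Mat m m" "unim m E" "B = E * A * E\<^sup>T" using AB unfolding mcong_def by blast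
  have m: "m = n" using E(1) A(1) by auto
  have Ec: "E \<in> Mat n n" using unim_carrier[OF E(2)] m by simp
  have Bc: "B \<in> Mat n n" by (rule mcong_carrier[OF AB A(1)])
  have cc: "c \<in> Vec n" and dc: "d \<in> Vec n" using c d by (simp_all add: char_vec_def)
  have Ecc: "E *v c \<in> Vec n" using Ec cc by simp
  have c': "char_vec n B (E *v c)" unfolding E(3) by (rule char_vec_congruence[OF A(1) Ec c])
  have ev: "even (d $ i - (E *v c) $ i)" if i: "i < n" for i
  proof -
    have u: "unit_vec n i \<in> Vec n" by simp
    have 1: "even (bil B (unit_vec n i) (unit_vec n i) - d $ i)"
      using d u dc i scalar_prod_right_unit[OF i, of d] unfolding char_vec_def by metis
    have 2: "even (bil B (unit_vec n i) (unit_vec n i) - (E *v c) $ i)"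
      using c' u Ecc i scalar_prod_right_unit[OF i, of "E *v c"] unfolding char_vec_def by metis
    show ?thesis using dvd_diff[OF 2 1] by simp
  qed
  define h where "h = vec n (\<lambda>i. (d $ i - (E *v c) $ i) div 2)"
  have h: "h \<in> Vec n" by (simp add: h_def)
  have dh: "d = E *v c + 2 \<cdot>v h"
    using ev dc Ecc by (intro eq_vecI) (auto simp: h_def)
  have "unim n B" using mcong_det[OF AB A(1)] A(3) Bc unfolding unim_def by simp
  then obtain F where F: "unim n F" "B * F = 1\<^sub>m n" "F * B = 1\<^sub>m n" by (rule unim_inverse)
  have Fc: "F \<in> Mat n n" by (rule unim_carrier[OF F(1)])
  have "B *v (F *v h) = h" using assoc_mult_mat_vec[OF Bc Fc h] F(2) h by simp
  hence "d = E *v c + 2 \<cdot>v (B *v (F *v h))" using dh by simp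
  thus ?thesis using E m cc Fc h by (intro coord_triple_congruence[OF A(1,2)]) auto
qed

section \<open>Glueing\<close>

definition stably_iso :: "'a lattice_triple \<Rightarrow> 'b lattice_triple \<Rightarrow> bool" where
  "stably_iso T T' \<longleftrightarrow> (\<exists>n n' \<epsilon> \<epsilon>'. signs n \<epsilon> \<and> signs n' \<epsilon>' \<and> T \<oplus>\<^sub>L unit_sum n \<epsilon> \<simeq>\<^sub>L T' \<oplus>\<^sub>L unit_sum n' \<epsilon>')"

text \<open>
  The matrix with blocks \<open>A, - R\<^sup>T, 0, 1\<close> turns the glued matrix into a block triangular one with
  determinant \<open>det (- B)\<close>.
\<close>

lemma glue_det_dvd:
  fixes A :: "int mat"
  assumes A: "A \<in> Mat n n" "A\<^sup>T = A" and B: "B \<in> Mat m m" "B\<^sup>T = B"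
    and P: "P \<in> Mat m n" and R: "R \<in> Mat m n" and S: "S \<in> Mat n n"
    and PA: "P * A = B * R" and AS: "A * S + R\<^sup>T * P = 1\<^sub>m n"
  shows "det A * det (four_block_mat S (- P\<^sup>T) (- P) (- B)) = det (- B)"
    "det A dvd det B"
proof -
  have Pt: "P\<^sup>T \<in> Mat n m" and Rt: "R\<^sup>T \<in> Mat n m" using P R by auto
  have mP: "- P\<^sup>T \<in> Mat n m" "- P \<in> Mat m n" "- B \<in> Mat m m" "- R\<^sup>T \<in> Mat n m"
    using P B R by auto
  let ?U = "four_block_mat S (- P\<^sup>T) (- P) (- B)"
  let ?L = "four_block_mat A (- R\<^sup>T) (0\<^sub>m m n) (1\<^sub>m m)"
  have U: "?U \<in> Mat (n + m) (n + m)" using S mP by (intro four_block_carrier_mat) auto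
  have L: "?L \<in> Mat (n + m) (n + m)" using A by (intro four_block_carrier_mat) auto
  have z1: "A * S + - R\<^sup>T * - P = 1\<^sub>m n"
    unfolding AS[symmetric] using Rt P by (subst uminus_mult_left_mat, simp, subst uminus_mult_right_mat, simp, simp)
  have "A * P\<^sup>T = R\<^sup>T * B"
    using arg_cong[OF PA, of transpose_mat] transpose_mult[OF P A(1)] transpose_mult[OF B(1) R] A(2) B(2) by simp
  moreover have "A * - P\<^sup>T = - (A * P\<^sup>T)" using A Pt by (intro uminus_mult_right_mat) auto
  moreover have "- R\<^sup>T * - B = R\<^sup>T * B"
    using Rt B by (subst uminus_mult_left_mat, simp, subst uminus_mult_right_mat, simp, simp)
  ultimately have z2: "A * - P\<^sup>T + - R\<^sup>T * - B = 0\<^sub>m n m"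
    using uminus_l_inv_mat[OF mult_carrier_mat[OF Rt B(1)]] by simp
  have "?L * ?U = four_block_mat (1\<^sub>m n) (0\<^sub>m n m) (- P) (- B)"
    unfolding mult_four_block_mat[OF A(1) mP(4) zero_carrier_mat[of m n] one_carrier_mat[of m] S mP(1,2,3)] z1 z2
      left_mult_zero_mat[OF S] left_mult_zero_mat[OF mP(1)] left_mult_one_mat[OF mP(2)] left_mult_one_mat[OF mP(3)]
      left_add_zero_mat[OF mP(2)] left_add_zero_mat[OF mP(3)] ..
  moreover have "det (four_block_mat (1\<^sub>m n) (0\<^sub>m n m) (- P) (- B)) = det (- B)"
    using det_four_block_mat_upper_right_zero[OF one_carrier_mat[of n] refl mP(2,3)] by simp
  moreover have "det ?L = det A"
    using det_four_block_mat_lower_left_zero[OF A(1) mP(4) refl one_carrier_mat[of m]] by simp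
  ultimately show 1: "det A * det ?U = det (- B)" using det_mult[OF L U] by simp
  have "det (- B) = (- 1) ^ m * det B"
  proof -
    have "- B = (- 1) \<cdot>\<^sub>m B" by (rule eq_matI) auto
    thus ?thesis using det_smult[of "- 1" B] B(1) by simp
  qed
  hence "det B = (- 1) ^ m * det (- B)" by (simp flip: mult.assoc power_mult_distrib)
  thus "det A dvd det B" unfolding 1[symmetric] by simp
qed

lemma mult_left_cancel:
  assumes T: "(T :: int mat) \<in> Mat m m" "det T \<noteq> 0" and M: "M \<in> Mat m k" "M' \<in> Mat m k" "T * M = T * M'"
  shows "M = M'"
proof -
  have "T * (M - M') = T * M - T * M'" by (rule mult_minus_distrib_mat[OF T(1) M(1,2)])
  also have "\<dots> = 0\<^sub>m m k" unfolding M(3) using T M by (intro eq_matI) auto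
  finally have "M - M' = 0\<^sub>m m k" by (rule mult_left_cancel_zero[OF T minus_carrier_mat[OF M(2)]])
  hence e: "(M - M') $$ (i, j) = 0" if "i < m" "j < k" for i j using that by simp
  show ?thesis using M e by (intro eq_matI) (auto simp: eq_diff_eq)
qed

text \<open>
  The hypotheses say in integral terms that \<open>P\<close> describes an isomorphism of the discriminants of \<open>A\<close> and \<open>B\<close>,
  with \<open>R = B\<inverse> P A\<close> and \<open>S = A\<inverse> - P\<^sup>T B\<inverse> P\<close>, that \<open>Q\<close> describes its inverse, and that \<open>\<gamma>\<close> is the resulting
  characteristic vector of \<open>S\<close>. The unimodular lattice \<open>U\<close> built from \<open>S\<close>, \<open>P\<close> and \<open>- B\<close> glues to \<open>B\<close>, and the
  rows of \<open>V\<close> span a copy of \<open>A\<close> in \<open>B \<oplus> U\<close>; both \<open>U\<close> and the complement \<open>W\<close> are stably diagonal.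
\<close>

lemma stably_iso_glue:
  fixes A B P Q R S K Z :: "int mat"
  assumes A: "A \<in> Mat n n" "A\<^sup>T = A" "det A \<noteq> 0" and B: "B \<in> Mat m m" "B\<^sup>T = B"
    and P: "P \<in> Mat m n" and R: "R \<in> Mat m n" and S: "S \<in> Mat n n" "S\<^sup>T = S"
    and Q: "Q \<in> Mat n m" and K: "K \<in> Mat n m" and Z: "Z \<in> Mat n n"
    and PA: "P * A = B * R" and AS: "A * S + R\<^sup>T * P = 1\<^sub>m n"
    and QB: "Q * B = A * K" and QP: "Q * P + A * Z = 1\<^sub>m n" and det: "\<bar>det A\<bar> = \<bar>det B\<bar>"
    and c': "char_vec m B c'" and g: "char_vec n S \<gamma>" and c: "c = A *v \<gamma> + R\<^sup>T *v c'"
  shows "stably_iso (coord_triple A c) (coord_triple B c')"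
proof -
  let ?k = "m + n + m - n" and ?Pt = "P\<^sup>T" and ?Rt = "R\<^sup>T"
  define U where "U = four_block_mat S (- ?Pt) (- P) (- B)"
  have Pt: "?Pt \<in> Mat n m" and Rt: "?Rt \<in> Mat n m" using P R by auto
  have mP: "- ?Pt \<in> Mat n m" "- P \<in> Mat m n" "- B \<in> Mat m m" using P B by auto
  have U: "U \<in> Mat (n + m) (n + m)" unfolding U_def using S mP by (intro four_block_carrier_mat) auto
  have Us: "U\<^sup>T = U"
    unfolding U_def transpose_four_block_mat[OF S(1) mP] using S(2) B(2) by (simp add: transpose_uminus)
  have dmB: "\<bar>det (- B)\<bar> = \<bar>det B\<bar>"
  proof -
    have "- B = (- 1) \<cdot>\<^sub>m B" by (rule eq_matI) auto
    thus ?thesis using det_smult[of "- 1" B] by (simp add: abs_mult power_abs)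
  qed
  have "\<bar>det A\<bar> * \<bar>det U\<bar> = \<bar>det B\<bar>"
    using glue_det_dvd(1)[OF A(1,2) B P R S(1) PA AS] dmB unfolding U_def by (metis abs_mult)
  moreover have "det B \<noteq> 0" using det A(3) by auto
  ultimately have dU: "\<bar>det U\<bar> = 1" using det by simp
  have gc: "\<gamma> \<in> Vec n" and c'c: "c' \<in> Vec m" using g c' by (simp_all add: char_vec_def)
  have mc: "- c' \<in> Vec m" using c'c by simp
  have cU: "char_vec (n + m) U (\<gamma> @v - c')"
    unfolding char_vec_def
  proof (intro conjI ballI)
    show "\<gamma> @v - c' \<in> Vec (n + m)" using gc mc by (rule append_carrier_vec)
    fix v :: "int vec" assume v: "v \<in> Vec (n + m)"
    define x y where "x = vec_first v n" and "y = vec_last v m"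
    have x: "x \<in> Vec n" and y: "y \<in> Vec m" by (simp_all add: x_def y_def)
    have vxy: "v = x @v y" using v by (simp add: x_def y_def)
    have Px: "P *v x \<in> Vec m" and Pty: "?Pt *v y \<in> Vec n" and By: "B *v y \<in> Vec m"
      and Sx: "S *v x \<in> Vec n" using P Pt B S x y by auto
    have nr: "a \<bullet> - b = - (a \<bullet> b)" if "a \<in> Vec l" "b \<in> Vec l" for a b :: "int vec" and l
      using that by (simp add: scalar_prod_def sum_negf)
    have "U *v v = (S *v x + - ?Pt *v y) @v (- P *v x + - B *v y)"
      unfolding U_def vxy by (rule four_block_mat_mult_vec[OF S(1) mP x y])
    also have "- ?Pt *v y = - (?Pt *v y)" using Pt y by (intro eq_vecI) auto
    also have "- P *v x = - (P *v x)" using P x by (intro eq_vecI) auto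
    also have "- B *v y = - (B *v y)" using B y by (intro eq_vecI) auto
    finally have Uv: "U *v v = (S *v x + - (?Pt *v y)) @v (- (P *v x) + - (B *v y))" .
    have "bil U v v = x \<bullet> (S *v x + - (?Pt *v y)) + y \<bullet> (- (P *v x) + - (B *v y))"
      unfolding bil_def Uv unfolding vxy using x y Sx Pty Px By by (intro scalar_prod_append) auto
    also have "x \<bullet> (S *v x + - (?Pt *v y)) = bil S x x - x \<bullet> (?Pt *v y)"
      using x Sx Pty by (simp add: bil_def scalar_prod_add_distrib[of _ n] nr[of _ n])
    also have "y \<bullet> (- (P *v x) + - (B *v y)) = - (y \<bullet> (P *v x)) - bil B y y"
      using y Px By by (simp add: bil_def scalar_prod_add_distrib[of _ m] nr[of _ m])
    also have "x \<bullet> (?Pt *v y) = y \<bullet> (P *v x)"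
      using transpose_vec_mult_scalar[OF P x y] comm_scalar_prod[OF x Pty] by simp
    finally have b: "bil U v v = (bil S x x - y \<bullet> (P *v x)) + (- (y \<bullet> (P *v x)) - bil B y y)" .
    have "(\<gamma> @v - c') \<bullet> v = \<gamma> \<bullet> x + (- c') \<bullet> y" unfolding vxy by (rule scalar_prod_append[OF gc mc x y])
    also have "(- c') \<bullet> y = - (c' \<bullet> y)" using c'c y by simp
    finally have "bil U v v - (\<gamma> @v - c') \<bullet> v = (bil S x x - \<gamma> \<bullet> x) - (bil B y y - c' \<bullet> y) - 2 * (y \<bullet> (P *v x))"
      using b by simp
    moreover have "even (bil S x x - \<gamma> \<bullet> x)" "even (bil B y y - c' \<bullet> y)"
      using g c' x y by (simp_all add: char_vec_def)
    ultimately show "even (bil U v v - (\<gamma> @v - c') \<bullet> v)" by simp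
  qed
  define G where "G = block_sum B U"
  define cG where "cG = c' @v (\<gamma> @v - c')"
  have N: "m + (n + m) = n + (m + m)" by simp
  have G: "G \<in> Mat (n + (m + m)) (n + (m + m))"
    unfolding G_def using block_sum_carrier[OF B(1) U] by (simp add: add.left_commute)
  have Gs: "G\<^sup>T = G" unfolding G_def block_sum_transpose[OF B(1) U] B(2) Us ..
  have cGc: "char_vec (n + (m + m)) G cG"
    using char_vec_block_sum[OF B(1) U c'c append_carrier_vec[OF gc mc]] c' cU unfolding G_def cG_def N by blast
  have cGcar: "cG \<in> Vec (n + (m + m))" using cGc by (simp add: char_vec_def)
  define V2 where "V2 = four_block_mat A (Q - ?Rt) (0\<^sub>m 0 n) (0\<^sub>m 0 m)"
  define Y2 where "Y2 = four_block_mat Z (- K) (0\<^sub>m 0 n) (0\<^sub>m 0 m)"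
  define V where "V = four_block_mat Q V2 (0\<^sub>m 0 m) (0\<^sub>m 0 (n + m))"
  define Y where "Y = four_block_mat K Y2 (0\<^sub>m 0 m) (0\<^sub>m 0 (n + m))"
  have QR: "Q - ?Rt \<in> Mat n m" and mK: "- K \<in> Mat n m" using Q Rt K by auto
  have V2: "V2 \<in> Mat n (n + m)" and Y2: "Y2 \<in> Mat n (n + m)"
    unfolding V2_def Y2_def using four_block_carrier_mat[OF A(1) zero_carrier_mat[of 0 m]]
      four_block_carrier_mat[OF Z zero_carrier_mat[of 0 m]] by simp_all
  have V: "V \<in> Mat n (n + (m + m))" and Y: "Y \<in> Mat n (n + (m + m))"
    unfolding V_def Y_def using four_block_carrier_mat[OF Q zero_carrier_mat[of 0 "n + m"]]
      four_block_carrier_mat[OF K zero_carrier_mat[of 0 "n + m"]] by (simp_all add: add.left_commute)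
  have e0: "X = Y" if "X \<in> Mat 0 r" "Y \<in> Mat 0 r" for X Y :: "int mat" and r
    using that by (intro eq_matI) auto
  have ARt: "A * ?Pt = ?Rt * B"
    using arg_cong[OF PA, of transpose_mat] transpose_mult[OF P A(1)] transpose_mult[OF B(1) R] A(2) B(2) by simp
  have s1: "A * S + (Q - ?Rt) * - P = A * Z"
  proof -
    have gen: "X + - (Y - W) = T" if "X \<in> Mat n n" "Y \<in> Mat n n" "W \<in> Mat n n" "T \<in> Mat n n"
      "X + W = Y + T" for X Y W T :: "int mat"
    proof (rule eq_matI)
      fix i j assume "i < dim_row T" "j < dim_col T"
      moreover have "(X + W) $$ (i, j) = (Y + T) $$ (i, j)" using that(5) by simp
      ultimately show "(X + - (Y - W)) $$ (i, j) = T $$ (i, j)" using that(1-4) by auto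
    qed (use that in auto)
    have e1: "(Q - ?Rt) * - P = - ((Q - ?Rt) * P)" using QR P by (intro uminus_mult_right_mat) auto
    have e2: "(Q - ?Rt) * P = Q * P - ?Rt * P" by (rule minus_mult_distrib_mat[OF Q Rt P])
    show ?thesis unfolding e1 e2
      by (rule gen[OF mult_carrier_mat[OF A(1) S(1)] mult_carrier_mat[OF Q P] mult_carrier_mat[OF Rt P] mult_carrier_mat[OF A(1) Z]
            trans[OF AS QP[symmetric]]])
  qed
  have s2: "A * - ?Pt + (Q - ?Rt) * - B = A * - K"
  proof -
    have gen: "- X + - (Y - X) = - Y" if "X \<in> Mat n m" "Y \<in> Mat n m" for X Y :: "int mat"
      using that by (intro eq_matI) auto
    have e1: "(Q - ?Rt) * - B = - ((Q - ?Rt) * B)" using QR B by (intro uminus_mult_right_mat) auto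
    have e2: "(Q - ?Rt) * B = Q * B - ?Rt * B" by (rule minus_mult_distrib_mat[OF Q Rt B(1)])
    have e3: "A * - ?Pt = - (A * ?Pt)" by (rule uminus_mult_right_mat) (use A Pt in simp)
    have e4: "A * - K = - (A * K)" by (rule uminus_mult_right_mat) (use A K in simp)
    show ?thesis unfolding e1 e2 e3 e4 ARt QB
      by (rule gen[OF mult_carrier_mat[OF Rt B(1)] mult_carrier_mat[OF A(1) K]])
  qed
  have V2U: "V2 * U = A * Y2"
  proof -
    have z1: "0\<^sub>m 0 n * S + 0\<^sub>m 0 m * - P = 0\<^sub>m 0 n" by (rule eq_matI) (use S P in auto)
    have z2: "0\<^sub>m 0 n * - ?Pt + 0\<^sub>m 0 m * - B = 0\<^sub>m 0 m" by (rule eq_matI) (use B in auto)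
    have "V2 * U = four_block_mat (A * Z) (A * - K) (0\<^sub>m 0 n) (0\<^sub>m 0 m)"
      unfolding V2_def U_def mult_four_block_mat[OF A(1) QR zero_carrier_mat zero_carrier_mat S(1) mP] s1 s2 z1 z2 ..
    moreover have "A * Y2 = four_block_mat (A * Z) (A * - K) (0\<^sub>m 0 n) (0\<^sub>m 0 m)"
      using A(1) Z mK unfolding Y2_def by (intro eq_matI) (auto simp: scalar_prod_def col_def four_block_mat_def Let_def sum_negf)
    ultimately show ?thesis by simp
  qed
  have VG: "V * G = A * Y"
  proof -
    have G': "G = four_block_mat B (0\<^sub>m m (n + m)) (0\<^sub>m (n + m) m) U" unfolding G_def block_sum_def using B U by auto
    have "V * G = four_block_mat (Q * B) (V2 * U) (0\<^sub>m 0 m) (0\<^sub>m 0 (n + m))"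
      unfolding V_def G' mult_four_block_mat[OF Q V2 zero_carrier_mat zero_carrier_mat B(1) zero_carrier_mat zero_carrier_mat U]
      using Q V2 B U mult_carrier_mat[OF Q B(1)] mult_carrier_mat[OF V2 U] by simp
    moreover have "A * Y = four_block_mat (A * K) (A * Y2) (0\<^sub>m 0 m) (0\<^sub>m 0 (n + m))"
      using A(1) K Y2 unfolding Y_def by (intro eq_matI) (auto simp: scalar_prod_def col_def four_block_mat_def Let_def)
    ultimately show ?thesis unfolding QB V2U by simp
  qed
  have ZA: "Z * A + K * R = 1\<^sub>m n"
  proof (rule mult_left_cancel[OF A(1,3)])
    have "A * (Z * A + K * R) = A * (Z * A) + A * (K * R)"
      using Z A K R by (intro mult_add_distrib_mat[of _ n n _ n]) (auto intro: mult_carrier_mat)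
    also have "A * (Z * A) = A * Z * A" by (rule assoc_mult_mat[OF A(1) Z A(1), symmetric])
    also have "A * (K * R) = Q * P * A"
      unfolding assoc_mult_mat[OF A(1) K R, symmetric] QB[symmetric] assoc_mult_mat[OF Q B(1) R] PA[symmetric]
      by (rule assoc_mult_mat[OF Q P A(1), symmetric])
    also have "A * Z * A + Q * P * A = (Q * P + A * Z) * A"
      using comm_add_mat[of "A * Z * A" n n "Q * P * A"] add_mult_distrib_mat[of "Q * P" n n "A * Z" A n]
        mult_carrier_mat[OF A(1) Z] mult_carrier_mat[OF Q P] A(1) by (simp add: mult_carrier_mat)
    finally show "A * (Z * A + K * R) = A * 1\<^sub>m n" unfolding QP using A(1) by simp
  qed (use mult_carrier_mat[OF Z A(1)] mult_carrier_mat[OF K R] in auto)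
  have YV: "Y * V\<^sup>T = 1\<^sub>m n"
  proof (rule mult_left_cancel[OF A(1,3)])
    have Vt: "V\<^sup>T = four_block_mat (Q\<^sup>T) (0\<^sub>m m 0) (V2\<^sup>T) (0\<^sub>m (n + m) 0)"
      unfolding V_def transpose_four_block_mat[OF Q V2 zero_carrier_mat zero_carrier_mat] by simp
    have V2t: "V2\<^sup>T = four_block_mat A (0\<^sub>m n 0) (Q\<^sup>T - R) (0\<^sub>m m 0)"
      unfolding V2_def transpose_four_block_mat[OF A(1) QR zero_carrier_mat zero_carrier_mat] A(2)
      using Q R by (simp add: transpose_minus[of Q n m])
    have Qt: "Q\<^sup>T \<in> Mat m n" "Q\<^sup>T - R \<in> Mat m n" using Q R by auto
    have 1: "Y2 * V2\<^sup>T = four_block_mat (Z * A + - K * (Q\<^sup>T - R)) (0\<^sub>m n 0) (0\<^sub>m 0 n) (0\<^sub>m 0 0)"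
      unfolding V2t Y2_def mult_four_block_mat[OF Z mK zero_carrier_mat zero_carrier_mat A(1) zero_carrier_mat Qt(2) zero_carrier_mat]
      by (rule cong_four_block_mat) (use Z mK A Qt in \<open>auto intro!: eq_matI\<close>)
    have V2tc: "V2\<^sup>T \<in> Mat (n + m) n" using V2 by simp
    have 2: "Y * V\<^sup>T = four_block_mat (K * Q\<^sup>T + Y2 * V2\<^sup>T) (0\<^sub>m n 0) (0\<^sub>m 0 n) (0\<^sub>m 0 0)"
      unfolding Vt Y_def mult_four_block_mat[OF K Y2 zero_carrier_mat zero_carrier_mat Qt(1) zero_carrier_mat V2tc zero_carrier_mat]
      by (rule cong_four_block_mat) (use K Y2 Qt V2tc in \<open>auto intro!: eq_matI\<close>)
    have fb: "four_block_mat X (0\<^sub>m n 0) (0\<^sub>m 0 n) (0\<^sub>m 0 0) = X" if "X \<in> Mat n n" for X :: "int mat"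
      using that by (intro eq_matI) auto
    have KQ: "K * Q\<^sup>T \<in> Mat n n" "K * R \<in> Mat n n" "Z * A \<in> Mat n n"
      using K Qt R Z A by (auto intro: mult_carrier_mat)
    have "- K * (Q\<^sup>T - R) = - (K * (Q\<^sup>T - R))" using K Qt by (intro uminus_mult_left_mat) auto
    also have "K * (Q\<^sup>T - R) = K * Q\<^sup>T - K * R" by (rule mult_minus_distrib_mat[OF K Qt(1) R])
    finally have 3: "- K * (Q\<^sup>T - R) = - (K * Q\<^sup>T - K * R)" .
    have "Y * V\<^sup>T = K * Q\<^sup>T + (Z * A + - (K * Q\<^sup>T - K * R))"
    proof -
      have c1: "Z * A + - (K * Q\<^sup>T - K * R) \<in> Mat n n" (is "?X \<in> _")
        by (intro add_carrier_mat uminus_carrier_mat minus_carrier_mat KQ)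
      have c2: "K * Q\<^sup>T + ?X \<in> Mat n n" by (rule add_carrier_mat[OF c1])
      show ?thesis unfolding 2 1 3 fb[OF c1] fb[OF c2] ..
    qed
    also have "\<dots> = Z * A + K * R" using KQ by (intro eq_matI) auto
    finally show "A * (Y * V\<^sup>T) = A * 1\<^sub>m n" unfolding ZA by simp
  qed (use Y V in \<open>auto intro: mult_carrier_mat\<close>)
  obtain E W where E: "unim (n + (m + m)) E" "\<And>i. i < n \<Longrightarrow> row E i = row V i" and W: "W \<in> Mat (m + m) (m + m)"
    and EGE: "E * G * E\<^sup>T = block_sum A W"
    using split_off_sublattice[OF G Gs A(1) V Y VG YV] by metis
  have Ec: "E \<in> Mat (n + (m + m)) (n + (m + m))" by (rule unim_carrier[OF E(1)])
  have GAW: "mcong G (block_sum A W)" by (rule mcongI[OF G E(1) EGE[symmetric]])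
  have Ws: "W\<^sup>T = W"
  proof -
    have "block_sum A (W\<^sup>T) = block_sum A W"
      using mcong_symmetric[OF GAW Gs] block_sum_transpose[OF A(1) W] A(2) by simp
    hence e: "block_sum A (W\<^sup>T) $$ (i + n, j + n) = block_sum A W $$ (i + n, j + n)" for i j by simp
    show ?thesis
    proof (rule eq_matI)
      fix i j assume "i < dim_row W" "j < dim_col W"
      thus "W\<^sup>T $$ (i, j) = W $$ (i, j)" using e[of i j] A(1) W by (simp add: block_sum_def)
    qed (use W in auto)
  qed
  have "det A * det W = det B * det U"
    using mcong_det[OF GAW G] block_sum_det[OF A(1) W] block_sum_det[OF B(1) U] by (simp add: G_def)
  hence "\<bar>det A\<bar> * \<bar>det W\<bar> = \<bar>det B\<bar> * \<bar>det U\<bar>" by (metis abs_mult)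
  hence "\<bar>det A\<bar> * \<bar>det W\<bar> = \<bar>det A\<bar> * 1" unfolding dU det by simp
  hence dW: "\<bar>det W\<bar> = 1" using A(3) by simp
  define cW where "cW = vec_last (E *v cG) (m + m)"
  have EcG: "E *v cG \<in> Vec (n + (m + m))" using Ec cGcar by simp
  have "vec_first (E *v cG) n = c"
  proof -
    have V2c: "V2 *v (\<gamma> @v - c') = A *v \<gamma> + (Q - ?Rt) *v - c'"
    proof -
      have "V2 *v (\<gamma> @v - c') = (A *v \<gamma> + (Q - ?Rt) *v - c') @v (0\<^sub>m 0 n *v \<gamma> + 0\<^sub>m 0 m *v - c')"
        unfolding V2_def by (rule four_block_mat_mult_vec[OF A(1) QR zero_carrier_mat zero_carrier_mat gc mc])
      thus ?thesis using A gc QR mc by (auto intro!: eq_vecI)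
    qed
    have "V *v cG = (Q *v c' + V2 *v (\<gamma> @v - c')) @v (0\<^sub>m 0 m *v c' + 0\<^sub>m 0 (n + m) *v (\<gamma> @v - c'))"
      unfolding V_def cG_def
      by (rule four_block_mat_mult_vec[OF Q V2 zero_carrier_mat zero_carrier_mat c'c append_carrier_vec[OF gc mc]])
    hence "V *v cG = Q *v c' + (A *v \<gamma> + (Q - ?Rt) *v - c')"
      unfolding V2c using Q c'c A gc QR mc by (auto intro!: eq_vecI)
    also have "(Q - ?Rt) *v - c' = - (Q *v c') + ?Rt *v c'"
    proof (rule eq_vecI)
      fix i assume "i < dim_vec (- (Q *v c') + ?Rt *v c')"
      hence i: "i < n" using Rt by simp
      have "row (Q - ?Rt) i = row Q i - row ?Rt i" using Q Rt i by (intro eq_vecI) auto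
      hence "((Q - ?Rt) *v - c') $ i = (row Q i - row ?Rt i) \<bullet> - c'"
        using index_mult_mat_vec[of i "Q - ?Rt" "- c'"] i carrier_matD(1)[OF QR] by metis
      also have "\<dots> = - (row Q i \<bullet> c' - row ?Rt i \<bullet> c')"
        using Q Rt i c'c minus_scalar_prod_distrib[of "row Q i" m "row ?Rt i" c'] by simp
      finally show "((Q - ?Rt) *v - c') $ i = (- (Q *v c') + ?Rt *v c') $ i" using i Q Rt by simp
    qed (use QR Rt in simp)
    also have "Q *v c' + (A *v \<gamma> + (- (Q *v c') + ?Rt *v c')) = c"
      unfolding c using Q A Rt c'c gc by (intro eq_vecI) auto
    finally have Vc: "V *v cG = c" .
    show ?thesis
    proof (rule eq_vecI)
      have "c \<in> Vec n" unfolding c using A gc Rt c'c by simp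
      thus "dim_vec (vec_first (E *v cG) n) = dim_vec c" by simp
      fix i assume "i < dim_vec c"
      hence i: "i < n" using \<open>c \<in> Vec n\<close> by simp
      have "(E *v cG) $ i = (V *v cG) $ i" using E(2)[OF i] i Ec V by simp
      thus "vec_first (E *v cG) n $ i = c $ i" unfolding Vc using i by (simp add: vec_first_def)
    qed
  qed
  hence cW: "E *v cG = c @v cW" unfolding cW_def using EcG by (metis vec_first_last_append)
  have cc: "c \<in> Vec n" unfolding c using A gc Rt c'c by simp
  have cWc: "cW \<in> Vec (m + m)" by (simp add: cW_def)
  have "char_vec (n + (m + m)) (block_sum A W) (c @v cW)"
    using char_vec_congruence[OF G Ec cGc] unfolding EGE cW .
  hence chW: "char_vec (m + m) W cW" using char_vec_block_sum[OF A(1) W cc cWc] by blast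
  obtain k \<epsilon> k' \<epsilon>' where u: "signs k \<epsilon>" "signs k' \<epsilon>'" "mcong (block_sum W (mat_diag k \<epsilon>)) (mat_diag k' \<epsilon>')"
    using unimodular_stably_diag[OF W Ws dW] unfolding stably_diag_def by blast
  obtain l \<delta> l' \<delta>' where w: "signs l \<delta>" "signs l' \<delta>'" "mcong (block_sum U (mat_diag l \<delta>)) (mat_diag l' \<delta>')"
    using unimodular_stably_diag[OF U Us dU] unfolding stably_diag_def by blast
  let ?D = "mat_diag k \<epsilon>" and ?D' = "mat_diag l \<delta>"
  \<comment> \<open>a common stabilisation diagonalises both\<close>
  define \<eta> where "\<eta> = (\<lambda>i. if i < k then \<epsilon> i else \<delta> (i - k))"
  define \<eta>1 where "\<eta>1 = (\<lambda>i. if i < k' then \<epsilon>' i else \<delta> (i - k'))"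
  define \<eta>2 where "\<eta>2 = (\<lambda>i. if i < l' then \<delta>' i else \<epsilon> (i - l'))"
  have sg: "signs (k + l) \<eta>" "signs (k' + l) \<eta>1" "signs (l' + k) \<eta>2"
    unfolding \<eta>_def \<eta>1_def \<eta>2_def by (intro signs_append u w)+
  have DD: "block_sum ?D ?D' = mat_diag (k + l) \<eta>" by (simp add: block_sum_mat_diag \<eta>_def)
  have W1: "mcong (block_sum W (mat_diag (k + l) \<eta>)) (mat_diag (k' + l) \<eta>1)"
  proof -
    have "mcong (block_sum (block_sum W ?D) ?D') (block_sum (mat_diag k' \<epsilon>') ?D')"
      by (rule mcong_block_sum[OF u(3) mcong_refl[OF mat_diag_dim]])
    thus ?thesis unfolding block_sum_assoc DD by (simp add: block_sum_mat_diag \<eta>1_def)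
  qed
  have U1: "mcong (block_sum U (mat_diag (k + l) \<eta>)) (mat_diag (l' + k) \<eta>2)"
  proof -
    have "mcong (block_sum (block_sum U ?D) ?D') (block_sum (block_sum U ?D') ?D)"
      by (rule mcong_block_sum_swap[OF U mat_diag_dim mat_diag_dim])
    moreover have "mcong (block_sum (block_sum U ?D') ?D) (block_sum (mat_diag l' \<delta>') ?D)"
      by (rule mcong_block_sum[OF w(3) mcong_refl[OF mat_diag_dim]])
    ultimately have "mcong (block_sum (block_sum U ?D) ?D') (block_sum (mat_diag l' \<delta>') ?D)" by (rule mcong_trans)
    thus ?thesis unfolding block_sum_assoc DD by (simp add: block_sum_mat_diag \<eta>2_def)
  qed
  have diag_iso: "coord_triple X cX \<oplus>\<^sub>L unit_sum (k + l) \<eta> \<simeq>\<^sub>L unit_sum p \<zeta>"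
    if X: "X \<in> Mat r r" "X\<^sup>T = X" "\<bar>det X\<bar> = 1" "char_vec r X cX"
      and sz: "signs p \<zeta>" and mc: "mcong (block_sum X (mat_diag (k + l) \<eta>)) (mat_diag p \<zeta>)" for X cX r p \<zeta>
  proof -
    let ?D = "mat_diag (k + l) \<eta>" and ?d = "vec (k + l) \<eta>"
    have cX: "cX \<in> Vec r" using X(4) by (simp add: char_vec_def)
    have XD: "block_sum X ?D \<in> Mat (r + (k + l)) (r + (k + l))" by (rule block_sum_carrier[OF X(1) mat_diag_dim])
    have XDs: "(block_sum X ?D)\<^sup>T = block_sum X ?D" by (rule transpose_block_sum_diag[OF X(1,2)])
    have XDd: "\<bar>det (block_sum X ?D)\<bar> = 1"
      unfolding block_sum_det[OF X(1) mat_diag_dim] abs_mult using X(3) det_signs[OF sg(1)] by simp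
    have p: "p = r + (k + l)" using carrier_matD(1)[OF mcong_carrier[OF mc XD]] by (simp add: mat_diag_def)
    have ch: "char_vec (r + (k + l)) (block_sum X ?D) (cX @v ?d)"
      using char_vec_block_sum[OF X(1) mat_diag_dim cX vec_carrier] X(4) char_vec_diag[OF sg(1)] by blast
    have chp: "char_vec (r + (k + l)) (mat_diag p \<zeta>) (vec p \<zeta>)" using char_vec_diag[OF sz] p by simp
    have bl: "bilinear (coord_triple X cX)" by (rule bilinear_coord_triple[OF X(1,2)])
    have bD: "bilinear (unit_sum q \<xi>)" "bilinear (coord_triple (mat_diag q \<xi>) v)" for q \<xi> v
      by (rule bilinear_unit_sum, rule bilinear_coord_triple[OF mat_diag_dim transpose_mat_diag])
    have bs: "bilinear (coord_triple (block_sum X ?D) (cX @v ?d))" by (rule bilinear_coord_triple[OF XD XDs])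
    have 1: "coord_triple X cX \<oplus>\<^sub>L unit_sum (k + l) \<eta> \<simeq>\<^sub>L coord_triple X cX \<oplus>\<^sub>L coord_triple ?D ?d"
      by (rule triple_iso_orth_sum[OF triple_iso_refl[OF bl] unit_sum_coord])
    have 2: "coord_triple X cX \<oplus>\<^sub>L coord_triple ?D ?d \<simeq>\<^sub>L coord_triple (block_sum X ?D) (cX @v ?d)"
      by (rule coord_triple_block_sum[OF X(1) mat_diag_dim cX vec_carrier])
    have 3: "coord_triple (block_sum X ?D) (cX @v ?d) \<simeq>\<^sub>L coord_triple (mat_diag p \<zeta>) (vec p \<zeta>)"
      by (rule triple_iso_sym[OF bD(2) bs unimodular_char_iso[OF XD XDs XDd mc ch chp]])
    have 4: "coord_triple (mat_diag p \<zeta>) (vec p \<zeta>) \<simeq>\<^sub>L unit_sum p \<zeta>"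
      by (rule triple_iso_sym[OF bD(1,2) unit_sum_coord])
    have bo: "bilinear (coord_triple X cX \<oplus>\<^sub>L unit_sum (k + l) \<eta>)" "bilinear (coord_triple X cX \<oplus>\<^sub>L coord_triple ?D ?d)"
      by (rule bilinear_orth_sum[OF bl bD(1)], rule bilinear_orth_sum[OF bl bD(2)])
    show ?thesis
      by (rule triple_iso_trans[OF bo(1,2) 1 triple_iso_trans[OF bo(2) bs 2 triple_iso_trans[OF bs bD(2) 3 4]]])
  qed
  have IW: "coord_triple W cW \<oplus>\<^sub>L unit_sum (k + l) \<eta> \<simeq>\<^sub>L unit_sum (k' + l) \<eta>1"
    by (rule diag_iso[OF W Ws dW chW sg(2) W1])
  have IU: "coord_triple U (\<gamma> @v - c') \<oplus>\<^sub>L unit_sum (k + l) \<eta> \<simeq>\<^sub>L unit_sum (l' + k) \<eta>2"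
    by (rule diag_iso[OF U Us dU cU sg(3) U1])
  let ?TA = "coord_triple A c" and ?TB = "coord_triple B c'" and ?TW = "coord_triple W cW"
    and ?TU = "coord_triple U (\<gamma> @v - c')" and ?u = "unit_sum (k + l) \<eta>"
  have bA: "bilinear ?TA" "bilinear ?TB" "bilinear ?TW" "bilinear ?TU"
    by (rule bilinear_coord_triple[OF A(1,2)], rule bilinear_coord_triple[OF B], rule bilinear_coord_triple[OF W Ws],
        rule bilinear_coord_triple[OF U Us])
  have GI: "coord_triple (block_sum A W) (c @v cW) \<simeq>\<^sub>L coord_triple G cG"
  proof (rule coord_triple_congruence[OF G Gs E(1) EGE[symmetric] cGcar zero_carrier_vec])
    have "block_sum A W \<in> Mat (n + (m + m)) (n + (m + m))" by (rule block_sum_carrier[OF A(1) W])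
    hence "2 \<cdot>v (block_sum A W *v 0\<^sub>v (n + (m + m))) = 0\<^sub>v (n + (m + m))" using A(1) W by (intro eq_vecI) auto
    thus "c @v cW = E *v cG + 2 \<cdot>v (block_sum A W *v 0\<^sub>v (n + (m + m)))" using cW EcG by simp
  qed
  have "?TA \<oplus>\<^sub>L ?TW \<simeq>\<^sub>L ?TB \<oplus>\<^sub>L ?TU"
  proof -
    have i1: "?TA \<oplus>\<^sub>L ?TW \<simeq>\<^sub>L coord_triple (block_sum A W) (c @v cW)" by (rule coord_triple_block_sum[OF A(1) W cc cWc])
    have i2: "?TB \<oplus>\<^sub>L ?TU \<simeq>\<^sub>L coord_triple G cG"
      unfolding G_def cG_def by (rule coord_triple_block_sum[OF B(1) U c'c append_carrier_vec[OF gc mc]])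
    have bG: "bilinear (coord_triple G cG)" by (rule bilinear_coord_triple[OF G Gs])
    have bAW: "bilinear (coord_triple (block_sum A W) (c @v cW))"
      by (rule bilinear_coord_triple[OF block_sum_carrier[OF A(1) W] mcong_symmetric[OF GAW Gs]])
    have bs: "bilinear (?TA \<oplus>\<^sub>L ?TW)" "bilinear (?TB \<oplus>\<^sub>L ?TU)"
      by (rule bilinear_orth_sum[OF bA(1,3)], rule bilinear_orth_sum[OF bA(2,4)])
    show ?thesis
      by (rule triple_iso_trans[OF bs(1) bAW i1 triple_iso_trans[OF bAW bG GI triple_iso_sym[OF bs(2) bG i2]]])
  qed
  note glue = this
  have bu: "bilinear (unit_sum q \<xi>)" for q \<xi> by (rule bilinear_unit_sum)
  have "(?TA \<oplus>\<^sub>L ?TW) \<oplus>\<^sub>L ?u \<simeq>\<^sub>L (?TB \<oplus>\<^sub>L ?TU) \<oplus>\<^sub>L ?u" by (rule triple_iso_orth_sum[OF glue triple_iso_refl[OF bu]])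
  moreover have reg: "(T \<oplus>\<^sub>L S) \<oplus>\<^sub>L ?u \<simeq>\<^sub>L T \<oplus>\<^sub>L unit_sum p \<zeta>"
    if "bilinear T" "bilinear S" "S \<oplus>\<^sub>L ?u \<simeq>\<^sub>L unit_sum p \<zeta>" for T :: "int vec lattice_triple" and S :: "int vec lattice_triple" and p \<zeta>
    using triple_iso_trans[OF bilinear_orth_sum[OF bilinear_orth_sum[OF that(1,2)] bu] bilinear_orth_sum[OF that(1) bilinear_orth_sum[OF that(2) bu]]
      triple_iso_assoc[OF that(1,2) bu] triple_iso_orth_sum[OF triple_iso_refl[OF that(1)] that(3)]] .
  moreover note regA = reg[OF bA(1,3) IW] and regB = reg[OF bA(2,4) IU]
  have bl: "bilinear ((?TA \<oplus>\<^sub>L ?TW) \<oplus>\<^sub>L ?u)" "bilinear ((?TB \<oplus>\<^sub>L ?TU) \<oplus>\<^sub>L ?u)"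
    "bilinear (?TA \<oplus>\<^sub>L unit_sum (k' + l) \<eta>1)" "bilinear (?TB \<oplus>\<^sub>L unit_sum (l' + k) \<eta>2)"
    by (intro bilinear_orth_sum bA bu)+
  have mid: "(?TA \<oplus>\<^sub>L ?TW) \<oplus>\<^sub>L ?u \<simeq>\<^sub>L (?TB \<oplus>\<^sub>L ?TU) \<oplus>\<^sub>L ?u" by (rule triple_iso_orth_sum[OF glue triple_iso_refl[OF bu]])
  have "?TA \<oplus>\<^sub>L unit_sum (k' + l) \<eta>1 \<simeq>\<^sub>L ?TB \<oplus>\<^sub>L unit_sum (l' + k) \<eta>2"
    by (rule triple_iso_trans[OF bl(3,1) triple_iso_sym[OF bl(1,3) regA] triple_iso_trans[OF bl(1,2) mid regB]])
  thus ?thesis unfolding stably_iso_def using sg by blast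
qed

section \<open>The discriminant group in coordinates\<close>

text \<open>
  Closure under differences suffices, as sums and multiples are built from them.
\<close>

lemma int_vec_induct:
  assumes P0: "P (0\<^sub>v n)" and P1: "\<And>i. i < n \<Longrightarrow> P (unit_vec n i)"
    and Pd: "\<And>x y. x \<in> Vec n \<Longrightarrow> y \<in> Vec n \<Longrightarrow> P x \<Longrightarrow> P y \<Longrightarrow> P (x - y)"
    and v: "(v :: int vec) \<in> Vec n"
  shows "P v"
proof -
  have add: "P (x + y)" if "x \<in> Vec n" "y \<in> Vec n" "P x" "P y" for x y
  proof -
    have "P (x - (0\<^sub>v n - y))" using Pd[OF that(1) _ that(3) Pd[OF zero_carrier_vec that(2) P0 that(4)]] that(2) by simp
    moreover have "x - (0\<^sub>v n - y) = x + y" using that by (intro eq_vecI) auto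
    ultimately show ?thesis by simp
  qed
  have m1: "P (int m \<cdot>v unit_vec n i)" if "i < n" for i m
  proof (induction m)
    case 0
    have "int 0 \<cdot>v unit_vec n i = 0\<^sub>v n" by (intro eq_vecI) auto
    thus ?case using P0 by simp
  next
    case (Suc m)
    have "int (Suc m) \<cdot>v unit_vec n i = int m \<cdot>v unit_vec n i + unit_vec n i"
      by (intro eq_vecI) (auto simp: algebra_simps)
    thus ?case using add[OF _ _ Suc P1[OF that]] by simp
  qed
  have m2: "P (k \<cdot>v unit_vec n i)" if "i < n" for i k
  proof (cases "0 \<le> k")
    case True thus ?thesis using m1[OF that, of "nat k"] by simp
  next
    case False
    hence "k \<cdot>v unit_vec n i = 0\<^sub>v n - int (nat (- k)) \<cdot>v unit_vec n i" by (intro eq_vecI) auto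
    thus ?thesis using Pd[OF zero_carrier_vec _ P0 m1[OF that, of "nat (- k)"]] by simp
  qed
  have "P (vec n (\<lambda>i. if i < k then v $ i else 0))" if "k \<le> n" for k
    using that
  proof (induction k)
    case 0
    have "vec n (\<lambda>i. if i < 0 then v $ i else 0) = 0\<^sub>v n" by (intro eq_vecI) auto
    thus ?case using P0 by simp
  next
    case (Suc k)
    have "vec n (\<lambda>i. if i < Suc k then v $ i else 0) = vec n (\<lambda>i. if i < k then v $ i else 0) + v $ k \<cdot>v unit_vec n k"
      using Suc.prems by (intro eq_vecI) (auto simp: less_Suc_eq)
    thus ?case using add[OF _ _ Suc.IH m2[of k "v $ k"]] Suc.prems by simp
  qed
  from this[of n] have "P (vec n (\<lambda>i. if i < n then v $ i else 0))" by simp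
  moreover have "vec n (\<lambda>i. if i < n then v $ i else 0) = v" using v by (intro eq_vecI) auto
  ultimately show ?thesis by simp
qed

lemma additive_int_vec:
  fixes h :: "int vec \<Rightarrow> int"
  assumes add: "\<And>x y. x \<in> Vec n \<Longrightarrow> y \<in> Vec n \<Longrightarrow> h (x + y) = h x + h y" and v: "v \<in> Vec n"
  shows "h v = (\<Sum>i<n. h (unit_vec n i) * v $ i)"
  using _ _ _ v
proof (rule int_vec_induct)
  have "h (0\<^sub>v n + 0\<^sub>v n) = h (0\<^sub>v n) + h (0\<^sub>v n)" by (rule add) auto
  thus "h (0\<^sub>v n) = (\<Sum>i<n. h (unit_vec n i) * 0\<^sub>v n $ i)" by simp
  fix i assume i: "i < n"
  have "(\<Sum>j<n. h (unit_vec n j) * unit_vec n i $ j) = (\<Sum>j<n. if j = i then h (unit_vec n i) else 0)"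
    by (intro sum.cong) (use i in auto)
  thus "h (unit_vec n i) = (\<Sum>j<n. h (unit_vec n j) * unit_vec n i $ j)" using i by simp
next
  fix x y :: "int vec" assume xy: "x \<in> Vec n" "y \<in> Vec n"
    and h: "h x = (\<Sum>i<n. h (unit_vec n i) * x $ i)" "h y = (\<Sum>i<n. h (unit_vec n i) * y $ i)"
  have "h ((x - y) + y) = h (x - y) + h y" by (rule add) (use xy in auto)
  moreover have "(x - y) + y = x" using xy by (intro eq_vecI) auto
  ultimately have "h (x - y) = h x - h y" by simp
  also have "\<dots> = (\<Sum>i<n. h (unit_vec n i) * (x - y) $ i)"
    unfolding h sum_subtractf[symmetric] using xy by (intro sum.cong) (auto simp: algebra_simps)
  finally show "h (x - y) = (\<Sum>i<n. h (unit_vec n i) * (x - y) $ i)" .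
qed

lemma free_abelian_coordinates:
  assumes "fin_gen_free_abelian M"
  obtains n \<pi> where "\<pi> \<in> iso M (Zvec n)"
proof -
  obtain S :: "nat set" and \<psi> where S: "finite S" and \<psi>: "\<psi> \<in> iso M (free_Abelian_group S)"
    using assms unfolding fin_gen_free_abelian_def is_iso_def by blast
  obtain e where e: "bij_betw e {..<card S} S" using ex_bij_betw_nat_finite[OF S] by (auto simp: lessThan_atLeast0)
  define n where "n = card S"
  have eS: "e i \<in> S" if "i < n" for i using bij_betwE[OF e] that by (auto simp: n_def)
  have einj: "e i = e j \<longleftrightarrow> i = j" if "i < n" "j < n" for i j
    using bij_betw_imp_inj_on[OF e] that by (auto simp: n_def inj_on_def)
  let ?\<chi> = "\<lambda>a :: nat \<Rightarrow>\<^sub>0 int. vec n (\<lambda>i. Poly_Mapping.lookup a (e i))"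
  have "?\<chi> \<in> iso (free_Abelian_group S) (Zvec n)"
    unfolding iso_def hom_def
  proof (intro CollectI conjI ballI)
    show "?\<chi> \<in> carrier (free_Abelian_group S) \<rightarrow> carrier (Zvec n)" by (simp add: monoid_vec_def)
  next
    fix a b :: "nat \<Rightarrow>\<^sub>0 int"
    show "?\<chi> (a \<otimes>\<^bsub>free_Abelian_group S\<^esub> b) = ?\<chi> a \<otimes>\<^bsub>Zvec n\<^esub> ?\<chi> b"
      by (intro eq_vecI) (simp_all add: monoid_vec_def lookup_add)
  next
    show "bij_betw ?\<chi> (carrier (free_Abelian_group S)) (carrier (Zvec n))"
      unfolding bij_betw_def
    proof (intro conjI inj_onI)
      fix a b assume a: "a \<in> carrier (free_Abelian_group S)" and b: "b \<in> carrier (free_Abelian_group S)" and ab: "?\<chi> a = ?\<chi> b"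
      have "Poly_Mapping.lookup a s = Poly_Mapping.lookup b s" for s
      proof (cases "s \<in> S")
        case True
        then obtain i where i: "i < n" "s = e i" using bij_betw_imp_surj_on[OF e] by (auto simp: n_def)
        have "?\<chi> a $ i = ?\<chi> b $ i" unfolding ab ..
        thus ?thesis using i by simp
      next
        case False
        hence "s \<notin> Poly_Mapping.keys a" "s \<notin> Poly_Mapping.keys b" using a b by auto
        thus ?thesis by (simp add: in_keys_iff)
      qed
      thus "a = b" by (rule poly_mapping_eqI)
    next
      show "?\<chi> ` carrier (free_Abelian_group S) = carrier (Zvec n)"
      proof
        show "carrier (Zvec n) \<subseteq> ?\<chi> ` carrier (free_Abelian_group S)"
        proof
          fix v :: "int vec" assume "v \<in> carrier (Zvec n)"
          hence v: "v \<in> Vec n" by (simp add: monoid_vec_def)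
          let ?a = "\<Sum>i<n. frag_cmul (v $ i) (frag_of (e i))"
          have "?a \<in> carrier (free_Abelian_group S)"
          proof (rule sum_closed_free_Abelian_group)
            fix i assume "i \<in> {..<n}"
            hence "e i \<in> S" by (simp add: eS)
            thus "frag_cmul (v $ i) (frag_of (e i)) \<in> carrier (free_Abelian_group S)"
              using keys_cmul[of "v $ i" "frag_of (e i)"] by (auto split: if_splits)
          qed
          moreover have "Poly_Mapping.lookup ?a (e j) = v $ j" if j: "j < n" for j
          proof -
            have "Poly_Mapping.lookup ?a (e j) = (\<Sum>i<n. v $ i * Poly_Mapping.lookup (frag_of (e i)) (e j))"
              by (simp add: lookup_sum)
            also have "\<dots> = (\<Sum>i<n. if i = j then v $ j else 0)"
              by (intro sum.cong) (use einj j in \<open>auto simp: lookup_frag_of\<close>)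
            finally show ?thesis using j by simp
          qed
          hence "v = ?\<chi> ?a" using v by (intro eq_vecI) auto
          ultimately show "v \<in> ?\<chi> ` carrier (free_Abelian_group S)" by (intro image_eqI)
        qed
      qed (auto simp: monoid_vec_def)
    qed
  qed
  from iso_set_trans[OF \<psi> this] show thesis by (rule that)
qed

lemma lattice_coordinates:
  assumes L: "symmetric_bilinear_lattice M f" and C: "characteristic_form M f c"
  obtains n \<pi> A c0 where "\<pi> \<in> iso M (Zvec n)" "A \<in> Mat n n" "A\<^sup>T = A"
    "c0 \<in> Vec n" "\<forall>x\<in>carrier M. \<forall>y\<in>carrier M. f x y = bil A (\<pi> x) (\<pi> y)"
    "\<forall>x\<in>carrier M. c x = c0 \<bullet> \<pi> x" "\<forall>x\<in>Vec n. even (bil A x x - c0 \<bullet> x)"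
proof -
  have fg: "fin_gen_free_abelian M" using L by (simp add: symmetric_bilinear_lattice_def)
  obtain n \<pi> where \<pi>: "\<pi> \<in> iso M (Zvec n)" using free_abelian_coordinates[OF fg] .
  interpret M: comm_group M using fg by (simp add: fin_gen_free_abelian_def)
  define \<beta> where "\<beta> = inv_into (carrier M) \<pi>"
  have b: "bij_betw \<pi> (carrier M) (carrier_vec n)" using \<pi> by (simp add: iso_def monoid_vec_def)
  have \<pi>c: "\<pi> x \<in> Vec n" and \<beta>\<pi>: "\<beta> (\<pi> x) = x" if "x \<in> carrier M" for x
    unfolding \<beta>_def using bij_betwE[OF b] bij_betw_inv_into_left[OF b] that by auto
  have \<beta>c: "\<beta> v \<in> carrier M" and \<pi>\<beta>: "\<pi> (\<beta> v) = v" if "v \<in> Vec n" for v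
    unfolding \<beta>_def using bij_betwE[OF bij_betw_inv_into[OF b]] bij_betw_inv_into_right[OF b] that by auto
  have \<beta>h: "\<beta> \<in> hom (Zvec n) M" using M.iso_set_sym[OF \<pi>] by (simp add: \<beta>_def iso_def)
  have \<beta>add: "\<beta> (x + y) = \<beta> x \<otimes>\<^bsub>M\<^esub> \<beta> y" if "x \<in> Vec n" "y \<in> Vec n" for x y
    using hom_mult[OF \<beta>h, of x y] that by (simp add: monoid_vec_def)
  have fh: "f x \<in> hom M integer_group" and fs: "y \<in> carrier M \<Longrightarrow> f x y = f y x" if "x \<in> carrier M" for x y
    using L that by (auto simp: symmetric_bilinear_lattice_def)
  have ch: "c \<in> hom M integer_group" and ce: "\<And>x. x \<in> carrier M \<Longrightarrow> even (f x x - c x)"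
    using C by (auto simp: characteristic_form_def)
  let ?u = "\<lambda>i. \<beta> (unit_vec n i)"
  define A where "A = mat n n (\<lambda>(i, j). f (?u i) (?u j))"
  define c0 where "c0 = vec n (\<lambda>i. c (?u i))"
  have uc: "?u i \<in> carrier M" for i by (rule \<beta>c) simp
  have Ac: "A \<in> Mat n n" by (simp add: A_def)
  have As: "A\<^sup>T = A" by (intro eq_matI) (auto simp: A_def intro: fs uc)
  have lin: "h x = (\<Sum>i<n. h (?u i) * \<pi> x $ i)" if h: "h \<in> hom M integer_group" and x: "x \<in> carrier M" for h x
  proof -
    have "h (\<beta> (\<pi> x)) = (\<Sum>i<n. h (\<beta> (unit_vec n i)) * \<pi> x $ i)"
    proof (rule additive_int_vec[where h = "\<lambda>v. h (\<beta> v)"])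
      fix v w :: "int vec" assume vw: "v \<in> Vec n" "w \<in> Vec n"
      show "h (\<beta> (v + w)) = h (\<beta> v) + h (\<beta> w)"
        unfolding \<beta>add[OF vw] using hom_mult[OF h \<beta>c[OF vw(1)] \<beta>c[OF vw(2)]] by simp
    qed (rule \<pi>c[OF x])
    thus ?thesis unfolding \<beta>\<pi>[OF x] .
  qed
  have fA: "f x y = bil A (\<pi> x) (\<pi> y)" if x: "x \<in> carrier M" and y: "y \<in> carrier M" for x y
  proof -
    have "f x y = (\<Sum>j<n. f (?u j) x * \<pi> y $ j)" unfolding lin[OF fh[OF x] y] by (intro sum.cong refl arg_cong2[of _ _ _ _ "(*)"] fs x uc)
    also have "\<dots> = (\<Sum>j<n. \<pi> y $ j * (\<Sum>i<n. f (?u j) (?u i) * \<pi> x $ i))"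
      by (intro sum.cong refl) (subst lin[OF fh[OF uc] x], simp add: mult.commute)
    also have "\<dots> = bil A (\<pi> y) (\<pi> x)"
      using \<pi>c[OF x] \<pi>c[OF y] by (simp add: bil_def scalar_prod_def A_def lessThan_atLeast0)
    finally show ?thesis using bil_sym[OF Ac As \<pi>c[OF x] \<pi>c[OF y]] by simp
  qed
  have cA: "c x = c0 \<bullet> \<pi> x" if x: "x \<in> carrier M" for x
    using lin[OF ch x] \<pi>c[OF x] by (simp add: scalar_prod_def c0_def lessThan_atLeast0)
  have ev: "even (bil A x x - c0 \<bullet> x)" if x: "x \<in> Vec n" for x
    using ce[OF \<beta>c[OF x]] fA[OF \<beta>c[OF x] \<beta>c[OF x]] cA[OF \<beta>c[OF x]] by (simp add: \<pi>\<beta>[OF x])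
  have c0c: "c0 \<in> Vec n" by (simp add: c0_def)
  show thesis
  proof (rule that[OF \<pi> Ac As c0c])
    show "\<forall>x\<in>carrier M. \<forall>y\<in>carrier M. f x y = bil A (\<pi> x) (\<pi> y)" using fA by blast
    show "\<forall>x\<in>carrier M. c x = c0 \<bullet> \<pi> x" using cA by blast
    show "\<forall>x\<in>Vec n. even (bil A x x - c0 \<bullet> x)" using ev by blast
  qed
qed

definition intvec :: "rat vec \<Rightarrow> bool" where "intvec x \<longleftrightarrow> (\<forall>i<dim_vec x. x $ i \<in> \<int>)"

abbreviation ratm :: "int mat \<Rightarrow> rat mat" where "ratm \<equiv> map_mat rat_of_int"
abbreviation ratv :: "int vec \<Rightarrow> rat vec" where "ratv \<equiv> map_vec rat_of_int"

definition duals :: "int mat \<Rightarrow> rat vec set"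
  where "duals A = {x \<in> Vec (dim_row A). intvec (ratm A *v x)}"

definition qform :: "int mat \<Rightarrow> int vec \<Rightarrow> rat vec \<Rightarrow> rat"
  where "qform A c x = (bil (ratm A) x x - ratv c \<bullet> x) / 2"

lemma integral_ratv [simp]: "intvec (ratv z)" by (simp add: intvec_def)

lemma intvecE:
  assumes "intvec x" "x \<in> Vec n" obtains z where "z \<in> Vec n" "x = ratv z"
proof
  show "map_vec floor x \<in> Vec n" using assms(2) by simp
  show "x = ratv (map_vec floor x)" using assms(1) by (intro eq_vecI) (auto simp: intvec_def elim!: Ints_cases)
qed

lemma frag_eval_sum: "frag_eval g (\<Sum>i\<in>I. h i) = (\<Sum>i\<in>I. frag_eval g (h i))"
  by (induction I rule: infinite_finite_induct) (simp_all add: frag_eval_add)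

lemma transpose_ratm: "A\<^sup>T = A \<Longrightarrow> (ratm A)\<^sup>T = ratm A"
  by (metis map_mat_transpose)

text \<open>
  Every element of \<open>M \<otimes> \<rat>\<close> is the class of a unique combination \<open>\<Sum> e\<^sub>i \<otimes> q\<^sub>i\<close> of the basis vectors: the relations
  of the tensor product reduce every fragment to such a combination, and the coordinate functionals,
  extended linearly, recover the \<open>q\<^sub>i\<close>. A coset of \<open>M\<close> is thus a rational vector modulo integral vectors.
\<close>

lemma discriminant_coordinates:
  assumes L: "symmetric_bilinear_lattice M f" and C: "characteristic_form M f c"
    and \<pi>: "\<pi> \<in> iso M (Zvec n)" and A: "A \<in> Mat n n" "A\<^sup>T = A"
    and c0: "c0 \<in> Vec n" and fA: "\<And>x y. x \<in> carrier M \<Longrightarrow> y \<in> carrier M \<Longrightarrow> f x y = bil A (\<pi> x) (\<pi> y)"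
    and cA: "\<And>x. x \<in> carrier M \<Longrightarrow> c x = c0 \<bullet> \<pi> x"
  obtains \<kappa> where "\<kappa> ` duals A = carrier (discriminant_group M f)"
    "\<And>x y. x \<in> duals A \<Longrightarrow> y \<in> duals A \<Longrightarrow> \<kappa> (x + y) = \<kappa> x \<otimes>\<^bsub>discriminant_group M f\<^esub> \<kappa> y"
    "\<And>x y. x \<in> duals A \<Longrightarrow> y \<in> duals A \<Longrightarrow> \<kappa> x = \<kappa> y \<longleftrightarrow> intvec (x - y)"
    "\<And>x. x \<in> duals A \<Longrightarrow> discriminant_quadratic f c (\<kappa> x) = mod_Ints (qform A c0 x)"
proof -
  have CM: "comm_group M" using L by (simp add: symmetric_bilinear_lattice_def fin_gen_free_abelian_def)
  interpret M: comm_group M by (rule CM)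
  define \<beta> where "\<beta> = inv_into (carrier M) \<pi>"
  have b: "bij_betw \<pi> (carrier M) (carrier_vec n)" using \<pi> by (simp add: iso_def monoid_vec_def)
  have \<pi>c: "\<pi> x \<in> Vec n" and \<beta>\<pi>: "\<beta> (\<pi> x) = x" if "x \<in> carrier M" for x
    unfolding \<beta>_def using bij_betwE[OF b] bij_betw_inv_into_left[OF b] that by auto
  have \<beta>c: "\<beta> v \<in> carrier M" and \<pi>\<beta>: "\<pi> (\<beta> v) = v" if "v \<in> Vec n" for v
    unfolding \<beta>_def using bij_betwE[OF bij_betw_inv_into[OF b]] bij_betw_inv_into_right[OF b] that by auto
  have \<beta>h: "\<beta> \<in> hom (Zvec n) M" using M.iso_set_sym[OF \<pi>] by (simp add: \<beta>_def iso_def)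
  have \<beta>add: "\<beta> (x + y) = \<beta> x \<otimes>\<^bsub>M\<^esub> \<beta> y" if "x \<in> Vec n" "y \<in> Vec n" for x y
    using hom_mult[OF \<beta>h, of x y] that by (simp add: monoid_vec_def)
  have \<pi>add: "\<pi> (x \<otimes>\<^bsub>M\<^esub> y) = \<pi> x + \<pi> y" if "x \<in> carrier M" "y \<in> carrier M" for x y
    using \<pi> that by (simp add: iso_def hom_def monoid_vec_def)
  let ?F = "free_Abelian_group (carrier M \<times> (UNIV :: rat set))"
  let ?K = "tensor_kernel M"
  let ?T = "rat_tensor M"
  define cs where "cs a = ?K #>\<^bsub>?F\<^esub> a" for a
  define u where "u i = \<beta> (unit_vec n i)" for i
  define rep where "rep g = (\<Sum>i<n. frag_of (u i, g i :: rat))" for g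
  have uc: "u i \<in> carrier M" for i unfolding u_def by (rule \<beta>c) simp
  have Ks: "subgroup ?K ?F" by (rule tensor_kernel_subgroup[OF CM])
  have KF: "?K \<subseteq> carrier ?F" by (rule subgroup.subset[OF Ks])
  have K0: "0 \<in> ?K" using subgroup.one_closed[OF Ks] by simp
  have Kadd: "a + a' \<in> ?K" if "a \<in> ?K" "a' \<in> ?K" for a a' using subgroup.m_closed[OF Ks that] by simp
  have Kneg: "- a \<in> ?K" if "a \<in> ?K" for a using subgroup.m_inv_closed[OF Ks that] that KF by auto
  have Kdiff: "a - a' \<in> ?K" if "a \<in> ?K" "a' \<in> ?K" for a a' using Kadd[OF that(1) Kneg[OF that(2)]] by simp
  have Ksum: "(\<Sum>i\<in>I. h i) \<in> ?K" if "\<And>i. i \<in> I \<Longrightarrow> h i \<in> ?K" for h and I :: "nat set"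
    using that by (induction I rule: infinite_finite_induct) (auto intro: K0 Kadd)
  have cs_eq: "cs a = cs a'" if "a - a' \<in> ?K" "a' \<in> carrier ?F" for a a'
  proof -
    have "a \<in> ?K #>\<^bsub>?F\<^esub> a'" using that(1) by (force simp: r_coset_def intro: bexI[of _ "a - a'"])
    from group.repr_independence[OF group_free_Abelian_group this that(2) Ks] show ?thesis by (simp add: cs_def)
  qed
  have rel1: "frag_of (x \<otimes>\<^bsub>M\<^esub> y, q) - frag_of (x, q) - frag_of (y, q) \<in> ?K" if "x \<in> carrier M" "y \<in> carrier M" for x y q
    unfolding tensor_kernel_def by (rule generate.incl) (use that in \<open>auto simp: tensor_relations_def\<close>)
  have rel2: "frag_of (x, q + r) - frag_of (x, q) - frag_of (x, r) \<in> ?K" if "x \<in> carrier M" for x q r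
    unfolding tensor_kernel_def tensor_relations_def by (rule generate.incl, rule UnI2) (use that in blast)
  have z2: "frag_of (x, 0) \<in> ?K" if "x \<in> carrier M" for x using Kneg[OF rel2[OF that, of 0 0]] by simp
  have repF: "rep g \<in> carrier ?F" for g unfolding rep_def by (rule sum_closed_free_Abelian_group) (simp add: uc)
  have rep_add: "rep (\<lambda>i. g i + h i) - (rep g + rep h) \<in> ?K" for g h
  proof -
    have "(\<Sum>i<n. frag_of (u i, g i + h i) - frag_of (u i, g i) - frag_of (u i, h i)) \<in> ?K"
      by (rule Ksum) (rule rel2[OF uc])
    thus ?thesis by (simp add: rep_def sum_subtractf sum.distrib algebra_simps)
  qed
  have main1: "frag_of (\<beta> v, q) - rep (\<lambda>i. q * of_int (v $ i)) \<in> ?K" if "v \<in> Vec n" for v q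
    using _ _ _ that
  proof (rule int_vec_induct)
    have "\<beta> (0\<^sub>v n + 0\<^sub>v n) = \<beta> (0\<^sub>v n) \<otimes>\<^bsub>M\<^esub> \<beta> (0\<^sub>v n)" by (rule \<beta>add) auto
    hence "frag_of (\<beta> (0\<^sub>v n), q) \<in> ?K"
      using Kneg[OF rel1[of "\<beta> (0\<^sub>v n)" "\<beta> (0\<^sub>v n)" q]] \<beta>c[of "0\<^sub>v n"] by simp
    moreover have "rep (\<lambda>i. q * of_int ((0\<^sub>v n :: int vec) $ i)) \<in> ?K" unfolding rep_def by (rule Ksum) (simp add: z2 uc)
    ultimately show "frag_of (\<beta> (0\<^sub>v n), q) - rep (\<lambda>i. q * of_int ((0\<^sub>v n :: int vec) $ i)) \<in> ?K" by (rule Kdiff)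
  next
    fix j assume j: "j < n"
    have "rep (\<lambda>i. q * of_int ((unit_vec n j :: int vec) $ i)) = frag_of (u j, q) + (\<Sum>i\<in>{..<n} - {j}. frag_of (u i, 0))"
      unfolding rep_def using j by (subst sum.remove[of _ j]) (auto intro!: sum.cong)
    moreover have "(\<Sum>i\<in>{..<n} - {j}. frag_of (u i, 0)) \<in> ?K" by (rule Ksum) (rule z2[OF uc])
    ultimately show "frag_of (\<beta> (unit_vec n j), q) - rep (\<lambda>i. q * of_int ((unit_vec n j :: int vec) $ i)) \<in> ?K"
      using Kneg by (simp add: u_def)
  next
    fix x y :: "int vec" assume xy: "x \<in> Vec n" "y \<in> Vec n"
    assume P: "frag_of (\<beta> x, q) - rep (\<lambda>i. q * of_int (x $ i)) \<in> ?K" "frag_of (\<beta> y, q) - rep (\<lambda>i. q * of_int (y $ i)) \<in> ?K"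
    have "(x - y) + y = x" using xy by (intro eq_vecI) auto
    hence 1: "frag_of (\<beta> x, q) - frag_of (\<beta> (x - y), q) - frag_of (\<beta> y, q) \<in> ?K"
      using rel1[OF \<beta>c \<beta>c, of "x - y" y q] \<beta>add[of "x - y" y] xy by simp
    have "rep (\<lambda>i. q * of_int ((x - y) $ i) + q * of_int (y $ i)) = rep (\<lambda>i. q * of_int (x $ i))"
      unfolding rep_def using xy by (intro sum.cong) (auto simp: algebra_simps)
    hence 2: "rep (\<lambda>i. q * of_int (x $ i)) - (rep (\<lambda>i. q * of_int ((x - y) $ i)) + rep (\<lambda>i. q * of_int (y $ i))) \<in> ?K"
      using rep_add[of "\<lambda>i. q * of_int ((x - y) $ i)" "\<lambda>i. q * of_int (y $ i)"] by simp
    show "frag_of (\<beta> (x - y), q) - rep (\<lambda>i. q * of_int ((x - y) $ i)) \<in> ?K"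
      using Kadd[OF Kdiff[OF Kdiff[OF P] 1] 2] by (simp add: algebra_simps)
  qed
  define E where "E i a = frag_eval (\<lambda>(x, q). q * of_int (\<pi> x $ i)) a" for i a
  have main2: "a - rep (\<lambda>i. E i a) \<in> ?K" if "a \<in> carrier ?F" for a
  proof -
    have "Poly_Mapping.keys a \<subseteq> carrier M \<times> UNIV" using that by simp
    thus ?thesis
    proof (induction a rule: frag_induction)
      case zero show ?case unfolding rep_def E_def by (simp add: Kneg Ksum z2 uc)
    next
      case (one p)
      then obtain x q where p: "p = (x, q)" "x \<in> carrier M" by auto
      show ?case using main1[OF \<pi>c[OF p(2)], of q] by (simp add: p E_def \<beta>\<pi>)
    next
      case (diff a a')
      have "rep (\<lambda>i. E i (a - a') + E i a') = rep (\<lambda>i. E i a)" by (simp add: E_def frag_eval_diff)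
      hence "rep (\<lambda>i. E i a) - (rep (\<lambda>i. E i (a - a')) + rep (\<lambda>i. E i a')) \<in> ?K"
        using rep_add[of "\<lambda>i. E i (a - a')" "\<lambda>i. E i a'"] by simp
      from Kadd[OF Kdiff[OF diff] this] show ?case by (simp add: algebra_simps)
    qed
  qed
  define \<iota> where "\<iota> p = cs (rep (\<lambda>i. p $ i))" for p
  have \<iota>T: "\<iota> p \<in> carrier ?T" for p
    using repF by (auto simp: \<iota>_def cs_def rat_tensor_def FactGroup_def RCOSETS_def)
  have \<iota>mult: "\<iota> p \<otimes>\<^bsub>?T\<^esub> \<iota> q = \<iota> (p + q)" if "p \<in> Vec n" "q \<in> Vec n" for p q
  proof -
    have "rep (\<lambda>i. (p + q) $ i) = rep (\<lambda>i. p $ i + q $ i)" unfolding rep_def using that by (intro sum.cong) auto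
    hence "cs (rep (\<lambda>i. (p + q) $ i)) = cs (rep (\<lambda>i. p $ i) + rep (\<lambda>i. q $ i))"
      using rep_add[of "\<lambda>i. p $ i" "\<lambda>i. q $ i"] subgroup.m_closed[OF group.subgroup_self[OF group_free_Abelian_group] repF repF]
      by (intro cs_eq) (simp_all del: carrier_free_Abelian_group_iff)
    thus ?thesis unfolding \<iota>_def using mult_rat_tensor_coset[OF CM repF repF] by (simp add: cs_def)
  qed
  have surj: "\<exists>p\<in>Vec n. t = \<iota> p" if t: "t \<in> carrier ?T" for t
  proof -
    obtain a where a: "a \<in> carrier ?F" "t = cs a" using carrier_rat_tensorE[OF t] unfolding cs_def .
    have "rep (\<lambda>i. vec n (\<lambda>i. E i a) $ i) = rep (\<lambda>i. E i a)" unfolding rep_def by (intro sum.cong) auto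
    hence "t = \<iota> (vec n (\<lambda>i. E i a))" unfolding a(2) \<iota>_def using cs_eq[OF main2[OF a(1)] repF] by simp
    thus ?thesis by (intro bexI[of _ "vec n (\<lambda>i. E i a)"]) auto
  qed
  have pure: "pure_tensor M x 1 = \<iota> (ratv (\<pi> x))" if x: "x \<in> carrier M" for x
  proof -
    have "rep (\<lambda>i. ratv (\<pi> x) $ i) = rep (\<lambda>i. 1 * of_int (\<pi> x $ i))"
      unfolding rep_def using \<pi>c[OF x] by (intro sum.cong) auto
    thus ?thesis using cs_eq[OF main1[OF \<pi>c[OF x], of 1] repF] by (simp add: \<iota>_def pure_tensor_def cs_def \<beta>\<pi>[OF x])
  qed
  have lin: "linear_ext h (\<iota> p) = (\<Sum>i<n. p $ i * of_int (h (u i)))" if "h \<in> hom M integer_group" for h p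
    unfolding \<iota>_def cs_def linear_ext_coset[OF CM that] rep_def frag_eval_sum by simp
  have \<pi>h: "(\<lambda>x. \<pi> x $ i) \<in> hom M integer_group" if "i < n" for i
  proof (rule homI)
    fix x y assume x: "x \<in> carrier M" and y: "y \<in> carrier M"
    show "\<pi> (x \<otimes>\<^bsub>M\<^esub> y) $ i = \<pi> x $ i \<otimes>\<^bsub>integer_group\<^esub> \<pi> y $ i"
      using that \<pi>c[OF x] \<pi>c[OF y] by (simp add: \<pi>add[OF x y])
  qed simp
  have inj: "p = q" if "p \<in> Vec n" "q \<in> Vec n" "\<iota> p = \<iota> q" for p q
  proof (rule eq_vecI)
    fix i assume "i < dim_vec q"
    hence i: "i < n" using that by simp
    have "linear_ext (\<lambda>x. \<pi> x $ i) (\<iota> r) = r $ i" for r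
    proof -
      have "linear_ext (\<lambda>x. \<pi> x $ i) (\<iota> r) = (\<Sum>j<n. r $ j * of_int ((unit_vec n j :: int vec) $ i))"
        unfolding lin[OF \<pi>h[OF i]] by (simp add: u_def \<pi>\<beta>)
      also have "\<dots> = (\<Sum>j<n. if j = i then r $ i else 0)" by (intro sum.cong) (use i in auto)
      finally show ?thesis using i by simp
    qed
    thus "p $ i = q $ i" using that(3) by metis
  qed (use that in simp)
  have bilx: "bilinear_ext f (\<iota> p) (\<iota> q) = bil (ratm A) p q" if "p \<in> Vec n" "q \<in> Vec n" for p q
  proof -
    have "bilinear_ext f (\<iota> p) (\<iota> q) = (\<Sum>i<n. \<Sum>j<n. p $ i * q $ j * of_int (f (u i) (u j)))"
      unfolding \<iota>_def cs_def bilinear_ext_coset[OF L repF repF] unfolding rep_def frag_eval_sum by (simp add: frag_eval_sum)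
    also have "\<dots> = (\<Sum>i<n. p $ i * (\<Sum>j<n. of_int (A $$ (i, j)) * q $ j))"
      unfolding sum_distrib_left
    proof (intro sum.cong refl)
      fix i j assume "i \<in> {..<n}" "j \<in> {..<n}"
      hence ij: "i < n" "j < n" by auto
      have "f (u i) (u j) = bil A (unit_vec n i) (unit_vec n j)" using fA[OF uc uc] by (simp add: u_def \<pi>\<beta>)
      also have "\<dots> = A $$ (i, j)" unfolding bil_def mult_unit_vec_col[OF A(1) ij(2)]
        using ij A(1) scalar_prod_left_unit[of "col A j" n i] by simp
      finally show "p $ i * q $ j * of_int (f (u i) (u j)) = p $ i * (of_int (A $$ (i, j)) * q $ j)" by simp
    qed
    also have "\<dots> = bil (ratm A) p q" using that A(1) by (simp add: bil_def scalar_prod_def lessThan_atLeast0)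
    finally show ?thesis .
  qed
  have cx: "linear_ext c (\<iota> p) = ratv c0 \<bullet> p" if p: "p \<in> Vec n" for p
  proof -
    have "c (u i) = c0 $ i" if "i < n" for i using cA[OF uc] that c0 scalar_prod_right_unit[OF that, of c0] by (simp add: u_def \<pi>\<beta>)
    moreover have "c \<in> hom M integer_group" using C by (simp add: characteristic_form_def)
    ultimately show ?thesis using p c0 lin[of c p] by (simp add: scalar_prod_def lessThan_atLeast0 mult.commute)
  qed
  have Aq: "ratm A \<in> Mat n n" using A by simp
  have dual: "\<iota> p \<in> dual_lattice M f \<longleftrightarrow> p \<in> duals A" if p: "p \<in> Vec n" for p
  proof -
    have Ap: "ratm A *v p \<in> Vec n" using Aq p by simp
    have e: "bilinear_ext f (\<iota> p) (pure_tensor M x 1) = ratv (\<pi> x) \<bullet> (ratm A *v p)" if x: "x \<in> carrier M" for x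
      unfolding pure[OF x] using bilx[OF p, of "ratv (\<pi> x)"] bil_sym[OF Aq transpose_ratm[OF A(2)] p, of "ratv (\<pi> x)"] \<pi>c[OF x]
      by (simp add: bil_def)
    have "(\<forall>x\<in>carrier M. ratv (\<pi> x) \<bullet> (ratm A *v p) \<in> \<int>) \<longleftrightarrow> intvec (ratm A *v p)"
    proof
      assume h: "\<forall>x\<in>carrier M. ratv (\<pi> x) \<bullet> (ratm A *v p) \<in> \<int>"
      show "intvec (ratm A *v p)" unfolding intvec_def
      proof (intro allI impI)
        fix i assume "i < dim_vec (ratm A *v p)"
        hence i: "i < n" using Ap by (metis carrier_vecD)
        have "ratv (\<pi> (u i)) = unit_vec n i" unfolding u_def by (subst \<pi>\<beta>) (use i in \<open>auto intro!: eq_vecI\<close>)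
        thus "(ratm A *v p) $ i \<in> \<int>" using h[rule_format, OF uc[of i]] scalar_prod_left_unit[OF Ap i] by simp
      qed
    next
      assume h: "intvec (ratm A *v p)"
      show "\<forall>x\<in>carrier M. ratv (\<pi> x) \<bullet> (ratm A *v p) \<in> \<int>"
      proof
        fix x assume x: "x \<in> carrier M"
        have "(ratv (\<pi> x) $ i) * (ratm A *v p) $ i \<in> \<int>" if "i < n" for i
        proof (rule Ints_mult)
          show "ratv (\<pi> x) $ i \<in> \<int>" using \<pi>c[OF x] that by simp
          show "(ratm A *v p) $ i \<in> \<int>" using h that unfolding intvec_def carrier_vecD[OF Ap] by blast
        qed
        thus "ratv (\<pi> x) \<bullet> (ratm A *v p) \<in> \<int>"
          unfolding scalar_prod_def carrier_vecD[OF Ap] by (intro Ints_sum) simp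
      qed
    qed
    thus ?thesis using \<iota>T[of p] p A e unfolding dual_lattice_def duals_def by auto
  qed
  let ?D = "?T\<lparr>carrier := dual_lattice M f\<rparr>"
  let ?H = "(\<lambda>x. pure_tensor M x 1) ` carrier M"
  have Hz: "?H = \<iota> ` {z \<in> Vec n. intvec z}"
  proof (intro Set.set_eqI iffI)
    fix t assume "t \<in> ?H" thus "t \<in> \<iota> ` {z \<in> Vec n. intvec z}" using pure \<pi>c by auto
  next
    fix t assume "t \<in> \<iota> ` {z \<in> Vec n. intvec z}"
    then obtain z where z: "z \<in> Vec n" "intvec z" "t = \<iota> z" by blast
    obtain w where w: "w \<in> Vec n" "z = ratv w" using intvecE[OF z(2,1)] .
    have "t = pure_tensor M (\<beta> w) 1" using pure[OF \<beta>c[OF w(1)]] by (simp add: z w \<pi>\<beta>)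
    thus "t \<in> ?H" using \<beta>c[OF w(1)] by blast
  qed
  define \<kappa> where "\<kappa> p = ?H #>\<^bsub>?D\<^esub> \<iota> p" for p
  have \<kappa>: "\<kappa> p = \<iota> ` {z + p | z. z \<in> Vec n \<and> intvec z}" if p: "p \<in> Vec n" for p
  proof -
    have "\<kappa> p = (\<lambda>z. \<iota> z \<otimes>\<^bsub>?T\<^esub> \<iota> p) ` {z \<in> Vec n. intvec z}"
      unfolding \<kappa>_def Hz r_coset_def by auto
    also have "\<dots> = (\<lambda>z. \<iota> (z + p)) ` {z \<in> Vec n. intvec z}"
      by (intro image_cong refl) (simp add: \<iota>mult[OF _ p])
    also have "\<dots> = \<iota> ` {z + p | z. z \<in> Vec n \<and> intvec z}" by blast
    finally show ?thesis .
  qed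
  have dualc: "p \<in> Vec n" if "p \<in> duals A" for p using that A by (auto simp: duals_def)
  have G: "carrier (discriminant_group M f) = {?H #>\<^bsub>?D\<^esub> t | t. t \<in> dual_lattice M f}"
    by (auto simp: discriminant_group_def FactGroup_def RCOSETS_def)
  show thesis
  proof (rule that[of \<kappa>])
    show "\<kappa> ` duals A = carrier (discriminant_group M f)"
      unfolding G
    proof (intro Set.set_eqI iffI)
      fix X assume "X \<in> {?H #>\<^bsub>?D\<^esub> t | t. t \<in> dual_lattice M f}"
      then obtain t where t: "X = ?H #>\<^bsub>?D\<^esub> t" "t \<in> dual_lattice M f" by blast
      then obtain p where p: "p \<in> Vec n" "t = \<iota> p" using surj[of t] by (auto simp: dual_lattice_def)
      show "X \<in> \<kappa> ` duals A" using dual[OF p(1)] t p by (auto simp: \<kappa>_def)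
    qed (use dual dualc in \<open>auto simp: \<kappa>_def\<close>)
  next
    fix x y assume "x \<in> duals A" "y \<in> duals A"
    hence x: "x \<in> Vec n" and y: "y \<in> Vec n" by (simp_all add: dualc)
    have "\<kappa> x \<otimes>\<^bsub>discriminant_group M f\<^esub> \<kappa> y = {s \<otimes>\<^bsub>?T\<^esub> t | s t. s \<in> \<kappa> x \<and> t \<in> \<kappa> y}"
      by (auto simp: discriminant_group_def FactGroup_def set_mult_def)
    also have "\<dots> = \<kappa> (x + y)"
    proof (intro Set.set_eqI iffI)
      fix r assume "r \<in> {s \<otimes>\<^bsub>?T\<^esub> t | s t. s \<in> \<kappa> x \<and> t \<in> \<kappa> y}"
      then obtain z w where z: "z \<in> Vec n" "intvec z" "w \<in> Vec n" "intvec w" "r = \<iota> (z + x) \<otimes>\<^bsub>?T\<^esub> \<iota> (w + y)"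
        unfolding \<kappa>[OF x] \<kappa>[OF y] by blast
      have "r = \<iota> ((z + x) + (w + y))" unfolding z(5) by (rule \<iota>mult) (use z x y in auto)
      moreover have "(z + x) + (w + y) = (z + w) + (x + y)" using z x y by (intro eq_vecI) auto
      moreover have "intvec (z + w)" using z by (auto simp: intvec_def)
      ultimately show "r \<in> \<kappa> (x + y)" unfolding \<kappa>[OF add_carrier_vec[OF x y]] using z by (intro image_eqI[of _ _ "(z + w) + (x + y)"]) auto
    next
      fix r assume "r \<in> \<kappa> (x + y)"
      then obtain z where z: "z \<in> Vec n" "intvec z" "r = \<iota> (z + (x + y))" unfolding \<kappa>[OF add_carrier_vec[OF x y]] by blast
      have "r = \<iota> ((z + x) + (0\<^sub>v n + y))" unfolding z(3) by (rule arg_cong[of _ _ \<iota>]) (use z x y in \<open>auto intro!: eq_vecI\<close>)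
      also have "\<dots> = \<iota> (z + x) \<otimes>\<^bsub>?T\<^esub> \<iota> (0\<^sub>v n + y)" by (rule \<iota>mult[symmetric]) (use z x y in auto)
      finally have 1: "r = \<iota> (z + x) \<otimes>\<^bsub>?T\<^esub> \<iota> (0\<^sub>v n + y)" .
      have 2: "\<iota> (z + x) \<in> \<kappa> x" unfolding \<kappa>[OF x] using z by blast
      have "intvec (0\<^sub>v n)" by (simp add: intvec_def)
      hence "\<iota> (0\<^sub>v n + y) \<in> \<kappa> y" unfolding \<kappa>[OF y] by (intro imageI CollectI exI[of _ "0\<^sub>v n"]) simp
      thus "r \<in> {s \<otimes>\<^bsub>?T\<^esub> t | s t. s \<in> \<kappa> x \<and> t \<in> \<kappa> y}" using 1 2 by blast
    qed
    finally show "\<kappa> (x + y) = \<kappa> x \<otimes>\<^bsub>discriminant_group M f\<^esub> \<kappa> y" ..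
    show "\<kappa> x = \<kappa> y \<longleftrightarrow> intvec (x - y)"
    proof
      assume eq: "\<kappa> x = \<kappa> y"
      have "intvec (0\<^sub>v n)" by (simp add: intvec_def)
      hence "\<iota> (0\<^sub>v n + x) \<in> \<kappa> x" unfolding \<kappa>[OF x] by (intro imageI CollectI exI[of _ "0\<^sub>v n"]) simp
      then obtain z where z: "z \<in> Vec n" "intvec z" "\<iota> (0\<^sub>v n + x) = \<iota> (z + y)" unfolding eq \<kappa>[OF y] by blast
      have "0\<^sub>v n + x = z + y" by (rule inj[OF _ _ z(3)]) (use x y z in auto)
      hence "(0\<^sub>v n + x) $ i = (z + y) $ i" for i by simp
      hence "x - y = z" using x y z by (intro eq_vecI) (auto simp: algebra_simps)
      thus "intvec (x - y)" using z by simp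
    next
      assume i: "intvec (x - y)"
      have 1: "{z + x | z. z \<in> Vec n \<and> intvec z} = {z + y | z. z \<in> Vec n \<and> intvec z}"
      proof (intro Set.set_eqI iffI)
        fix t assume "t \<in> {z + x | z. z \<in> Vec n \<and> intvec z}"
        then obtain z where z: "t = z + x" "z \<in> Vec n" "intvec z" by blast
        have "t = (z + (x - y)) + y" unfolding z using z x y by (intro eq_vecI) auto
        moreover have "intvec (z + (x - y))" using z i x y by (auto simp: intvec_def)
        moreover have "z + (x - y) \<in> Vec n" using z x y by simp
        ultimately show "t \<in> {z + y | z. z \<in> Vec n \<and> intvec z}" by blast
      next
        fix t assume "t \<in> {z + y | z. z \<in> Vec n \<and> intvec z}"
        then obtain z where z: "t = z + y" "z \<in> Vec n" "intvec z" by blast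
        have "t = (z - (x - y)) + x" unfolding z using z x y by (intro eq_vecI) auto
        moreover have "intvec (z - (x - y))" using z i x y by (auto simp: intvec_def)
        moreover have "z - (x - y) \<in> Vec n" using z x y by simp
        ultimately show "t \<in> {z + x | z. z \<in> Vec n \<and> intvec z}" by blast
      qed
      show "\<kappa> x = \<kappa> y" unfolding \<kappa>[OF x] \<kappa>[OF y] 1 ..
    qed
  next
    fix x assume x: "x \<in> duals A"
    have xc: "x \<in> Vec n" by (rule dualc[OF x])
    have "discriminant_quadratic f c (\<kappa> x) = mod_Ints ((bilinear_ext f (\<iota> x) (\<iota> x) - linear_ext c (\<iota> x)) / 2)"
      unfolding \<kappa>_def by (rule discriminant_quadratic_coset[OF L C]) (use dual[OF xc] x in simp)
    thus "discriminant_quadratic f c (\<kappa> x) = mod_Ints (qform A c0 x)" unfolding bilx[OF xc xc] cx[OF xc] qform_def .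
  qed
qed

section \<open>Isomorphisms of discriminants as maps of rational vectors\<close>

lemma integral_add: "intvec x \<Longrightarrow> intvec y \<Longrightarrow> dim_vec x = dim_vec y \<Longrightarrow> intvec (x + y)"
  by (simp add: intvec_def)

lemma integral_trans:
  assumes "intvec (x - y)" "intvec (y - z)" "x \<in> Vec n" "y \<in> Vec n" "z \<in> Vec n"
  shows "intvec (x - z)"
proof -
  have "x - z = (x - y) + (y - z)" using assms(3-5) by (intro eq_vecI) auto
  thus ?thesis using integral_add[OF assms(1,2)] assms(3-5) by simp
qed

lemma integral_sym:
  assumes "intvec (x - y)" "x \<in> Vec n" "y \<in> Vec n" shows "intvec (y - x)"
  unfolding intvec_def
proof (intro allI impI)
  fix i assume "i < dim_vec (y - x)"
  hence "(x - y) $ i \<in> \<int>" "(y - x) $ i = - ((x - y) $ i)" using assms by (auto simp: intvec_def)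
  thus "(y - x) $ i \<in> \<int>" by simp
qed

lemma ratm_mult_ratv: "A \<in> Mat m n \<Longrightarrow> z \<in> Vec n \<Longrightarrow> ratm A *v ratv z = ratv (A *v z)"
  by (rule of_int_hom.mult_mat_vec_hom[symmetric])

lemma ratm_mult: "A \<in> Mat m n \<Longrightarrow> B \<in> Mat n k \<Longrightarrow> ratm (A * B) = ratm A * ratm B"
  by (rule of_int_hom.mat_hom_mult)

lemma scalar_prod_ratv: "dim_vec x = dim_vec y \<Longrightarrow> ratv x \<bullet> ratv y = of_int (x \<bullet> y)"
  by (simp add: scalar_prod_def)

lemma integral_mult_mat:
  assumes "A \<in> Mat m n" "intvec x" "x \<in> Vec n" shows "intvec (ratm A *v x)"
proof -
  obtain z where z: "z \<in> Vec n" "x = ratv z" using intvecE[OF assms(2,3)] .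
  show ?thesis unfolding z(2) ratm_mult_ratv[OF assms(1) z(1)] by simp
qed

lemma integral_scalar_prod:
  assumes "intvec x" "intvec y" "x \<in> Vec n" "y \<in> Vec n" shows "x \<bullet> y \<in> \<int>"
proof -
  obtain z where z: "z \<in> Vec n" "x = ratv z" using intvecE[OF assms(1,3)] .
  obtain w where w: "w \<in> Vec n" "y = ratv w" using intvecE[OF assms(2,4)] .
  show ?thesis unfolding z(2) w(2) using z w by (subst scalar_prod_ratv) auto
qed

lemma mem_duals: "A \<in> Mat n n \<Longrightarrow> x \<in> duals A \<longleftrightarrow> x \<in> Vec n \<and> intvec (ratm A *v x)"
  by (auto simp: duals_def)

lemma duals_add:
  assumes A: "A \<in> Mat n n" and x: "x \<in> duals A" and y: "y \<in> duals A" shows "x + y \<in> duals A"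
proof -
  have c: "x \<in> Vec n" "y \<in> Vec n" "intvec (ratm A *v x)" "intvec (ratm A *v y)"
    using x y by (auto simp: mem_duals[OF A])
  have "ratm A *v (x + y) = ratm A *v x + ratm A *v y" by (rule mult_add_distrib_mat_vec[OF _ c(1,2)]) (use A in simp)
  thus ?thesis using c integral_add[OF c(3,4)] by (simp add: mem_duals[OF A])
qed

lemma integral_duals: "A \<in> Mat n n \<Longrightarrow> intvec x \<Longrightarrow> x \<in> Vec n \<Longrightarrow> x \<in> duals A"
  by (simp add: mem_duals integral_mult_mat)

text \<open>
  A homomorphism of discriminant groups that respects the quadratic functions, lifted to rational
  vectors. The lift is not additive; it is so modulo integral vectors.
\<close>

definition disc_map :: "int mat \<Rightarrow> int vec \<Rightarrow> int mat \<Rightarrow> int vec \<Rightarrow> (rat vec \<Rightarrow> rat vec) \<Rightarrow> bool"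
  where "disc_map A c A' c' g \<longleftrightarrow>
    (\<forall>x\<in>duals A. g x \<in> duals A' \<and> qform A' c' (g x) - qform A c x \<in> \<int>) \<and>
    (\<forall>x\<in>duals A. \<forall>y\<in>duals A. intvec (g (x + y) - (g x + g y)) \<and>
      (intvec (x - y) \<longrightarrow> intvec (g x - g y)))"

definition disc_equiv :: "int mat \<Rightarrow> int vec \<Rightarrow> int mat \<Rightarrow> int vec \<Rightarrow> bool"
  where "disc_equiv A c A' c' \<longleftrightarrow>
    (\<exists>g h. disc_map A c A' c' g \<and> disc_map A' c' A c h \<and>
      (\<forall>x\<in>duals A. intvec (h (g x) - x)) \<and> (\<forall>y\<in>duals A'. intvec (g (h y) - y)))"

lemma disc_mapD:
  assumes "disc_map A c A' c' g" "x \<in> duals A"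
  shows "g x \<in> duals A'" "qform A' c' (g x) - qform A c x \<in> \<int>"
    "y \<in> duals A \<Longrightarrow> intvec (g (x + y) - (g x + g y))"
    "y \<in> duals A \<Longrightarrow> intvec (x - y) \<Longrightarrow> intvec (g x - g y)"
  using assms unfolding disc_map_def by blast+

lemma disc_equiv_sym: "disc_equiv A c A' c' \<Longrightarrow> disc_equiv A' c' A c"
  unfolding disc_equiv_def by blast

lemma disc_map_comp:
  assumes A: "A \<in> Mat n n" and A': "A' \<in> Mat n' n'" and A'': "A'' \<in> Mat n'' n''"
    and g: "disc_map A c A' c' g" and g': "disc_map A' c' A'' c'' g'"
  shows "disc_map A c A'' c'' (\<lambda>x. g' (g x))"
  unfolding disc_map_def
proof (intro conjI ballI impI)
  fix x assume x: "x \<in> duals A"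
  note gx = disc_mapD[OF g x]
  note ggx = disc_mapD[OF g' gx(1)]
  show "g' (g x) \<in> duals A''" by (rule ggx(1))
  have "(qform A'' c'' (g' (g x)) - qform A' c' (g x)) + (qform A' c' (g x) - qform A c x) \<in> \<int>" by (rule Ints_add[OF ggx(2) gx(2)])
  thus "qform A'' c'' (g' (g x)) - qform A c x \<in> \<int>" by simp
  fix y assume y: "y \<in> duals A"
  note gy = disc_mapD[OF g y]
  show "intvec (g' (g x) - g' (g y))" if "intvec (x - y)" by (rule ggx(4)[OF gy(1) gx(4)[OF y that]])
  show "intvec (g' (g (x + y)) - (g' (g x) + g' (g y)))"
  proof -
    have True: "x + y \<in> duals A" by (rule duals_add[OF A x y])
    have s: "g x + g y \<in> duals A'" by (rule duals_add[OF A' gx(1) gy(1)])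
    have "intvec (g' (g (x + y)) - g' (g x + g y))"
      by (rule disc_mapD(4)[OF g' disc_mapD(1)[OF g True] s gx(3)[OF y]])
    moreover have "intvec (g' (g x + g y) - (g' (g x) + g' (g y)))" by (rule ggx(3)[OF gy(1)])
    moreover have "g' (g (x + y)) \<in> Vec n''" "g' (g x + g y) \<in> Vec n''" "g' (g x) + g' (g y) \<in> Vec n''"
      using disc_mapD(1)[OF g' disc_mapD(1)[OF g True]] disc_mapD(1)[OF g' s]
        duals_add[OF A'' ggx(1) disc_mapD(1)[OF g' gy(1)]] by (simp_all add: mem_duals[OF A''])
    ultimately show ?thesis by (rule integral_trans)
  qed
qed

lemma disc_equiv_trans:
  assumes A: "A \<in> Mat n n" and A': "A' \<in> Mat n' n'" and A'': "A'' \<in> Mat n'' n''"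
    and 1: "disc_equiv A c A' c'" and 2: "disc_equiv A' c' A'' c''"
  shows "disc_equiv A c A'' c''"
proof -
  obtain g h where g: "disc_map A c A' c' g" and h: "disc_map A' c' A c h"
    and hg: "\<And>x. x \<in> duals A \<Longrightarrow> intvec (h (g x) - x)" and gh: "\<And>x. x \<in> duals A' \<Longrightarrow> intvec (g (h x) - x)"
    using 1 unfolding disc_equiv_def by blast
  obtain g' h' where g': "disc_map A' c' A'' c'' g'" and h': "disc_map A'' c'' A' c' h'"
    and hg': "\<And>x. x \<in> duals A' \<Longrightarrow> intvec (h' (g' x) - x)" and gh': "\<And>x. x \<in> duals A'' \<Longrightarrow> intvec (g' (h' x) - x)"
    using 2 unfolding disc_equiv_def by blast
  have aux: "intvec (b (b' (a' (a x))) - x)"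
    if X: "X \<in> Mat p p" and a: "disc_map X cx A' c' a" and b: "disc_map A' c' X cx b"
      and a': "disc_map A' c' Y cy a'" and b': "disc_map Y cy A' c' b'"
      and ba: "\<And>x. x \<in> duals X \<Longrightarrow> intvec (b (a x) - x)" and ba': "\<And>x. x \<in> duals A' \<Longrightarrow> intvec (b' (a' x) - x)"
      and x: "x \<in> duals X" for X Y a b a' b' p cx cy x
  proof -
    note ax = disc_mapD(1)[OF a x]
    note bax = disc_mapD(1)[OF b' disc_mapD(1)[OF a' ax]]
    have "intvec (b (b' (a' (a x))) - b (a x))" by (rule disc_mapD(4)[OF b bax ax ba'[OF ax]])
    moreover have "intvec (b (a x) - x)" by (rule ba[OF x])
    moreover have "b (b' (a' (a x))) \<in> Vec p" "b (a x) \<in> Vec p" "x \<in> Vec p"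
      using disc_mapD(1)[OF b bax] disc_mapD(1)[OF b ax] x by (simp_all add: mem_duals[OF X])
    ultimately show ?thesis by (rule integral_trans)
  qed
  show ?thesis unfolding disc_equiv_def
  proof (intro exI conjI ballI)
    show "disc_map A c A'' c'' (\<lambda>x. g' (g x))" by (rule disc_map_comp[OF A A' A'' g g'])
    show "disc_map A'' c'' A c (\<lambda>x. h (h' x))" by (rule disc_map_comp[OF A'' A' A h' h])
    show "intvec (h (h' (g' (g x))) - x)" if "x \<in> duals A" for x by (rule aux[OF A g h g' h' hg hg' that])
    show "intvec (g' (g (h (h' x))) - x)" if "x \<in> duals A''" for x by (rule aux[OF A'' h' g' h g gh' gh that])
  qed
qed

lemma discriminant_iso_iff:
  fixes G :: "'g monoid" and G' :: "'h monoid" and q q'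
  assumes A: "A \<in> Mat n n" and A': "A' \<in> Mat n' n'"
    and k: "\<kappa> ` duals A = carrier G"
    "\<And>x y. x \<in> duals A \<Longrightarrow> y \<in> duals A \<Longrightarrow> \<kappa> (x + y) = \<kappa> x \<otimes>\<^bsub>G\<^esub> \<kappa> y"
    "\<And>x y. x \<in> duals A \<Longrightarrow> y \<in> duals A \<Longrightarrow> \<kappa> x = \<kappa> y \<longleftrightarrow> intvec (x - y)"
    "\<And>x. x \<in> duals A \<Longrightarrow> q (\<kappa> x) = mod_Ints (qform A c x)"
    and k': "\<kappa>' ` duals A' = carrier G'"
    "\<And>x y. x \<in> duals A' \<Longrightarrow> y \<in> duals A' \<Longrightarrow> \<kappa>' (x + y) = \<kappa>' x \<otimes>\<^bsub>G'\<^esub> \<kappa>' y"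
    "\<And>x y. x \<in> duals A' \<Longrightarrow> y \<in> duals A' \<Longrightarrow> \<kappa>' x = \<kappa>' y \<longleftrightarrow> intvec (x - y)"
    "\<And>x. x \<in> duals A' \<Longrightarrow> q' (\<kappa>' x) = mod_Ints (qform A' c' x)"
  shows "(\<exists>\<Psi>\<in>iso G G'. \<forall>X\<in>carrier G. q' (\<Psi> X) = q X) \<longleftrightarrow> disc_equiv A c A' c'"
proof
  assume "\<exists>\<Psi>\<in>iso G G'. \<forall>X\<in>carrier G. q' (\<Psi> X) = q X"
  then obtain \<Psi> where \<Psi>: "\<Psi> \<in> hom G G'" "bij_betw \<Psi> (carrier G) (carrier G')" and qq: "\<And>X. X \<in> carrier G \<Longrightarrow> q' (\<Psi> X) = q X"
    by (auto simp: iso_def)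
  have kc: "\<kappa> x \<in> carrier G" if "x \<in> duals A" for x using k(1) that by blast
  have kc': "\<kappa>' x \<in> carrier G'" if "x \<in> duals A'" for x using k'(1) that by blast
  have \<Psi>inj: "X = Y" if "X \<in> carrier G" "Y \<in> carrier G" "\<Psi> X = \<Psi> Y" for X Y
    using inj_onD[OF bij_betw_imp_inj_on[OF \<Psi>(2)] that(3,1,2)] .
  define g where "g x = (SOME y. y \<in> duals A' \<and> \<kappa>' y = \<Psi> (\<kappa> x))" for x
  define h where "h y = (SOME x. x \<in> duals A \<and> \<Psi> (\<kappa> x) = \<kappa>' y)" for y
  have g: "g x \<in> duals A' \<and> \<kappa>' (g x) = \<Psi> (\<kappa> x)" if "x \<in> duals A" for x
  proof -
    have "\<Psi> (\<kappa> x) \<in> carrier G'" by (rule hom_in_carrier[OF \<Psi>(1) kc[OF that]])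
    hence "\<Psi> (\<kappa> x) \<in> \<kappa>' ` duals A'" using k'(1) by simp
    then obtain y where "y \<in> duals A' \<and> \<kappa>' y = \<Psi> (\<kappa> x)" by auto
    thus ?thesis unfolding g_def by (rule someI)
  qed
  have h: "h y \<in> duals A \<and> \<Psi> (\<kappa> (h y)) = \<kappa>' y" if "y \<in> duals A'" for y
  proof -
    have "\<kappa>' y \<in> \<Psi> ` carrier G" using kc'[OF that] bij_betw_imp_surj_on[OF \<Psi>(2)] by simp
    hence "\<kappa>' y \<in> \<Psi> ` \<kappa> ` duals A" using k(1) by simp
    then obtain x where "x \<in> duals A \<and> \<Psi> (\<kappa> x) = \<kappa>' y" by auto
    thus ?thesis unfolding h_def by (rule someI)
  qed
  have "disc_map A c A' c' g"
    unfolding disc_map_def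
  proof (intro conjI ballI impI)
    fix x assume x: "x \<in> duals A"
    show "g x \<in> duals A'" using g[OF x] by simp
    have "mod_Ints (qform A' c' (g x)) = mod_Ints (qform A c x)"
      using k'(4)[of "g x"] g[OF x] qq[OF kc[OF x]] k(4)[OF x] by simp
    thus "qform A' c' (g x) - qform A c x \<in> \<int>" by (simp only: mod_Ints_eq_iff)
    fix y assume y: "y \<in> duals A"
    have xy: "x + y \<in> duals A" "g x + g y \<in> duals A'" using duals_add[OF A x y] duals_add[OF A'] g[OF x] g[OF y] by auto
    have "\<kappa>' (g (x + y)) = \<kappa>' (g x + g y)"
      using g[OF xy(1)] k(2)[OF x y] hom_mult[OF \<Psi>(1) kc[OF x] kc[OF y]] g[OF x] g[OF y] k'(2)[of "g x" "g y"] by simp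
    thus "intvec (g (x + y) - (g x + g y))" using k'(3)[of "g (x + y)" "g x + g y"] g[OF xy(1)] xy(2) by simp
    assume "intvec (x - y)"
    hence "\<kappa> x = \<kappa> y" using k(3)[OF x y] by simp
    thus "intvec (g x - g y)" using k'(3)[of "g x" "g y"] g[OF x] g[OF y] by simp
  qed
  moreover have "disc_map A' c' A c h"
    unfolding disc_map_def
  proof (intro conjI ballI impI)
    fix x assume x: "x \<in> duals A'"
    show "h x \<in> duals A" using h[OF x] by simp
    have "mod_Ints (qform A c (h x)) = mod_Ints (qform A' c' x)"
      using k(4)[of "h x"] h[OF x] qq[OF kc, of "h x"] k'(4)[OF x] by simp
    thus "qform A c (h x) - qform A' c' x \<in> \<int>" by (simp only: mod_Ints_eq_iff)
    fix y assume y: "y \<in> duals A'"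
    have xy: "x + y \<in> duals A'" "h x + h y \<in> duals A" using duals_add[OF A' x y] duals_add[OF A] h[OF x] h[OF y] by auto
    have "\<Psi> (\<kappa> (h (x + y))) = \<Psi> (\<kappa> (h x + h y))"
      using h[OF xy(1)] k'(2)[OF x y] hom_mult[OF \<Psi>(1) kc kc, of "h x" "h y"] h[OF x] h[OF y] k(2)[of "h x" "h y"] by simp
    hence "\<kappa> (h (x + y)) = \<kappa> (h x + h y)" using \<Psi>inj kc h[OF xy(1)] xy(2) by blast
    thus "intvec (h (x + y) - (h x + h y))" using k(3)[of "h (x + y)" "h x + h y"] h[OF xy(1)] xy(2) by simp
    assume "intvec (x - y)"
    hence "\<kappa>' x = \<kappa>' y" using k'(3)[OF x y] by simp
    hence "\<Psi> (\<kappa> (h x)) = \<Psi> (\<kappa> (h y))" using h[OF x] h[OF y] by simp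
    hence "\<kappa> (h x) = \<kappa> (h y)" using \<Psi>inj kc h[OF x] h[OF y] by blast
    thus "intvec (h x - h y)" using k(3)[of "h x" "h y"] h[OF x] h[OF y] by simp
  qed
  moreover have "intvec (h (g x) - x)" if x: "x \<in> duals A" for x
  proof -
    have "\<Psi> (\<kappa> (h (g x))) = \<Psi> (\<kappa> x)" using h[of "g x"] g[OF x] by simp
    hence "\<kappa> (h (g x)) = \<kappa> x" using \<Psi>inj kc h[of "g x"] g[OF x] x by blast
    thus ?thesis using k(3)[of "h (g x)" x] h[of "g x"] g[OF x] x by simp
  qed
  moreover have "intvec (g (h y) - y)" if y: "y \<in> duals A'" for y
    using k'(3)[of "g (h y)" y] h[OF y] g[of "h y"] y by simp
  ultimately show "disc_equiv A c A' c'" unfolding disc_equiv_def by blast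
next
  assume "disc_equiv A c A' c'"
  then obtain g h where g: "disc_map A c A' c' g" and h: "disc_map A' c' A c h"
    and hg: "\<And>x. x \<in> duals A \<Longrightarrow> intvec (h (g x) - x)" and gh: "\<And>y. y \<in> duals A' \<Longrightarrow> intvec (g (h y) - y)"
    unfolding disc_equiv_def by blast
  define \<xi> where "\<xi> X = (SOME x. x \<in> duals A \<and> \<kappa> x = X)" for X
  have \<xi>: "\<xi> X \<in> duals A \<and> \<kappa> (\<xi> X) = X" if X: "X \<in> carrier G" for X
  proof -
    have "X \<in> \<kappa> ` duals A" using k(1) X by simp
    then obtain x where "x \<in> duals A \<and> \<kappa> x = X" by auto
    thus ?thesis unfolding \<xi>_def by (rule someI)
  qed
  define \<Psi> where "\<Psi> X = \<kappa>' (g (\<xi> X))" for X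
  have kc: "\<kappa> x \<in> carrier G" if "x \<in> duals A" for x using k(1) that by blast
  have kc': "\<kappa>' x \<in> carrier G'" if "x \<in> duals A'" for x using k'(1) that by blast
  have \<Psi>: "\<Psi> (\<kappa> x) = \<kappa>' (g x)" if x: "x \<in> duals A" for x
  proof -
    have e: "\<xi> (\<kappa> x) \<in> duals A" "\<kappa> (\<xi> (\<kappa> x)) = \<kappa> x" using \<xi>[OF kc[OF x]] by auto
    hence "intvec (\<xi> (\<kappa> x) - x)" using k(3)[OF e(1) x] by simp
    hence "intvec (g (\<xi> (\<kappa> x)) - g x)" by (rule disc_mapD(4)[OF g e(1) x])
    thus ?thesis unfolding \<Psi>_def using k'(3)[OF disc_mapD(1)[OF g e(1)] disc_mapD(1)[OF g x]] by simp
  qed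
  have ex: "\<exists>x\<in>duals A. X = \<kappa> x" if "X \<in> carrier G" for X using \<xi>[OF that] by metis
  show "\<exists>\<Psi>\<in>iso G G'. \<forall>X\<in>carrier G. q' (\<Psi> X) = q X"
  proof (intro bexI[of _ \<Psi>] ballI)
    fix X assume "X \<in> carrier G"
    then obtain x where x: "x \<in> duals A" "X = \<kappa> x" using ex by blast
    show "q' (\<Psi> X) = q X" unfolding x(2) \<Psi>[OF x(1)] k(4)[OF x(1)] k'(4)[OF disc_mapD(1)[OF g x(1)]] mod_Ints_eq_iff
      by (rule disc_mapD(2)[OF g x(1)])
  next
    have hm: "\<Psi> \<in> hom G G'"
    proof (rule homI)
      fix X assume "X \<in> carrier G"
      then obtain x where x: "x \<in> duals A" "X = \<kappa> x" using ex by blast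
      show "\<Psi> X \<in> carrier G'" unfolding x(2) \<Psi>[OF x(1)] by (rule kc'[OF disc_mapD(1)[OF g x(1)]])
      fix Y assume "Y \<in> carrier G"
      then obtain y where y: "y \<in> duals A" "Y = \<kappa> y" using ex by blast
      note gx = disc_mapD(1)[OF g x(1)] and gy = disc_mapD(1)[OF g y(1)] and xy = duals_add[OF A x(1) y(1)]
      have "\<Psi> (X \<otimes>\<^bsub>G\<^esub> Y) = \<kappa>' (g (x + y))" unfolding x(2) y(2) k(2)[OF x(1) y(1), symmetric] by (rule \<Psi>[OF xy])
      also have "\<dots> = \<kappa>' (g x + g y)"
        using k'(3)[OF disc_mapD(1)[OF g xy] duals_add[OF A' gx gy]] disc_mapD(3)[OF g x(1) y(1)] by simp
      finally show "\<Psi> (X \<otimes>\<^bsub>G\<^esub> Y) = \<Psi> X \<otimes>\<^bsub>G'\<^esub> \<Psi> Y" unfolding k'(2)[OF gx gy] x(2) y(2) \<Psi>[OF x(1)] \<Psi>[OF y(1)] .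
    qed
    have inj: "inj_on \<Psi> (carrier G)"
    proof (rule inj_onI)
      fix X Y assume XY: "X \<in> carrier G" "Y \<in> carrier G" "\<Psi> X = \<Psi> Y"
      obtain x where x: "x \<in> duals A" "X = \<kappa> x" using ex[OF XY(1)] by blast
      obtain y where y: "y \<in> duals A" "Y = \<kappa> y" using ex[OF XY(2)] by blast
      note gx = disc_mapD(1)[OF g x(1)] and gy = disc_mapD(1)[OF g y(1)]
      note hx = disc_mapD(1)[OF h gx] and hy = disc_mapD(1)[OF h gy]
      have "\<kappa>' (g x) = \<kappa>' (g y)" using XY(3) unfolding x(2) y(2) \<Psi>[OF x(1)] \<Psi>[OF y(1)] .
      hence "intvec (g x - g y)" using k'(3)[OF gx gy] by simp
      hence "intvec (h (g x) - h (g y))" by (rule disc_mapD(4)[OF h gx gy])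
      hence "\<kappa> (h (g x)) = \<kappa> (h (g y))" using k(3)[OF hx hy] by simp
      moreover have "\<kappa> (h (g x)) = \<kappa> x" using k(3)[OF hx x(1)] hg[OF x(1)] by simp
      moreover have "\<kappa> (h (g y)) = \<kappa> y" using k(3)[OF hy y(1)] hg[OF y(1)] by simp
      ultimately show "X = Y" unfolding x(2) y(2) by simp
    qed
    have sur: "carrier G' \<subseteq> \<Psi> ` carrier G"
    proof
      fix Y assume "Y \<in> carrier G'"
      then obtain y where y: "y \<in> duals A'" "Y = \<kappa>' y" using k'(1) by blast
      note hy = disc_mapD(1)[OF h y(1)]
      have "\<Psi> (\<kappa> (h y)) = Y" unfolding \<Psi>[OF hy] y(2) using k'(3)[OF disc_mapD(1)[OF g hy] y(1)] gh[OF y(1)] by simp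
      thus "Y \<in> \<Psi> ` carrier G" using kc[OF hy] by blast
    qed
    have "\<Psi> ` carrier G = carrier G'" by (rule equalityI[OF image_subsetI[OF hom_in_carrier[OF hm]] sur])
    thus "\<Psi> \<in> iso G G'" by (simp add: iso_def bij_betw_def hm inj)
  qed
qed

lemma mat_eq_on_bil:
  fixes S T :: "int mat"
  assumes "S \<in> Mat n n" "T \<in> Mat n n"
    and "\<And>x y. x \<in> Vec n \<Longrightarrow> y \<in> Vec n \<Longrightarrow> bil S x y = bil T x y"
  shows "S = T"
proof (rule eq_matI)
  have e: "bil X (unit_vec n i) (unit_vec n j) = X $$ (i, j)" if "X \<in> Mat n n" "i < n" "j < n" for X :: "int mat" and i j
    unfolding bil_def mult_unit_vec_col[OF that(1,3)] using that scalar_prod_left_unit[of "col X j" n i] by simp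
  fix i j assume "i < dim_row T" "j < dim_col T"
  hence ij: "i < n" "j < n" using assms(2) by auto
  show "S $$ (i, j) = T $$ (i, j)" using assms(3)[of "unit_vec n i" "unit_vec n j"] e[OF assms(1) ij] e[OF assms(2) ij] by simp
qed (use assms in auto)

lemma bil_transform:
  fixes A :: "'a :: comm_ring_1 mat"
  assumes A: "A \<in> Mat m m" and E: "E \<in> Mat m n" and x: "x \<in> Vec n" and y: "y \<in> Vec n"
  shows "bil (E\<^sup>T * A * E) x y = bil A (E *v x) (E *v y)"
proof -
  have Et: "E\<^sup>T \<in> Mat n m" and Ex: "E *v x \<in> Vec m" and Ey: "E *v y \<in> Vec m" using E x y by auto
  have AE: "A *v (E *v y) \<in> Vec m" using A Ey by simp
  have "(E\<^sup>T * A * E) *v y = E\<^sup>T *v (A *v (E *v y))"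
    using assoc_mult_mat_vec[OF mult_carrier_mat[OF Et A] E y] assoc_mult_mat_vec[OF Et A Ey] by simp
  moreover have "x \<bullet> (E\<^sup>T *v (A *v (E *v y))) = (E\<^sup>T *v (A *v (E *v y))) \<bullet> x"
    by (rule comm_scalar_prod[OF x]) (use Et AE in simp)
  moreover have "\<dots> = (A *v (E *v y)) \<bullet> (E *v x)" by (rule transpose_vec_mult_scalar[OF E x AE])
  moreover have "\<dots> = (E *v x) \<bullet> (A *v (E *v y))" by (rule comm_scalar_prod[OF AE Ex])
  ultimately show ?thesis by (simp add: bil_def)
qed

text \<open>
  An isometry extends to rational vectors. The term \<open>2 A z\<close> in the characteristic form contributes the
  pairing of \<open>z\<close> with a dual vector, which is integral.
\<close>

lemma disc_map_of_matrix:
  assumes A: "A \<in> Mat n n" "A\<^sup>T = A" and A': "A' \<in> Mat m m"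
    and c: "c \<in> Vec n" and c': "c' \<in> Vec m"
    and E: "E \<in> Mat m n" and F: "F \<in> Mat n m" and EF: "E * F = 1\<^sub>m m"
    and bilE: "\<And>x y. x \<in> Vec n \<Longrightarrow> y \<in> Vec n \<Longrightarrow> bil A' (E *v x) (E *v y) = bil A x y"
    and z: "z \<in> Vec n" and cE: "\<And>x. x \<in> Vec n \<Longrightarrow> c' \<bullet> (E *v x) - c \<bullet> x = 2 * bil A z x"
  shows "disc_map A c A' c' (\<lambda>x. ratm E *v x)"
proof -
  have Et: "E\<^sup>T \<in> Mat n m" and Ft: "F\<^sup>T \<in> Mat m n" using E F by auto
  have EAE: "E\<^sup>T * A' * E \<in> Mat n n" using Et A' E by (intro mult_carrier_mat[of _ _ m]) auto
  have T: "E\<^sup>T * A' * E = A"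
    by (rule mat_eq_on_bil[OF EAE A(1)]) (simp add: bil_transform[OF A' E] bilE)
  have FEt: "F\<^sup>T * E\<^sup>T = 1\<^sub>m m" using transpose_mult[OF E F] EF by simp
  have "F\<^sup>T * A = F\<^sup>T * (E\<^sup>T * (A' * E))"
    unfolding T[symmetric] using assoc_mult_mat[OF Et A' E] by simp
  also have "\<dots> = (F\<^sup>T * E\<^sup>T) * (A' * E)" by (rule assoc_mult_mat[OF Ft Et mult_carrier_mat[OF A' E], symmetric])
  also have "\<dots> = A' * E" unfolding FEt using A' E by (intro left_mult_one_mat[of _ m n] mult_carrier_mat[of _ _ m]) auto
  finally have FA: "A' * E = F\<^sup>T * A" ..
  have Eq: "ratm E \<in> Mat m n" and Aq: "ratm A \<in> Mat n n" and Aq': "ratm A' \<in> Mat m m" and Fq: "ratm (F\<^sup>T) \<in> Mat m n"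
    using E A A' Ft by auto
  have cv: "E\<^sup>T *v c' = c + 2 \<cdot>v (A *v z)"
  proof (rule eq_vecI)
    fix i assume "i < dim_vec (c + 2 \<cdot>v (A *v z))"
    hence i: "i < n" using A by simp
    let ?u = "unit_vec n i :: int vec"
    have Az: "A *v z \<in> Vec n" using A z by simp
    have "c' \<bullet> (E *v ?u) = (E\<^sup>T *v c') \<bullet> ?u" using transpose_vec_mult_scalar[OF E, of ?u c'] c' by simp
    also have "\<dots> = (E\<^sup>T *v c') $ i" using scalar_prod_right_unit[OF i, of "E\<^sup>T *v c'"] by simp
    finally have 1: "c' \<bullet> (E *v ?u) = (E\<^sup>T *v c') $ i" .
    have "bil A z ?u = ?u \<bullet> (A *v z)" using bil_sym[OF A z, of ?u] by (simp add: bil_def)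
    hence 2: "bil A z ?u = (A *v z) $ i" using scalar_prod_left_unit[OF Az i] by simp
    have 3: "c \<bullet> ?u = c $ i" using scalar_prod_right_unit[OF i, of c] by simp
    show "(E\<^sup>T *v c') $ i = (c + 2 \<cdot>v (A *v z)) $ i" using cE[of ?u] i c A(1) unfolding 1 2 3 by (simp add: algebra_simps)
  qed (use Et A in simp)
  show ?thesis unfolding disc_map_def
  proof (intro conjI ballI impI)
    fix x assume xd: "x \<in> duals A"
    hence x: "x \<in> Vec n" and ix: "intvec (ratm A *v x)" by (simp_all add: mem_duals[OF A(1)])
    have Ex: "ratm E *v x \<in> Vec m" and Ax: "ratm A *v x \<in> Vec n" using Eq Aq x by auto
    have "ratm A' *v (ratm E *v x) = ratm (A' * E) *v x" using assoc_mult_mat_vec[OF Aq' Eq x] ratm_mult[OF A' E] by simp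
    also have "\<dots> = ratm (F\<^sup>T) *v (ratm A *v x)" unfolding FA ratm_mult[OF Ft A(1)] by (rule assoc_mult_mat_vec[OF Fq Aq x])
    finally have "intvec (ratm A' *v (ratm E *v x))" using integral_mult_mat[OF Ft ix Ax] by simp
    thus "ratm E *v x \<in> duals A'" using Ex by (simp add: mem_duals[OF A'])
    have b: "bil (ratm A') (ratm E *v x) (ratm E *v x) = bil (ratm A) x x"
    proof -
      have "ratm A = (ratm E)\<^sup>T * ratm A' * ratm E"
        unfolding T[symmetric] ratm_mult[OF mult_carrier_mat[OF Et A'] E] ratm_mult[OF Et A'] by (simp add: map_mat_transpose)
      thus ?thesis using bil_transform[OF Aq' Eq x x] by simp
    qed
    have Az: "A *v z \<in> Vec n" using A z by simp
    have "ratv c' \<bullet> (ratm E *v x) = ((ratm E)\<^sup>T *v ratv c') \<bullet> x"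
      using transpose_vec_mult_scalar[OF Eq x, of "ratv c'"] c' by simp
    also have "(ratm E)\<^sup>T *v ratv c' = ratv (c + 2 \<cdot>v (A *v z))"
    proof -
      have tE: "(ratm E)\<^sup>T = ratm (E\<^sup>T)" by (rule eq_matI) auto
      show ?thesis unfolding tE ratm_mult_ratv[OF Et c'] cv ..
    qed
    also have "\<dots> = ratv c + 2 \<cdot>v ratv (A *v z)" using c Az A(1) by (intro eq_vecI) auto
    also have "\<dots> \<bullet> x = ratv c \<bullet> x + 2 * (ratv (A *v z) \<bullet> x)"
      using c Az x by (simp add: add_scalar_prod_distrib[of _ n])
    also have "ratv (A *v z) \<bullet> x = ratv z \<bullet> (ratm A *v x)"
      unfolding ratm_mult_ratv[OF A(1) z, symmetric] using transpose_vec_mult_scalar[OF Aq x, of "ratv z"] transpose_ratm[OF A(2)] z by simp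
    finally have "qform A' c' (ratm E *v x) - qform A c x = - (ratv z \<bullet> (ratm A *v x))"
      unfolding qform_def b by (simp add: field_simps)
    moreover have "ratv z \<bullet> (ratm A *v x) \<in> \<int>" by (rule integral_scalar_prod[OF _ ix _ Ax]) (use z in auto)
    ultimately show "qform A' c' (ratm E *v x) - qform A c x \<in> \<int>" by simp
    fix y assume "y \<in> duals A"
    hence y: "y \<in> Vec n" by (simp add: mem_duals[OF A(1)])
    have "ratm E *v (x + y) = ratm E *v x + ratm E *v y" by (rule mult_add_distrib_mat_vec[OF Eq x y])
    thus "intvec (ratm E *v (x + y) - (ratm E *v x + ratm E *v y))" by (simp add: intvec_def)
    assume "intvec (x - y)"
    hence "intvec (ratm E *v (x - y))" by (rule integral_mult_mat[OF E]) (use x y in simp)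
    thus "intvec (ratm E *v x - ratm E *v y)" using mult_minus_distrib_mat_vec[OF Eq x y] by simp
  qed
qed

lemma iso_coord_matrix:
  assumes "h \<in> hom (Zvec n) (Zvec m)"
  obtains E where "E \<in> Mat m n" "\<And>x. x \<in> Vec n \<Longrightarrow> h x = E *v x"
proof
  let ?E = "mat m n (\<lambda>(i, j). h (unit_vec n j) $ i)"
  show "?E \<in> Mat m n" by simp
  fix x :: "int vec" assume x: "x \<in> Vec n"
  have hc: "h v \<in> Vec m" if "v \<in> Vec n" for v using hom_in_carrier[OF assms, of v] that by (simp add: monoid_vec_def)
  have hadd: "h (v + w) = h v + h w" if "v \<in> Vec n" "w \<in> Vec n" for v w
    using hom_mult[OF assms, of v w] that by (simp add: monoid_vec_def)
  show "h x = ?E *v x"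
  proof (rule eq_vecI)
    fix i assume "i < dim_vec (?E *v x)"
    hence i: "i < m" by simp
    have "h x $ i = (\<Sum>j<n. h (unit_vec n j) $ i * x $ j)"
    proof (rule additive_int_vec[OF _ x])
      fix v w :: "int vec" assume vw: "v \<in> Vec n" "w \<in> Vec n"
      show "h (v + w) $ i = h v $ i + h w $ i" unfolding hadd[OF vw] using i hc[OF vw(2)] by simp
    qed
    thus "h x $ i = (?E *v x) $ i" using i x by (simp add: scalar_prod_def lessThan_atLeast0)
  qed (use hc[OF x] in simp)
qed

lemma mat_eq_one: "(X :: int mat) \<in> Mat n n \<Longrightarrow> (\<And>x. x \<in> Vec n \<Longrightarrow> X *v x = x) \<Longrightarrow> X = 1\<^sub>m n"
  by (rule mat_eq_on_bil) (auto simp: bil_def)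

lemma coord_iso_disc_equiv:
  assumes A: "A \<in> Mat n n" "A\<^sup>T = A" and A': "A' \<in> Mat m m" "A'\<^sup>T = A'"
    and c: "c \<in> Vec n" and c': "c' \<in> Vec m" and iso: "coord_triple A c \<simeq>\<^sub>L coord_triple A' c'"
  shows "disc_equiv A c A' c'"
proof -
  let ?M = "Zvec n" and ?M' = "Zvec m"
  obtain \<theta> z where th: "\<theta> \<in> iso ?M ?M'" and b: "\<And>x y. x \<in> Vec n \<Longrightarrow> y \<in> Vec n \<Longrightarrow> bil A' (\<theta> x) (\<theta> y) = bil A x y"
    and z: "z \<in> Vec n" and cz: "\<And>x. x \<in> Vec n \<Longrightarrow> c' \<bullet> \<theta> x - c \<bullet> x = 2 * bil A z x"
    using iso A(1) A'(1) unfolding coord_triple_def triple_iso.simps by (auto simp: monoid_vec_simps)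
  interpret Mg: comm_group ?M by (rule monoid_vec_group)
  have bij: "bij_betw \<theta> (carrier_vec n) (carrier_vec m)" using th by (simp add: iso_def monoid_vec_simps)
  define \<eta> where "\<eta> = inv_into (carrier_vec n) \<theta>"
  have \<eta>: "\<eta> \<in> iso ?M' ?M" using Mg.iso_set_sym[OF th] by (simp add: \<eta>_def monoid_vec_simps)
  obtain E where E: "E \<in> Mat m n" "\<And>x. x \<in> Vec n \<Longrightarrow> \<theta> x = E *v x"
    using iso_coord_matrix[of \<theta> n m] th by (auto simp: iso_def)
  obtain F where F: "F \<in> Mat n m" "\<And>x. x \<in> Vec m \<Longrightarrow> \<eta> x = F *v x"
    using iso_coord_matrix[of \<eta> m n] \<eta> by (auto simp: iso_def)
  have EFx: "E *v (F *v x) = x" if x: "x \<in> Vec m" for x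
    using bij_betw_inv_into_right[OF bij x] F(2)[OF x] E(2)[of "F *v x"] F(1) x by (simp add: \<eta>_def)
  have FEx: "F *v (E *v x) = x" if x: "x \<in> Vec n" for x
    using bij_betw_inv_into_left[OF bij x] E(2)[OF x] F(2)[of "E *v x"] E(1) x by (simp add: \<eta>_def)
  have EF: "E * F = 1\<^sub>m m" by (rule mat_eq_one[OF mult_carrier_mat[OF E(1) F(1)]]) (simp add: assoc_mult_mat_vec[OF E(1) F(1)] EFx)
  have FE: "F * E = 1\<^sub>m n" by (rule mat_eq_one[OF mult_carrier_mat[OF F(1) E(1)]]) (simp add: assoc_mult_mat_vec[OF F(1) E(1)] FEx)
  have Fc: "F *v x \<in> Vec n" if "x \<in> Vec m" for x using F(1) that by simp
  have Ez: "E *v z \<in> Vec m" using E z by simp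
  have g: "disc_map A c A' c' (\<lambda>x. ratm E *v x)"
    by (rule disc_map_of_matrix[OF A A'(1) c c' E(1) F(1) EF _ z]) (simp_all add: E(2)[symmetric] b cz)
  have h: "disc_map A' c' A c (\<lambda>x. ratm F *v x)"
  proof (rule disc_map_of_matrix[OF A' A(1) c' c F(1) E(1) FE _ uminus_carrier_vec[THEN iffD2, OF Ez]])
    show "bil A (F *v x) (F *v y) = bil A' x y" if "x \<in> Vec m" "y \<in> Vec m" for x y
      using b[OF Fc[OF that(1)] Fc[OF that(2)]] E(2)[OF Fc[OF that(1)]] E(2)[OF Fc[OF that(2)]] EFx that by simp
    show "c \<bullet> (F *v x) - c' \<bullet> x = 2 * bil A' (- (E *v z)) x" if x: "x \<in> Vec m" for x
    proof -
      have "bil A' (E *v z) x = bil A z (F *v x)" using b[OF z Fc[OF x]] E(2)[OF z] E(2)[OF Fc[OF x]] EFx[OF x] by simp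
      moreover have "bil A' (- (E *v z)) x = - bil A' (E *v z) x"
        unfolding bil_def using Ez E(1) A' x by (simp add: scalar_prod_def sum_negf)
      ultimately show ?thesis using cz[OF Fc[OF x]] E(2)[OF Fc[OF x]] EFx[OF x] by simp
    qed
  qed
  have Eq: "ratm E \<in> Mat m n" and Fq: "ratm F \<in> Mat n m" using E F by auto
  have i0: "intvec (x - x)" for x by (simp add: intvec_def)
  have "ratm F *v (ratm E *v x) = x" if "x \<in> duals A" for x
  proof -
    have x: "x \<in> Vec n" using that by (simp add: mem_duals[OF A(1)])
    have "ratm F * ratm E = 1\<^sub>m n" unfolding ratm_mult[OF F(1) E(1), symmetric] FE by (rule of_int_hom.mat_hom_one)
    thus ?thesis unfolding assoc_mult_mat_vec[OF Fq Eq x, symmetric] using x by simp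
  qed
  moreover have "ratm E *v (ratm F *v x) = x" if "x \<in> duals A'" for x
  proof -
    have x: "x \<in> Vec m" using that by (simp add: mem_duals[OF A'(1)])
    have "ratm E * ratm F = 1\<^sub>m m" unfolding ratm_mult[OF E(1) F(1), symmetric] EF by (rule of_int_hom.mat_hom_one)
    thus ?thesis unfolding assoc_mult_mat_vec[OF Eq Fq x, symmetric] using x by simp
  qed
  ultimately show ?thesis unfolding disc_equiv_def using g h i0
    by (intro exI[of _ "\<lambda>x. ratm E *v x"] exI[of _ "\<lambda>x. ratm F *v x"]) simp
qed

lemma ratm_block_sum:
  assumes A: "A \<in> Mat n n" and U: "U \<in> Mat k k"
  shows "ratm (block_sum A U) = block_sum (ratm A) (ratm U)"
  using A U by (intro eq_matI) (auto simp: block_sum_index)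

lemma qform_block_sum:
  assumes A: "A \<in> Mat n n" and U: "U \<in> Mat k k" and c: "c \<in> Vec n" and u: "u \<in> Vec k"
    and x: "x \<in> Vec n" and y: "y \<in> Vec k"
  shows "qform (block_sum A U) (c @v u) (x @v y) = qform A c x + qform U u y"
proof -
  have Aq: "ratm A \<in> Mat n n" and Uq: "ratm U \<in> Mat k k" using A U by auto
  have cu: "ratv (c @v u) = ratv c @v ratv u" by (intro eq_vecI) auto
  have "ratv (c @v u) \<bullet> (x @v y) = ratv c \<bullet> x + ratv u \<bullet> y"
    unfolding cu by (rule scalar_prod_append[OF _ _ x y]) (use c u in auto)
  thus ?thesis unfolding qform_def ratm_block_sum[OF A U] bil_block_sum[OF Aq Uq x x y y] by (simp add: field_simps)
qed

lemma integral_append: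
  "intvec (a @v b) \<longleftrightarrow> intvec a \<and> intvec b"
proof
  assume h: "intvec (a @v b)"
  have "a $ i \<in> \<int>" if "i < dim_vec a" for i using h[unfolded intvec_def, rule_format, of i] that by simp
  moreover have "b $ i \<in> \<int>" if "i < dim_vec b" for i
    using h[unfolded intvec_def, rule_format, of "dim_vec a + i"] that by simp
  ultimately show "intvec a \<and> intvec b" by (simp add: intvec_def)
qed (auto simp: intvec_def)

lemma duals_block_sum:
  assumes A: "A \<in> Mat n n" and U: "U \<in> Mat k k" and x: "x \<in> Vec n" and y: "y \<in> Vec k"
  shows "x @v y \<in> duals (block_sum A U) \<longleftrightarrow> x \<in> duals A \<and> y \<in> duals U"
proof -
  have Aq: "ratm A \<in> Mat n n" and Uq: "ratm U \<in> Mat k k" using A U by auto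
  have "block_sum (ratm A) (ratm U) = four_block_mat (ratm A) (0\<^sub>m n k) (0\<^sub>m k n) (ratm U)" using A U by (simp add: block_sum_def)
  hence e: "ratm (block_sum A U) *v (x @v y) = (ratm A *v x) @v (ratm U *v y)"
    unfolding ratm_block_sum[OF A U] using mult_mat_vec_split[OF Aq Uq x y] by simp
  show ?thesis unfolding mem_duals[OF block_sum_carrier[OF A U]] mem_duals[OF A] mem_duals[OF U] e integral_append
    using x y by auto
qed

text \<open>
  The dual of the unimodular summand is integral, and there the quadratic function vanishes modulo \<open>\<int>\<close>
  since \<open>vec k \<epsilon>\<close> is characteristic.
\<close>

lemma disc_equiv_stabilise:
  assumes A: "A \<in> Mat n n" and s: "signs k \<epsilon>" and c: "c \<in> Vec n"
  shows "disc_equiv A c (block_sum A (mat_diag k \<epsilon>)) (c @v vec k \<epsilon>)"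
proof -
  let ?U = "mat_diag k \<epsilon>" and ?u = "vec k \<epsilon>"
  let ?B = "block_sum A ?U"
  have U: "?U \<in> Mat k k" and u: "?u \<in> Vec k" by auto
  have Uq: "ratm ?U \<in> Mat k k" by simp
  have int: "intvec y" if y: "y \<in> duals ?U" for y
    unfolding intvec_def
  proof (intro allI impI)
    fix i assume "i < dim_vec y"
    hence i: "i < k" and yc: "y \<in> Vec k" using y by (auto simp: mem_duals[OF U])
    have "(ratm ?U *v y) $ i = (\<Sum>j<k. of_int (if i = j then \<epsilon> j else 0) * y $ j)"
      using i yc by (simp add: mat_diag_def scalar_prod_def lessThan_atLeast0)
    also have "\<dots> = (\<Sum>j<k. if j = i then of_int (\<epsilon> i) * y $ i else 0)" by (intro sum.cong) auto
    finally have "(ratm ?U *v y) $ i = (\<Sum>j<k. if j = i then of_int (\<epsilon> i) * y $ i else 0)" .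
    hence "(ratm ?U *v y) $ i = of_int (\<epsilon> i) * y $ i" using i by simp
    moreover have iv: "intvec (ratm ?U *v y)" using y by (simp add: mem_duals[OF U])
    moreover have "(ratm ?U *v y) $ i \<in> \<int>" by (rule iv[unfolded intvec_def, rule_format]) (use i in \<open>simp add: mat_diag_def\<close>)
    moreover have "\<epsilon> i = 1 \<or> \<epsilon> i = - 1" using s i by (auto simp: signs_def)
    ultimately show "y $ i \<in> \<int>" by (auto simp: minus_in_Ints_iff)
  qed
  have q0: "qform ?U ?u y \<in> \<int>" if y: "intvec y" "y \<in> Vec k" for y
  proof -
    obtain z where z: "z \<in> Vec k" "y = ratv z" using intvecE[OF y] .
    have "even (bil ?U z z - ?u \<bullet> z)" using char_vec_diag[OF s] z by (simp add: char_vec_def)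
    then obtain t where t: "bil ?U z z - ?u \<bullet> z = 2 * t" by blast
    have "bil (ratm ?U) y y = of_int (bil ?U z z)" unfolding bil_def z(2) ratm_mult_ratv[OF U z(1)]
      using z by (intro scalar_prod_ratv) (simp add: mat_diag_def)
    moreover have "ratv ?u \<bullet> y = of_int (?u \<bullet> z)" unfolding z(2) using z by (intro scalar_prod_ratv) simp
    ultimately have "qform ?U ?u y = of_int (bil ?U z z - ?u \<bullet> z) / 2" by (simp add: qform_def)
    thus ?thesis unfolding t by simp
  qed
  have q00: "qform ?U ?u (0\<^sub>v k) = 0" by (simp add: qform_def bil_def scalar_prod_def mat_diag_def)
  have z0: "0\<^sub>v k \<in> duals ?U" by (rule integral_duals[OF U]) (auto simp: intvec_def)
  have sp: "vec_first y n @v vec_last y k = y" if "y \<in> Vec (n + k)" for y :: "rat vec" using that by simp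
  have dB: "vec_first y n \<in> duals A" "vec_last y k \<in> duals ?U" "y \<in> Vec (n + k)" if "y \<in> duals ?B" for y
  proof -
    show yc: "y \<in> Vec (n + k)" using that by (simp add: mem_duals[OF block_sum_carrier[OF A U]])
    show "vec_first y n \<in> duals A" "vec_last y k \<in> duals ?U"
      using duals_block_sum[OF A U, of "vec_first y n" "vec_last y k"] that sp[OF yc] by auto
  qed
  have g: "disc_map A c ?B (c @v ?u) (\<lambda>x. x @v 0\<^sub>v k)"
    unfolding disc_map_def
  proof (intro conjI ballI impI)
    fix x assume x: "x \<in> duals A"
    have xc: "x \<in> Vec n" using x by (simp add: mem_duals[OF A])
    show "x @v 0\<^sub>v k \<in> duals ?B" using duals_block_sum[OF A U xc, of "0\<^sub>v k"] x z0 by simp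
    show "qform ?B (c @v ?u) (x @v 0\<^sub>v k) - qform A c x \<in> \<int>"
      using qform_block_sum[OF A U c u xc zero_carrier_vec] q00 by simp
    fix y assume "y \<in> duals A"
    hence yc: "y \<in> Vec n" by (simp add: mem_duals[OF A])
    show "intvec (((x + y) @v 0\<^sub>v k) - ((x @v 0\<^sub>v k) + (y @v 0\<^sub>v k)))"
      using xc yc by (auto simp: intvec_def append_vec_def Let_def)
    assume "intvec (x - y)"
    thus "intvec ((x @v 0\<^sub>v k) - (y @v 0\<^sub>v k))" using xc yc by (auto simp: intvec_def append_vec_def Let_def)
  qed
  have h: "disc_map ?B (c @v ?u) A c (\<lambda>y. vec_first y n)"
    unfolding disc_map_def
  proof (intro conjI ballI impI)
    fix x assume x: "x \<in> duals ?B"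
    note d = dB[OF x]
    show "vec_first x n \<in> duals A" by (rule d(1))
    have "qform ?B (c @v ?u) x = qform A c (vec_first x n) + qform ?U ?u (vec_last x k)"
      using qform_block_sum[OF A U c u, of "vec_first x n" "vec_last x k"] sp[OF d(3)] by simp
    moreover have "qform ?U ?u (vec_last x k) \<in> \<int>" by (rule q0[OF int[OF d(2)]]) simp
    ultimately show "qform A c (vec_first x n) - qform ?B (c @v ?u) x \<in> \<int>" by simp
    fix y assume "y \<in> duals ?B"
    note e = dB[OF this]
    show "intvec (vec_first (x + y) n - (vec_first x n + vec_first y n))"
      using d(3) e(3) by (auto simp: intvec_def vec_first_def)
    assume "intvec (x - y)"
    thus "intvec (vec_first x n - vec_first y n)" using d(3) e(3) by (auto simp: intvec_def vec_first_def)
  qed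
  have "intvec (vec_first (x @v 0\<^sub>v k) n - x)" if "x \<in> duals A" for x
    using that by (auto simp: mem_duals[OF A] intvec_def vec_first_def)
  moreover have "intvec ((vec_first y n @v 0\<^sub>v k) - y)" if y: "y \<in> duals ?B" for y
    unfolding intvec_def
  proof (intro allI impI)
    note e = dB[OF y]
    fix i assume "i < dim_vec ((vec_first y n @v 0\<^sub>v k) - y)"
    hence i: "i < n + k" using e(3) by simp
    show "((vec_first y n @v 0\<^sub>v k) - y) $ i \<in> \<int>"
    proof (cases "i < n")
      case True thus ?thesis using i e(3) by (simp add: vec_first_def append_vec_def Let_def)
    next
      case False
      hence "vec_last y k $ (i - n) \<in> \<int>" using int[OF e(2)] i unfolding intvec_def by simp
      moreover have "vec_last y k $ (i - n) = y $ i"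
      proof -
        have "n + (i - n) = i" using False by simp
        thus ?thesis using i e(3) False by (simp add: vec_last_def)
      qed
      ultimately show ?thesis using i e(3) False by (simp add: vec_first_def append_vec_def Let_def)
    qed
  qed
  ultimately show ?thesis unfolding disc_equiv_def using g h by blast
qed

lemma stably_iso_disc_equiv:
  assumes A: "A \<in> Mat n n" "A\<^sup>T = A" and A': "A' \<in> Mat m m" "A'\<^sup>T = A'"
    and c: "c \<in> Vec n" and c': "c' \<in> Vec m" and st: "stably_iso (coord_triple A c) (coord_triple A' c')"
  shows "disc_equiv A c A' c'"
proof -
  obtain k k' \<epsilon> \<epsilon>' where s: "signs k \<epsilon>" "signs k' \<epsilon>'"
    and i: "coord_triple A c \<oplus>\<^sub>L unit_sum k \<epsilon> \<simeq>\<^sub>L coord_triple A' c' \<oplus>\<^sub>L unit_sum k' \<epsilon>'"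
    using st unfolding stably_iso_def by blast
  let ?B = "block_sum A (mat_diag k \<epsilon>)" and ?b = "c @v vec k \<epsilon>"
  let ?B' = "block_sum A' (mat_diag k' \<epsilon>')" and ?b' = "c' @v vec k' \<epsilon>'"
  have t: "coord_triple X x \<oplus>\<^sub>L unit_sum l \<delta> \<simeq>\<^sub>L coord_triple (block_sum X (mat_diag l \<delta>)) (x @v vec l \<delta>)"
    and bt: "bilinear (coord_triple X x \<oplus>\<^sub>L unit_sum l \<delta>)"
    and bb: "bilinear (coord_triple (block_sum X (mat_diag l \<delta>)) (x @v vec l \<delta>))"
    if X: "X \<in> Mat p p" "X\<^sup>T = X" "x \<in> Vec p" for X x l \<delta> p
  proof -
    have b1: "bilinear (coord_triple X x)" by (rule bilinear_coord_triple[OF X(1,2)])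
    have b2: "bilinear (coord_triple (mat_diag l \<delta>) (vec l \<delta>))" by (rule bilinear_coord_triple[OF mat_diag_dim transpose_mat_diag])
    show bt: "bilinear (coord_triple X x \<oplus>\<^sub>L unit_sum l \<delta>)" by (rule bilinear_orth_sum[OF b1 bilinear_unit_sum])
    show "bilinear (coord_triple (block_sum X (mat_diag l \<delta>)) (x @v vec l \<delta>))"
      by (rule bilinear_coord_triple[OF block_sum_carrier[OF X(1) mat_diag_dim] transpose_block_sum_diag[OF X(1,2)]])
    show "coord_triple X x \<oplus>\<^sub>L unit_sum l \<delta> \<simeq>\<^sub>L coord_triple (block_sum X (mat_diag l \<delta>)) (x @v vec l \<delta>)"
      by (rule triple_iso_trans[OF bt bilinear_orth_sum[OF b1 b2] triple_iso_orth_sum[OF triple_iso_refl[OF b1] unit_sum_coord]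
        coord_triple_block_sum[OF X(1) mat_diag_dim X(3) vec_carrier]])
  qed
  note tA = t[OF A c, of k \<epsilon>] and btA = bt[OF A c, of k \<epsilon>] and bbA = bb[OF A c, of k \<epsilon>]
  note tB = t[OF A' c', of k' \<epsilon>'] and btB = bt[OF A' c', of k' \<epsilon>'] and bbB = bb[OF A' c', of k' \<epsilon>']
  have iso: "coord_triple ?B ?b \<simeq>\<^sub>L coord_triple ?B' ?b'"
    by (rule triple_iso_trans[OF bbA btA triple_iso_sym[OF btA bbA tA] triple_iso_trans[OF btA btB i tB]])
  have B: "?B \<in> Mat (n + k) (n + k)" "?B' \<in> Mat (m + k') (m + k')"
    by (rule block_sum_carrier[OF A(1) mat_diag_dim], rule block_sum_carrier[OF A'(1) mat_diag_dim])
  have e: "disc_equiv ?B ?b ?B' ?b'"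
    by (rule coord_iso_disc_equiv[OF B(1) transpose_block_sum_diag[OF A] B(2) transpose_block_sum_diag[OF A'] _ _ iso]) (use c c' in auto)
  show ?thesis
    by (rule disc_equiv_trans[OF A(1) B(1) A'(1) disc_equiv_stabilise[OF A(1) s(1) c]
      disc_equiv_trans[OF B A'(1) e disc_equiv_sym[OF disc_equiv_stabilise[OF A'(1) s(2) c']]]])
qed

section \<open>The radical\<close>

lemma unim_uminus: assumes "unim n E" shows "unim n ((- 1) \<cdot>\<^sub>m E)"
  using assms unfolding unim_def by (simp add: det_smult abs_mult power_abs)

lemma block_sum_zero_zero: "block_sum (0\<^sub>m p p) (0\<^sub>m q q) = 0\<^sub>m (p + q) (p + q)"
  by (intro eq_matI) (auto simp: block_sum_index)

text \<open>
  A degenerate integral matrix kills an integral vector; after \<open>reduce_vec\<close> this is a multiple of the first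
  basis vector, whose row and column then vanish.
\<close>

lemma radical_split:
  assumes "A \<in> Mat n n" "A\<^sup>T = A"
  shows "\<exists>r k N. n = r + k \<and> N \<in> Mat k k \<and> N\<^sup>T = N \<and> det N \<noteq> (0 :: int) \<and> mcong A (block_sum (0\<^sub>m r r) N)"
  using assms
proof (induction n arbitrary: A)
  case 0
  have "block_sum (0\<^sub>m 0 0) A = A" using 0 by (intro eq_matI) (auto simp: block_sum_index)
  thus ?case using 0 mcong_refl[OF 0(1)] by (intro exI[of _ 0] exI[of _ A]) simp
next
  case (Suc n)
  show ?case
  proof (cases "det A = 0")
    case False
    have "block_sum (0\<^sub>m 0 0) A = A" using Suc.prems by (intro eq_matI) (auto simp: block_sum_index)
    thus ?thesis using False Suc.prems mcong_refl[OF Suc.prems(1)] by (intro exI[of _ 0] exI[of _ "Suc n"] exI[of _ A]) simp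
  next
    case True
    then obtain v where v: "v \<in> Vec (Suc n)" "v \<noteq> 0\<^sub>v (Suc n)" "A *v v = 0\<^sub>v (Suc n)"
      using det_0_iff_vec_prod_zero[OF Suc.prems(1)] by blast
    obtain F where F: "unim (Suc n) F" "\<And>i. i < Suc n \<Longrightarrow> 0 < i \<Longrightarrow> (F *v v) $ i = 0"
      using reduce_vec[OF v(1), of 0] by auto
    have Fc: "F \<in> Mat (Suc n) (Suc n)" by (rule unim_carrier[OF F(1)])
    obtain H where H: "unim (Suc n) H" "F * H = 1\<^sub>m (Suc n)" "H * F = 1\<^sub>m (Suc n)" using unim_inverse[OF F(1)] .
    have Hc: "H \<in> Mat (Suc n) (Suc n)" by (rule unim_carrier[OF H(1)])
    define t where "t = (F *v v) $ 0"
    have Fv: "F *v v = t \<cdot>v unit_vec (Suc n) 0"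
    proof (rule eq_vecI)
      fix i assume "i < dim_vec (t \<cdot>v unit_vec (Suc n) 0)"
      hence i: "i < Suc n" by simp
      show "(F *v v) $ i = (t \<cdot>v unit_vec (Suc n) 0) $ i"
        using F(2)[OF i] i by (cases "i = 0") (simp_all only: t_def index_smult_vec index_unit_vec, simp_all)
    qed (use Fc in simp)
    have vH: "v = t \<cdot>v (H *v unit_vec (Suc n) 0)"
      using assoc_mult_mat_vec[OF Hc Fc v(1)] H(3) v(1) mult_mat_vec_smult[OF Hc, of "unit_vec (Suc n) 0" t] Fv by simp
    have Hu: "H *v unit_vec (Suc n) 0 \<in> Vec (Suc n)" using Hc by simp
    have t0: "t \<noteq> 0"
    proof
      assume "t = 0"
      hence "v = 0\<^sub>v (Suc n)" using vH Hc by (intro eq_vecI) auto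
      thus False using v(2) by simp
    qed
    have "t \<cdot>v (A *v (H *v unit_vec (Suc n) 0)) = 0\<^sub>v (Suc n)"
      using mult_mat_vec_smult[OF Suc.prems(1) Hu, of t] vH v(3) by simp
    hence AH: "A *v (H *v unit_vec (Suc n) 0) = 0\<^sub>v (Suc n)"
    proof -
      assume e: "t \<cdot>v (A *v (H *v unit_vec (Suc n) 0)) = 0\<^sub>v (Suc n)"
      have c: "A *v (H *v unit_vec (Suc n) 0) \<in> Vec (Suc n)" using Suc.prems(1) Hu by simp
      show ?thesis
      proof (rule eq_vecI)
        fix i assume "i < dim_vec (0\<^sub>v (Suc n))"
        hence i: "i < Suc n" by simp
        have "(t \<cdot>v (A *v (H *v unit_vec (Suc n) 0))) $ i = 0" unfolding e using i by simp
        hence "t * (A *v (H *v unit_vec (Suc n) 0)) $ i = 0" using i c by (simp only: index_smult_vec carrier_vecD)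
        thus "(A *v (H *v unit_vec (Suc n) 0)) $ i = 0\<^sub>v (Suc n) $ i" using t0 i by simp
      qed (use Suc.prems(1) in simp)
    qed
    define G where "G = H\<^sup>T * A * (H\<^sup>T)\<^sup>T"
    have mc: "mcong A G" by (rule mcongI[OF Suc.prems(1) unim_transpose[OF H(1)] G_def])
    have Gc: "G \<in> Mat (Suc n) (Suc n)" by (rule mcong_carrier[OF mc Suc.prems(1)])
    have Gs: "G\<^sup>T = G" by (rule mcong_symmetric[OF mc Suc.prems(2)])
    have Ht: "H\<^sup>T \<in> Mat (Suc n) (Suc n)" using Hc by simp
    have "G *v unit_vec (Suc n) 0 = H\<^sup>T *v (A *v (H *v unit_vec (Suc n) 0))"
      unfolding G_def transpose_transpose
      using assoc_mult_mat_vec[OF mult_carrier_mat[OF Ht Suc.prems(1)] Hc, of "unit_vec (Suc n) 0"] assoc_mult_mat_vec[OF Ht Suc.prems(1) Hu] by simp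
    hence "col G 0 = 0\<^sub>v (Suc n)" unfolding AH using mult_unit_vec_col[OF Gc, of 0] Ht by (auto intro!: eq_vecI)
    hence G0: "G $$ (i, 0) = 0" if "i < Suc n" for i using that Gc by (metis index_col carrier_matD index_zero_vec(1) zero_less_Suc)
    have G0': "G $$ (0, i) = 0" if "i < Suc n" for i
      using G0[OF that] that Gc Gs by (metis carrier_matD index_transpose_mat(1) zero_less_Suc)
    define A1 where "A1 = mat n n (\<lambda>(i, j). G $$ (Suc i, Suc j))"
    have A1: "A1 \<in> Mat n n" by (simp add: A1_def)
    have A1s: "A1\<^sup>T = A1"
    proof (rule eq_matI)
      fix i j assume "i < dim_row A1" "j < dim_col A1"
      hence ij: "i < n" "j < n" using A1 by auto
      have "G $$ (Suc j, Suc i) = G $$ (Suc i, Suc j)" using arg_cong[OF Gs, of "\<lambda>X. X $$ (Suc i, Suc j)"] Gc ij by simp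
      thus "A1\<^sup>T $$ (i, j) = A1 $$ (i, j)" using ij by (simp add: A1_def)
    qed (simp_all add: A1_def)
    have GA: "G = block_sum (0\<^sub>m 1 1) A1"
    proof (rule eq_matI)
      fix i j assume "i < dim_row (block_sum (0\<^sub>m 1 1) A1)" "j < dim_col (block_sum (0\<^sub>m 1 1) A1)"
      hence ij: "i < Suc n" "j < Suc n" using A1 by auto
      show "G $$ (i, j) = block_sum (0\<^sub>m 1 1) A1 $$ (i, j)"
        using ij G0 G0' A1 by (cases i; cases j) (auto simp: block_sum_index A1_def)
    qed (use Gc A1 in auto)
    obtain r k N where N: "n = r + k" "N \<in> Mat k k" "N\<^sup>T = N" "det N \<noteq> 0" "mcong A1 (block_sum (0\<^sub>m r r) N)"
      using Suc.IH[OF A1 A1s] by blast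
    have "mcong G (block_sum (0\<^sub>m 1 1) (block_sum (0\<^sub>m r r) N))" unfolding GA
      by (rule mcong_block_sum[OF mcong_refl[OF zero_carrier_mat] N(5)])
    hence "mcong G (block_sum (0\<^sub>m (Suc r) (Suc r)) N)" unfolding block_sum_assoc[symmetric] block_sum_zero_zero by simp
    hence "mcong A (block_sum (0\<^sub>m (Suc r) (Suc r)) N)" by (rule mcong_trans[OF mc])
    thus ?thesis using N by (intro exI[of _ "Suc r"] exI[of _ k] exI[of _ N]) simp
  qed
qed

text \<open>
  Twice \<open>d\<close> times the first coordinate: a characteristic form on a lattice with zero form is even, and
  every even functional has this shape in a suitable basis.
\<close>

definition rad_char :: "nat \<Rightarrow> int \<Rightarrow> int vec"
  where "rad_char r d = vec r (\<lambda>i. if i = 0 then 2 * d else 0)"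

lemma rad_char_carrier [simp]: "rad_char r d \<in> Vec r" by (simp add: rad_char_def)

lemma transpose_block_sum_zero:
  assumes "N \<in> Mat k k" "N\<^sup>T = N" shows "transpose_mat (block_sum (0\<^sub>m r r) N) = block_sum (0\<^sub>m r r :: int mat) N"
  using block_sum_transpose[OF zero_carrier_mat[of r r] assms(1)] assms(2) by simp

lemma normal_form:
  assumes A: "A \<in> Mat n n" "A\<^sup>T = A" and c: "char_vec n A c"
  obtains r k N d cN where "N \<in> Mat k k" "N\<^sup>T = N" "det N \<noteq> 0" "char_vec k N cN" "0 \<le> d" "r = 0 \<longrightarrow> d = 0"
    "coord_triple (block_sum (0\<^sub>m r r) N) (rad_char r d @v cN) \<simeq>\<^sub>L coord_triple A c"
proof -
  obtain r k N where n: "n = r + k" and N: "N \<in> Mat k k" "N\<^sup>T = N" "det N \<noteq> 0" and mc: "mcong A (block_sum (0\<^sub>m r r) N)"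
    using radical_split[OF A] by blast
  let ?B = "block_sum (0\<^sub>m r r) N"
  have B: "?B \<in> Mat (r + k) (r + k)" by (rule block_sum_carrier[OF zero_carrier_mat N(1)])
  have Bs: "?B\<^sup>T = ?B" by (rule transpose_block_sum_zero[OF N(1,2)])
  obtain m E where E0: "A \<in> Mat m m" "unim m E" and E: "?B = E * A * E\<^sup>T" using mc unfolding mcong_def by blast
  have m: "m = r + k" using E0(1) A(1) n by auto
  have Eu: "unim (r + k) E" using E0(2) m by simp
  have Ar: "A \<in> Mat (r + k) (r + k)" using A(1) n by simp
  have Ec: "E \<in> Mat (r + k) (r + k)" by (rule unim_carrier[OF Eu])
  have cr: "char_vec (r + k) A c" using c n by simp
  hence cc: "c \<in> Vec (r + k)" by (simp add: char_vec_def)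
  have ch: "char_vec (r + k) ?B (E *v c)" unfolding E by (rule char_vec_congruence[OF Ar Ec cr])
  define a b where "a = vec_first (E *v c) r" and "b = vec_last (E *v c) k"
  have a: "a \<in> Vec r" and b: "b \<in> Vec k" by (simp_all add: a_def b_def)
  have Ecc: "E *v c \<in> Vec (r + k)" using Ec cc by simp
  have ab: "E *v c = a @v b" unfolding a_def b_def using Ecc by simp
  have chs: "char_vec r (0\<^sub>m r r) a" "char_vec k N b"
    using ch unfolding ab char_vec_block_sum[OF zero_carrier_mat N(1) a b] by auto
  have ev: "even (a $ i)" if i: "i < r" for i
  proof -
    have "bil (0\<^sub>m r r) (unit_vec r i) (unit_vec r i) = (0 :: int)"
      unfolding bil_def mult_unit_vec_col[OF zero_carrier_mat i] using i by (simp add: scalar_prod_def)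
    moreover have "even (bil (0\<^sub>m r r) (unit_vec r i) (unit_vec r i) - a \<bullet> unit_vec r i)" using chs(1) by (simp add: char_vec_def)
    ultimately show ?thesis using scalar_prod_right_unit[OF i, of a] by simp
  qed
  have "\<exists>F d. unim r F \<and> 0 \<le> d \<and> (r = 0 \<longrightarrow> d = 0) \<and> F *v a = rad_char r d"
  proof (cases "r = 0")
    case True
    hence "(1\<^sub>m r) *v a = rad_char r 0" using a by (intro eq_vecI) (auto simp: rad_char_def)
    thus ?thesis using True by (intro exI[of _ "1\<^sub>m r"] exI[of _ 0]) simp
  next
    case False
    hence r: "0 < r" by simp
    define a2 where "a2 = vec r (\<lambda>i. a $ i div 2)"
    have a2: "a2 \<in> Vec r" by (simp add: a2_def)
    have aa: "a = 2 \<cdot>v a2" using ev a by (intro eq_vecI) (auto simp: a2_def)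
    obtain F where F: "unim r F" "\<And>i. i < r \<Longrightarrow> 0 < i \<Longrightarrow> (F *v a2) $ i = 0" using reduce_vec[OF a2 r] by auto
    have Fc: "F \<in> Mat r r" by (rule unim_carrier[OF F(1)])
    have FF: "G *v a = rad_char r ((G *v a2) $ 0)"
      if G: "G \<in> Mat r r" "\<And>i. i < r \<Longrightarrow> 0 < i \<Longrightarrow> (G *v a2) $ i = 0" for G
    proof (rule eq_vecI)
      fix i assume "i < dim_vec (rad_char r ((G *v a2) $ 0))"
      hence i: "i < r" by (simp add: rad_char_def)
      have "(G *v a) $ i = 2 * (G *v a2) $ i"
        unfolding aa mult_mat_vec_smult[OF G(1) a2] using i G(1) by (simp only: index_smult_vec dim_mult_mat_vec carrier_matD)
      thus "(G *v a) $ i = rad_char r ((G *v a2) $ 0) $ i"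
        using G(2)[OF i] i by (cases "i = 0") (simp_all only: rad_char_def index_vec, simp_all)
    qed (use G in \<open>simp add: rad_char_def\<close>)
    show ?thesis
    proof (cases "0 \<le> (F *v a2) $ 0")
      case True
      thus ?thesis using F(1) FF[OF Fc F(2)] r by blast
    next
      case neg: False
      let ?G = "(- 1) \<cdot>\<^sub>m F"
      have Ge: "(?G *v a2) $ i = - ((F *v a2) $ i)" if "i < r" for i
        using that Fc a2 by (simp add: scalar_prod_def sum_negf)
      have "?G *v a = rad_char r ((?G *v a2) $ 0)"
        by (rule FF) (use Fc Ge F(2) in auto)
      moreover have "0 \<le> (?G *v a2) $ 0" using Ge[OF r] neg by linarith
      ultimately show ?thesis using unim_uminus[OF F(1)] r by blast
    qed
  qed
  then obtain F d where F: "unim r F" and d: "0 \<le> d" "r = 0 \<longrightarrow> d = 0" and Fa: "F *v a = rad_char r d" by blast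
  have Fc: "F \<in> Mat r r" by (rule unim_carrier[OF F])
  let ?E = "block_sum F (1\<^sub>m k)"
  have Eb: "?E \<in> Mat (r + k) (r + k)" by (rule block_sum_carrier[OF Fc one_carrier_mat])
  have "\<bar>det F\<bar> = 1" using F unfolding unim_def by simp
  hence dE: "\<bar>det ?E\<bar> = 1" unfolding block_sum_det[OF Fc one_carrier_mat] by simp
  have Eun: "unim (r + k) ?E" unfolding unim_def by (rule conjI[OF Eb dE])
  have Et: "?E\<^sup>T = block_sum (F\<^sup>T) (1\<^sub>m k)" using block_sum_transpose[OF Fc one_carrier_mat] by simp
  have "?E * ?B = block_sum (F * 0\<^sub>m r r) (1\<^sub>m k * N)" by (rule block_sum_mult[OF Fc one_carrier_mat zero_carrier_mat N(1)])
  also have "\<dots> = ?B" using Fc N by simp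
  finally have EB: "?E * ?B = ?B" .
  have "?B * ?E\<^sup>T = block_sum (0\<^sub>m r r * F\<^sup>T) (N * 1\<^sub>m k)"
    unfolding Et by (rule block_sum_mult[OF zero_carrier_mat N(1) _ one_carrier_mat]) (use Fc in simp)
  also have "\<dots> = ?B" using Fc N by simp
  finally have EBE: "?B = ?E * ?B * ?E\<^sup>T" unfolding EB ..
  have "?E = four_block_mat F (0\<^sub>m r k) (0\<^sub>m k r) (1\<^sub>m k)" using Fc by (simp add: block_sum_def)
  hence "?E *v (a @v b) = (F *v a) @v (1\<^sub>m k *v b)" using mult_mat_vec_split[OF Fc one_carrier_mat a b] by simp
  hence Ev: "?E *v (a @v b) = rad_char r d @v b" unfolding Fa using b by simp
  have zz: "v = v + 2 \<cdot>v (?B *v 0\<^sub>v (r + k))" if "v \<in> Vec (r + k)" for v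
    using that B N(1) by (intro eq_vecI) (auto simp: scalar_prod_def)
  have 1: "coord_triple ?B (rad_char r d @v b) \<simeq>\<^sub>L coord_triple ?B (a @v b)"
    by (rule coord_triple_congruence[OF B Bs Eun EBE append_carrier_vec[OF a b] zero_carrier_vec]) (unfold Ev, rule zz, use b in simp)
  have 2: "coord_triple ?B (a @v b) \<simeq>\<^sub>L coord_triple A c"
    by (rule coord_triple_congruence[OF Ar A(2) Eu E cc zero_carrier_vec]) (unfold ab, rule zz, use a b in simp)
  have fin: "coord_triple ?B (rad_char r d @v b) \<simeq>\<^sub>L coord_triple A c"
    by (rule triple_iso_trans[OF bilinear_coord_triple[OF B Bs] bilinear_coord_triple[OF B Bs] 1 2])
  show thesis by (rule that[OF N chs(2) d fin])
qed

lemma stably_iso_cong: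
  assumes bl: "bilinear T1" "bilinear T" "bilinear T'" "bilinear T1'"
    and 1: "T1 \<simeq>\<^sub>L T" and st: "stably_iso T T'" and 2: "T' \<simeq>\<^sub>L T1'"
  shows "stably_iso T1 T1'"
proof -
  obtain n n' \<epsilon> \<epsilon>' where s: "signs n \<epsilon>" "signs n' \<epsilon>'" and i: "T \<oplus>\<^sub>L unit_sum n \<epsilon> \<simeq>\<^sub>L T' \<oplus>\<^sub>L unit_sum n' \<epsilon>'"
    using st unfolding stably_iso_def by blast
  have u: "unit_sum n \<epsilon> \<simeq>\<^sub>L unit_sum n \<epsilon>" for n \<epsilon> by (rule triple_iso_refl[OF bilinear_unit_sum])
  have b: "bilinear (T1 \<oplus>\<^sub>L unit_sum n \<epsilon>)" "bilinear (T \<oplus>\<^sub>L unit_sum n \<epsilon>)" "bilinear (T' \<oplus>\<^sub>L unit_sum n' \<epsilon>')"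
    by (intro bilinear_orth_sum bl bilinear_unit_sum)+
  have "T1 \<oplus>\<^sub>L unit_sum n \<epsilon> \<simeq>\<^sub>L T1' \<oplus>\<^sub>L unit_sum n' \<epsilon>'"
    by (rule triple_iso_trans[OF b(1,2) triple_iso_orth_sum[OF 1 u] triple_iso_trans[OF b(2,3) i triple_iso_orth_sum[OF 2 u]]])
  thus ?thesis unfolding stably_iso_def using s by blast
qed

lemma stably_iso_add_left:
  assumes bl: "bilinear K" "bilinear T" "bilinear T'" and st: "stably_iso T T'"
  shows "stably_iso (K \<oplus>\<^sub>L T) (K \<oplus>\<^sub>L T')"
proof -
  obtain n n' \<epsilon> \<epsilon>' where s: "signs n \<epsilon>" "signs n' \<epsilon>'" and i: "T \<oplus>\<^sub>L unit_sum n \<epsilon> \<simeq>\<^sub>L T' \<oplus>\<^sub>L unit_sum n' \<epsilon>'"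
    using st unfolding stably_iso_def by blast
  have b: "bilinear ((K \<oplus>\<^sub>L T) \<oplus>\<^sub>L unit_sum n \<epsilon>)" "bilinear (K \<oplus>\<^sub>L T \<oplus>\<^sub>L unit_sum n \<epsilon>)"
    "bilinear ((K \<oplus>\<^sub>L T') \<oplus>\<^sub>L unit_sum n' \<epsilon>')" "bilinear (K \<oplus>\<^sub>L T' \<oplus>\<^sub>L unit_sum n' \<epsilon>')"
    by (intro bilinear_orth_sum bl bilinear_unit_sum)+
  have "K \<oplus>\<^sub>L T \<oplus>\<^sub>L unit_sum n \<epsilon> \<simeq>\<^sub>L K \<oplus>\<^sub>L T' \<oplus>\<^sub>L unit_sum n' \<epsilon>'" by (rule triple_iso_orth_sum[OF triple_iso_refl[OF bl(1)] i])
  hence "(K \<oplus>\<^sub>L T) \<oplus>\<^sub>L unit_sum n \<epsilon> \<simeq>\<^sub>L (K \<oplus>\<^sub>L T') \<oplus>\<^sub>L unit_sum n' \<epsilon>'"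
    using triple_iso_trans[OF b(1,2) triple_iso_assoc[OF bl(1,2) bilinear_unit_sum]
      triple_iso_trans[OF b(2,4) _ triple_iso_sym[OF b(3,4) triple_iso_assoc[OF bl(1,3) bilinear_unit_sum]]]] by blast
  thus ?thesis unfolding stably_iso_def using s by blast
qed

text \<open>
  A half-integer modulo \<open>\<int>\<close> is determined by whether it is an integer.
\<close>

lemma half_integers_diff:
  fixes a b :: rat assumes "2 * a \<in> \<int>" "2 * b \<in> \<int>" "a \<in> \<int> \<longleftrightarrow> b \<in> \<int>" shows "a - b \<in> \<int>"
proof (cases "a \<in> \<int>")
  case True thus ?thesis using assms by simp
next
  case False
  obtain p where p: "2 * a = of_int p" using Ints_cases[OF assms(1)] .
  obtain q where q: "2 * b = of_int q" using Ints_cases[OF assms(2)] .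
  have odd: "odd p'" if "2 * x = of_int p'" "x \<notin> \<int>" for x :: rat and p'
  proof
    assume "even p'"
    then obtain s where "p' = 2 * s" by blast
    hence "x = of_int s" using that(1) by simp
    thus False using that(2) by simp
  qed
  have "odd p" "odd q" using odd[OF p False] odd[OF q] False assms(3) by blast+
  hence "even (p - q)" by simp
  then obtain s where "p - q = 2 * s" by blast
  hence "2 * a - 2 * b = of_int (2 * s)" unfolding p q by (simp only: of_int_diff[symmetric])
  hence "a - b = of_int s" by simp
  thus ?thesis by simp
qed

lemma disc_map_integral:
  assumes A: "A \<in> Mat n n" and A': "A' \<in> Mat n' n'" and g: "disc_map A c A' c' g" and x: "x \<in> Vec n" "intvec x"
  shows "intvec (g x)"
proof -
  have z: "0\<^sub>v n \<in> duals A" by (rule integral_duals[OF A]) (auto simp: intvec_def)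
  have xd: "x \<in> duals A" by (rule integral_duals[OF A x(2,1)])
  have gz: "g (0\<^sub>v n) \<in> Vec n'" and gx: "g x \<in> Vec n'"
    using disc_mapD(1)[OF g z] disc_mapD(1)[OF g xd] by (auto simp: mem_duals[OF A'])
  have "intvec (g (0\<^sub>v n + 0\<^sub>v n) - (g (0\<^sub>v n) + g (0\<^sub>v n)))" by (rule disc_mapD(3)[OF g z z])
  hence 1: "intvec (g (0\<^sub>v n))" using gz by (auto simp: intvec_def minus_in_Ints_iff)
  have "x - 0\<^sub>v n = x" using x by (intro eq_vecI) auto
  hence 2: "intvec (g x - g (0\<^sub>v n))" using disc_mapD(4)[OF g xd z] x by simp
  have "g x = (g x - g (0\<^sub>v n)) + g (0\<^sub>v n)" using gx gz by (intro eq_vecI) auto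
  thus ?thesis using integral_add[OF 2 1] gz by simp
qed

lemma duals_smult:
  assumes A: "A \<in> Mat n n" and x: "x \<in> duals A" shows "of_nat m \<cdot>v x \<in> duals A"
proof -
  have c: "x \<in> Vec n" "intvec (ratm A *v x)" using x by (simp_all add: mem_duals[OF A])
  have e: "ratm A *v (of_nat m \<cdot>v x) = of_nat m \<cdot>v (ratm A *v x)" by (rule mult_mat_vec_smult[OF _ c(1)]) (use A in simp)
  have "intvec (of_nat m \<cdot>v (ratm A *v x))" using c(2) unfolding intvec_def by (metis Ints_mult Ints_of_nat index_smult_vec)
  thus ?thesis using c(1) e by (simp add: mem_duals[OF A])
qed

lemma disc_map_smult:
  assumes A: "A \<in> Mat n n" and A': "A' \<in> Mat n' n'" and g: "disc_map A c A' c' g" and x: "x \<in> duals A"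
  shows "intvec (g (of_nat m \<cdot>v x) - of_nat m \<cdot>v g x)"
proof (induction m)
  have xc: "x \<in> Vec n" using x by (simp add: mem_duals[OF A])
  have gc: "g v \<in> Vec n'" if "v \<in> duals A" for v using disc_mapD(1)[OF g that] by (simp add: mem_duals[OF A'])
  {
    case 0
    have "intvec (g (of_nat 0 \<cdot>v x))"
      by (rule disc_map_integral[OF A A' g]) (use xc in \<open>auto simp: intvec_def\<close>)
    moreover have "g (of_nat 0 \<cdot>v x) - of_nat 0 \<cdot>v g x = g (of_nat 0 \<cdot>v x)"
    proof -
      have c0: "g (of_nat 0 \<cdot>v x) \<in> Vec n'" by (rule gc[OF duals_smult[OF A x]])
      show ?thesis using c0 gc[OF x] by (intro eq_vecI) auto
    qed
    ultimately show ?case by metis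
  next
    case (Suc m)
    let ?y = "of_nat m \<cdot>v x"
    have y: "?y \<in> duals A" by (rule duals_smult[OF A x])
    have e: "of_nat (Suc m) \<cdot>v x = ?y + x" using xc by (intro eq_vecI) (auto simp: algebra_simps)
    have m1: "intvec (g (?y + x) - (g ?y + g x))" by (rule disc_mapD(3)[OF g y x])
    have m2: "intvec ((g ?y + g x) - of_nat (Suc m) \<cdot>v g x)"
    proof -
      have "(g ?y + g x) - of_nat (Suc m) \<cdot>v g x = g ?y - of_nat m \<cdot>v g x" using gc[OF x] gc[OF y] by (intro eq_vecI) (auto simp: algebra_simps)
      thus ?thesis using Suc.IH by simp
    qed
    have c1: "g (?y + x) \<in> Vec n'" by (rule gc[OF duals_add[OF A y x]])
    show ?case unfolding e by (rule integral_trans[OF m1 m2 c1]) (use gc[OF x] gc[OF y] in auto)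
  }
qed

lemma duals_radical:
  assumes N: "N \<in> Mat k k"
  shows "u \<in> Vec r \<Longrightarrow> v \<in> Vec k \<Longrightarrow> u @v v \<in> duals (block_sum (0\<^sub>m r r) N) \<longleftrightarrow> v \<in> duals N"
    and "x \<in> duals (block_sum (0\<^sub>m r r) N) \<Longrightarrow> x \<in> Vec (r + k) \<and> x = vec_first x r @v vec_last x k \<and> vec_last x k \<in> duals N"
proof -
  have z: "u \<in> duals (0\<^sub>m r r)" if "u \<in> Vec r" for u
    using that unfolding mem_duals[OF zero_carrier_mat[of r r]] intvec_def by (auto simp: scalar_prod_def)
  show 1: "u @v v \<in> duals (block_sum (0\<^sub>m r r) N) \<longleftrightarrow> v \<in> duals N" if "u \<in> Vec r" "v \<in> Vec k" for u v
    using duals_block_sum[OF zero_carrier_mat[of r r] N that] z[OF that(1)] by simp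
  assume x: "x \<in> duals (block_sum (0\<^sub>m r r) N)"
  hence c: "x \<in> Vec (r + k)" by (simp add: mem_duals[OF block_sum_carrier[OF zero_carrier_mat N]])
  hence e: "x = vec_first x r @v vec_last x k" by simp
  have "vec_last x k \<in> duals N" using 1[of "vec_first x r" "vec_last x k"] x e by simp
  thus "x \<in> Vec (r + k) \<and> x = vec_first x r @v vec_last x k \<and> vec_last x k \<in> duals N" using c e by blast
qed

text \<open>
  Cramer's rule: the adjugate matrix turns the integral vector \<open>N v\<close> into \<open>det N\<close> times \<open>v\<close>.
\<close>

lemma det_times_dual_integral:
  assumes N: "N \<in> Mat k k" and v: "v \<in> duals N"
  shows "intvec (of_nat (nat \<bar>det N\<bar>) \<cdot>v v)"
proof -
  have vc: "v \<in> Vec k" and iv: "intvec (ratm N *v v)" using v by (simp_all add: mem_duals[OF N])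
  have aN: "adj_mat N \<in> Mat k k" "adj_mat N * N = det N \<cdot>\<^sub>m 1\<^sub>m k" using adj_mat[OF N] by auto
  have Nq: "ratm N \<in> Mat k k" "ratm (adj_mat N) \<in> Mat k k" using N aN by auto
  have "intvec (ratm (adj_mat N) *v (ratm N *v v))" by (rule integral_mult_mat[OF aN(1) iv]) (use Nq vc in simp)
  also have "ratm (adj_mat N) *v (ratm N *v v) = ratm (adj_mat N * N) *v v"
    unfolding ratm_mult[OF aN(1) N] by (rule assoc_mult_mat_vec[OF Nq(2,1) vc, symmetric])
  also have "ratm (adj_mat N * N) = of_int (det N) \<cdot>\<^sub>m 1\<^sub>m k" unfolding aN(2) by (intro eq_matI) auto
  also have "(of_int (det N) \<cdot>\<^sub>m 1\<^sub>m k) *v v = of_int (det N) \<cdot>v v" using vc by (intro eq_vecI) auto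
  finally have i: "intvec (of_int (det N) \<cdot>v v)" .
  have "of_nat (nat \<bar>det N\<bar>) = (of_int \<bar>det N\<bar> :: rat)" by simp
  hence "of_nat (nat \<bar>det N\<bar>) = (of_int (det N) :: rat) \<or> of_nat (nat \<bar>det N\<bar>) = (- of_int (det N) :: rat)" by (auto simp: abs_if)
  thus ?thesis
  proof
    assume "of_nat (nat \<bar>det N\<bar>) = (- of_int (det N) :: rat)"
    thus ?thesis using i by (simp add: intvec_def minus_in_Ints_iff)
  qed (use i in simp)
qed

text \<open>
  A dual vector whose class is divisible by \<open>det N'\<close> has integral second component by
  \<open>det_times_dual_integral\<close>, and a vector with integral second component is divisible by everything.
\<close>

lemma radical_preserved:
  assumes N: "N \<in> Mat k k" and N': "N' \<in> Mat k' k'" "det N' \<noteq> 0"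
    and g: "disc_map (block_sum (0\<^sub>m r r) N) c (block_sum (0\<^sub>m r' r') N') c' g"
    and x: "x \<in> duals (block_sum (0\<^sub>m r r) N)" and ix: "intvec (vec_last x k)"
  shows "intvec (vec_last (g x) k')"
proof -
  let ?B = "block_sum (0\<^sub>m r r) N" and ?B' = "block_sum (0\<^sub>m r' r') N'"
  have B: "?B \<in> Mat (r + k) (r + k)" and B': "?B' \<in> Mat (r' + k') (r' + k')"
    by (rule block_sum_carrier[OF zero_carrier_mat N], rule block_sum_carrier[OF zero_carrier_mat N'(1)])
  define m where "m = nat \<bar>det N'\<bar>"
  have m: "0 < m" using N'(2) by (simp add: m_def)
  note xd = duals_radical(2)[OF N x]
  \<comment> \<open>\<open>x\<close> is \<open>m\<close> times \<open>y\<close> modulo integral vectors\<close>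
  define y where "y = (1 / of_nat m) \<cdot>v vec_first x r @v 0\<^sub>v k"
  have z: "0\<^sub>v k \<in> duals N" by (rule integral_duals[OF N]) (auto simp: intvec_def)
  have y: "y \<in> duals ?B" unfolding y_def by (rule duals_radical(1)[OF N, THEN iffD2]) (use z in auto)
  have yc: "y \<in> Vec (r + k)" by (simp add: y_def)
  have "x - of_nat m \<cdot>v y = 0\<^sub>v r @v vec_last x k"
  proof -
    have "(vec_first x r @v vec_last x k) - of_nat m \<cdot>v y = 0\<^sub>v r @v vec_last x k"
      unfolding y_def using m by (intro eq_vecI) auto
    thus ?thesis using xd by simp
  qed
  moreover have "intvec (0\<^sub>v r @v vec_last x k)" unfolding integral_append using ix by (simp add: intvec_def)
  ultimately have "intvec (x - of_nat m \<cdot>v y)" by simp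
  hence 1: "intvec (g x - g (of_nat m \<cdot>v y))" by (rule disc_mapD(4)[OF g x duals_smult[OF B y]])
  have 2: "intvec (g (of_nat m \<cdot>v y) - of_nat m \<cdot>v g y)" by (rule disc_map_smult[OF B B' g y])
  note gx = duals_radical(2)[OF N'(1) disc_mapD(1)[OF g x]] and gy = duals_radical(2)[OF N'(1) disc_mapD(1)[OF g y]]
    and gm = duals_radical(2)[OF N'(1) disc_mapD(1)[OF g duals_smult[OF B y, of m]]]
  have 3: "intvec (g x - of_nat m \<cdot>v g y)" by (rule integral_trans[OF 1 2]) (use gx gy gm in auto)
  have 4: "intvec (of_nat m \<cdot>v vec_last (g y) k')" unfolding m_def by (rule det_times_dual_integral[OF N'(1)]) (use gy in blast)
  show ?thesis unfolding intvec_def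
  proof (intro allI impI)
    fix i assume "i < dim_vec (vec_last (g x) k')"
    hence i: "i < k'" by simp
    have c: "g x \<in> Vec (r' + k')" "g y \<in> Vec (r' + k')" using gx gy by auto
    have "(g x - of_nat m \<cdot>v g y) $ (r' + i) \<in> \<int>" using 3 i c unfolding intvec_def by simp
    moreover have "(of_nat m \<cdot>v vec_last (g y) k') $ i \<in> \<int>" using 4 i unfolding intvec_def by simp
    moreover have "vec_last (g x) k' $ i = (g x - of_nat m \<cdot>v g y) $ (r' + i) + (of_nat m \<cdot>v vec_last (g y) k') $ i"
      using i c by (simp add: vec_last_def)
    ultimately show "vec_last (g x) k' $ i \<in> \<int>" by (metis Ints_add)
  qed
qed

text \<open>
  The elements of order at most two in the divisible part correspond to the subsets of the \<open>r\<close> coordinates,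
  and the map is injective on them.
\<close>

lemma radical_rank_le:
  assumes N: "N \<in> Mat k k" and N': "N' \<in> Mat k' k'" "det N' \<noteq> 0"
    and e: "disc_equiv (block_sum (0\<^sub>m r r) N) c (block_sum (0\<^sub>m r' r') N') c'"
  shows "r \<le> r'"
proof -
  let ?B = "block_sum (0\<^sub>m r r) N" and ?B' = "block_sum (0\<^sub>m r' r') N'"
  have B: "?B \<in> Mat (r + k) (r + k)" and B': "?B' \<in> Mat (r' + k') (r' + k')"
    by (rule block_sum_carrier[OF zero_carrier_mat N], rule block_sum_carrier[OF zero_carrier_mat N'(1)])
  obtain g h where g: "disc_map ?B c ?B' c' g" and h: "disc_map ?B' c' ?B c h"
    and hg: "\<And>x. x \<in> duals ?B \<Longrightarrow> intvec (h (g x) - x)"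
    using e unfolding disc_equiv_def by blast
  define x where "x I = vec r (\<lambda>i. if i \<in> I then 1 / 2 else (0 :: rat)) @v 0\<^sub>v k" for I :: "nat set"
  have z: "0\<^sub>v k \<in> duals N" by (rule integral_duals[OF N]) (auto simp: intvec_def)
  have xd: "x I \<in> duals ?B" for I unfolding x_def by (rule duals_radical(1)[OF N, THEN iffD2]) (use z in auto)
  have xc: "x I \<in> Vec (r + k)" for I by (simp add: x_def)
  note gd = duals_radical(2)[OF N'(1) disc_mapD(1)[OF g xd]]
  have gc: "g (x I) \<in> Vec (r' + k')" for I using gd[of I] by blast
  have vl: "vec_last (x I) k = 0\<^sub>v k" for I unfolding x_def by (intro eq_vecI) (auto simp: vec_last_def)
  have last: "intvec (vec_last (g (x I)) k')" for I
    by (rule radical_preserved[OF N N' g xd]) (simp add: vl intvec_def)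
  have two: "2 * g (x I) $ i \<in> \<int>" if i: "i < r' + k'" for I i
  proof -
    have 1: "intvec (g (of_nat 2 \<cdot>v x I))"
      by (rule disc_map_integral[OF B B' g]) (use xc in \<open>auto simp: intvec_def x_def\<close>)
    have 2: "intvec (g (of_nat 2 \<cdot>v x I) - of_nat 2 \<cdot>v g (x I))" by (rule disc_map_smult[OF B B' g xd])
    have c: "g (of_nat 2 \<cdot>v x I) \<in> Vec (r' + k')"
      using disc_mapD(1)[OF g duals_smult[OF B xd, where m = 2]] unfolding mem_duals[OF B'] by (rule conjunct1)
    have "g (of_nat 2 \<cdot>v x I) $ i \<in> \<int>" using 1 c i unfolding intvec_def by simp
    moreover have "(g (of_nat 2 \<cdot>v x I) - of_nat 2 \<cdot>v g (x I)) $ i \<in> \<int>" using 2 c gc[of I] i unfolding intvec_def by simp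
    moreover have "2 * g (x I) $ i = g (of_nat 2 \<cdot>v x I) $ i - (g (of_nat 2 \<cdot>v x I) - of_nat 2 \<cdot>v g (x I)) $ i"
      using c gc[of I] i by simp
    ultimately show ?thesis by (metis Ints_diff)
  qed
  define \<tau> where "\<tau> I = {i. i < r' \<and> g (x I) $ i \<notin> \<int>}" for I
  have "inj_on \<tau> (Pow {..<r})"
  proof (rule inj_onI)
    fix I J assume I: "I \<in> Pow {..<r}" and J: "J \<in> Pow {..<r}" and eq: "\<tau> I = \<tau> J"
    have "intvec (g (x I) - g (x J))"
      unfolding intvec_def
    proof (intro allI impI)
      fix i assume "i < dim_vec (g (x I) - g (x J))"
      hence i: "i < r' + k'" using gc[of J] by simp
      have "g (x I) $ i - g (x J) $ i \<in> \<int>"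
      proof (cases "i < r'")
        case True
        hence "g (x I) $ i \<in> \<int> \<longleftrightarrow> g (x J) $ i \<in> \<int>" using eq unfolding \<tau>_def set_eq_iff by blast
        thus ?thesis by (rule half_integers_diff[OF two[OF i] two[OF i]])
      next
        case False
        have "g (x I) $ i \<in> \<int>" for I
        proof -
          have "vec_last (g (x I)) k' $ (i - r') \<in> \<int>" using last[of I] False i unfolding intvec_def by simp
          thus ?thesis using False i gc[of I] by (simp add: vec_last_def not_less)
        qed
        thus ?thesis by simp
      qed
      thus "(g (x I) - g (x J)) $ i \<in> \<int>" using i gc[of J] by simp
    qed
    hence hh: "intvec (h (g (x I)) - h (g (x J)))"
      by (rule disc_mapD(4)[OF h disc_mapD(1)[OF g xd] disc_mapD(1)[OF g xd]])
    have hc: "h (g (x I)) \<in> Vec (r + k)" for I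
      using disc_mapD(1)[OF h disc_mapD(1)[OF g xd]] by (simp add: mem_duals[OF B])
    have "intvec (x I - h (g (x I)))" by (rule integral_sym[OF hg[OF xd] hc xc])
    hence "intvec (x I - h (g (x J)))" by (rule integral_trans[OF _ hh xc hc hc])
    hence d: "intvec (x I - x J)" by (rule integral_trans[OF _ hg[OF xd] xc hc xc])
    have "i \<in> I \<longleftrightarrow> i \<in> J" if i: "i < r" for i
    proof -
      have xi: "x I $ i = (if i \<in> I then 1 / 2 else 0)" for I using i by (simp add: x_def)
      have di: "i < dim_vec (x J)" using i by (simp add: x_def)
      have "(x I - x J) $ i \<in> \<int>" by (rule d[unfolded intvec_def, rule_format]) (use di in simp)
      hence "(if i \<in> I then 1 / 2 else 0) - (if i \<in> J then 1 / 2 else 0) \<in> (\<int> :: rat set)"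
        unfolding index_minus_vec(1)[OF di] xi .
      moreover have "(1 / 2 :: rat) \<notin> \<int>"
      proof
        assume "(1 / 2 :: rat) \<in> \<int>"
        from Ints_cases[OF this] obtain s where "(1 / 2 :: rat) = of_int s" .
        hence "(1 :: rat) = of_int (2 * s)" by simp
        hence "1 = 2 * s" by (metis of_int_1 of_int_eq_iff)
        thus False by presburger
      qed
      moreover from this have "(- (1 / 2) :: rat) \<notin> \<int>" using minus_in_Ints_iff by blast
      ultimately show ?thesis by (auto split: if_splits)
    qed
    thus "I = J" using I J by blast
  qed
  moreover have "\<tau> ` Pow {..<r} \<subseteq> Pow {..<r'}" by (auto simp: \<tau>_def)
  ultimately have "card (Pow {..<r}) \<le> card (Pow {..<r'})" by (rule card_inj_on_le) simp
  hence "(2 :: nat) ^ r \<le> 2 ^ r'" by (simp add: card_Pow)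
  thus ?thesis by simp
qed

lemma qform_radical:
  assumes "u \<in> Vec r" shows "qform (0\<^sub>m r r) (rad_char r d) u = - of_int d * (if r = 0 then 0 else u $ 0)"
proof -
  have "bil (ratm (0\<^sub>m r r)) u u = 0" using assms by (simp add: bil_def scalar_prod_def)
  moreover have "ratv (rad_char r d) \<bullet> u = (\<Sum>i<r. if i = 0 then 2 * of_int d * u $ 0 else 0)"
  proof -
    have "ratv (rad_char r d) \<bullet> u = (\<Sum>i<r. of_int (if i = 0 then 2 * d else 0) * u $ i)"
      using assms by (simp add: scalar_prod_def rad_char_def lessThan_atLeast0)
    also have "\<dots> = (\<Sum>i<r. if i = 0 then 2 * of_int d * u $ 0 else 0)" by (intro sum.cong) auto
    finally show ?thesis .
  qed
  ultimately show ?thesis by (simp add: qform_def)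
qed

lemma qform_integral:
  assumes N: "N \<in> Mat k k" and ch: "char_vec k N c" and y: "intvec y" "y \<in> Vec k"
  shows "qform N c y \<in> \<int>"
proof -
  obtain z where z: "z \<in> Vec k" "y = ratv z" using intvecE[OF y] .
  have "even (bil N z z - c \<bullet> z)" and cc: "c \<in> Vec k" using ch z by (auto simp: char_vec_def)
  then obtain t where t: "bil N z z - c \<bullet> z = 2 * t" by blast
  have "bil (ratm N) y y = of_int (bil N z z)" unfolding bil_def z(2) ratm_mult_ratv[OF N z(1)]
    using z N by (intro scalar_prod_ratv) simp
  moreover have "ratv c \<bullet> y = of_int (c \<bullet> z)" unfolding z(2) using z cc by (intro scalar_prod_ratv) simp
  ultimately have "qform N c y = of_int (bil N z z - c \<bullet> z) / 2" by (simp add: qform_def)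
  thus ?thesis unfolding t by simp
qed

text \<open>
  On the elements of order \<open>m\<close> in the divisible part the quadratic function \<open>- d x\<^sub>1\<close> vanishes exactly if \<open>m\<close>
  divides \<open>d\<close>. The element with first coordinate \<open>1 / m\<close> detects this.
\<close>

lemma rad_char_dvd:
  assumes N: "N \<in> Mat k k" "det N \<noteq> 0" and N': "N' \<in> Mat k' k'" and r: "0 < r" "0 < r'"
    and ch: "char_vec k N cN" and cc': "cN' \<in> Vec k'"
    and h: "disc_map (block_sum (0\<^sub>m r' r') N') (rad_char r' d' @v cN') (block_sum (0\<^sub>m r r) N) (rad_char r d @v cN) h"
    and m: "0 < m" "int m dvd d"
  shows "int m dvd d'"
proof -
  let ?B = "block_sum (0\<^sub>m r r) N" and ?B' = "block_sum (0\<^sub>m r' r') N'"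
  have B: "?B \<in> Mat (r + k) (r + k)" and B': "?B' \<in> Mat (r' + k') (r' + k')"
    by (rule block_sum_carrier[OF zero_carrier_mat N(1)], rule block_sum_carrier[OF zero_carrier_mat N'])
  have cc: "cN \<in> Vec k" using ch by (simp add: char_vec_def)
  define u where "u = vec r' (\<lambda>i. if i = 0 then 1 / of_nat m else (0 :: rat))"
  define y where "y = u @v 0\<^sub>v k'"
  have uc: "u \<in> Vec r'" by (simp add: u_def)
  have z: "0\<^sub>v k' \<in> duals N'" by (rule integral_duals[OF N']) (auto simp: intvec_def)
  have y: "y \<in> duals ?B'" unfolding y_def by (rule duals_radical(1)[OF N', THEN iffD2]) (use z uc in auto)
  have yc: "y \<in> Vec (r' + k')" using uc by (simp add: y_def)
  note hy = duals_radical(2)[OF N(1) disc_mapD(1)[OF h y]]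
  have hc: "h y \<in> Vec (r + k)" using hy by blast
  have "vec_last y k' = 0\<^sub>v k'" unfolding y_def using uc by (intro eq_vecI) (auto simp: vec_last_def)
  hence last: "intvec (vec_last (h y) k)" by (intro radical_preserved[OF N' N h y]) (simp add: intvec_def)
  have "intvec (h (of_nat m \<cdot>v y))"
    by (rule disc_map_integral[OF B' B h]) (use yc m in \<open>auto simp: intvec_def y_def u_def\<close>)
  moreover have "intvec (h (of_nat m \<cdot>v y) - of_nat m \<cdot>v h y)" by (rule disc_map_smult[OF B' B h y])
  moreover have c: "h (of_nat m \<cdot>v y) \<in> Vec (r + k)"
    using disc_mapD(1)[OF h duals_smult[OF B' y]] by (simp add: mem_duals[OF B])
  ultimately have "h (of_nat m \<cdot>v y) $ 0 \<in> \<int>" "(h (of_nat m \<cdot>v y) - of_nat m \<cdot>v h y) $ 0 \<in> \<int>"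
    using r hc unfolding intvec_def by auto
  hence "h (of_nat m \<cdot>v y) $ 0 - (h (of_nat m \<cdot>v y) - of_nat m \<cdot>v h y) $ 0 \<in> \<int>" by (rule Ints_diff)
  hence my: "of_nat m * h y $ 0 \<in> \<int>" using c hc r by simp
  obtain l where l: "d = int m * l" using m(2) by blast
  have "of_int l * (of_nat m * h y $ 0) \<in> \<int>" by (rule Ints_mult[OF Ints_of_int my])
  hence dy: "of_int d * h y $ 0 \<in> \<int>" unfolding l by (simp add: algebra_simps)
  have "qform ?B' (rad_char r' d' @v cN') y = - of_int d' / of_nat m"
  proof -
    have "qform N' cN' (0\<^sub>v k') = 0" using N' cc' by (simp add: qform_def bil_def scalar_prod_def)
    thus ?thesis unfolding y_def qform_block_sum[OF zero_carrier_mat N' rad_char_carrier cc' uc zero_carrier_vec] qform_radical[OF uc]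
      using r by (simp add: u_def)
  qed
  moreover have "qform ?B (rad_char r d @v cN) (h y) + of_int d * h y $ 0 \<in> \<int>"
  proof -
    have "qform ?B (rad_char r d @v cN) (vec_first (h y) r @v vec_last (h y) k) =
        - of_int d * vec_first (h y) r $ 0 + qform N cN (vec_last (h y) k)"
      using qform_block_sum[OF zero_carrier_mat N(1) rad_char_carrier cc, of "vec_first (h y) r" r "vec_last (h y) k" d]
        qform_radical[of "vec_first (h y) r" r d] r by simp
    moreover have "vec_first (h y) r @v vec_last (h y) k = h y" using hy by simp
    moreover have "vec_first (h y) r $ 0 = h y $ 0" using r by (simp add: vec_first_def)
    moreover have "qform N cN (vec_last (h y) k) \<in> \<int>" by (rule qform_integral[OF N(1) ch last]) simp
    ultimately show ?thesis by simp
  qed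
  moreover have "qform ?B (rad_char r d @v cN) (h y) - qform ?B' (rad_char r' d' @v cN') y \<in> \<int>"
    by (rule disc_mapD(2)[OF h y])
  ultimately have fr: "of_int d' / of_nat m \<in> (\<int> :: rat set)" using dy
  proof -
    assume a: "qform ?B' (rad_char r' d' @v cN') y = - of_int d' / of_nat m"
      "qform ?B (rad_char r d @v cN) (h y) + of_int d * h y $ 0 \<in> \<int>"
      "qform ?B (rad_char r d @v cN) (h y) - qform ?B' (rad_char r' d' @v cN') y \<in> \<int>" "of_int d * h y $ 0 \<in> \<int>"
    have "(qform ?B (rad_char r d @v cN) (h y) - qform ?B' (rad_char r' d' @v cN') y)
       - ((qform ?B (rad_char r d @v cN) (h y) + of_int d * h y $ 0) - of_int d * h y $ 0) \<in> \<int>"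
      by (intro Ints_diff a)
    thus ?thesis unfolding a(1) by simp
  qed
  obtain s where "of_int d' / of_nat m = (of_int s :: rat)" using Ints_cases[OF fr] .
  hence "(of_int d' :: rat) = of_int (s * int m)" using m(1) by (simp add: field_simps)
  hence "d' = s * int m" by (simp only: of_int_eq_iff)
  thus ?thesis by simp
qed

section \<open>From discriminants to stable isomorphisms\<close>

lemma ratm_inj: "ratm X = ratm Y \<Longrightarrow> X = Y" by (rule of_int_hom.mat_hom_inj)

lemma ratv_inj: "ratv x = ratv y \<Longrightarrow> x = y" by (rule of_int_hom.vec_hom_inj)

lemma ratv_unit: "ratv (unit_vec n i) = unit_vec n i"
  by (intro eq_vecI) (auto simp: unit_vec_def)

lemma rat_mult_unit_vec:
  assumes "X \<in> Mat m k" "i < m" "j < k" shows "((X :: rat mat) *v unit_vec k j) $ i = X $$ (i, j)"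
  using assms scalar_prod_right_unit[OF assms(3), of "row X i"] by simp

lemma integral_matE:
  fixes X :: "rat mat"
  assumes X: "X \<in> Mat m k" and int: "\<And>w. w \<in> Vec k \<Longrightarrow> intvec (X *v ratv w)"
  obtains Y where "Y \<in> Mat m k" "X = ratm Y"
proof
  show "map_mat floor X \<in> Mat m k" using X by simp
  show "X = ratm (map_mat floor X)"
  proof (rule eq_matI)
    fix i j assume "i < dim_row (ratm (map_mat floor X))" "j < dim_col (ratm (map_mat floor X))"
    hence ij: "i < m" "j < k" using X by auto
    have "intvec (X *v unit_vec k j)" using int[of "unit_vec k j"] by (simp add: ratv_unit)
    hence "(X *v unit_vec k j) $ i \<in> \<int>" by (rule intvec_def[THEN iffD1, rule_format]) (use ij X in simp)
    hence "X $$ (i, j) \<in> \<int>" unfolding rat_mult_unit_vec[OF X ij] .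
    from Ints_cases[OF this] obtain t where "X $$ (i, j) = of_int t" .
    thus "X $$ (i, j) = ratm (map_mat floor X) $$ (i, j)" using ij X by simp
  qed auto
qed

lemma rational_inverse:
  assumes N: "N \<in> Mat k k" "N\<^sup>T = N" "det N \<noteq> 0"
  obtains I where "I \<in> Mat k k" "ratm N * I = 1\<^sub>m k" "I * ratm N = 1\<^sub>m k" "I\<^sup>T = I"
proof -
  have a: "adj_mat N \<in> Mat k k" "N * adj_mat N = det N \<cdot>\<^sub>m 1\<^sub>m k" "adj_mat N * N = det N \<cdot>\<^sub>m 1\<^sub>m k" using adj_mat[OF N(1)] by auto
  define I where "I = (1 / of_int (det N)) \<cdot>\<^sub>m ratm (adj_mat N)"
  have Nq: "ratm N \<in> Mat k k" and aq: "ratm (adj_mat N) \<in> Mat k k" using N a by auto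
  have I: "I \<in> Mat k k" using aq by (simp add: I_def)
  have d: "(1 / of_int (det N)) \<cdot>\<^sub>m ratm (det N \<cdot>\<^sub>m 1\<^sub>m k) = (1\<^sub>m k :: rat mat)" using N(3) by (intro eq_matI) auto
  have NI: "ratm N * I = 1\<^sub>m k"
    unfolding I_def mult_smult_distrib[OF Nq aq] ratm_mult[OF N(1) a(1), symmetric] a(2) by (rule d)
  have IN: "I * ratm N = 1\<^sub>m k"
    unfolding I_def mult_smult_assoc_mat[OF aq Nq] ratm_mult[OF a(1) N(1), symmetric] a(3) by (rule d)
  have It: "I\<^sup>T \<in> Mat k k" using I by simp
  have ItN: "I\<^sup>T * ratm N = 1\<^sub>m k"
    using transpose_mult[OF Nq I] NI transpose_ratm[OF N(2)] by simp
  have "I\<^sup>T = I\<^sup>T * (ratm N * I)" unfolding NI using It by simp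
  also have "\<dots> = (I\<^sup>T * ratm N) * I" by (rule assoc_mult_mat[OF It Nq I, symmetric])
  also have "\<dots> = I" unfolding ItN using I by simp
  finally show thesis by (intro that[OF I NI IN])
qed

lemma bil_minus:
  assumes "X \<in> Mat k k" "Y \<in> Mat k k" "x \<in> Vec k" "y \<in> Vec k"
  shows "bil (X - Y) x y = bil X x y - bil (Y :: rat mat) x y"
  unfolding bil_def minus_mult_distrib_mat_vec[OF assms(1,2,4)]
  by (rule scalar_prod_minus_distrib[of _ k]) (use assms in auto)

text \<open>
  Polarisation shows that the bilinear form is integral; then so is the linear part, and the parity
  condition is the hypothesis itself.
\<close>

lemma integral_quadratic:
  fixes S :: "rat mat"
  assumes S: "S \<in> Mat k k" "S\<^sup>T = S" and \<gamma>: "\<gamma> \<in> Vec k"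
    and int: "\<And>w. w \<in> Vec k \<Longrightarrow> (bil S (ratv w) (ratv w) - \<gamma> \<bullet> ratv w) / 2 \<in> \<int>"
  obtains S0 \<gamma>0 where "S0 \<in> Mat k k" "S = ratm S0" "S0\<^sup>T = S0" "\<gamma> = ratv \<gamma>0" "char_vec k S0 \<gamma>0"
proof -
  let ?f = "\<lambda>w. (bil S (ratv w) (ratv w) - \<gamma> \<bullet> ratv w) / 2"
  have bint: "bil S (ratv v) (ratv w) \<in> \<int>" if v: "v \<in> Vec k" and w: "w \<in> Vec k" for v w
  proof -
    have vq: "ratv v \<in> Vec k" and wq: "ratv w \<in> Vec k" and vwq: "ratv v + ratv w \<in> Vec k" using v w by auto
    have e: "ratv (v + w) = ratv v + ratv w" using v w by (intro eq_vecI) auto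
    have "bil S (ratv v + ratv w) (ratv v + ratv w) = bil S (ratv v) (ratv v) + bil S (ratv w) (ratv w) + 2 * bil S (ratv v) (ratv w)"
      unfolding bil_add_left[OF S(1) vq wq vwq] bil_add_right[OF S(1) vq vq wq] bil_add_right[OF S(1) wq vq wq]
      using bil_sym[OF S wq vq] by simp
    moreover have "\<gamma> \<bullet> (ratv v + ratv w) = \<gamma> \<bullet> ratv v + \<gamma> \<bullet> ratv w" by (rule scalar_prod_add_distrib[OF \<gamma> vq wq])
    ultimately have "bil S (ratv v) (ratv w) = ?f (v + w) - ?f v - ?f w" unfolding e by (simp add: field_simps)
    moreover have "?f (v + w) - ?f v - ?f w \<in> \<int>" by (intro Ints_diff int) (use v w in auto)
    ultimately show ?thesis by simp
  qed
  obtain S0 where S0: "S0 \<in> Mat k k" "S = ratm S0"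
  proof (rule integral_matE[OF S(1)])
    fix w :: "int vec" assume w: "w \<in> Vec k"
    show "intvec (S *v ratv w)" unfolding intvec_def
    proof (intro allI impI)
      fix i assume "i < dim_vec (S *v ratv w)"
      hence i: "i < k" using S by simp
      have "bil S (ratv (unit_vec k i)) (ratv w) = (S *v ratv w) $ i"
        unfolding bil_def ratv_unit by (rule scalar_prod_left_unit[OF _ i]) (use S w in simp)
      thus "(S *v ratv w) $ i \<in> \<int>" using bint[OF _ w, of "unit_vec k i"] by simp
    qed
  qed
  have S0t: "S0\<^sup>T = S0"
    by (rule ratm_inj) (use S(2) S0(2) in \<open>simp add: map_mat_transpose\<close>)
  have gi: "\<gamma> \<bullet> ratv w \<in> \<int>" if w: "w \<in> Vec k" for w
  proof -
    have "bil S (ratv w) (ratv w) - 2 * ?f w \<in> \<int>" by (intro Ints_diff Ints_mult bint int w) simp_all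
    thus ?thesis by (simp add: field_simps)
  qed
  have "intvec \<gamma>" unfolding intvec_def
  proof (intro allI impI)
    fix i assume "i < dim_vec \<gamma>"
    hence i: "i < k" using \<gamma> by simp
    show "\<gamma> $ i \<in> \<int>" using gi[of "unit_vec k i"] scalar_prod_right_unit[OF i, of \<gamma>] by (simp add: ratv_unit)
  qed
  from intvecE[OF this \<gamma>] obtain \<gamma>0 where g0: "\<gamma>0 \<in> Vec k" "\<gamma> = ratv \<gamma>0" .
  have "even (bil S0 z z - \<gamma>0 \<bullet> z)" if z: "z \<in> Vec k" for z
  proof -
    have "bil S (ratv z) (ratv z) = of_int (bil S0 z z)"
      unfolding bil_def S0(2) ratm_mult_ratv[OF S0(1) z] using S0 z by (intro scalar_prod_ratv) simp
    moreover have "\<gamma> \<bullet> ratv z = of_int (\<gamma>0 \<bullet> z)" unfolding g0(2) using g0 z by (intro scalar_prod_ratv) simp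
    ultimately have "of_int (bil S0 z z - \<gamma>0 \<bullet> z) / 2 \<in> (\<int> :: rat set)" using int[OF z] by simp
    from Ints_cases[OF this] obtain s where s: "of_int (bil S0 z z - \<gamma>0 \<bullet> z) / 2 = (of_int s :: rat)" .
    hence "(of_int (bil S0 z z - \<gamma>0 \<bullet> z) :: rat) = of_int (2 * s)" by simp
    hence "bil S0 z z - \<gamma>0 \<bullet> z = 2 * s" by (simp only: of_int_eq_iff)
    thus ?thesis by simp
  qed
  hence "char_vec k S0 \<gamma>0" using g0 by (simp add: char_vec_def)
  thus thesis by (rule that[OF S0 S0t g0(2)])
qed

lemma qform_congruent:
  assumes N: "N \<in> Mat k k" "N\<^sup>T = N" and ch: "char_vec k N c" and p: "p \<in> duals N"
    and e: "intvec (q - p)" and q: "q \<in> Vec k"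
  shows "qform N c q - qform N c p \<in> \<int>"
proof -
  have pc: "p \<in> Vec k" and ip: "intvec (ratm N *v p)" using p by (simp_all add: mem_duals[OF N(1)])
  let ?e = "q - p"
  have Nq: "ratm N \<in> Mat k k" and ec: "?e \<in> Vec k" and cc: "ratv c \<in> Vec k"
    using N pc q ch by (auto simp: char_vec_def)
  have q': "q = p + ?e" using pc q by (intro eq_vecI) auto
  have pe: "p + ?e \<in> Vec k" using pc ec by simp
  have "bil (ratm N) (p + ?e) (p + ?e) = bil (ratm N) p p + bil (ratm N) ?e ?e + 2 * bil (ratm N) ?e p"
    unfolding bil_add_left[OF Nq pc ec pe] bil_add_right[OF Nq pc pc ec] bil_add_right[OF Nq ec pc ec]
    using bil_sym[OF Nq transpose_ratm[OF N(2)] pc ec] by simp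
  moreover have "ratv c \<bullet> (p + ?e) = ratv c \<bullet> p + ratv c \<bullet> ?e" by (rule scalar_prod_add_distrib[OF cc pc ec])
  ultimately have "qform N c (p + ?e) = qform N c p + qform N c ?e + bil (ratm N) ?e p" by (simp add: qform_def field_simps)
  moreover have "qform N c ?e \<in> \<int>" by (rule qform_integral[OF N(1) ch e ec])
  moreover have "bil (ratm N) ?e p \<in> \<int>" unfolding bil_def by (rule integral_scalar_prod[OF e ip ec]) (use Nq pc in simp)
  ultimately show ?thesis using q' by (metis Ints_add add.assoc add_diff_cancel_left')
qed

lemma ratm_add: "X \<in> Mat m n \<Longrightarrow> Y \<in> Mat m n \<Longrightarrow> ratm (X + Y) = ratm X + ratm Y"
  by (intro eq_matI) auto

lemma mat_diff_add_cancel: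
  assumes "(A :: rat mat) \<in> Mat m n" "X \<in> Mat m n"
  shows "A - X + X = A" "X + (A - X) = A"
  by (rule eq_matI, use assms in auto)+

lemma vec_diff_diff_add_cancel:
  assumes "(a :: rat vec) \<in> Vec n" "y \<in> Vec n" "b \<in> Vec n"
  shows "a - y - b + y = a - b"
  by (rule eq_vecI) (use assms in auto)

lemma vec_last_append_eq: "b \<in> Vec k \<Longrightarrow> vec_last (a @v b) k = b"
  by (intro eq_vecI) (auto simp: vec_last_def)

lemma integral_diff: "intvec x \<Longrightarrow> intvec y \<Longrightarrow> dim_vec x = dim_vec y \<Longrightarrow> intvec (x - y)"
  by (simp add: intvec_def)

text \<open>
  The images of the columns of \<open>N\<inverse>\<close> have a radical part and a part in the dual of \<open>N'\<close>; the latter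
  are the columns of \<open>V\<close>, and \<open>P = N' V\<close>. Since integral vectors go to integral vectors, \<open>V N\<close> and the pairing
  of \<open>N\<close> with the first row \<open>uv\<close> of the radical part are integral. The vector \<open>t = N uv\<close> measures by how much the
  characteristic vector has to be corrected along the radical.
\<close>

lemma glue_data:
  assumes N: "N \<in> Mat k k" "N\<^sup>T = N" "det N \<noteq> 0" and N': "N' \<in> Mat k' k'" "N'\<^sup>T = N'" "det N' \<noteq> 0"
    and ch: "char_vec k N cN" and ch': "char_vec k' N' cN'"
    and I: "I \<in> Mat k k" "ratm N * I = 1\<^sub>m k" "I * ratm N = 1\<^sub>m k" "I\<^sup>T = I"
    and g: "disc_map (block_sum (0\<^sub>m r r) N) (rad_char r d @v cN) (block_sum (0\<^sub>m r r) N') (rad_char r d @v cN') g"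
  obtains P R S \<gamma> t V where "P \<in> Mat k' k" "R \<in> Mat k' k" "S \<in> Mat k k" "S\<^sup>T = S"
    "P * N = N' * R" "N * S + R\<^sup>T * P = 1\<^sub>m k" "char_vec k S \<gamma>" "t \<in> Vec k" "r = 0 \<longrightarrow> t = 0\<^sub>v k"
    "N *v \<gamma> + R\<^sup>T *v cN' = cN - (2 * d) \<cdot>v t" "V \<in> Mat k' k" "ratm P = ratm N' * V"
    "\<forall>w\<in>Vec k. intvec (vec_last (g (0\<^sub>v r @v (I *v ratv w))) k' - V *v ratv w)"
proof -
  let ?B = "block_sum (0\<^sub>m r r) N" and ?B' = "block_sum (0\<^sub>m r r) N'"
  have B: "?B \<in> Mat (r + k) (r + k)" and B': "?B' \<in> Mat (r + k') (r + k')"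
    by (rule block_sum_carrier[OF zero_carrier_mat N(1)], rule block_sum_carrier[OF zero_carrier_mat N'(1)])
  have Nq: "ratm N \<in> Mat k k" and Nq': "ratm N' \<in> Mat k' k'" using N N' by auto
  have cc: "cN \<in> Vec k" and cc': "cN' \<in> Vec k'" using ch ch' by (auto simp: char_vec_def)
  have cq: "ratv cN \<in> Vec k" and cq': "ratv cN' \<in> Vec k'" using cc cc' by auto
  define s where "s w = 0\<^sub>v r @v (I *v ratv w)" for w
  have Iw: "I *v ratv w \<in> Vec k" if "w \<in> Vec k" for w using I that by simp
  have NIw: "ratm N *v (I *v ratv w) = ratv w" if "w \<in> Vec k" for w
    using assoc_mult_mat_vec[OF Nq I(1), of "ratv w"] I(2) that by simp
  have Id: "I *v ratv w \<in> duals N" if "w \<in> Vec k" for w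
    using Iw[OF that] NIw[OF that] by (simp add: mem_duals[OF N(1)])
  have sd: "s w \<in> duals ?B" if "w \<in> Vec k" for w
    unfolding s_def by (rule duals_radical(1)[OF N(1), THEN iffD2]) (use Iw[OF that] Id[OF that] in auto)
  have sc: "s w \<in> Vec (r + k)" if "w \<in> Vec k" for w unfolding s_def using Iw[OF that] by simp
  note gd = duals_radical(2)[OF N'(1) disc_mapD(1)[OF g sd]]
  have gc: "g (s w) \<in> Vec (r + k')" if "w \<in> Vec k" for w using gd[OF that] by blast
  define G where "G = mat (r + k') k (\<lambda>(i, j). g (s (unit_vec k j)) $ i)"
  have G: "G \<in> Mat (r + k') k" by (simp add: G_def)
  have appr: "intvec (g (s w) - G *v ratv w)" if w: "w \<in> Vec k" for w
  proof -
    have "\<forall>i<r + k'. (g (s w)) $ i - (G *v ratv w) $ i \<in> \<int>"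
      using _ _ _ w
    proof (rule int_vec_induct)
      have "intvec (g (s (0\<^sub>v k)))"
        by (rule disc_map_integral[OF B B' g sc]) (use I in \<open>auto simp: s_def intvec_def scalar_prod_def\<close>)
      hence "g (s (0\<^sub>v k)) $ i \<in> \<int>" if "i < r + k'" for i using that gc[of "0\<^sub>v k"] unfolding intvec_def by simp
      moreover have "(G *v ratv (0\<^sub>v k)) $ i = 0" if "i < r + k'" for i using that G by (simp add: scalar_prod_def)
      ultimately show "\<forall>i<r + k'. g (s (0\<^sub>v k)) $ i - (G *v ratv (0\<^sub>v k)) $ i \<in> \<int>" by simp
    next
      fix j assume j: "j < k"
      show "\<forall>i<r + k'. g (s (unit_vec k j)) $ i - (G *v ratv (unit_vec k j)) $ i \<in> \<int>"
      proof (intro allI impI)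
        fix i assume i: "i < r + k'"
        have "(G *v ratv (unit_vec k j)) $ i = g (s (unit_vec k j)) $ i"
          unfolding ratv_unit rat_mult_unit_vec[OF G i j] using i j by (simp add: G_def)
        thus "g (s (unit_vec k j)) $ i - (G *v ratv (unit_vec k j)) $ i \<in> \<int>" by simp
      qed
    next
      fix x y :: "int vec" assume x: "x \<in> Vec k" and y: "y \<in> Vec k"
      assume hx: "\<forall>i<r + k'. g (s x) $ i - (G *v ratv x) $ i \<in> \<int>" and hy: "\<forall>i<r + k'. g (s y) $ i - (G *v ratv y) $ i \<in> \<int>"
      have xy: "x - y \<in> Vec k" using x y by simp
      have rxy: "ratv (x - y) = ratv x - ratv y" using x y by (intro eq_vecI) auto
      have Ixy: "I *v ratv (x - y) = I *v ratv x - I *v ratv y" unfolding rxy by (rule mult_minus_distrib_mat_vec[OF I(1)]) (use x y in auto)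
      have Gxy: "G *v ratv (x - y) = G *v ratv x - G *v ratv y" unfolding rxy by (rule mult_minus_distrib_mat_vec[OF G]) (use x y in auto)
      have sxy: "s x = s (x - y) + s y" unfolding s_def Ixy using Iw[OF x] Iw[OF y] I(1) by (intro eq_vecI) auto
      have "intvec (g (s (x - y) + s y) - (g (s (x - y)) + g (s y)))" by (rule disc_mapD(3)[OF g sd[OF xy] sd[OF y]])
      hence a: "intvec (g (s x) - (g (s (x - y)) + g (s y)))" unfolding sxy[symmetric] .
      show "\<forall>i<r + k'. g (s (x - y)) $ i - (G *v ratv (x - y)) $ i \<in> \<int>"
      proof (intro allI impI)
        fix i assume i: "i < r + k'"
        have "(g (s x) - (g (s (x - y)) + g (s y))) $ i \<in> \<int>"
          by (rule a[unfolded intvec_def, rule_format]) (use i gc[OF xy] gc[OF y] in simp)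
        hence a2: "g (s x) $ i - (g (s (x - y)) $ i + g (s y) $ i) \<in> \<int>" using i gc[OF x] gc[OF xy] gc[OF y] by simp
        have "((g (s x) $ i - (G *v ratv x) $ i) - (g (s y) $ i - (G *v ratv y) $ i)) - (g (s x) $ i - (g (s (x - y)) $ i + g (s y) $ i)) \<in> \<int>"
          by (rule Ints_diff[OF Ints_diff[OF hx[rule_format, OF i] hy[rule_format, OF i]] a2])
        also have "((g (s x) $ i - (G *v ratv x) $ i) - (g (s y) $ i - (G *v ratv y) $ i)) - (g (s x) $ i - (g (s (x - y)) $ i + g (s y) $ i))
            = g (s (x - y)) $ i - ((G *v ratv x) $ i - (G *v ratv y) $ i)" by simp
        also have "(G *v ratv x) $ i - (G *v ratv y) $ i = (G *v ratv (x - y)) $ i" unfolding Gxy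
          by (rule index_minus_vec(1)[symmetric]) (use i G in simp)
        finally show "g (s (x - y)) $ i - (G *v ratv (x - y)) $ i \<in> \<int>" .
      qed
    qed
    moreover have "(g (s w) - G *v ratv w) $ i = (g (s w)) $ i - (G *v ratv w) $ i" if "i < r + k'" for i
      by (rule index_minus_vec(1)) (use that G in simp)
    ultimately show ?thesis unfolding intvec_def using G by simp
  qed
  \<comment> \<open>the map is linear modulo integral vectors, given by a matrix with blocks for the radical and for \<open>N'\<close>\<close>
  define V where "V = mat k' k (\<lambda>(i, j). G $$ (r + i, j))"
  define uv where "uv = (if r = 0 then 0\<^sub>v k else vec k (\<lambda>j. G $$ (0, j)))"
  have V: "V \<in> Mat k' k" and uvc: "uv \<in> Vec k" by (simp_all add: V_def uv_def)
  have Vw: "V *v ratv w \<in> Vec k'" for w by (rule carrier_vecI) (use V in simp)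
  have GV: "(G *v ratv w) $ (r + i) = (V *v ratv w) $ i" if "i < k'" "w \<in> Vec k" for w i
    using that G by (simp add: V_def scalar_prod_def)
  have Gu: "(G *v ratv w) $ 0 = uv \<bullet> ratv w" if "r \<noteq> 0" "w \<in> Vec k" for w
    using that G by (simp add: uv_def scalar_prod_def)
  have last: "intvec (vec_last (g (s w)) k' - V *v ratv w)" if w: "w \<in> Vec k" for w
    unfolding intvec_def
  proof (intro allI impI)
    fix i assume "i < dim_vec (vec_last (g (s w)) k' - V *v ratv w)"
    hence i: "i < k'" using V by simp
    have "(g (s w) - G *v ratv w) $ (r + i) \<in> \<int>" by (rule appr[OF w, unfolded intvec_def, rule_format]) (use i G in simp)
    hence "g (s w) $ (r + i) - (V *v ratv w) $ i \<in> \<int>" using i G gc[OF w] GV[OF i w] by simp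
    moreover have "vec_last (g (s w)) k' $ i = g (s w) $ (r + i)" using i gc[OF w] by (simp add: vec_last_def)
    ultimately show "(vec_last (g (s w)) k' - V *v ratv w) $ i \<in> \<int>" using i V by simp
  qed
  have first: "g (s w) $ 0 - uv \<bullet> ratv w \<in> \<int>" if r: "r \<noteq> 0" and w: "w \<in> Vec k" for w
  proof -
    have "(g (s w) - G *v ratv w) $ 0 \<in> \<int>" by (rule appr[OF w, unfolded intvec_def, rule_format]) (use r G in simp)
    thus ?thesis using r G gc[OF w] Gu[OF r w] by simp
  qed
  have NV: "ratm N' * V \<in> Mat k' k" and VN: "V * ratm N \<in> Mat k' k" and Vt: "V\<^sup>T \<in> Mat k k'"
    using mult_carrier_mat[OF Nq' V] mult_carrier_mat[OF V Nq] V by auto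
  have gl: "vec_last (g (s w)) k' \<in> duals N'" "vec_last (g (s w)) k' \<in> Vec k'" if "w \<in> Vec k" for w
    using gd[OF that] by auto
  obtain P where P: "P \<in> Mat k' k" "ratm N' * V = ratm P"
  proof (rule integral_matE[OF NV])
    fix w :: "int vec" assume w: "w \<in> Vec k"
    let ?l = "vec_last (g (s w)) k'"
    have i1: "intvec (ratm N' *v ?l)" using gl(1)[OF w] by (simp add: mem_duals[OF N'(1)])
    have i2: "intvec (ratm N' *v (?l - V *v ratv w))" by (rule integral_mult_mat[OF N'(1) last[OF w]]) (use gl(2)[OF w] Vw in simp)
    have "(ratm N' * V) *v ratv w = ratm N' *v (V *v ratv w)" by (rule assoc_mult_mat_vec[OF Nq' V]) (use w in simp)
    also have "\<dots> = ratm N' *v ?l - ratm N' *v (?l - V *v ratv w)"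
      unfolding mult_minus_distrib_mat_vec[OF Nq' gl(2)[OF w] Vw] using Nq' by (intro eq_vecI) auto
    finally show "intvec ((ratm N' * V) *v ratv w)" using integral_diff[OF i1 i2] by simp
  qed
  have sN: "intvec (g (s (N *v x)))" if x: "x \<in> Vec k" for x
  proof -
    have Nx: "N *v x \<in> Vec k" using N x by simp
    have "I *v ratv (N *v x) = ratv x"
      unfolding ratm_mult_ratv[OF N(1) x, symmetric] using assoc_mult_mat_vec[OF I(1) Nq, of "ratv x"] I(3) x by simp
    hence "intvec (s (N *v x))" unfolding s_def integral_append by (simp add: intvec_def)
    thus ?thesis by (rule disc_map_integral[OF B B' g sc[OF Nx]])
  qed
  obtain R where R: "R \<in> Mat k' k" "V * ratm N = ratm R"
  proof (rule integral_matE[OF VN])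
    fix x :: "int vec" assume x: "x \<in> Vec k"
    have Nx: "N *v x \<in> Vec k" using N x by simp
    have e: "(V * ratm N) *v ratv x = V *v ratv (N *v x)"
      unfolding ratm_mult_ratv[OF N(1) x, symmetric] by (rule assoc_mult_mat_vec[OF V Nq]) (use x in simp)
    have i1: "intvec (vec_last (g (s (N *v x))) k')"
      using sN[OF x] gd[OF Nx] integral_append by metis
    have "V *v ratv (N *v x) = vec_last (g (s (N *v x))) k' - (vec_last (g (s (N *v x))) k' - V *v ratv (N *v x))"
      using V by (intro eq_vecI) auto
    thus "intvec ((V * ratm N) *v ratv x)" unfolding e using integral_diff[OF i1 last[OF Nx]] V by simp
  qed
  have uvN: "uv \<bullet> ratv (N *v x) \<in> \<int>" if x: "x \<in> Vec k" for x
  proof (cases "r = 0")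
    case True
    have "uv \<bullet> ratv (N *v x) = 0" using True N x by (simp add: uv_def scalar_prod_def)
    thus ?thesis by simp
  next
    case False
    have Nx: "N *v x \<in> Vec k" using N x by simp
    have "g (s (N *v x)) $ 0 \<in> \<int>" using sN[OF x] False gc[OF Nx] unfolding intvec_def by simp
    from Ints_diff[OF this first[OF False Nx]] show ?thesis by simp
  qed
  have Nuv: "ratm N *v uv \<in> Vec k" using Nq uvc by simp
  have "intvec (ratm N *v uv)" unfolding intvec_def
  proof (intro allI impI)
    fix i assume "i < dim_vec (ratm N *v uv)"
    hence i: "i < k" using N by simp
    have "uv \<bullet> ratv (N *v unit_vec k i) = bil (ratm N) uv (unit_vec k i)"
      unfolding bil_def ratm_mult_ratv[OF N(1) unit_vec_carrier, symmetric] ratv_unit ..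
    also have "\<dots> = bil (ratm N) (unit_vec k i) uv" by (rule bil_sym[OF Nq transpose_ratm[OF N(2)] uvc]) simp
    also have "\<dots> = (ratm N *v uv) $ i" unfolding bil_def by (rule scalar_prod_left_unit[OF Nuv i])
    finally show "(ratm N *v uv) $ i \<in> \<int>" using uvN[of "unit_vec k i"] by simp
  qed
  from intvecE[OF this Nuv] obtain t where t: "t \<in> Vec k" "ratm N *v uv = ratv t" .
  have t0: "t = 0\<^sub>v k" if "r = 0"
  proof -
    have "ratm N *v uv = 0\<^sub>v k" using that N by (intro eq_vecI) (auto simp: uv_def scalar_prod_def)
    hence "ratv t = ratv (0\<^sub>v k)" unfolding t(2) by (auto intro!: eq_vecI)
    thus ?thesis by (rule ratv_inj)
  qed
  define T where "T = V\<^sup>T * ratm N' * V"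
  have VtN: "V\<^sup>T * ratm N' \<in> Mat k k'" by (rule mult_carrier_mat[OF Vt Nq'])
  have T: "T \<in> Mat k k" unfolding T_def by (rule mult_carrier_mat[OF VtN V])
  have Tt: "T\<^sup>T = T"
    unfolding T_def transpose_mult[OF VtN V] transpose_mult[OF Vt Nq'] transpose_ratm[OF N'(2)] transpose_transpose
    by (rule assoc_mult_mat[OF Vt Nq' V, symmetric])
  define \<gamma> where "\<gamma> = I *v ratv cN - V\<^sup>T *v ratv cN' - (2 * of_int d) \<cdot>v uv"
  have v1: "I *v ratv cN \<in> Vec k" and v2: "V\<^sup>T *v ratv cN' \<in> Vec k" and v3: "(2 * of_int d) \<cdot>v uv \<in> Vec k"
    using I Vt uvc cq cq' by auto
  have \<gamma>c: "\<gamma> \<in> Vec k" unfolding \<gamma>_def by (intro minus_carrier_vec v1 v2 v3)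
  \<comment> \<open>the equality of the quadratic functions on the classes of \<open>N\<inverse> w\<close>\<close>
  have key: "(bil (I - T) (ratv w) (ratv w) - \<gamma> \<bullet> ratv w) / 2 \<in> \<int>" if w: "w \<in> Vec k" for w
  proof -
    have wq: "ratv w \<in> Vec k" using w by simp
    let ?l = "vec_last (g (s w)) k'" and ?f = "vec_first (g (s w)) r"
    have q1: "qform ?B (rad_char r d @v cN) (s w) = qform N cN (I *v ratv w)"
      unfolding s_def qform_block_sum[OF zero_carrier_mat N(1) rad_char_carrier cc zero_carrier_vec Iw[OF w]] qform_radical[OF zero_carrier_vec]
      by simp
    have q2: "qform ?B' (rad_char r d @v cN') (g (s w)) = - of_int d * (if r = 0 then 0 else g (s w) $ 0) + qform N' cN' ?l"
    proof -
      have "qform ?B' (rad_char r d @v cN') (?f @v ?l) = - of_int d * (if r = 0 then 0 else ?f $ 0) + qform N' cN' ?l"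
        using qform_block_sum[OF zero_carrier_mat N'(1) rad_char_carrier cc', of ?f r ?l d] qform_radical[of ?f r d] by simp
      moreover have "?f @v ?l = g (s w)" using gd[OF w] by simp
      moreover have "r \<noteq> 0 \<Longrightarrow> ?f $ 0 = g (s w) $ 0" by (simp add: vec_first_def)
      ultimately show ?thesis by (auto split: if_splits)
    qed
    have q3: "qform ?B' (rad_char r d @v cN') (g (s w)) - qform ?B (rad_char r d @v cN) (s w) \<in> \<int>" by (rule disc_mapD(2)[OF g sd[OF w]])
    have q4: "qform N' cN' (V *v ratv w) - qform N' cN' ?l \<in> \<int>"
      by (rule qform_congruent[OF N'(1,2) ch' gl(1)[OF w] integral_sym[OF last[OF w] gl(2)[OF w] Vw] Vw])
    have q5: "of_int d * ((if r = 0 then 0 else g (s w) $ 0) - uv \<bullet> ratv w) \<in> \<int>"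
    proof (cases "r = 0")
      case True
      hence "uv \<bullet> ratv w = 0" using w by (simp add: uv_def scalar_prod_def)
      thus ?thesis using True by simp
    next
      case False
      thus ?thesis using Ints_mult[OF Ints_of_int first[OF False w], of d] by simp
    qed
    have "bil (ratm N) (I *v ratv w) (I *v ratv w) = bil I (ratv w) (ratv w)"
    proof -
      have "I\<^sup>T * ratm N * I = I" unfolding I(4) I(3) using I(1) by simp
      thus ?thesis using bil_transform[OF Nq I(1) wq wq] by simp
    qed
    moreover have "bil (ratm N') (V *v ratv w) (V *v ratv w) = bil T (ratv w) (ratv w)"
      unfolding T_def by (rule bil_transform[OF Nq' V wq wq, symmetric])
    moreover have "bil (I - T) (ratv w) (ratv w) = bil I (ratv w) (ratv w) - bil T (ratv w) (ratv w)" by (rule bil_minus[OF I(1) T wq wq])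
    moreover have "\<gamma> \<bullet> ratv w = ratv cN \<bullet> (I *v ratv w) - ratv cN' \<bullet> (V *v ratv w) - 2 * of_int d * (uv \<bullet> ratv w)"
    proof -
      have "(I *v ratv cN) \<bullet> ratv w = ratv cN \<bullet> (I *v ratv w)" using transpose_vec_mult_scalar[OF I(1) wq cq] I(4) by simp
      moreover have "(V\<^sup>T *v ratv cN') \<bullet> ratv w = ratv cN' \<bullet> (V *v ratv w)" by (rule transpose_vec_mult_scalar[OF V wq cq'])
      moreover have "((2 * of_int d) \<cdot>v uv) \<bullet> ratv w = 2 * of_int d * (uv \<bullet> ratv w)" by (rule smult_scalar_prod_distrib[OF uvc wq])
      moreover have "\<gamma> \<bullet> ratv w = (I *v ratv cN) \<bullet> ratv w - (V\<^sup>T *v ratv cN') \<bullet> ratv w - ((2 * of_int d) \<cdot>v uv) \<bullet> ratv w"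
        unfolding \<gamma>_def minus_scalar_prod_distrib[OF minus_carrier_vec[OF v1 v2] v3 wq] minus_scalar_prod_distrib[OF v1 v2 wq] ..
      ultimately show ?thesis by simp
    qed
    ultimately have e: "(bil (I - T) (ratv w) (ratv w) - \<gamma> \<bullet> ratv w) / 2 =
        qform N cN (I *v ratv w) - qform N' cN' (V *v ratv w) + of_int d * (uv \<bullet> ratv w)"
      by (simp add: qform_def field_simps)
    have "- (qform ?B' (rad_char r d @v cN') (g (s w)) - qform ?B (rad_char r d @v cN) (s w))
       - (qform N' cN' (V *v ratv w) - qform N' cN' ?l) - of_int d * ((if r = 0 then 0 else g (s w) $ 0) - uv \<bullet> ratv w) \<in> \<int>"
      by (rule Ints_diff[OF Ints_diff[OF Ints_minus[OF q3] q4] q5])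
    thus ?thesis unfolding e q1 q2 by (simp add: algebra_simps)
  qed
  have IT: "I - T \<in> Mat k k" by (rule minus_carrier_mat[OF T])
  have ITt: "(I - T)\<^sup>T = I - T" using transpose_minus[OF I(1) T] I(4) Tt by simp
  obtain S \<gamma>0 where S: "S \<in> Mat k k" "I - T = ratm S" "S\<^sup>T = S" and g0: "\<gamma> = ratv \<gamma>0" "char_vec k S \<gamma>0"
    using integral_quadratic[OF IT ITt \<gamma>c key] .
  have g0c: "\<gamma>0 \<in> Vec k" using g0(2) by (simp add: char_vec_def)
  have Rt: "R\<^sup>T \<in> Mat k k'" using R by simp
  have Rtq: "ratm (R\<^sup>T) = ratm N * V\<^sup>T"
    using transpose_mult[OF V Nq] transpose_ratm[OF N(2)] R(2) by (simp add: map_mat_transpose)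
  have PN: "P * N = N' * R"
    by (rule ratm_inj) (unfold ratm_mult[OF P(1) N(1)] ratm_mult[OF N'(1) R(1)] P(2)[symmetric] R(2)[symmetric], rule assoc_mult_mat[OF Nq' V Nq])
  have NS: "N * S + R\<^sup>T * P = 1\<^sub>m k"
  proof (rule ratm_inj)
    have X: "ratm N * T \<in> Mat k k" by (rule mult_carrier_mat[OF Nq T])
    have a1: "ratm (N * S) = 1\<^sub>m k - ratm N * T"
      unfolding ratm_mult[OF N(1) S(1)] S(2)[symmetric] mult_minus_distrib_mat[OF Nq I(1) T] I(2) ..
    have "ratm (R\<^sup>T * P) = (ratm N * V\<^sup>T) * (ratm N' * V)" unfolding ratm_mult[OF Rt P(1)] Rtq P(2) ..
    also have "\<dots> = ratm N * (V\<^sup>T * (ratm N' * V))" by (rule assoc_mult_mat[OF Nq Vt NV])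
    also have "V\<^sup>T * (ratm N' * V) = T" unfolding T_def by (rule assoc_mult_mat[OF Vt Nq' V, symmetric])
    finally have a2: "ratm (R\<^sup>T * P) = ratm N * T" .
    have "ratm (N * S + R\<^sup>T * P) = ratm (N * S) + ratm (R\<^sup>T * P)"
      by (rule ratm_add[OF mult_carrier_mat[OF N(1) S(1)] mult_carrier_mat[OF Rt P(1)]])
    also have "\<dots> = 1\<^sub>m k" unfolding a1 a2 by (rule mat_diff_add_cancel(1)[OF one_carrier_mat X])
    also have "\<dots> = ratm (1\<^sub>m k)" by (rule of_int_hom.mat_hom_one[symmetric])
    finally show "ratm (N * S + R\<^sup>T * P) = ratm (1\<^sub>m k)" .
  qed
  have cv: "N *v \<gamma>0 + R\<^sup>T *v cN' = cN - (2 * d) \<cdot>v t"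
  proof (rule ratv_inj)
    have a1: "ratv (N *v \<gamma>0) = ratv cN - ratm N *v (V\<^sup>T *v ratv cN') - (2 * of_int d) \<cdot>v ratv t"
    proof -
      have "ratm N *v (I *v ratv cN) = ratv cN" by (rule NIw[OF cc])
      moreover have "ratm N *v ((2 * of_int d) \<cdot>v uv) = (2 * of_int d) \<cdot>v ratv t" unfolding mult_mat_vec_smult[OF Nq uvc] t(2) ..
      ultimately show ?thesis
        unfolding ratm_mult_ratv[OF N(1) g0c, symmetric] g0(1)[symmetric] \<gamma>_def
          mult_minus_distrib_mat_vec[OF Nq minus_carrier_vec[OF v1 v2] v3] mult_minus_distrib_mat_vec[OF Nq v1 v2] by simp
    qed
    have a2: "ratv (R\<^sup>T *v cN') = ratm N *v (V\<^sup>T *v ratv cN')"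
      unfolding ratm_mult_ratv[OF Rt cc', symmetric] Rtq by (rule assoc_mult_mat_vec[OF Nq Vt cq'])
    have Y: "ratm N *v (V\<^sup>T *v ratv cN') \<in> Vec k" using Nq v2 by simp
    have "ratv (N *v \<gamma>0 + R\<^sup>T *v cN') = ratv (N *v \<gamma>0) + ratv (R\<^sup>T *v cN')"
      using N(1) R(1) by (intro eq_vecI) auto
    also have "\<dots> = ratv cN - (2 * of_int d) \<cdot>v ratv t"
      unfolding a1 a2 by (rule vec_diff_diff_add_cancel[OF cq Y]) (use t(1) in simp)
    also have "\<dots> = ratv (cN - (2 * d) \<cdot>v t)" using cc t(1) by (intro eq_vecI) auto
    finally show "ratv (N *v \<gamma>0 + R\<^sup>T *v cN') = ratv (cN - (2 * d) \<cdot>v t)" .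
  qed
  show thesis
    by (rule that[OF P(1) R(1) S(1,3) PN NS g0(2) t(1) _ cv V P(2)[symmetric]]) (use t0 last in \<open>auto simp: s_def\<close>)
qed

text \<open>
  The basis vectors of \<open>N\<close> are moved by multiples of the first radical vector. This leaves the form alone
  and changes the characteristic vector by multiples of its value \<open>2 d\<close>.
\<close>

lemma radical_shear:
  assumes N: "N \<in> Mat k k" "N\<^sup>T = N" and c: "c \<in> Vec k" and t: "t \<in> Vec k" "r = 0 \<Longrightarrow> t = 0\<^sub>v k"
  shows "coord_triple (block_sum (0\<^sub>m r r) N) (rad_char r d @v (c - (2 * d) \<cdot>v t)) \<simeq>\<^sub>L
    coord_triple (block_sum (0\<^sub>m r r) N) (rad_char r d @v c)"
proof -
  let ?B = "block_sum (0\<^sub>m r r) N"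
  have B: "?B \<in> Mat (r + k) (r + k)" by (rule block_sum_carrier[OF zero_carrier_mat N(1)])
  have Bf: "?B = four_block_mat (0\<^sub>m r r) (0\<^sub>m r k) (0\<^sub>m k r) N" using N by (simp add: block_sum_def)
  define X where "X = mat k r (\<lambda>(i, j). if j = 0 then - t $ i else 0)"
  define E where "E = four_block_mat (1\<^sub>m r) (0\<^sub>m r k) X (1\<^sub>m k)"
  have X: "X \<in> Mat k r" by (simp add: X_def)
  have Ec: "E \<in> Mat (r + k) (r + k)" unfolding E_def using X by (intro four_block_carrier_mat) auto
  have "det E = det (1\<^sub>m r) * det (1\<^sub>m k)" unfolding E_def by (rule det_four_block_mat_upper_right_zero[OF one_carrier_mat refl X one_carrier_mat])
  hence "unim (r + k) E" unfolding unim_def using Ec by simp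
  moreover have "?B = E * ?B * E\<^sup>T"
  proof -
    have Xt: "X\<^sup>T \<in> Mat r k" using X by simp
    have "E * ?B = ?B" unfolding E_def Bf mult_four_block_mat[OF one_carrier_mat zero_carrier_mat X one_carrier_mat zero_carrier_mat zero_carrier_mat zero_carrier_mat N(1)]
      using X N by simp
    moreover have "E\<^sup>T = four_block_mat (1\<^sub>m r) (X\<^sup>T) (0\<^sub>m k r) (1\<^sub>m k)"
      unfolding E_def transpose_four_block_mat[OF one_carrier_mat zero_carrier_mat X one_carrier_mat] by simp
    moreover have "?B * four_block_mat (1\<^sub>m r) (X\<^sup>T) (0\<^sub>m k r) (1\<^sub>m k) = ?B"
      unfolding Bf mult_four_block_mat[OF zero_carrier_mat zero_carrier_mat zero_carrier_mat N(1) one_carrier_mat Xt zero_carrier_mat one_carrier_mat]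
      using Xt N by simp
    ultimately show ?thesis by simp
  qed
  moreover have "rad_char r d @v (c - (2 * d) \<cdot>v t) = E *v (rad_char r d @v c) + 2 \<cdot>v (?B *v 0\<^sub>v (r + k))"
  proof -
    have Xv: "X *v rad_char r d = - ((2 * d) \<cdot>v t)"
    proof (rule eq_vecI)
      fix i assume "i < dim_vec (- ((2 * d) \<cdot>v t))"
      hence i: "i < k" using t by simp
      have "(X *v rad_char r d) $ i = (\<Sum>j<r. (if j = 0 then - t $ i else 0) * (if j = 0 then 2 * d else 0))"
        using i by (simp add: X_def rad_char_def scalar_prod_def lessThan_atLeast0)
      also have "\<dots> = (\<Sum>j<r. if j = 0 then - (2 * d * t $ i) else 0)" by (intro sum.cong) auto
      also have "\<dots> = - (2 * d * t $ i)" using t(2) i by (cases "r = 0") auto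
      finally show "(X *v rad_char r d) $ i = (- ((2 * d) \<cdot>v t)) $ i" using i t by simp
    qed (use t X in simp)
    have "E *v (rad_char r d @v c) = (1\<^sub>m r *v rad_char r d + 0\<^sub>m r k *v c) @v (X *v rad_char r d + 1\<^sub>m k *v c)"
      unfolding E_def by (rule four_block_mat_mult_vec[OF one_carrier_mat zero_carrier_mat X one_carrier_mat rad_char_carrier c])
    also have "1\<^sub>m r *v rad_char r d + 0\<^sub>m r k *v c = rad_char r d"
      using c by (intro eq_vecI) (auto simp: scalar_prod_def rad_char_def)
    also have "X *v rad_char r d + 1\<^sub>m k *v c = c - (2 * d) \<cdot>v t" unfolding Xv using c t by (intro eq_vecI) auto
    finally have Ev: "E *v (rad_char r d @v c) = rad_char r d @v (c - (2 * d) \<cdot>v t)" .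
    have "2 \<cdot>v (?B *v 0\<^sub>v (r + k)) = 0\<^sub>v (r + k)" using N(1) by (intro eq_vecI) (auto simp: scalar_prod_def)
    moreover have "rad_char r d @v (c - (2 * d) \<cdot>v t) \<in> Vec (r + k)" using c t by (intro append_carrier_vec) auto
    ultimately show ?thesis unfolding Ev by simp
  qed
  ultimately show ?thesis
    by (intro coord_triple_congruence[OF B transpose_block_sum_zero[OF N] _ _ append_carrier_vec[OF rad_char_carrier c] zero_carrier_vec])
qed

text \<open>
  The ranks and divisors agree by \<open>radical_rank_le\<close> and \<open>rad_char_dvd\<close>. The data of \<open>glue_data\<close> for the two
  inverse maps feed \<open>stably_iso_glue\<close>; that the composition is the identity modulo integral vectors
  provides the matrix \<open>Z\<close>. The zero summands are added afterwards.
\<close>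

lemma normal_form_stably_iso:
  assumes N: "N \<in> Mat k k" "N\<^sup>T = N" "det N \<noteq> 0" and N': "N' \<in> Mat k' k'" "N'\<^sup>T = N'" "det N' \<noteq> 0"
    and ch: "char_vec k N cN" and ch': "char_vec k' N' cN'" and d: "0 \<le> d" "r = 0 \<Longrightarrow> d = 0" and d': "0 \<le> d'" "r' = 0 \<Longrightarrow> d' = 0"
    and e: "disc_equiv (block_sum (0\<^sub>m r r) N) (rad_char r d @v cN) (block_sum (0\<^sub>m r' r') N') (rad_char r' d' @v cN')"
  shows "stably_iso (coord_triple (block_sum (0\<^sub>m r r) N) (rad_char r d @v cN)) (coord_triple (block_sum (0\<^sub>m r' r') N') (rad_char r' d' @v cN'))"
proof -
  have cc: "cN \<in> Vec k" and cc': "cN' \<in> Vec k'" using ch ch' by (auto simp: char_vec_def)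
  have rr: "r' = r" using radical_rank_le[OF N(1) N'(1,3) e] radical_rank_le[OF N'(1) N(1,3) disc_equiv_sym[OF e]] by simp
  let ?B = "block_sum (0\<^sub>m r r) N" and ?B' = "block_sum (0\<^sub>m r r) N'"
  have B: "?B \<in> Mat (r + k) (r + k)" and B': "?B' \<in> Mat (r + k') (r + k')"
    by (rule block_sum_carrier[OF zero_carrier_mat N(1)], rule block_sum_carrier[OF zero_carrier_mat N'(1)])
  have Bs: "?B\<^sup>T = ?B" "?B'\<^sup>T = ?B'" by (rule transpose_block_sum_zero[OF N(1,2)], rule transpose_block_sum_zero[OF N'(1,2)])
  obtain g h where g0: "disc_map ?B (rad_char r d @v cN) ?B' (rad_char r d' @v cN') g"
    and h0: "disc_map ?B' (rad_char r d' @v cN') ?B (rad_char r d @v cN) h"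
    and hg: "\<And>x. x \<in> duals ?B \<Longrightarrow> intvec (h (g x) - x)"
    using e unfolding rr disc_equiv_def by blast
  have dd: "d' = d"
  proof (cases "r = 0")
    case True thus ?thesis using d d' rr by simp
  next
    case False
    hence r: "0 < r" by simp
    have 1: "int m dvd d \<longleftrightarrow> int m dvd d'" if "0 < m" for m
      using rad_char_dvd[OF N(1,3) N'(1) r r ch cc' h0 that] rad_char_dvd[OF N'(1,3) N(1) r r ch' cc g0 that] by blast
    have ex: "\<exists>m. d = int m \<and> d' = int m"
    proof (cases "d = 0 \<or> d' = 0")
      case True
      define m where "m = nat (d + d' + 1)"
      have m: "0 < m" "int m = d + d' + 1" using d(1) d'(1) by (auto simp: m_def)
      have "d = 0 \<and> d' = 0"
      proof (cases "d = 0")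
        case True
        hence "d' + 1 dvd d'" using 1[OF m(1)] m(2) by simp
        thus ?thesis using True d'(1) zdvd_imp_le[of "d' + 1" d'] by (cases "d' = 0") auto
      next
        case False
        hence d0: "d' = 0" using \<open>d = 0 \<or> d' = 0\<close> by simp
        hence "d + 1 dvd d" using 1[OF m(1)] m(2) by simp
        thus ?thesis using False d(1) zdvd_imp_le[of "d + 1" d] by simp
      qed
      thus ?thesis by (intro exI[of _ 0]) simp
    next
      case False
      hence p: "0 < nat d" "0 < nat d'" using d(1) d'(1) by auto
      have "d dvd d'" using 1[OF p(1)] d(1) by simp
      moreover have "d' dvd d" using 1[OF p(2)] d'(1) by simp
      ultimately have "d = d'" using d(1) d'(1) by (simp add: zdvd_antisym_nonneg)
      thus ?thesis using d(1) by (intro exI[of _ "nat d"]) simp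
    qed
    thus ?thesis by auto
  qed
  note g = g0[unfolded dd] and h = h0[unfolded dd]
  obtain I where I: "I \<in> Mat k k" "ratm N * I = 1\<^sub>m k" "I * ratm N = 1\<^sub>m k" "I\<^sup>T = I" using rational_inverse[OF N] .
  obtain I' where I': "I' \<in> Mat k' k'" "ratm N' * I' = 1\<^sub>m k'" "I' * ratm N' = 1\<^sub>m k'" "I'\<^sup>T = I'" using rational_inverse[OF N'] .
  obtain P R S \<gamma> t V where P: "P \<in> Mat k' k" and R: "R \<in> Mat k' k" and S: "S \<in> Mat k k" "S\<^sup>T = S"
    and PN: "P * N = N' * R" and NS: "N * S + R\<^sup>T * P = 1\<^sub>m k" and chS: "char_vec k S \<gamma>" and t: "t \<in> Vec k" "r = 0 \<longrightarrow> t = 0\<^sub>v k"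
    and cv: "N *v \<gamma> + R\<^sup>T *v cN' = cN - (2 * d) \<cdot>v t" and V: "V \<in> Mat k' k" and PV: "ratm P = ratm N' * V"
    and last0: "\<forall>w\<in>Vec k. intvec (vec_last (g (0\<^sub>v r @v (I *v ratv w))) k' - V *v ratv w)"
    using glue_data[OF N N' ch ch' I g] .
  obtain P' R' S' \<gamma>' t' V' where P': "P' \<in> Mat k k'" and R': "R' \<in> Mat k k'" and S': "S' \<in> Mat k' k'" "S'\<^sup>T = S'"
    and PN': "P' * N' = N * R'" and NS': "N' * S' + R'\<^sup>T * P' = 1\<^sub>m k'" and "char_vec k' S' \<gamma>'" "t' \<in> Vec k'" "r = 0 \<longrightarrow> t' = 0\<^sub>v k'"
    and "N' *v \<gamma>' + R'\<^sup>T *v cN = cN' - (2 * d) \<cdot>v t'" and V': "V' \<in> Mat k k'" and PV': "ratm P' = ratm N * V'"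
    and last0': "\<forall>w\<in>Vec k'. intvec (vec_last (h (0\<^sub>v r @v (I' *v ratv w))) k - V' *v ratv w)"
    using glue_data[OF N' N ch' ch I' h] .
  note last = last0[rule_format] and last' = last0'[rule_format]
  have det: "\<bar>det N\<bar> = \<bar>det N'\<bar>"
    by (rule zdvd_antisym_abs[OF glue_det_dvd(2)[OF N(1,2) N'(1,2) P R S(1) PN NS] glue_det_dvd(2)[OF N'(1,2) N(1,2) P' R' S'(1) PN' NS']])
  have Nq: "ratm N \<in> Mat k k" and Nq': "ratm N' \<in> Mat k' k'" and Pq: "ratm P \<in> Mat k' k" using N N' P by auto
  have VP: "V' * ratm P \<in> Mat k k" by (rule mult_carrier_mat[OF V' Pq])
  have IVP: "I - V' * ratm P \<in> Mat k k" by (rule minus_carrier_mat[OF VP])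
  \<comment> \<open>on classes of \<open>N\<inverse> w\<close> the composition of both maps is the identity modulo integral and radical vectors\<close>
  obtain Z where Z: "Z \<in> Mat k k" "I - V' * ratm P = ratm Z"
  proof (rule integral_matE[OF IVP])
    fix w :: "int vec" assume w: "w \<in> Vec k"
    have wq: "ratv w \<in> Vec k" using w by simp
    have Pw: "P *v w \<in> Vec k'" using P w by simp
    let ?s = "0\<^sub>v r @v (I *v ratv w)" and ?s' = "0\<^sub>v r @v (I' *v ratv (P *v w))"
    have Iw: "I *v ratv w \<in> Vec k" and Iw': "I' *v ratv (P *v w) \<in> Vec k'" using I I' w Pw by auto
    have "I *v ratv w \<in> duals N"
      using assoc_mult_mat_vec[OF Nq I(1) wq] I(2) wq Iw by (simp add: mem_duals[OF N(1)])
    hence sd: "?s \<in> duals ?B" by (intro duals_radical(1)[OF N(1), THEN iffD2] zero_carrier_vec Iw)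
    have VI: "V *v ratv w = I' *v ratv (P *v w)"
    proof -
      have Vw: "V *v ratv w \<in> Vec k'" using V wq by simp
      have "ratv (P *v w) = ratm N' *v (V *v ratv w)"
        unfolding ratm_mult_ratv[OF P w, symmetric] PV by (rule assoc_mult_mat_vec[OF Nq' V wq])
      hence "I' *v ratv (P *v w) = (I' * ratm N') *v (V *v ratv w)" using assoc_mult_mat_vec[OF I'(1) Nq' Vw] by simp
      thus ?thesis unfolding I'(3) using Vw by simp
    qed
    have "I' *v ratv (P *v w) \<in> duals N'"
      using assoc_mult_mat_vec[OF Nq' I'(1), of "ratv (P *v w)"] I'(2) Pw Iw' by (simp add: mem_duals[OF N'(1)])
    hence sd': "?s' \<in> duals ?B'" by (intro duals_radical(1)[OF N'(1), THEN iffD2] zero_carrier_vec Iw')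
    let ?y = "g ?s"
    have yd: "?y \<in> duals ?B'" by (rule disc_mapD(1)[OF g sd])
    note yy = duals_radical(2)[OF N'(1) yd]
    define ee where "ee = vec_first ?y r @v (vec_last ?y k' - V *v ratv w)"
    have dl: "vec_last ?y k' - V *v ratv w \<in> Vec k'" by (rule carrier_vecI) (use V in simp)
    have eint: "intvec (vec_last ?y k' - V *v ratv w)" by (rule last[OF w])
    have ed: "ee \<in> duals ?B'" unfolding ee_def
      by (rule duals_radical(1)[OF N'(1), THEN iffD2]) (use integral_duals[OF N'(1) eint dl] dl in auto)
    have ye: "?y = ee + ?s'"
    proof -
      have "vec_first ?y r @v vec_last ?y k' = ee + ?s'" unfolding ee_def VI using Iw' I' by (intro eq_vecI) auto
      thus ?thesis using yy by simp
    qed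
    have hy: "intvec (h ?y - (h ee + h ?s'))" unfolding ye by (rule disc_mapD(3)[OF h ed sd'])
    have "vec_last ee k' = vec_last ?y k' - V *v ratv w"
      unfolding ee_def by (rule vec_last_append_eq[OF dl])
    hence he: "intvec (vec_last (h ee) k)" using radical_preserved[OF N'(1) N(1,3) h ed] eint by simp
    have hs: "intvec (vec_last (h ?s') k - V' *v ratv (P *v w))" by (rule last'[OF Pw])
    have hyx: "intvec (h ?y - ?s)" by (rule hg[OF sd])
    have hc: "h x \<in> Vec (r + k)" if "x \<in> duals ?B'" for x
      using disc_mapD(1)[OF h that] by (simp add: mem_duals[OF B])
    note c1 = hc[OF yd] and c2 = hc[OF ed] and c3 = hc[OF sd']
    have M: "(I - V' * ratm P) *v ratv w = I *v ratv w - V' *v ratv (P *v w)"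
      unfolding minus_mult_distrib_mat_vec[OF I(1) VP wq] ratm_mult_ratv[OF P w, symmetric] assoc_mult_mat_vec[OF V' Pq wq] ..
    show "intvec ((I - V' * ratm P) *v ratv w)" unfolding M intvec_def
    proof (intro allI impI)
      fix i assume "i < dim_vec (I *v ratv w - V' *v ratv (P *v w))"
      hence i: "i < k" using V' by simp
      have "(h ?y - (h ee + h ?s')) $ (r + i) \<in> \<int>" by (rule hy[unfolded intvec_def, rule_format]) (use i c2 c3 in simp)
      hence a1: "h ?y $ (r + i) - (h ee $ (r + i) + h ?s' $ (r + i)) \<in> \<int>" using i c2 c3 by simp
      have "vec_last (h ee) k $ i \<in> \<int>" by (rule he[unfolded intvec_def, rule_format]) (use i in simp)
      hence a2: "h ee $ (r + i) \<in> \<int>" using i c2 by (simp add: vec_last_def)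
      have "(vec_last (h ?s') k - V' *v ratv (P *v w)) $ i \<in> \<int>" by (rule hs[unfolded intvec_def, rule_format]) (use i V' in simp)
      moreover have "vec_last (h ?s') k $ i = h ?s' $ (r + i)" using i c3 by (simp add: vec_last_def)
      moreover have "(vec_last (h ?s') k - V' *v ratv (P *v w)) $ i = vec_last (h ?s') k $ i - (V' *v ratv (P *v w)) $ i"
        by (rule index_minus_vec(1)) (use i V' in simp)
      ultimately have a3: "h ?s' $ (r + i) - (V' *v ratv (P *v w)) $ i \<in> \<int>" by simp
      have "(h ?y - ?s) $ (r + i) \<in> \<int>" by (rule hyx[unfolded intvec_def, rule_format]) (use i I in simp)
      moreover have "(h ?y - ?s) $ (r + i) = h ?y $ (r + i) - ?s $ (r + i)" by (rule index_minus_vec(1)) (use i I in simp)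
      moreover have "?s $ (r + i) = (I *v ratv w) $ i" using i I(1) by (subst index_append_vec) auto
      ultimately have a4: "h ?y $ (r + i) - (I *v ratv w) $ i \<in> \<int>" by simp
      have "((h ?y $ (r + i) - (h ee $ (r + i) + h ?s' $ (r + i))) + h ee $ (r + i)) + (h ?s' $ (r + i) - (V' *v ratv (P *v w)) $ i)
          - (h ?y $ (r + i) - (I *v ratv w) $ i) \<in> \<int>"
        by (rule Ints_diff[OF Ints_add[OF Ints_add[OF a1 a2] a3] a4])
      hence "(I *v ratv w) $ i - (V' *v ratv (P *v w)) $ i \<in> \<int>" by simp
      moreover have "(I *v ratv w - V' *v ratv (P *v w)) $ i = (I *v ratv w) $ i - (V' *v ratv (P *v w)) $ i"
        by (rule index_minus_vec(1)) (use i V' in simp)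
      ultimately show "(I *v ratv w - V' *v ratv (P *v w)) $ i \<in> \<int>" by simp
    qed
  qed
  have QP: "P' * P + N * Z = 1\<^sub>m k"
  proof (rule ratm_inj)
    have X: "ratm N * (V' * ratm P) \<in> Mat k k" by (rule mult_carrier_mat[OF Nq VP])
    have a1: "ratm (P' * P) = ratm N * (V' * ratm P)" unfolding ratm_mult[OF P' P] PV' by (rule assoc_mult_mat[OF Nq V' Pq])
    have a2: "ratm (N * Z) = 1\<^sub>m k - ratm N * (V' * ratm P)"
      unfolding ratm_mult[OF N(1) Z(1)] Z(2)[symmetric] mult_minus_distrib_mat[OF Nq I(1) VP] I(2) ..
    have "ratm (P' * P + N * Z) = ratm (P' * P) + ratm (N * Z)"
      by (rule ratm_add[OF mult_carrier_mat[OF P' P] mult_carrier_mat[OF N(1) Z(1)]])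
    also have "\<dots> = 1\<^sub>m k" unfolding a1 a2 by (rule mat_diff_add_cancel(2)[OF one_carrier_mat X])
    also have "\<dots> = ratm (1\<^sub>m k)" by (rule of_int_hom.mat_hom_one[symmetric])
    finally show "ratm (P' * P + N * Z) = ratm (1\<^sub>m k)" .
  qed
  let ?c1 = "cN - (2 * d) \<cdot>v t"
  have c1: "?c1 \<in> Vec k" using cc t by simp
  have st: "stably_iso (coord_triple N ?c1) (coord_triple N' cN')"
    by (rule stably_iso_glue[OF N N'(1,2) P R S P' R' Z(1) PN NS PN' QP det ch' chS cv[symmetric]])
  let ?K = "coord_triple (0\<^sub>m r r) (rad_char r d)"
  have bK: "bilinear ?K" by (rule bilinear_coord_triple[OF zero_carrier_mat]) simp
  have bN: "bilinear (coord_triple N x)" for x by (rule bilinear_coord_triple[OF N(1,2)])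
  have bN': "bilinear (coord_triple N' x)" for x by (rule bilinear_coord_triple[OF N'(1,2)])
  have bB: "bilinear (coord_triple ?B x)" for x by (rule bilinear_coord_triple[OF B Bs(1)])
  have bB': "bilinear (coord_triple ?B' x)" for x by (rule bilinear_coord_triple[OF B' Bs(2)])
  have sum: "?K \<oplus>\<^sub>L coord_triple N ?c1 \<simeq>\<^sub>L coord_triple ?B (rad_char r d @v ?c1)"
    by (rule coord_triple_block_sum[OF zero_carrier_mat N(1) rad_char_carrier c1])
  have sum': "?K \<oplus>\<^sub>L coord_triple N' cN' \<simeq>\<^sub>L coord_triple ?B' (rad_char r d @v cN')"
    by (rule coord_triple_block_sum[OF zero_carrier_mat N'(1) rad_char_carrier cc'])
  have bKN: "bilinear (?K \<oplus>\<^sub>L coord_triple N ?c1)" "bilinear (?K \<oplus>\<^sub>L coord_triple N' cN')"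
    by (rule bilinear_orth_sum[OF bK bN], rule bilinear_orth_sum[OF bK bN'])
  have shear: "coord_triple ?B (rad_char r d @v ?c1) \<simeq>\<^sub>L coord_triple ?B (rad_char r d @v cN)" by (rule radical_shear[OF N(1,2) cc t(1) t(2)[rule_format]])
  have left: "coord_triple ?B (rad_char r d @v cN) \<simeq>\<^sub>L ?K \<oplus>\<^sub>L coord_triple N ?c1"
    by (rule triple_iso_sym[OF bKN(1) bB triple_iso_trans[OF bKN(1) bB sum shear]])
  show ?thesis unfolding rr dd by (rule stably_iso_cong[OF bB bKN bB' left stably_iso_add_left[OF bK bN bN' st] sum'])
qed

lemma disc_equiv_stably_iso:
  assumes A: "A \<in> Mat n n" "A\<^sup>T = A" "char_vec n A c" and A': "A' \<in> Mat n' n'" "A'\<^sup>T = A'" "char_vec n' A' c'"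
    and e: "disc_equiv A c A' c'"
  shows "stably_iso (coord_triple A c) (coord_triple A' c')"
proof -
  have cc: "c \<in> Vec n" and cc': "c' \<in> Vec n'" using A(3) A'(3) by (auto simp: char_vec_def)
  obtain r k N d cN where N: "N \<in> Mat k k" "N\<^sup>T = N" "det N \<noteq> 0" "char_vec k N cN" "0 \<le> d" "r = 0 \<longrightarrow> d = 0"
    and i: "coord_triple (block_sum (0\<^sub>m r r) N) (rad_char r d @v cN) \<simeq>\<^sub>L coord_triple A c" using normal_form[OF A] .
  obtain r' k' N' d' cN' where N': "N' \<in> Mat k' k'" "N'\<^sup>T = N'" "det N' \<noteq> 0" "char_vec k' N' cN'" "0 \<le> d'" "r' = 0 \<longrightarrow> d' = 0"
    and i': "coord_triple (block_sum (0\<^sub>m r' r') N') (rad_char r' d' @v cN') \<simeq>\<^sub>L coord_triple A' c'" using normal_form[OF A'] .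
  let ?B = "block_sum (0\<^sub>m r r) N" and ?b = "rad_char r d @v cN" and ?B' = "block_sum (0\<^sub>m r' r') N'" and ?b' = "rad_char r' d' @v cN'"
  have B: "?B \<in> Mat (r + k) (r + k)" and B': "?B' \<in> Mat (r' + k') (r' + k')"
    by (rule block_sum_carrier[OF zero_carrier_mat N(1)], rule block_sum_carrier[OF zero_carrier_mat N'(1)])
  have Bs: "?B\<^sup>T = ?B" "?B'\<^sup>T = ?B'" by (rule transpose_block_sum_zero[OF N(1,2)], rule transpose_block_sum_zero[OF N'(1,2)])
  have b: "?b \<in> Vec (r + k)" "?b' \<in> Vec (r' + k')"
    using N(4) N'(4) by (auto simp: char_vec_def intro: append_carrier_vec)
  have e1: "disc_equiv ?B ?b A c" by (rule coord_iso_disc_equiv[OF B Bs(1) A(1,2) b(1) cc i])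
  have e2: "disc_equiv ?B' ?b' A' c'" by (rule coord_iso_disc_equiv[OF B' Bs(2) A'(1,2) b(2) cc' i'])
  have eB: "disc_equiv ?B ?b ?B' ?b'"
    by (rule disc_equiv_trans[OF B A(1) B' e1 disc_equiv_trans[OF A(1) A'(1) B' e disc_equiv_sym[OF e2]]])
  have st: "stably_iso (coord_triple ?B ?b) (coord_triple ?B' ?b')"
    by (rule normal_form_stably_iso[OF N(1-3) N'(1-3) N(4) N'(4) N(5) _ N'(5) _ eB]) (use N(6) N'(6) in auto)
  have bl: "bilinear (coord_triple A c)" "bilinear (coord_triple ?B ?b)" "bilinear (coord_triple ?B' ?b')" "bilinear (coord_triple A' c')"
    by (rule bilinear_coord_triple[OF A(1,2)], rule bilinear_coord_triple[OF B Bs(1)], rule bilinear_coord_triple[OF B' Bs(2)], rule bilinear_coord_triple[OF A'(1,2)])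
  show ?thesis by (rule stably_iso_cong[OF bl triple_iso_sym[OF bl(2,1) i] st i'])
qed

lemma lattice_bilinear:
  assumes "symmetric_bilinear_lattice M f" shows "bilinear (M, f, c)"
  using assms by (simp add: symmetric_bilinear_lattice_def fin_gen_free_abelian_def)

lemma lattice_coord_iso:
  assumes L: "symmetric_bilinear_lattice M f" and \<pi>: "\<pi> \<in> iso M (Zvec n)" and A: "A \<in> Mat n n"
    and fA: "\<And>x y. x \<in> carrier M \<Longrightarrow> y \<in> carrier M \<Longrightarrow> f x y = bil A (\<pi> x) (\<pi> y)" and cA: "\<And>x. x \<in> carrier M \<Longrightarrow> c x = c0 \<bullet> \<pi> x"
  shows "(M, f, c) \<simeq>\<^sub>L coord_triple A c0"
proof -
  interpret M: comm_group M using L by (simp add: symmetric_bilinear_lattice_def fin_gen_free_abelian_def)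
  have "f \<one>\<^bsub>M\<^esub> x = 0" if x: "x \<in> carrier M" for x
  proof -
    have h: "f x \<in> hom M integer_group" and s: "f \<one>\<^bsub>M\<^esub> x = f x \<one>\<^bsub>M\<^esub>" using L x by (auto simp: symmetric_bilinear_lattice_def)
    from hom_mult[OF h M.one_closed M.one_closed] have "f x \<one>\<^bsub>M\<^esub> = f x \<one>\<^bsub>M\<^esub> + f x \<one>\<^bsub>M\<^esub>" by simp
    thus ?thesis using s by simp
  qed
  moreover have "dim_row A = n" using A by simp
  ultimately show ?thesis unfolding coord_triple_def triple_iso.simps using \<pi> fA cA
    by (intro bexI[of _ \<pi>] conjI bexI[of _ "\<one>\<^bsub>M\<^esub>"]) auto
qed

theorem corollary3p5:
  fixes M :: "'a monoid" and f :: "'a \<Rightarrow> 'a \<Rightarrow> int" and c :: "'a \<Rightarrow> int"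
    and M' :: "'b monoid" and f' :: "'b \<Rightarrow> 'b \<Rightarrow> int" and c' :: "'b \<Rightarrow> int"
  assumes "symmetric_bilinear_lattice M f" and "characteristic_form M f c"
    and "symmetric_bilinear_lattice M' f'" and "characteristic_form M' f' c'"
  shows "(\<exists>\<Psi>\<in>iso (discriminant_group M f) (discriminant_group M' f').
            \<forall>X\<in>carrier (discriminant_group M f).
              discriminant_quadratic f' c' (\<Psi> X) = discriminant_quadratic f c X) \<longleftrightarrow>
         (\<exists>n n' (\<epsilon> :: nat \<Rightarrow> int) (\<epsilon>' :: nat \<Rightarrow> int).
            (\<forall>i<n. \<epsilon> i \<in> {1, -1}) \<and> (\<forall>i<n'. \<epsilon>' i \<in> {1, -1}) \<and>
            (M, f, c) \<oplus>\<^sub>L unit_sum n \<epsilon> \<simeq>\<^sub>L (M', f', c') \<oplus>\<^sub>L unit_sum n' \<epsilon>')"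
proof -
  obtain n \<pi> A c0 where \<pi>: "\<pi> \<in> iso M (Zvec n)" and A: "A \<in> Mat n n" "A\<^sup>T = A" and c0: "c0 \<in> Vec n"
    and fA0: "\<forall>x\<in>carrier M. \<forall>y\<in>carrier M. f x y = bil A (\<pi> x) (\<pi> y)" and cA0: "\<forall>x\<in>carrier M. c x = c0 \<bullet> \<pi> x"
    and ev: "\<forall>x\<in>Vec n. even (bil A x x - c0 \<bullet> x)" using lattice_coordinates[OF assms(1,2)] .
  obtain n' \<pi>' A' c0' where \<pi>': "\<pi>' \<in> iso M' (Zvec n')" and A': "A' \<in> Mat n' n'" "A'\<^sup>T = A'" and c0': "c0' \<in> Vec n'"
    and fA0': "\<forall>x\<in>carrier M'. \<forall>y\<in>carrier M'. f' x y = bil A' (\<pi>' x) (\<pi>' y)" and cA0': "\<forall>x\<in>carrier M'. c' x = c0' \<bullet> \<pi>' x"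
    and ev': "\<forall>x\<in>Vec n'. even (bil A' x x - c0' \<bullet> x)" using lattice_coordinates[OF assms(3,4)] .
  note fA = fA0[rule_format] and cA = cA0[rule_format] and fA' = fA0'[rule_format] and cA' = cA0'[rule_format]
  have main: "(\<exists>\<Psi>\<in>iso (discriminant_group M f) (discriminant_group M' f'). \<forall>X\<in>carrier (discriminant_group M f).
      discriminant_quadratic f' c' (\<Psi> X) = discriminant_quadratic f c X) \<longleftrightarrow> disc_equiv A c0 A' c0'"
    (is ?goal)
  proof (rule discriminant_coordinates[OF assms(1,2) \<pi> A c0 fA cA])
    fix \<kappa>
    assume \<kappa>: "\<kappa> ` duals A = carrier (discriminant_group M f)"
      "\<And>x y. x \<in> duals A \<Longrightarrow> y \<in> duals A \<Longrightarrow> \<kappa> (x + y) = \<kappa> x \<otimes>\<^bsub>discriminant_group M f\<^esub> \<kappa> y"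
      "\<And>x y. x \<in> duals A \<Longrightarrow> y \<in> duals A \<Longrightarrow> \<kappa> x = \<kappa> y \<longleftrightarrow> intvec (x - y)"
      "\<And>x. x \<in> duals A \<Longrightarrow> discriminant_quadratic f c (\<kappa> x) = mod_Ints (qform A c0 x)"
    show ?goal
    proof (rule discriminant_coordinates[OF assms(3,4) \<pi>' A' c0' fA' cA'])
      fix \<kappa>'
      assume \<kappa>': "\<kappa>' ` duals A' = carrier (discriminant_group M' f')"
        "\<And>x y. x \<in> duals A' \<Longrightarrow> y \<in> duals A' \<Longrightarrow> \<kappa>' (x + y) = \<kappa>' x \<otimes>\<^bsub>discriminant_group M' f'\<^esub> \<kappa>' y"
        "\<And>x y. x \<in> duals A' \<Longrightarrow> y \<in> duals A' \<Longrightarrow> \<kappa>' x = \<kappa>' y \<longleftrightarrow> intvec (x - y)"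
        "\<And>x. x \<in> duals A' \<Longrightarrow> discriminant_quadratic f' c' (\<kappa>' x) = mod_Ints (qform A' c0' x)"
      show ?goal by (rule discriminant_iso_iff[OF A(1) A'(1) \<kappa> \<kappa>'])
    qed
  qed
  have ch: "char_vec n A c0" "char_vec n' A' c0'" using c0 ev c0' ev' by (auto simp: char_vec_def)
  let ?T = "(M, f, c)" and ?T' = "(M', f', c')" and ?C = "coord_triple A c0" and ?C' = "coord_triple A' c0'"
  have bl: "bilinear ?T" "bilinear ?C" "bilinear ?C'" "bilinear ?T'"
    by (rule lattice_bilinear[OF assms(1)], rule bilinear_coord_triple[OF A], rule bilinear_coord_triple[OF A'], rule lattice_bilinear[OF assms(3)])
  have i: "?T \<simeq>\<^sub>L ?C" by (rule lattice_coord_iso[OF assms(1) \<pi> A(1) fA cA])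
  have i': "?T' \<simeq>\<^sub>L ?C'" by (rule lattice_coord_iso[OF assms(3) \<pi>' A'(1) fA' cA'])
  have "stably_iso ?T ?T' \<longleftrightarrow> stably_iso ?C ?C'"
  proof
    assume "stably_iso ?T ?T'"
    thus "stably_iso ?C ?C'" by (rule stably_iso_cong[OF bl(2,1,4,3) triple_iso_sym[OF bl(1,2) i] _ i'])
  next
    assume "stably_iso ?C ?C'"
    thus "stably_iso ?T ?T'" by (rule stably_iso_cong[OF bl i _ triple_iso_sym[OF bl(4,3) i']])
  qed
  moreover have "stably_iso ?C ?C' \<longleftrightarrow> disc_equiv A c0 A' c0'"
    using disc_equiv_stably_iso[OF A ch(1) A' ch(2)] stably_iso_disc_equiv[OF A A' c0 c0'] by blast
  ultimately show ?thesis unfolding main stably_iso_def signs_def by simp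
qed

end
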